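(* Let $\mathcal{S}$ be a $\mathcal{C}^k$-smooth real surface in $\mathbb{C}^2$, $k\geq 3$, and let $p\in\mathcal{S}$ be a CR singularity. Assume that $p$ is non-parabolic and that $\mathcal{S}$ is thin at $p$. Suppose $\mathrm{Ind}_{\mathcal{M}}(\mathcal{S},p)\leq 0$. Let $(z,w)$ be holomorphic coordinates centred at $p$ such that (as is possible by hypothesis) $\mathcal{S}$ is locally defined by $$\mathcal{S}\cap U_p:\quad w=\mathscr{F}_m(z,\overline z)+\mathcal{R}(z)\qquad(\mathcal{R}(z)=O(|z|^{m+1})\text{ for }|z|\text{ small}),$$ where $U_p$ is a neighbourhood of $p$ and $\mathscr{F}_m$ is a real-valued polynomial that is homogeneous of degree $m$, $2\leq m<k$. (1) If $\mathcal{R}$ is real-valued, then $\mathcal{S}$ is locally polynomially convex at $p$. (2) Suppose $k\geq 4$ (now $\mathcal{R}$ need not be real-valued). Given any $\alpha\in(0,1)$, it is impossible to find a continuous one-parameter family $\mathfrak{g}:(0,1)\to A^\alpha(\mathbb{D};\mathbb{C}^2)$ of immersed, non-constant analytic discs having all the following properties: - $\mathfrak{g}(t)(\partial\mathbb{D})\subset(\mathcal{S}\setminus\{p\})\cap U_p$ for all $t\in(0,1)$; - $\theta\mapsto\mathfrak{g}(t)(e^{i\theta})$ is a simple closed curve in $\mathcal{S}$ for all $t\in(0,1)$; and - $\mathfrak{g}(t)(\zeta)\to p$ for each $\zeta\in\overline{\mathbb{D}}$ as $t\to 0^+$.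
   Context: Throughout, $\mathbb{D}$ is the open unit disc in $\mathbb{C}$. CR singularity: a point $p$ of a real surface $\mathcal{S}\subset\mathbb{C}^2$ at which the tangent plane $T_p(\mathcal{S})$ is a complex line. For a function $F$ near $0\in\mathbb{C}$, $\Gamma(F)=\{(z,F(z))\}$ denotes its graph in $\mathbb{C}^2$. Local polynomial convexity: $\mathcal{S}$ is locally polynomially convex at $p$ if there is a closed ball $B$ centred at $p$ of positive radius such that $\mathcal{S}\cap B$ is compact and polynomially convex. Non-parabolic: let $\mathcal{S}$ be $\mathcal{C}^k$-smooth, $k\geq 3$, and let $p\in\mathcal{S}$ be an isolated CR singularity. Then $p$ is non-parabolic if there exist an integer $m$, $2\leq m<k$, and holomorphic coordinates $(z,w)$ centred at $p$ relative to which $\mathcal{S}$ has a local defining equation $$\mathcal{S}\cap U_p:\quad w=\mathscr{F}_m(z,\overline z)+\mathcal{R}(z)\qquad(\star)$$ (with $U_p$ a neighbourhood of $p$), where $\mathscr{F}_m$ is a homogeneous polynomial in $z$ and $\overline z$ of degree $m$, $\mathcal{R}(z)=O(|z|^{m+1})$, and the graph $\Gamma(\mathscr{F}_m)$ has an isolated CR singularity at $(0,0)$. Thin: let $\mathcal{S}$ be $\mathcal{C}^k$-smooth, $k\geq 3$, and let $p\in\mathcal{S}$ be an isolated CR singularity such that $T_p(\mathcal{S})$ has finite order of contact $m$, $2\leq m<k$, with $\mathcal{S}$ at $p$. Then $\mathcal{S}$ is thin at $p$ if there exist holomorphic coordinates $(z,w)$ centred at $p$ such that $\mathcal{S}$ is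 locally a graph of the form $(\star)$ (so $\mathscr{F}_m\not\equiv 0$ is homogeneous of degree $m$ and $\mathcal{R}(z)=O(|z|^{m+1})$) and with respect to which $\mathscr{F}_m$ is real-valued. The coordinates referred to in the theorem are coordinates of this kind. Maslov-type index of a path: let $M$ be a totally real $2$-submanifold of a region in $\mathbb{C}^2$ and $\gamma:S^1\to M$ a smooth closed path along which $M$ is orientable (i.e. $\gamma^*TM|_{\gamma(S^1)}$ is trivial). For an oriented totally real plane $P\subset\mathbb{C}^2$ put $\mathfrak{G}(P):=\det[X_1\ X_2]\in\mathbb{C}\setminus\{0\}$, where $(X_1,X_2)$ is any positively oriented orthonormal basis of $P$ (vectors in $\mathbb{C}^2$ written as columns; this does not depend on the basis). The index $\mathrm{Ind}_{\mathcal{M},\gamma}(M)\in\mathbb{Z}$ is the degree (winding number around $0$) of the map $S^1\ni\zeta\mapsto\mathfrak{G}(T_{\gamma(\zeta)}M)\in\mathbb{C}\setminus\{0\}$. Maslov-type index of a CR singularity: let $\mathcal{S}$ be an orientable real surface in a region of $\mathbb{C}^2$ with an isolated CR singularity at $p$. Let $W_p$ be an $\mathcal{S}$-open neighbourhood of $p$, contractible to $p$, whose only CR singularity is $p$, oriented by the orientation induced by the complex line $T_p(\mathcal{S})$. Then $\mathrm{Ind}_{\mathcal{M}}(\mathcal{S},p):=\mathrm{Ind}_{\mathcal{M},\gamma}(W_p\setminus\{p\})$, where $\gamma:S^1\to W_p\setminus\{p\}$ is any smooth simple closed curve that has positive orientation with respect to the orientation of $W_p$ (i.e. winds once positively around $p$).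 For a surface of which only a neighbourhood of $p$ is considered, the index is computed locally near $p$. $A^\alpha(\mathbb{D};\mathbb{C}^2)$: the class of all $\mathbb{C}^2$-valued maps on $\overline{\mathbb{D}}$ that are holomorphic on $\mathbb{D}$ and whose restrictions to $\partial\mathbb{D}$ are of Hölder class $\mathcal{C}^\alpha(\partial\mathbb{D})$ (a Banach space with the Hölder norm $\|f\|_{\mathcal{C}^\alpha}=\sup_\theta|f(e^{i\theta})|+\sup_{\theta\ne\phi}|f(e^{i\theta})-f(e^{i\phi})|/|\theta-\phi|^\alpha$ of the boundary values). Its elements are called analytic discs.
   Formalization: In (2), U_p is a sufficiently small neighbourhood of p (independent of α): for an arbitrary given U_p the claim fails, as convergence to p is only pointwise (e.g. w = 2Re(z²) − |z|⁴, U_p = C²). Discs are taken continuous on the closed disc. *)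

theory Defs
  imports "HOL-Complex_Analysis.Complex_Analysis" "HOL-Library.Landau_Symbols"
begin

section \<open>Surfaces in \<open>\<complex>\<^sup>2\<close> and CR singularities\<close>

type_synonym C2 = "complex \<times> complex"

definition cscale :: "complex \<Rightarrow> C2 \<Rightarrow> C2" where
  "cscale c v = (c * fst v, c * snd v)"

text \<open>For open \<open>A\<close> in a finite-dimensional space this is the class \<open>C\<^sup>k(A)\<close>: all iterated directional
  derivatives up to order \<open>k\<close> exist, as Frechet derivatives, and are continuous.\<close>

primrec Ck_on :: "nat \<Rightarrow> 'a::real_normed_vector set \<Rightarrow> ('a \<Rightarrow> 'b::real_normed_vector) \<Rightarrow> bool" where
  "Ck_on 0 A f \<longleftrightarrow> continuous_on A f"
| "Ck_on (Suc k) A f \<longleftrightarrow>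
     (\<forall>x\<in>A. f differentiable (at x)) \<and> (\<forall>v. Ck_on k A (\<lambda>x. frechet_derivative f (at x) v))"

text \<open>The parameter domain is an open subset of \<open>\<complex>\<close>, regarded as \<open>\<real>\<^sup>2\<close>.\<close>

definition parametrization :: "nat \<Rightarrow> complex set \<Rightarrow> (complex \<Rightarrow> C2) \<Rightarrow> C2 set \<Rightarrow> bool" where
  "parametrization k V \<sigma> W \<longleftrightarrow>
     open V \<and> Ck_on k V \<sigma> \<and> (\<forall>x\<in>V. inj (frechet_derivative \<sigma> (at x))) \<and>
     homeomorphism V W \<sigma> (inv_into V \<sigma>)"

definition Ck_surface :: "nat \<Rightarrow> C2 set \<Rightarrow> bool" where
  "Ck_surface k S \<longleftrightarrow>
     (\<forall>q\<in>S. \<exists>W V \<sigma>. openin (top_of_set S) W \<and> q \<in> W \<and> parametrization k V \<sigma> W)"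

definition tangent_space :: "C2 set \<Rightarrow> C2 \<Rightarrow> C2 set" where
  "tangent_space S q = {v. \<exists>e>0. \<exists>\<gamma>::real \<Rightarrow> C2.
     \<gamma> 0 = q \<and> \<gamma> ` {-e<..<e} \<subseteq> S \<and> \<gamma> C1_differentiable_on {-e<..<e} \<and>
     (\<gamma> has_vector_derivative v) (at 0)}"

definition CR_singularity :: "C2 set \<Rightarrow> C2 \<Rightarrow> bool" where
  "CR_singularity S q \<longleftrightarrow>
     q \<in> S \<and> (\<exists>v. v \<noteq> 0 \<and> tangent_space S q = range (\<lambda>c. cscale c v))"

definition isolated_CR_singularity :: "C2 set \<Rightarrow> C2 \<Rightarrow> bool" where
  "isolated_CR_singularity S q \<longleftrightarrow> CR_singularity S q \<and>
     (\<exists>U. open U \<and> q \<in> U \<and> (\<forall>x \<in> S \<inter> U. CR_singularity S x \<longrightarrow> x = q))"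

definition totally_real :: "C2 set \<Rightarrow> bool" where
  "totally_real M \<longleftrightarrow>
     (\<forall>q\<in>M. tangent_space M q \<inter> cscale \<i> ` tangent_space M q = {0})"


section \<open>Polynomial convexity\<close>

definition polynomial2 :: "(C2 \<Rightarrow> complex) \<Rightarrow> bool" where
  "polynomial2 P \<longleftrightarrow>
     (\<exists>N (c :: nat \<Rightarrow> nat \<Rightarrow> complex). \<forall>x. P x = (\<Sum>i\<le>N. \<Sum>j\<le>N. c i j * fst x ^ i * snd x ^ j))"

text \<open>The hull is only used for compact \<open>K\<close>, where \<open>|P|\<close> attains its maximum over \<open>K\<close>.\<close>

definition polynomial_hull :: "C2 set \<Rightarrow> C2 set" where
  "polynomial_hull K = {x. \<forall>P. polynomial2 P \<longrightarrow> (\<exists>y\<in>K. norm (P x) \<le> norm (P y))}"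

definition polynomially_convex :: "C2 set \<Rightarrow> bool" where
  "polynomially_convex K \<longleftrightarrow> compact K \<and> polynomial_hull K = K"

definition locally_polynomially_convex_at :: "C2 set \<Rightarrow> C2 \<Rightarrow> bool" where
  "locally_polynomially_convex_at S p \<longleftrightarrow>
     (\<exists>r>0. compact (S \<inter> cball p r) \<and> polynomially_convex (S \<inter> cball p r))"


section \<open>Holomorphic coordinates, non-parabolic and thin singularities\<close>

definition holomorphic2_on :: "C2 set \<Rightarrow> (C2 \<Rightarrow> C2) \<Rightarrow> bool" where
  "holomorphic2_on U f \<longleftrightarrow>
     (\<forall>x\<in>U. \<exists>D. (f has_derivative D) (at x) \<and> (\<forall>c v. D (cscale c v) = cscale c (D v)))"

definition biholomorphic2_on :: "C2 set \<Rightarrow> (C2 \<Rightarrow> C2) \<Rightarrow> bool" where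
  "biholomorphic2_on U f \<longleftrightarrow>
     open U \<and> open (f ` U) \<and> inj_on f U \<and> holomorphic2_on U f \<and>
     holomorphic2_on (f ` U) (inv_into U f)"

definition homogeneous_polynomial :: "nat \<Rightarrow> (complex \<Rightarrow> complex) \<Rightarrow> bool" where
  "homogeneous_polynomial m F \<longleftrightarrow>
     (\<exists>c. \<forall>z. F z = (\<Sum>j\<le>m. c j * z ^ j * cnj z ^ (m - j)))"

definition graph_of :: "(complex \<Rightarrow> complex) \<Rightarrow> C2 set" where
  "graph_of F = {(z, F z) | z. True}"

text \<open>\<open>\<Phi> = (z, w)\<close> are holomorphic coordinates on \<open>U\<close> centred at \<open>p\<close> in which \<open>S \<inter> U\<close> is given by
  \<open>w = F + R\<close>. Only the values of \<open>R\<close> at the points \<open>fst (\<Phi> q)\<close>, \<open>q \<in> U\<close>, matter; when \<open>p \<in> S\<close> and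
  \<open>m \<ge> 1\<close>, they include all points near \<open>0\<close>, and \<open>R 0 = 0\<close>.\<close>

definition graph_coordinates ::
  "C2 set \<Rightarrow> C2 \<Rightarrow> nat \<Rightarrow> C2 set \<Rightarrow> (C2 \<Rightarrow> C2) \<Rightarrow> (complex \<Rightarrow> complex) \<Rightarrow> (complex \<Rightarrow> complex) \<Rightarrow> bool"
where
  "graph_coordinates S p m U \<Phi> F R \<longleftrightarrow>
     p \<in> U \<and> biholomorphic2_on U \<Phi> \<and> \<Phi> p = 0 \<and>
     homogeneous_polynomial m F \<and> R \<in> O[at 0](\<lambda>z. z ^ (m + 1)) \<and>
     S \<inter> U = {q \<in> U. snd (\<Phi> q) = F (fst (\<Phi> q)) + R (fst (\<Phi> q))}"

definition non_parabolic :: "nat \<Rightarrow> C2 set \<Rightarrow> C2 \<Rightarrow> bool" where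
  "non_parabolic k S p \<longleftrightarrow> isolated_CR_singularity S p \<and>
     (\<exists>m U \<Phi> F R. 2 \<le> m \<and> m < k \<and> graph_coordinates S p m U \<Phi> F R \<and>
        isolated_CR_singularity (graph_of F) (0, 0))"

text \<open>Convention: contact of order \<open>m\<close> means that the distance to the (affine) tangent plane is
  \<open>O(|q - p|\<^sup>m)\<close> but not \<open>O(|q - p|\<^sup>m\<^sup>+\<^sup>1)\<close>, so that a graph \<open>w = F + R\<close> as above has contact of
  order exactly \<open>m\<close> with \<open>w = 0\<close> iff \<open>F \<noteq> 0\<close>.\<close>

definition tangent_contact_order :: "C2 set \<Rightarrow> C2 \<Rightarrow> nat \<Rightarrow> bool" where
  "tangent_contact_order S p m \<longleftrightarrow>
     (let d = (\<lambda>q. infdist q ((+) p ` tangent_space S p)) in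
        d \<in> O[at p within S](\<lambda>q. norm (q - p) ^ m) \<and>
        d \<notin> O[at p within S](\<lambda>q. norm (q - p) ^ (m + 1)))"

text \<open>The order of contact with the tangent plane is not invariant under biholomorphic maps (for
  \<open>w = z\<^sup>2 + |z|\<^sup>4\<close> it is 2, but it is 4 in the coordinates \<open>(z, w - z\<^sup>2)\<close>); it is measured in the
  coordinates \<open>\<Phi>\<close> themselves, which is what makes the homogeneous polynomial \<open>F\<close> nonzero.\<close>

definition thin_coordinates ::
  "C2 set \<Rightarrow> C2 \<Rightarrow> nat \<Rightarrow> C2 set \<Rightarrow> (C2 \<Rightarrow> C2) \<Rightarrow> (complex \<Rightarrow> complex) \<Rightarrow> (complex \<Rightarrow> complex) \<Rightarrow> bool"
where
  "thin_coordinates S p m U \<Phi> F R \<longleftrightarrow>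
     graph_coordinates S p m U \<Phi> F R \<and> tangent_contact_order (\<Phi> ` (S \<inter> U)) 0 m \<and> (\<forall>z. F z \<in> \<real>)"

definition thin :: "nat \<Rightarrow> C2 set \<Rightarrow> C2 \<Rightarrow> bool" where
  "thin k S p \<longleftrightarrow> isolated_CR_singularity S p \<and>
     (\<exists>m U \<Phi> F R. 2 \<le> m \<and> m < k \<and> thin_coordinates S p m U \<Phi> F R)"


section \<open>The Maslov-type index\<close>

definition det2 :: "C2 \<Rightarrow> C2 \<Rightarrow> complex" where
  "det2 X Y = fst X * snd Y - fst Y * snd X"

definition orthonormal_basis_of :: "C2 set \<Rightarrow> C2 \<Rightarrow> C2 \<Rightarrow> bool" where
  "orthonormal_basis_of P X Y \<longleftrightarrow>
     norm X = 1 \<and> norm Y = 1 \<and> inner X Y = 0 \<and> span {X, Y} = P"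

text \<open>The closed frame \<open>(X, Y)\<close> witnesses that \<open>M\<close> is orientable along \<open>\<gamma>\<close> and provides the
  orientation of the tangent planes; \<open>det2 (X t) (Y t)\<close> depends only on this orientation, and
  reversing it only changes the sign, which does not affect the winding number.\<close>

definition has_maslov_path_index :: "C2 set \<Rightarrow> (real \<Rightarrow> C2) \<Rightarrow> int \<Rightarrow> bool" where
  "has_maslov_path_index M \<gamma> n \<longleftrightarrow> totally_real M \<and>
     (\<exists>X Y. path X \<and> path Y \<and> X 1 = X 0 \<and> Y 1 = Y 0 \<and>
        (\<forall>t\<in>{0..1}. orthonormal_basis_of (tangent_space M (\<gamma> t)) (X t) (Y t)) \<and>
        winding_number (\<lambda>t. det2 (X t) (Y t)) 0 = of_int n)"

definition CR_neighbourhood :: "C2 set \<Rightarrow> C2 \<Rightarrow> C2 set \<Rightarrow> bool" where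
  "CR_neighbourhood S p W \<longleftrightarrow>
     openin (top_of_set S) W \<and> p \<in> W \<and> contractible W \<and> (\<forall>q\<in>W. CR_singularity S q \<longleftrightarrow> q = p)"

text \<open>Closed curves are 1-periodic functions on the real line. \<open>W\<close> is oriented by the complex line
  \<open>T\<^sub>p(S)\<close>: the global chart \<open>\<sigma>\<close> is orientation preserving iff the basis \<open>d\<sigma>(1), d\<sigma>(\<i>)\<close> of
  that line at \<open>p\<close> is positive, i.e. the second vector is a complex multiple of the first with
  a factor in the upper half plane.\<close>

definition positive_loop_around :: "C2 set \<Rightarrow> C2 \<Rightarrow> (real \<Rightarrow> C2) \<Rightarrow> bool" where
  "positive_loop_around W p \<gamma> \<longleftrightarrow>
     (\<forall>t. \<gamma> (t + 1) = \<gamma> t) \<and> \<gamma> C1_differentiable_on UNIV \<and> simple_path \<gamma> \<and>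
     path_image \<gamma> \<subseteq> W - {p} \<and>
     (\<exists>V \<sigma>. parametrization 1 V \<sigma> W \<and> 0 \<in> V \<and> \<sigma> 0 = p \<and>
        (\<exists>c. Im c > 0 \<and>
           frechet_derivative \<sigma> (at 0) \<i> = cscale c (frechet_derivative \<sigma> (at 0) 1)) \<and>
        winding_number (inv_into V \<sigma> \<circ> \<gamma>) 0 = 1)"

text \<open>\<open>n\<close> is the index iff it is the common value of the path indices along all admissible loops.\<close>

definition has_maslov_index :: "C2 set \<Rightarrow> C2 \<Rightarrow> int \<Rightarrow> bool" where
  "has_maslov_index S p n \<longleftrightarrow>
     (\<exists>W \<gamma>. CR_neighbourhood S p W \<and> positive_loop_around W p \<gamma>) \<and>
     (\<forall>W \<gamma>. CR_neighbourhood S p W \<and> positive_loop_around W p \<gamma> \<longrightarrow>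
        has_maslov_path_index (W - {p}) \<gamma> n)"


section \<open>Analytic discs with boundary values of Hoelder class\<close>

definition holder_quotient :: "real \<Rightarrow> (complex \<Rightarrow> C2) \<Rightarrow> real \<times> real \<Rightarrow> real" where
  "holder_quotient \<alpha> f = (\<lambda>(\<theta>, \<phi>). norm (f (cis \<theta>) - f (cis \<phi>)) / \<bar>\<theta> - \<phi>\<bar> powr \<alpha>)"

definition holder_norm :: "real \<Rightarrow> (complex \<Rightarrow> C2) \<Rightarrow> real" where
  "holder_norm \<alpha> f =
     (SUP \<theta>. norm (f (cis \<theta>))) + (SUP x \<in> {(\<theta>, \<phi>). \<theta> \<noteq> \<phi>}. holder_quotient \<alpha> f x)"

text \<open>Continuity up to the boundary ties the boundary values to the holomorphic map (otherwise
  \<open>holder_norm\<close> would not be a norm).\<close>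

definition analytic_discs :: "real \<Rightarrow> (complex \<Rightarrow> C2) set" where
  "analytic_discs \<alpha> = {f. continuous_on (cball 0 1) f \<and>
     (fst \<circ> f) holomorphic_on ball 0 1 \<and> (snd \<circ> f) holomorphic_on ball 0 1 \<and>
     bdd_above (holder_quotient \<alpha> f ` {(\<theta>, \<phi>). \<theta> \<noteq> \<phi>})}"

definition continuous_disc_family :: "real \<Rightarrow> (real \<Rightarrow> complex \<Rightarrow> C2) \<Rightarrow> bool" where
  "continuous_disc_family \<alpha> g \<longleftrightarrow> (\<forall>t\<in>{0<..<1}. g t \<in> analytic_discs \<alpha>) \<and>
     (\<forall>t\<in>{0<..<1}. ((\<lambda>s. holder_norm \<alpha> (\<lambda>\<zeta>. g s \<zeta> - g t \<zeta>)) \<longlongrightarrow> 0) (at t within {0<..<1}))"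

definition immersed_disc :: "(complex \<Rightarrow> C2) \<Rightarrow> bool" where
  "immersed_disc f \<longleftrightarrow> (\<forall>\<zeta>\<in>ball 0 1. (deriv (fst \<circ> f) \<zeta>, deriv (snd \<circ> f) \<zeta>) \<noteq> 0)"

text \<open>The convergence to \<open>p\<close> is pointwise. It does not force the discs close to \<open>p\<close>: composing discs
  having one boundary point close to \<open>p\<close> with automorphisms of the unit disc produces pointwise
  convergent families. Statements on the absence of such families are therefore local in \<open>U\<close>. For
  instance, on the graph of \<open>w = 2 Re (z\<^sup>2) - |z|\<^sup>4\<close>, which has index \<open>-1\<close> at \<open>0\<close>, the level curves
  of \<open>w\<close> around the CR singularity \<open>(1, 1)\<close> bound such a family.\<close>

definition shrinking_disc_family ::
  "real \<Rightarrow> C2 set \<Rightarrow> C2 \<Rightarrow> C2 set \<Rightarrow> (real \<Rightarrow> complex \<Rightarrow> C2) \<Rightarrow> bool"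
where
  "shrinking_disc_family \<alpha> S p U g \<longleftrightarrow>
     continuous_disc_family \<alpha> g \<and>
     (\<forall>t\<in>{0<..<1}. immersed_disc (g t) \<and> \<not> g t constant_on cball 0 1) \<and>
     (\<forall>t\<in>{0<..<1}. g t ` sphere 0 1 \<subseteq> (S - {p}) \<inter> U) \<and>
     (\<forall>t\<in>{0<..<1}. simple_path (g t \<circ> circlepath 0 1)) \<and>
     (\<forall>\<zeta>\<in>cball 0 1. ((\<lambda>t. g t \<zeta>) \<longlongrightarrow> p) (at_right 0))"

end

theory Submission
  imports Defs
begin

text \<open>Near \<open>p\<close> the surface is the graph of \<open>f = F + R\<close>, with \<open>f\<close> of class \<open>C\<^sup>1\<close> and \<open>dR = O(|z|\<^sup>m)\<close>. By the
  non-parabolicity \<open>F\<close> has no critical point except \<open>0\<close>. If \<open>F\<close> did not change sign, then \<open>Re (cnj z (f\<^sub>x + \<i> f\<^sub>y))\<close>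
  would have constant sign near \<open>0\<close> and the index would be \<open>1\<close>; so \<open>F\<close> takes both signs.

  If \<open>f\<close> is real, the functions \<open>exp (- N (w - c)\<^sup>2) q(z)\<close> reduce polynomial convexity to that of the level
  sets of \<open>f\<close> in a small disc. These have connected complement: in a bounded component of the complement
  \<open>f\<close> would have an extremum, hence a CR singularity, which can only be \<open>0\<close>, where \<open>f\<close> takes both signs.

  For the discs, a single small disc is already impossible. Its first component is univalent,
  so that it is the graph of a holomorphic function \<open>h\<close> on a plane domain, with the boundary values of \<open>f\<close>.
  By Dirichlet's principle the energy of \<open>h\<close> is at most a constant times that of \<open>Im R\<close>, which is small
  compared with \<open>\<integral> |z|\<^sup>2\<^sup>m\<^sup>-\<^sup>2\<close>. As \<open>F\<close> has a zero besides \<open>0\<close>, there is a form \<open>G\<close> of degree \<open>m\<close> with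
  \<open>{F, G} \<ge> c |z|\<^sup>2\<^sup>m\<^sup>-\<^sup>2\<close>; since \<open>Re (f - h)\<close> vanishes on the boundary, its Poisson bracket with \<open>G\<close> has
  integral zero, and this is a contradiction.\<close>

section \<open>Functions of class \<open>C\<^sup>k\<close>\<close>

text \<open>The index serves to exclude a definite \<open>F\<close>, and this border is natural. If
  \<open>F\<close> is positive off \<open>0\<close>, the level sets of the graph
  \<open>w = F\<close> bound discs \<open>w = c\<close>, and no \<open>G\<close> with
  \<open>{F, G} > 0\<close> off \<open>0\<close> exists, because the bracket has integral zero over
  \<open>F < c\<close>. A zero of \<open>F\<close> off \<open>0\<close> removes this obstruction.

  The coordinates that witness non-parabolicity need not be the thin ones, so two leading forms are
  compared through the transition map before \<open>F\<close> is known to have no critical point off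
  \<open>0\<close>.

  The obstacle for discs is that the projection of a disc is only known to be bounded by a Jordan
  curve, and that its position relative to \<open>0\<close> is not controlled; neither Green's
  formula up to the boundary nor rescaling is available. Boundary values are therefore used only
  through the compactness of the sets where the real or imaginary part of \<open>f - h\<close> is
  not small, with test functions truncated accordingly, and all estimates are pointwise with the
  weight \<open>|z|^(2m-2)\<close>. In squared gradient the remainder gains a factor
  \<open>|z|^2\<close> over this weight, which is arbitrarily small on a small disc.\<close>

lemma Ck_on_subset: "Ck_on k A f \<Longrightarrow> B \<subseteq> A \<Longrightarrow> Ck_on k B f"
  by (induction k arbitrary: f) (auto intro: continuous_on_subset)

lemma Ck_on_imp_continuous_on: "Ck_on k A f \<Longrightarrow> continuous_on A f"
proof (cases k)
  case (Suc j)
  assume "Ck_on k A f"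
  then have "\<forall>x\<in>A. f differentiable (at x)" by (simp add: Suc)
  then show ?thesis
    by (intro continuous_at_imp_continuous_on ballI differentiable_imp_continuous_within) blast
qed simp

lemma Ck_on_SucD: "Ck_on (Suc k) A f \<Longrightarrow> Ck_on k A f"
proof (induction k arbitrary: f)
  case 0
  then show ?case using Ck_on_imp_continuous_on by (metis Ck_on.simps(1))
next
  case (Suc k)
  then show ?case by (metis Ck_on.simps(2))
qed

lemma Ck_on_mono: "Ck_on k A f \<Longrightarrow> j \<le> k \<Longrightarrow> Ck_on j A f"
  by (induction k) (auto simp: le_Suc_eq dest: Ck_on_SucD simp del: Ck_on.simps)

lemma frechet_derivative_cong_open:
  assumes "open A" "x \<in> A" "\<And>y. y \<in> A \<Longrightarrow> f y = g y"
  shows "frechet_derivative f (at x) = frechet_derivative g (at x)"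
proof -
  have "(f has_derivative D) (at x) \<longleftrightarrow> (g has_derivative D) (at x)" for D
    using assms by (metis has_derivative_transform_within_open)
  then show ?thesis unfolding frechet_derivative_def by simp
qed

lemma Ck_on_cong:
  assumes "open A" "\<And>x. x \<in> A \<Longrightarrow> f x = g x" "Ck_on k A f"
  shows "Ck_on k A g"
  using assms(2,3)
proof (induction k arbitrary: f g)
  case 0
  then show ?case using continuous_on_cong by force
next
  case (Suc k)
  have "g differentiable (at x)" if "x \<in> A" for x
    using Suc.prems that assms(1) by (metis Ck_on.simps(2) differentiable_def has_derivative_transform_within_open)
  moreover have "Ck_on k A (\<lambda>x. frechet_derivative g (at x) v)" for v
    using Suc.IH[of "\<lambda>x. frechet_derivative f (at x) v" "\<lambda>x. frechet_derivative g (at x) v"]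
      frechet_derivative_cong_open[OF assms(1), of _ f g] Suc.prems by simp
  ultimately show ?case by simp
qed

text \<open>\<open>frechet_derivative\<close> is a choice; on an open set any explicit derivative
  may stand in for it. With the converse below, the closure properties follow from the sum, product
  and chain rules for such a \<open>D\<close>.\<close>

lemma Ck_on_SucI:
  assumes "open A" "\<And>x. x \<in> A \<Longrightarrow> (f has_derivative D x) (at x)" "\<And>v. Ck_on k A (\<lambda>x. D x v)"
  shows "Ck_on (Suc k) A f"
proof -
  have "frechet_derivative f (at x) = D x" if "x \<in> A" for x
    using assms(2)[OF that] by (metis frechet_derivative_at)
  then show ?thesis
    using assms Ck_on_cong[OF assms(1), of "\<lambda>x. D x v" "\<lambda>x. frechet_derivative f (at x) v" k for v]
    by (auto simp: differentiable_def)
qed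

lemma Ck_on_SucE:
  assumes "Ck_on (Suc k) A f"
  obtains D where "\<And>x. x \<in> A \<Longrightarrow> (f has_derivative D x) (at x)" "\<And>v. Ck_on k A (\<lambda>x. D x v)"
  using assms by (metis Ck_on.simps(2) frechet_derivative_works)

lemma Ck_on_const: "Ck_on k A (\<lambda>x. c)"
  by (induction k arbitrary: c) auto

lemma Ck_on_bounded_linear:
  assumes "open A" "bounded_linear L" "Ck_on k A f"
  shows "Ck_on k A (\<lambda>x. L (f x))"
  using assms(3)
proof (induction k arbitrary: f)
  case 0
  then show ?case using bounded_linear.continuous_on[OF assms(2)] by auto
next
  case (Suc k)
  from Ck_on_SucE[OF Suc.prems] obtain D where
    "\<And>x. x \<in> A \<Longrightarrow> (f has_derivative D x) (at x)" "\<And>v. Ck_on k A (\<lambda>x. D x v)" by blast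
  then show ?case
    using Suc.IH by (intro Ck_on_SucI[OF assms(1), where D = "\<lambda>x v. L (D x v)"])
      (auto intro: bounded_linear.has_derivative[OF assms(2)])
qed

lemma Ck_on_id: "open A \<Longrightarrow> Ck_on k A (\<lambda>x. x)"
  by (cases k) (auto intro!: Ck_on_SucI[where D = "\<lambda>x v. v"] Ck_on_const simp del: Ck_on.simps(2))

lemma Ck_on_add:
  assumes "open A" "Ck_on k A f" "Ck_on k A g"
  shows "Ck_on k A (\<lambda>x. f x + g x)"
  using assms(2,3)
proof (induction k arbitrary: f g)
  case 0
  then show ?case by (auto intro: continuous_on_add)
next
  case (Suc k)
  from Ck_on_SucE[OF Suc.prems(1)] obtain D where
    "\<And>x. x \<in> A \<Longrightarrow> (f has_derivative D x) (at x)" "\<And>v. Ck_on k A (\<lambda>x. D x v)" by blast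
  moreover from Ck_on_SucE[OF Suc.prems(2)] obtain E where
    "\<And>x. x \<in> A \<Longrightarrow> (g has_derivative E x) (at x)" "\<And>v. Ck_on k A (\<lambda>x. E x v)" by blast
  ultimately show ?case
    using Suc.IH by (intro Ck_on_SucI[OF assms(1), where D = "\<lambda>x v. D x v + E x v"])
      (auto intro: has_derivative_add)
qed

lemma Ck_on_mult:
  fixes f g :: "'a::real_normed_vector \<Rightarrow> 'b::real_normed_algebra"
  assumes "open A" "Ck_on k A f" "Ck_on k A g"
  shows "Ck_on k A (\<lambda>x. f x * g x)"
  using assms(2,3)
proof (induction k arbitrary: f g)
  case 0
  then show ?case by (auto intro: continuous_on_mult)
next
  case (Suc k)
  from Ck_on_SucE[OF Suc.prems(1)] obtain D where
    D: "\<And>x. x \<in> A \<Longrightarrow> (f has_derivative D x) (at x)" "\<And>v. Ck_on k A (\<lambda>x. D x v)" by blast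
  from Ck_on_SucE[OF Suc.prems(2)] obtain E where
    E: "\<And>x. x \<in> A \<Longrightarrow> (g has_derivative E x) (at x)" "\<And>v. Ck_on k A (\<lambda>x. E x v)" by blast
  show ?case
  proof (rule Ck_on_SucI[OF assms(1), where D = "\<lambda>x v. f x * E x v + D x v * g x"])
    show "((\<lambda>x. f x * g x) has_derivative (\<lambda>v. f x * E x v + D x v * g x)) (at x)" if "x \<in> A" for x
      using has_derivative_mult[OF D(1) E(1)] that by blast
    show "Ck_on k A (\<lambda>x. f x * E x v + D x v * g x)" for v
      using Suc.IH D(2) E(2) Suc.prems[THEN Ck_on_SucD] by (intro Ck_on_add[OF assms(1)]) blast+
  qed
qed

lemma Ck_on_sum:
  assumes "open A" "\<And>i. i \<in> I \<Longrightarrow> Ck_on k A (f i)"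
  shows "Ck_on k A (\<lambda>x. \<Sum>i\<in>I. f i x)"
  using assms(2) by (induction I rule: infinite_finite_induct) (auto intro: Ck_on_const Ck_on_add[OF assms(1)])

lemma Ck_on_power:
  fixes f :: "'a::real_normed_vector \<Rightarrow> 'b::real_normed_algebra_1"
  assumes "open A" "Ck_on k A f"
  shows "Ck_on k A (\<lambda>x. f x ^ n)"
  using assms(2) by (induction n) (auto intro: Ck_on_const Ck_on_mult[OF assms(1)])

text \<open>Taylor's formula: a step of length exactly \<open>h\<close> leads from \<open>s\<close>
  to a point \<open>u\<close> of the interval, on one side at least because
  \<open>h \<le> 1/2\<close>. Then \<open>h * norm (g' s)\<close> is at most
  \<open>2 * A + B * h * h\<close>.\<close>

lemma landau_vector:
  fixes g g' g'' :: "real \<Rightarrow> 'a::real_normed_vector"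
  assumes g: "\<And>s. s \<in> {0..1} \<Longrightarrow> (g has_vector_derivative g' s) (at s within {0..1})"
    and g': "\<And>s. s \<in> {0..1} \<Longrightarrow> (g' has_vector_derivative g'' s) (at s within {0..1})"
    and A: "\<And>s. s \<in> {0..1} \<Longrightarrow> norm (g s) \<le> A"
    and B: "\<And>s. s \<in> {0..1} \<Longrightarrow> norm (g'' s) \<le> B"
    and h: "0 < h" "h \<le> 1/2" and s: "s \<in> {0..1}"
  shows "norm (g' s) \<le> 2 * A / h + B * h"
proof -
  obtain u where u: "u \<in> {0..1}" "\<bar>u - s\<bar> = h"
  proof (cases "s \<le> 1/2")
    case True then show ?thesis using that[of "s+h"] h s by auto
  next
    case False then show ?thesis using that[of "s-h"] h s by auto
  qed
  define S where "S = closed_segment s u"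
  have S: "S \<subseteq> {0..1}" "convex S" "s \<in> S" "u \<in> S"
    using s u by (auto simp: S_def closed_segment_eq_real_ivl split: if_splits)
  have dist: "\<bar>x - s\<bar> \<le> h" if "x \<in> S" for x
    using that u(2) by (auto simp: S_def closed_segment_eq_real_ivl split: if_splits)
  have B0: "0 \<le> B" using B[OF s] norm_ge_zero order_trans by blast
  have 1: "norm (g' x - g' s) \<le> B * h" if "x \<in> S" for x
  proof -
    have "norm (g' x - g' s) \<le> B * norm (x - s)"
    proof (rule differentiable_bound[OF S(2), where f = g' and f' = "\<lambda>x h. h *\<^sub>R g'' x"])
      show "(g' has_derivative (\<lambda>h. h *\<^sub>R g'' x)) (at x within S)" if "x \<in> S" for x
        using g'[of x] that S(1) by (metis has_derivative_subset has_vector_derivative_def subsetD)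
      show "onorm (\<lambda>h. h *\<^sub>R g'' x) \<le> B" if "x \<in> S" for x
        using B[of x] that S(1) by (intro onorm_le) (auto simp: mult_left_mono mult.commute[of B])
    qed (use that S in auto)
    also have "\<dots> \<le> B * h" using dist[OF that] B0 by (simp add: mult_left_mono)
    finally show ?thesis .
  qed
  \<comment> \<open>Removing the linear part with slope \<open>g' s\<close> leaves a function whose
    derivative is at most \<open>B * h\<close> on the segment.\<close>
  have 2: "norm ((g u - u *\<^sub>R g' s) - (g s - s *\<^sub>R g' s)) \<le> (B * h) * norm (u - s)"
  proof (rule differentiable_bound[OF S(2), where f = "\<lambda>x. g x - x *\<^sub>R g' s" and f' = "\<lambda>x h. h *\<^sub>R (g' x - g' s)"])
    show "((\<lambda>x. g x - x *\<^sub>R g' s) has_derivative (\<lambda>h. h *\<^sub>R (g' x - g' s))) (at x within S)" if "x \<in> S" for x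
    proof -
      have "(g has_derivative (\<lambda>h. h *\<^sub>R g' x)) (at x within S)"
        using g[of x] that S(1) by (metis has_derivative_subset has_vector_derivative_def subsetD)
      then show ?thesis by (auto intro!: derivative_eq_intros simp: algebra_simps)
    qed
    show "onorm (\<lambda>h. h *\<^sub>R (g' x - g' s)) \<le> B * h" if "x \<in> S" for x
      using 1[OF that] by (intro onorm_le) (auto simp: mult_left_mono mult.commute[of "B * h"])
  qed (use S in auto)
  have "norm ((u - s) *\<^sub>R g' s) \<le> norm (g u) + norm (g s) + (B * h) * h"
  proof -
    have "(u - s) *\<^sub>R g' s = (g u - g s) - ((g u - u *\<^sub>R g' s) - (g s - s *\<^sub>R g' s))"
      by (simp add: algebra_simps)
    then show ?thesis using 2 u(2) norm_triangle_ineq4[of "g u - g s" "(g u - u *\<^sub>R g' s) - (g s - s *\<^sub>R g' s)"]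
        norm_triangle_ineq4[of "g u" "g s"] by simp
  qed
  then have "h * norm (g' s) \<le> 2 * A + B * h * h" using A[OF u(1)] A[OF s] u(2) by simp
  then show ?thesis using h(1) by (simp add: field_simps)
qed

text \<open>Landau--Kolmogorov on the unit interval, by induction on the order \<open>n\<close>: the induction hypothesis for
  \<open>g'\<close> bounds \<open>g''\<close>, and its contribution is absorbed by a small step in the second-order bound.\<close>

lemma landau_kolmogorov:
  "\<exists>C\<ge>0. \<forall>(g :: nat \<Rightarrow> real \<Rightarrow> 'a::real_normed_vector) A B.
     (\<forall>j\<le>n. \<forall>s\<in>{0..1}. (g j has_vector_derivative g (Suc j) s) (at s within {0..1})) \<longrightarrow>
     (\<forall>s\<in>{0..1}. norm (g 0 s) \<le> A) \<longrightarrow> (\<forall>s\<in>{0..1}. norm (g (Suc n) s) \<le> B) \<longrightarrow>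
     (\<forall>s\<in>{0..1}. norm (g 1 s) \<le> C * (A + B))"
proof (induction n)
  case 0
  have "norm (g 1 s) \<le> 1 * (A + B)"
    if "\<forall>s\<in>{0..1}. norm (g 0 s) \<le> A" "\<forall>s\<in>{0..1}. norm (g (Suc 0) s) \<le> B" "s \<in> {0..1}"
    for g :: "nat \<Rightarrow> real \<Rightarrow> 'a" and A B s
    using order_trans[OF norm_ge_zero bspec[OF that(1) that(3)]] bspec[OF that(2) that(3)] by simp
  then show ?case by (intro exI[of _ 1]) auto
next
  case (Suc n)
  obtain C where C: "C \<ge> 0" and P: "\<forall>(g :: nat \<Rightarrow> real \<Rightarrow> 'a) A B.
     (\<forall>j\<le>n. \<forall>s\<in>{0..1}. (g j has_vector_derivative g (Suc j) s) (at s within {0..1})) \<longrightarrow>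
     (\<forall>s\<in>{0..1}. norm (g 0 s) \<le> A) \<longrightarrow> (\<forall>s\<in>{0..1}. norm (g (Suc n) s) \<le> B) \<longrightarrow>
     (\<forall>s\<in>{0..1}. norm (g 1 s) \<le> C * (A + B))"
    using Suc.IH by (elim exE conjE, intro that)
  have IH: "norm (g 1 s) \<le> C * (A + B)"
    if "\<forall>j\<le>n. \<forall>s\<in>{0..1}. (g j has_vector_derivative g (Suc j) s) (at s within {0..1})"
      "\<forall>s\<in>{0..1}. norm (g 0 s) \<le> A" "\<forall>s\<in>{0..1}. norm (g (Suc n) s) \<le> B" "s \<in> {0..1}"
    for g :: "nat \<Rightarrow> real \<Rightarrow> 'a" and A B s
    using P that by blast
  \<comment> \<open>Chosen so that \<open>C * h \<le> 1/2\<close>: in the bound for the maximum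
    \<open>M\<close> of \<open>norm (g 1 s)\<close> the term \<open>C * h * M\<close> then moves to
    the left-hand side.\<close>
  define h where "h = 1 / (2 * C + 2)"
  have h: "0 < h" "h \<le> 1/2" "C * h \<le> 1/2" using C by (auto simp: h_def field_simps)
  have "norm (g 1 s) \<le> (4 / h + 1) * (A + B)"
    if d: "\<forall>j\<le>Suc n. \<forall>s\<in>{0..1}. (g j has_vector_derivative g (Suc j) s) (at s within {0..1})"
      and A: "\<forall>s\<in>{0..1}. norm (g 0 s) \<le> A" and B: "\<forall>s\<in>{0..1}. norm (g (Suc (Suc n)) s) \<le> B"
      and s: "s \<in> {0..1}"
    for g :: "nat \<Rightarrow> real \<Rightarrow> 'a" and A B s
  proof -
    have "continuous_on {0..1} (g 1)"
      using d by (force intro!: continuous_on_vector_derivative)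
    then have "continuous_on {0..1} (\<lambda>s. norm (g 1 s))" by (intro continuous_intros)
    then obtain u where u: "u \<in> {0..1}" "\<And>s. s \<in> {0..1} \<Longrightarrow> norm (g 1 s) \<le> norm (g 1 u)"
      using continuous_attains_sup[of "{0..1::real}" "\<lambda>s. norm (g 1 s)"] by auto
    define M where "M = norm (g 1 u)"
    have A0: "A \<ge> 0" using order_trans[OF norm_ge_zero bspec[OF A u(1)]] .
    have B0: "B \<ge> 0" using order_trans[OF norm_ge_zero bspec[OF B u(1)]] .
    have "norm (g 2 s) \<le> C * (M + B)" if "s \<in> {0..1}" for s
      using IH[of "\<lambda>j. g (Suc j)" M B s] d B u that by (auto simp: M_def numeral_2_eq_2)
    then have "norm (g 1 u) \<le> 2 * A / h + C * (M + B) * h"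
      using d A h u(1) by (intro landau_vector[of "g 0" "g 1" "g 2"]) (auto simp: numeral_2_eq_2)
    also have "\<dots> = 2 * A / h + (C * h) * (M + B)" by (simp add: algebra_simps)
    also have "\<dots> \<le> 2 * A / h + 1/2 * (M + B)"
      using h(3) B0 by (intro add_left_mono mult_right_mono) (auto simp: M_def)
    finally have "M \<le> 2 * A / h + 1/2 * (M + B)" by (simp only: M_def)
    then have "M \<le> 2 * q + 1/2 * (M + B)" if "q = A / h" for q using that by simp
    from this[OF refl] have "M \<le> 4 * (A / h) + B" by argo
    then have "M \<le> 4 * A / h + B" by simp
    also have "\<dots> \<le> (4 / h + 1) * (A + B)" using A0 B0 h(1)
      by (simp add: algebra_simps add_divide_distrib)
    finally show ?thesis using u(2)[OF s] by (simp add: M_def)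
  qed
  then show ?case using h(1) by (intro exI[of _ "4 / h + 1"]) auto
qed

section \<open>Holomorphic functions of two variables\<close>

definition dz :: "(C2 \<Rightarrow> complex) \<Rightarrow> C2 \<Rightarrow> complex" where
  "dz h x = deriv (\<lambda>z. h (z, snd x)) (fst x)"

definition dw :: "(C2 \<Rightarrow> complex) \<Rightarrow> C2 \<Rightarrow> complex" where
  "dw h x = deriv (\<lambda>w. h (fst x, w)) (snd x)"

text \<open>Continuous and separately holomorphic functions. This class is visibly closed under partial
  derivatives, and it consists of the holomorphic functions.\<close>

definition holo :: "C2 set \<Rightarrow> (C2 \<Rightarrow> complex) \<Rightarrow> bool" where
  "holo U h \<longleftrightarrow> open U \<and> continuous_on U h \<and>
     (\<forall>x\<in>U. (\<lambda>z. h (z, snd x)) field_differentiable at (fst x)) \<and>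
     (\<forall>x\<in>U. (\<lambda>w. h (fst x, w)) field_differentiable at (snd x))"

lemma open_slice1: "open U \<Longrightarrow> open {z. (z, w) \<in> (U :: C2 set)}"
  using open_vimage[of U "\<lambda>z. (z, w)"] continuous_on_Pair[OF continuous_on_id continuous_on_const]
  by (auto simp: vimage_def)

lemma continuous_on_swap: "continuous_on A (prod.swap :: 'a::topological_space \<times> 'b::topological_space \<Rightarrow> _)"
  by (simp add: prod.swap_def continuous_on_Pair continuous_on_fst continuous_on_snd)

lemma holo_swap: "holo U h \<Longrightarrow> holo (prod.swap ` U) (h \<circ> prod.swap)"
proof -
  assume h: "holo U h"
  have "prod.swap ` U = prod.swap -` U" by (force simp: image_iff)
  moreover have "open (prod.swap -` U)"
    using h by (intro open_vimage continuous_on_swap) (auto simp: holo_def)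
  ultimately have "open (prod.swap ` U)" by simp
  moreover have "continuous_on (prod.swap ` U) (h \<circ> prod.swap)"
    using h by (intro continuous_on_compose continuous_on_swap) (auto simp: holo_def image_image)
  ultimately show ?thesis using h by (auto simp: holo_def)
qed

lemma dz_swap: "dz (h \<circ> prod.swap) = dw h \<circ> prod.swap"
  by (auto simp: dz_def dw_def fun_eq_iff)

lemma closed_bidisc_in_open:
  assumes "open (U :: C2 set)" "x \<in> U"
  obtains r where "r > 0" "cball (fst x) r \<times> cball (snd x) r \<subseteq> U"
proof -
  obtain A B where AB: "open A" "open B" "x \<in> A \<times> B" "A \<times> B \<subseteq> U"
    using open_prod_elim[OF assms] by blast
  obtain r s where "r > 0" "cball (fst x) r \<subseteq> A" "s > 0" "cball (snd x) s \<subseteq> B"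
    using AB by (metis open_contains_cball mem_Times_iff)
  then have "cball (fst x) (min r s) \<times> cball (snd x) (min r s) \<subseteq> A \<times> B" by auto
  then show ?thesis using that[of "min r s"] \<open>r > 0\<close> \<open>s > 0\<close> AB(4) by auto
qed

lemma holo_slice1:
  assumes "holo U h" shows "(\<lambda>z. h (z, w)) holomorphic_on {z. (z, w) \<in> U}"
  unfolding holomorphic_on_def
proof
  fix z assume "z \<in> {z. (z, w) \<in> U}"
  then have "(z, w) \<in> U" by simp
  from bspec[OF _ this, of "\<lambda>x. (\<lambda>z. h (z, snd x)) field_differentiable at (fst x)"] assms
  show "(\<lambda>z. h (z, w)) field_differentiable at z within {z. (z, w) \<in> U}"
    by (simp add: holo_def field_differentiable_at_within)
qed

lemma holo_slice2:
  assumes "holo U h" shows "(\<lambda>w. h (z, w)) holomorphic_on {w. (z, w) \<in> U}"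
  unfolding holomorphic_on_def
proof
  fix w assume "w \<in> {w. (z, w) \<in> U}"
  then have "(z, w) \<in> U" by simp
  from bspec[OF _ this, of "\<lambda>x. (\<lambda>w. h (fst x, w)) field_differentiable at (snd x)"] assms
  show "(\<lambda>w. h (z, w)) field_differentiable at w within {w. (z, w) \<in> U}"
    by (simp add: holo_def field_differentiable_at_within)
qed

text \<open>Cauchy's inequality, applied to the difference of two slices.\<close>

lemma continuous_on_dz:
  assumes h: "holo U h"
  shows "continuous_on U (dz h)"
proof -
  have oU: "open U" and ch: "continuous_on U h" using h by (auto simp: holo_def)
  have "isCont (dz h) x" if "x \<in> U" for x
  proof -
    obtain r where r: "r > 0" "cball (fst x) r \<times> cball (snd x) r \<subseteq> U"
      using closed_bidisc_in_open[OF oU \<open>x \<in> U\<close>] by blast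
    define K where "K = cball (fst x) r \<times> cball (snd x) r"
    have "compact K" by (simp add: K_def compact_Times)
    then have uc: "uniformly_continuous_on K h"
      using compact_uniformly_continuous ch r(2) K_def continuous_on_subset by blast
    have "\<exists>d>0. \<forall>y. dist y x < d \<longrightarrow> dist (dz h y) (dz h x) < e" if e: "e > 0" for e
    proof -
      \<comment> \<open>Cauchy's inequality at radius \<open>r / 2\<close> will turn the bound
        \<open>e * r / 8\<close> into \<open>e / 4\<close>.\<close>
      obtain d1 where d1: "d1 > 0" "\<And>a b. a \<in> K \<Longrightarrow> b \<in> K \<Longrightarrow> dist a b < d1 \<Longrightarrow> dist (h a) (h b) < e * r / 8"
        using uniformly_continuous_onE[OF uc, of "e * r / 8"] e r(1)
        by (auto simp: dist_commute)
      have "(\<lambda>z. h (z, snd x)) holomorphic_on ball (fst x) r"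
        by (rule holomorphic_on_subset[OF holo_slice1[OF h]]) (use r in auto)
      then have "isCont (deriv (\<lambda>z. h (z, snd x))) (fst x)"
        using r(1) by (meson centre_in_ball continuous_on_eq_continuous_at holomorphic_deriv
            holomorphic_on_imp_continuous_on open_ball)
      then obtain d2 where d2: "d2 > 0" "\<And>z. dist z (fst x) < d2 \<Longrightarrow>
          dist (deriv (\<lambda>z. h (z, snd x)) z) (deriv (\<lambda>z. h (z, snd x)) (fst x)) < e / 2"
        using e unfolding continuous_at_eps_delta dist_norm by (meson half_gt_zero)
      show ?thesis
      proof (intro exI[of _ "min (min d1 d2) (r/2)"] conjI allI impI)
        fix y assume y: "dist y x < min (min d1 d2) (r/2)"
        have y1: "dist (fst y) (fst x) < min d2 (r/2)" and y2: "dist (snd y) (snd x) < min d1 (r/2)"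
          using y dist_fst_le[of y x] dist_snd_le[of y x] by auto
        define k where "k = (\<lambda>z. h (z, snd y) - h (z, snd x))"
        have sub: "cball (fst y) (r/2) \<subseteq> cball (fst x) r"
          using y1 by (intro cball_subset_cball_iff[THEN iffD2]) auto
        have K: "(z, snd y) \<in> K" "(z, snd x) \<in> K" if "z \<in> cball (fst y) (r/2)" for z
          using that sub y2 r(1) by (auto simp: K_def dist_commute)
        have hol: "(\<lambda>z. h (z, snd y)) holomorphic_on ball (fst y) (r/2)"
            "(\<lambda>z. h (z, snd x)) holomorphic_on ball (fst y) (r/2)"
          using K[OF subsetD[OF ball_subset_cball]] r(2)[folded K_def]
          by (auto intro!: holomorphic_on_subset[OF holo_slice1[OF h]])
        have "norm ((deriv ^^ 1) k (fst y)) \<le> fact 1 * (e * r / 8) / (r/2) ^ 1"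
        proof (rule Cauchy_inequality)
          show "k holomorphic_on ball (fst y) (r/2)"
            unfolding k_def by (intro holomorphic_intros hol)
          show "continuous_on (cball (fst y) (r/2)) k"
            unfolding k_def using K r(2)
            by (intro continuous_intros continuous_on_compose2[OF ch]) (force simp: K_def)+
          show "norm (k z) \<le> e * r / 8" if "norm (fst y - z) = r/2" for z
          proof -
            have "z \<in> cball (fst y) (r/2)" using that by (simp add: dist_norm)
            then show ?thesis
              using d1(2)[OF K(1) K(2), of z z] y2 by (simp add: k_def dist_norm dist_Pair_Pair)
          qed
        qed (use r in auto)
        moreover have "deriv k (fst y) = dz h y - deriv (\<lambda>z. h (z, snd x)) (fst y)"
          unfolding k_def dz_def using hol r(1)
          by (intro deriv_diff) (auto intro: holomorphic_on_imp_differentiable_at)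
        ultimately have "dist (dz h y) (deriv (\<lambda>z. h (z, snd x)) (fst y)) \<le> e / 4"
          using r(1) by (simp add: dist_norm)
        moreover have "dist (deriv (\<lambda>z. h (z, snd x)) (fst y)) (dz h x) < e / 2"
          using d2(2)[of "fst y"] y1 by (simp add: dz_def)
        ultimately show "dist (dz h y) (dz h x) < e"
          using e dist_triangle[of "dz h y" "dz h x" "deriv (\<lambda>z. h (z, snd x)) (fst y)"] by linarith
      qed (use d1 d2 r in auto)
    qed
    then show ?thesis unfolding continuous_at_eps_delta dist_norm by blast
  qed
  then show ?thesis by (simp add: continuous_at_imp_continuous_on)
qed

text \<open>In the other variable, the partial derivative is a locally uniform limit of difference quotients.\<close>

lemma dz_differentiable_snd:
  assumes h: "holo U h" and x: "x \<in> U"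
  shows "(\<lambda>w. dz h (fst x, w)) field_differentiable at (snd x)"
proof -
  have oU: "open U" using h by (auto simp: holo_def)
  obtain r where r: "r > 0" "cball (fst x) r \<times> cball (snd x) r \<subseteq> U"
    using closed_bidisc_in_open[OF oU x] by blast
  define K where "K = cball (fst x) r \<times> cball (snd x) r"
  \<comment> \<open>Difference quotients in \<open>z\<close> with step at most \<open>r\<close>, so
    that all points stay in the closed bidisc; each quotient is holomorphic in
    \<open>w\<close>.\<close>
  define q where "q = (\<lambda>n w. (h (fst x + of_real (r / Suc n), w) - h (fst x, w)) / of_real (r / Suc n))"
  have "compact K" by (simp add: K_def compact_Times)
  then have uc: "uniformly_continuous_on K (dz h)"
    using compact_uniformly_continuous continuous_on_dz[OF h] r(2) K_def continuous_on_subset by blast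
  have lim: "uniform_limit (cball (snd x) r) q (\<lambda>w. dz h (fst x, w)) sequentially"
  proof (rule uniform_limitI)
    fix e :: real assume e: "e > 0"
    obtain d where d: "d > 0" "\<And>a b. a \<in> K \<Longrightarrow> b \<in> K \<Longrightarrow> dist a b < d \<Longrightarrow> dist (dz h a) (dz h b) < e / 2"
      using uniformly_continuous_onE[OF uc, of "e / 2"] e by (auto simp: dist_commute)
    have "(\<lambda>n. r / Suc n) \<longlonglongrightarrow> 0"
      using LIMSEQ_Suc[OF lim_const_over_n[of r]] by simp
    then have "eventually (\<lambda>n. r / Suc n < d) sequentially" using d(1) by (rule order_tendstoD)
    then show "eventually (\<lambda>n. \<forall>w\<in>cball (snd x) r. dist (q n w) (dz h (fst x, w)) < e) sequentially"
    proof (rule eventually_mono, intro ballI)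
      fix n w assume n: "r / Suc n < d" and w: "w \<in> cball (snd x) r"
      define t where "t = r / Suc n"
      have t: "0 < t" "t \<le> r" "t < d" using r(1) n by (auto simp: t_def divide_le_eq)
      define S where "S = closed_segment (fst x) (fst x + of_real t)"
      have Sd: "norm (z - fst x) \<le> t" if "z \<in> S" for z
        using segment_bound1[OF that[unfolded S_def]] t(1) by simp
      have SK: "(z, w) \<in> K" if "z \<in> S" for z
        using Sd[OF that] t w by (auto simp: K_def dist_norm norm_minus_commute)
      have S0: "fst x \<in> S" "fst x + of_real t \<in> S" by (auto simp: S_def)
      have "norm ((h (fst x + of_real t, w) - dz h (fst x, w) * (fst x + of_real t)) - (h (fst x, w) - dz h (fst x, w) * fst x))
          \<le> e / 2 * norm ((fst x + of_real t) - fst x)"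
      proof (rule field_differentiable_bound[where S = S and f' = "\<lambda>z. dz h (z, w) - dz h (fst x, w)"])
        show "convex S" by (simp add: S_def)
        show "((\<lambda>z. h (z, w) - dz h (fst x, w) * z) has_field_derivative dz h (z, w) - dz h (fst x, w)) (at z within S)"
          if "z \<in> S" for z
        proof -
          have "(z, w) \<in> U" using SK[OF that] r(2) by (auto simp: K_def)
          then have "((\<lambda>z. h (z, w)) has_field_derivative dz h (z, w)) (at z)"
            using h by (auto simp: holo_def dz_def DERIV_deriv_iff_field_differentiable)
          then have "((\<lambda>z. h (z, w) - dz h (fst x, w) * z) has_field_derivative dz h (z, w) - dz h (fst x, w)) (at z)"
            by (auto intro!: derivative_eq_intros)
          then show ?thesis by (rule has_field_derivative_at_within)
        qed
        show "norm (dz h (z, w) - dz h (fst x, w)) \<le> e / 2" if "z \<in> S" for z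
          using d(2)[OF SK[OF that] SK[OF S0(1)]] Sd[OF that] t
          by (simp add: dist_Pair_Pair dist_norm)
      qed (use S0 in auto)
      then have "norm (h (fst x + of_real t, w) - h (fst x, w) - dz h (fst x, w) * of_real t) \<le> e / 2 * t"
        using t(1) by (simp add: algebra_simps)
      moreover have "h (fst x + of_real t, w) - h (fst x, w) - dz h (fst x, w) * of_real t
          = (q n w - dz h (fst x, w)) * of_real t"
        using t(1) unfolding q_def t_def[symmetric] by (simp add: field_simps)
      ultimately have "norm (q n w - dz h (fst x, w)) * t \<le> e / 2 * t"
        using t(1) by (simp add: norm_mult)
      then show "dist (q n w) (dz h (fst x, w)) < e" using t(1) e by (simp add: dist_norm)
    qed
  qed
  have "continuous_on (cball (snd x) r) (q n) \<and> q n holomorphic_on ball (snd x) r" for n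
  proof -
    have "r / Suc n \<le> r" using r(1) by (simp add: divide_le_eq)
    then have sub: "cball (snd x) r \<subseteq> {w. (fst x + of_real (r / Suc n), w) \<in> U}" "cball (snd x) r \<subseteq> {w. (fst x, w) \<in> U}"
      using r(1) by (auto intro!: subsetD[OF r(2)] simp: dist_norm norm_divide simp del: of_nat_Suc)
    have hol: "(\<lambda>w. h (fst x + of_real (r / Suc n), w)) holomorphic_on cball (snd x) r"
      "(\<lambda>w. h (fst x, w)) holomorphic_on cball (snd x) r"
      using holomorphic_on_subset[OF holo_slice2[OF h]] sub by blast+
    have "of_real (r / Suc n) \<noteq> (0 :: complex)" using r(1) by (simp del: of_nat_Suc)
    then have "q n holomorphic_on cball (snd x) r"
      unfolding q_def by (intro holomorphic_on_divide holomorphic_on_diff hol holomorphic_on_const) auto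
    then show ?thesis
      using holomorphic_on_imp_continuous_on holomorphic_on_subset ball_subset_cball by blast
  qed
  then have "(\<lambda>w. dz h (fst x, w)) holomorphic_on ball (snd x) r"
    using holomorphic_uniform_limit[OF _ lim] by auto
  then show ?thesis using r(1) by (meson centre_in_ball holomorphic_on_imp_differentiable_at open_ball)
qed

lemma holo_dz:
  assumes h: "holo U h" shows "holo U (dz h)"
proof -
  have "(\<lambda>z. dz h (z, snd x)) field_differentiable at (fst x)" if "x \<in> U" for x
  proof -
    have "(\<lambda>z. h (z, snd x)) holomorphic_on {z. (z, snd x) \<in> U}" "open {z. (z, snd x) \<in> U}"
      using holo_slice1[OF h] open_slice1 h by (auto simp: holo_def)
    then have "deriv (\<lambda>z. h (z, snd x)) holomorphic_on {z. (z, snd x) \<in> U}" by (rule holomorphic_deriv)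
    then show ?thesis using that \<open>open {z. (z, snd x) \<in> U}\<close>
      by (auto simp: dz_def intro!: holomorphic_on_imp_differentiable_at)
  qed
  then show ?thesis using h continuous_on_dz[OF h] dz_differentiable_snd[OF h] by (simp add: holo_def)
qed

lemma holo_dw:
  assumes h: "holo U h" shows "holo U (dw h)"
proof -
  have "holo (prod.swap ` (prod.swap ` U)) (dz (h \<circ> prod.swap) \<circ> prod.swap)"
    by (intro holo_swap holo_dz h)
  then show ?thesis by (simp add: dz_swap image_image comp_assoc)
qed

text \<open>Partial derivatives yield a total derivative once one of them is jointly continuous; for
  \<open>dw h\<close> this is part of \<open>holo_dw\<close>.\<close>

lemma holo_has_derivative:
  assumes h: "holo U h" and x: "x \<in> U"
  shows "(h has_derivative (\<lambda>v. dz h x * fst v + dw h x * snd v)) (at x)"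
proof -
  have oU: "open U" using h by (auto simp: holo_def)
  obtain r where r: "r > 0" "cball (fst x) r \<times> cball (snd x) r \<subseteq> U"
    using closed_bidisc_in_open[OF oU x] by blast
  define X where "X = ball (fst x) r" define Y where "Y = ball (snd x) r"
  have XY: "X \<times> Y \<subseteq> U" "fst x \<in> X" "snd x \<in> Y" "open X" "open Y" "convex Y"
    using r by (auto simp: X_def Y_def)
  have "((\<lambda>(z, w). curry h z w) has_derivative
      (\<lambda>(tz, tw). dz h x * tz + blinfun_apply (blinfun_mult_right (dw h (fst x, snd x))) tw)) (at (fst x, snd x) within X \<times> Y)"
  proof (rule has_derivative_partialsI[where fy = "\<lambda>z w. blinfun_mult_right (dw h (z, w))"])
    show "((\<lambda>z. curry h z (snd x)) has_derivative (\<lambda>tz. dz h x * tz)) (at (fst x) within X)"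
    proof -
      have "((\<lambda>z. h (z, snd x)) has_field_derivative dz h x) (at (fst x))"
        using h x by (simp add: holo_def dz_def DERIV_deriv_iff_field_differentiable)
      then show ?thesis
        by (auto simp: has_field_derivative_def intro: has_derivative_at_withinI)
    qed
    show "((\<lambda>w. curry h z w) has_derivative blinfun_apply (blinfun_mult_right (dw h (z, w)))) (at w within Y)"
      if "z \<in> X" "w \<in> Y" for z w
    proof -
      have "(z, w) \<in> U" using that XY by auto
      then have "((\<lambda>w. h (z, w)) has_field_derivative dw h (z, w)) (at w)"
        using h by (auto simp: holo_def dw_def DERIV_deriv_iff_field_differentiable)
      then show ?thesis
        by (auto simp: has_field_derivative_def blinfun_mult_right.rep_eq intro: has_derivative_at_withinI)
    qed
    have "isCont (dw h) x"
      using holo_dw[OF h] x oU by (simp add: holo_def continuous_on_eq_continuous_at)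
    then have "isCont (\<lambda>y. blinfun_mult_right (dw h y)) x"
      by (intro continuous_intros)
    then show "continuous (at (fst x, snd x) within X \<times> Y) (\<lambda>(z, w). blinfun_mult_right (dw h (z, w)))"
      by (auto simp: case_prod_beta' intro: continuous_within_subset)
  qed (use XY in auto)
  then have "(h has_derivative (\<lambda>v. dz h x * fst v + dw h x * snd v)) (at x within X \<times> Y)"
    by (simp add: case_prod_beta' blinfun_mult_right.rep_eq)
  then show ?thesis using XY by (metis at_within_open mem_Times_iff open_Times)
qed

lemma holo_linear_derivative:
  assumes "open U" "\<And>x. x \<in> U \<Longrightarrow> \<exists>a b. (h has_derivative (\<lambda>v. a * fst v + b * snd v)) (at x)"
  shows "holo U h"
  unfolding holo_def
proof (intro conjI ballI assms(1))
  show "continuous_on U h"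
    using assms(2) has_derivative_continuous by (intro continuous_at_imp_continuous_on) blast
  fix x assume "x \<in> U"
  then obtain a b where "(h has_derivative (\<lambda>v. a * fst v + b * snd v)) (at x)"
    using assms(2) by blast
  then have D: "(h has_derivative (\<lambda>v. a * fst v + b * snd v)) (at (fst x, snd x))" by simp
  have "((\<lambda>z. h (z, snd x)) has_derivative (\<lambda>v. a * fst (v, 0) + b * snd (v, 0))) (at (fst x))"
  proof -
    have "((\<lambda>z. (z, snd x)) has_derivative (\<lambda>v. (v, 0))) (at (fst x))"
      by (rule has_derivative_Pair[OF has_derivative_ident has_derivative_const])
    from has_derivative_compose[OF this, of h, OF D] show ?thesis by simp
  qed
  then show "(\<lambda>z. h (z, snd x)) field_differentiable at (fst x)"
    by (auto simp: field_differentiable_def has_field_derivative_def)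
  have "((\<lambda>w. h (fst x, w)) has_derivative (\<lambda>v. a * fst (0, v) + b * snd (0, v))) (at (snd x))"
  proof -
    have "((\<lambda>w. (fst x, w)) has_derivative (\<lambda>v. (0, v))) (at (snd x))"
      by (rule has_derivative_Pair[OF has_derivative_const has_derivative_ident])
    from has_derivative_compose[OF this, of h, OF D] show ?thesis by simp
  qed
  then show "(\<lambda>w. h (fst x, w)) field_differentiable at (snd x)"
    by (auto simp: field_differentiable_def has_field_derivative_def)
qed

lemma complex_linear_coordinates:
  fixes D :: "C2 \<Rightarrow> C2"
  assumes "linear D" "\<And>c v. D (cscale c v) = cscale c (D v)"
  shows "D v = (fst (D (1, 0)) * fst v + fst (D (0, 1)) * snd v, snd (D (1, 0)) * fst v + snd (D (0, 1)) * snd v)"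
proof -
  have "D v = D (cscale (fst v) (1, 0) + cscale (snd v) (0, 1))" by (simp add: cscale_def)
  also have "\<dots> = cscale (fst v) (D (1, 0)) + cscale (snd v) (D (0, 1))"
    using assms by (simp add: linear_add)
  finally show ?thesis by (simp add: cscale_def mult.commute)
qed

text \<open>A complex linear derivative is a matrix with complex entries, so each component has a
  derivative of the form required by \<open>holo_linear_derivative\<close>.\<close>

lemma holomorphic2_on_holo:
  assumes "open U" "holomorphic2_on U f"
  shows "holo U (fst \<circ> f)" "holo U (snd \<circ> f)"
proof -
  have *: "\<exists>a b c d. (f has_derivative (\<lambda>v. (a * fst v + b * snd v, c * fst v + d * snd v))) (at x)" if "x \<in> U" for x
  proof -
    obtain D where D: "(f has_derivative D) (at x)" "\<forall>c v. D (cscale c v) = cscale c (D v)"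
      using bspec[OF assms(2)[unfolded holomorphic2_on_def] \<open>x \<in> U\<close>] by (elim exE conjE)
    have eq: "D = (\<lambda>v. (fst (D (1, 0)) * fst v + fst (D (0, 1)) * snd v, snd (D (1, 0)) * fst v + snd (D (0, 1)) * snd v))"
      using D(2) by (intro ext complex_linear_coordinates[OF has_derivative_linear[OF D(1)]]) blast
    show ?thesis by (intro exI) (rule has_derivative_eq_rhs[OF D(1) eq])
  qed
  show "holo U (fst \<circ> f)" "holo U (snd \<circ> f)"
    using * by (intro holo_linear_derivative[OF assms(1)]; force dest: has_derivative_fst has_derivative_snd simp: o_def)+
qed

section \<open>Polynomial approximation and polynomial hulls\<close>

lemma polynomial2_monomial: "polynomial2 (\<lambda>x. c * fst x ^ i * snd x ^ j)"
proof -
  have "c * fst x ^ i * snd x ^ j =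
      (\<Sum>a\<le>max i j. \<Sum>b\<le>max i j. (if a = i \<and> b = j then c else 0) * fst x ^ a * snd x ^ b)" for x :: C2
  proof -
    have "(\<Sum>b\<le>max i j. (if a = i \<and> b = j then c else 0) * fst x ^ a * snd x ^ b) =
        (if a = i then c * fst x ^ i * snd x ^ j else 0)" for a
      by (auto simp: if_distrib[of "\<lambda>t. t * _"] sum.delta cong: if_cong)
    then show ?thesis by (simp add: sum.delta)
  qed
  then show ?thesis unfolding polynomial2_def
    by (intro exI[of _ "max i j"] exI[of _ "\<lambda>a b. if a = i \<and> b = j then c else 0"]) blast
qed

lemma polynomial2_add:
  assumes "polynomial2 P" "polynomial2 Q" shows "polynomial2 (\<lambda>x. P x + Q x)"
proof -
  obtain N c where P: "\<And>x. P x = (\<Sum>i\<le>N. \<Sum>j\<le>N. c i j * fst x ^ i * snd x ^ j)"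
    using assms(1) unfolding polynomial2_def by blast
  obtain M d where Q: "\<And>x. Q x = (\<Sum>i\<le>M. \<Sum>j\<le>M. d i j * fst x ^ i * snd x ^ j)"
    using assms(2) unfolding polynomial2_def by blast
  have pad: "(\<Sum>i\<le>N. \<Sum>j\<le>N. c i j * fst x ^ i * snd x ^ j) =
      (\<Sum>i\<le>L. \<Sum>j\<le>L. (if i \<le> N \<and> j \<le> N then c i j else 0) * fst x ^ i * snd x ^ j)"
    if "N \<le> L" for N L c and x :: C2
  proof -
    have "(\<Sum>j\<le>L. (if i \<le> N \<and> j \<le> N then c i j else 0) * fst x ^ i * snd x ^ j) =
        (if i \<le> N then \<Sum>j\<le>N. c i j * fst x ^ i * snd x ^ j else 0)" for i
      using that by (auto intro!: sum.mono_neutral_cong_right split: if_splits)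
    then show ?thesis using that by (auto intro!: sum.mono_neutral_cong_left split: if_splits)
  qed
  show ?thesis unfolding polynomial2_def
    by (rule exI[of _ "max N M"], rule exI[of _ "\<lambda>i j. (if i \<le> N \<and> j \<le> N then c i j else 0) + (if i \<le> M \<and> j \<le> M then d i j else 0)"])
      (simp add: P Q pad[of N "max N M"] pad[of M "max N M"] sum.distrib distrib_right)
qed

lemma polynomial2_const: "polynomial2 (\<lambda>x. c)"
  using polynomial2_monomial[of c 0 0] by simp

lemma polynomial2_fst: "polynomial2 fst"
  using polynomial2_monomial[of 1 1 0] by simp

lemma polynomial2_snd: "polynomial2 snd"
  using polynomial2_monomial[of 1 0 1] by simp

lemma polynomial2_sum:
  "(\<And>i. i \<in> I \<Longrightarrow> polynomial2 (P i)) \<Longrightarrow> polynomial2 (\<lambda>x. \<Sum>i\<in>I. P i x)"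
  by (induction I rule: infinite_finite_induct) (auto intro: polynomial2_const polynomial2_add)

lemma polynomial2_mult:
  assumes "polynomial2 P" "polynomial2 Q" shows "polynomial2 (\<lambda>x. P x * Q x)"
proof -
  obtain N c where P: "\<And>x. P x = (\<Sum>i\<le>N. \<Sum>j\<le>N. c i j * fst x ^ i * snd x ^ j)"
    using assms(1) unfolding polynomial2_def by blast
  obtain M d where Q: "\<And>x. Q x = (\<Sum>i\<le>M. \<Sum>j\<le>M. d i j * fst x ^ i * snd x ^ j)"
    using assms(2) unfolding polynomial2_def by blast
  have "(\<lambda>x. P x * Q x) = (\<lambda>x. \<Sum>i\<le>N. \<Sum>j\<le>N. \<Sum>k\<le>M. \<Sum>l\<le>M. (c i j * d k l) * fst x ^ (i + k) * snd x ^ (j + l))"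
  proof
    fix x
    have "P x * Q x = (\<Sum>i\<le>N. \<Sum>j\<le>N. c i j * fst x ^ i * snd x ^ j * Q x)"
      by (simp only: P sum_distrib_right)
    also have "\<dots> = (\<Sum>i\<le>N. \<Sum>j\<le>N. \<Sum>k\<le>M. \<Sum>l\<le>M. (c i j * fst x ^ i * snd x ^ j) * (d k l * fst x ^ k * snd x ^ l))"
      by (simp only: Q sum_distrib_left)
    finally show "P x * Q x = (\<Sum>i\<le>N. \<Sum>j\<le>N. \<Sum>k\<le>M. \<Sum>l\<le>M. (c i j * d k l) * fst x ^ (i + k) * snd x ^ (j + l))"
      by (simp add: power_add mult_ac)
  qed
  then show ?thesis by (auto intro!: polynomial2_sum polynomial2_monomial)
qed

lemma polynomial2_power: "polynomial2 P \<Longrightarrow> polynomial2 (\<lambda>x. P x ^ n)"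
  by (induction n) (auto intro: polynomial2_const polynomial2_mult)

lemma polynomial2_translate:
  assumes "polynomial2 P" shows "polynomial2 (\<lambda>x. P (x - p))"
proof -
  obtain N c where P: "\<And>x. P x = (\<Sum>i\<le>N. \<Sum>j\<le>N. c i j * fst x ^ i * snd x ^ j)"
    using assms unfolding polynomial2_def by blast
  have "polynomial2 (\<lambda>x. \<Sum>i\<le>N. \<Sum>j\<le>N. c i j * (fst x + - fst p) ^ i * (snd x + - snd p) ^ j)"
    by (intro polynomial2_sum polynomial2_mult polynomial2_power polynomial2_add polynomial2_const polynomial2_fst polynomial2_snd)
  then show ?thesis by (simp add: P)
qed

section \<open>Taylor expansion along complex lines\<close>

lemma holo_along_line:
  assumes h: "holo U h"
  shows "open {t. p + cscale t x \<in> U}"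
    and "p + cscale t x \<in> U \<Longrightarrow> ((\<lambda>t. h (p + cscale t x)) has_field_derivative
        (fst x * dz h (p + cscale t x) + snd x * dw h (p + cscale t x))) (at t)"
    and "(\<lambda>t. h (p + cscale t x)) holomorphic_on {t. p + cscale t x \<in> U}"
proof -
  have d: "((\<lambda>t. p + cscale t x) has_derivative (\<lambda>s. cscale s x)) (at t)" for t
    unfolding cscale_def by (auto intro!: derivative_eq_intros)
  have "isCont (\<lambda>t. p + cscale t x) t" for t
    using has_derivative_continuous[OF d] .
  then have "continuous_on UNIV (\<lambda>t. p + cscale t x)" by (simp add: continuous_at_imp_continuous_on)
  then show "open {t. p + cscale t x \<in> U}"
    using open_vimage[of U "\<lambda>t. p + cscale t x"] h by (auto simp: holo_def vimage_def)
  show D: "((\<lambda>t. h (p + cscale t x)) has_field_derivative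
        (fst x * dz h (p + cscale t x) + snd x * dw h (p + cscale t x))) (at t)" if "p + cscale t x \<in> U" for t
    using has_derivative_compose[OF d holo_has_derivative[OF h that]]
    by (simp add: has_field_derivative_def cscale_def algebra_simps)
      (erule has_derivative_eq_rhs, simp add: fun_eq_iff algebra_simps)
  show "(\<lambda>t. h (p + cscale t x)) holomorphic_on {t. p + cscale t x \<in> U}"
    unfolding holomorphic_on_def using D by (auto simp: field_differentiable_def intro: has_field_derivative_at_within)
qed

text \<open>The \<open>n\<close>-th derivative along the line through \<open>p\<close> in direction
  \<open>x\<close> is \<open>n!\<close> times the homogeneous Taylor part of degree
  \<open>n\<close>. One differentiation produces the factors \<open>fst x\<close> and
  \<open>snd x\<close> in front of the same expression for \<open>dz h\<close> and
  \<open>dw h\<close>, hence the induction over all \<open>h\<close>.\<close>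

lemma polynomial2_higher_deriv:
  assumes "holo U h" "p \<in> U"
  shows "polynomial2 (\<lambda>x. (deriv ^^ n) (\<lambda>t. h (p + cscale t x)) 0)"
  using assms(1)
proof (induction n arbitrary: h)
  case 0
  then show ?case by (simp add: cscale_def polynomial2_const)
next
  case (Suc n)
  have "(deriv ^^ Suc n) (\<lambda>t. h (p + cscale t x)) 0 =
      fst x * (deriv ^^ n) (\<lambda>t. dz h (p + cscale t x)) 0 + snd x * (deriv ^^ n) (\<lambda>t. dw h (p + cscale t x)) 0" for x
  proof -
    define T where "T = {t. p + cscale t x \<in> U}"
    have T: "open T" "0 \<in> T" using holo_along_line(1)[OF Suc.prems] assms(2) by (auto simp: T_def cscale_def simp flip: zero_prod_def)
    have hol: "(\<lambda>t. dz h (p + cscale t x)) holomorphic_on T" "(\<lambda>t. dw h (p + cscale t x)) holomorphic_on T"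
      using holo_along_line(3) holo_dz holo_dw Suc.prems unfolding T_def by blast+
    have "(deriv ^^ Suc n) (\<lambda>t. h (p + cscale t x)) 0 = (deriv ^^ n) (deriv (\<lambda>t. h (p + cscale t x))) 0"
      by (simp add: funpow_Suc_right del: funpow.simps)
    also have "\<dots> = (deriv ^^ n) (\<lambda>t. fst x * dz h (p + cscale t x) + snd x * dw h (p + cscale t x)) 0"
    proof (rule higher_deriv_cong_ev)
      have "eventually (\<lambda>t. t \<in> T) (nhds 0)" using T by (rule eventually_nhds_in_open)
      then show "eventually (\<lambda>t. deriv (\<lambda>t. h (p + cscale t x)) t =
          fst x * dz h (p + cscale t x) + snd x * dw h (p + cscale t x)) (nhds 0)"
        by eventually_elim (rule DERIV_imp_deriv, rule holo_along_line(2)[OF Suc.prems], simp add: T_def)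
    qed simp
    also have "\<dots> = (deriv ^^ n) (\<lambda>t. fst x * dz h (p + cscale t x)) 0 + (deriv ^^ n) (\<lambda>t. snd x * dw h (p + cscale t x)) 0"
      using T hol by (intro higher_deriv_add[of _ T]) (auto intro!: holomorphic_intros)
    finally show ?thesis using T hol by (simp add: higher_deriv_cmult)
  qed
  then show ?case
    using Suc.IH[OF holo_dz[OF Suc.prems]] Suc.IH[OF holo_dw[OF Suc.prems]]
    by (simp only:) (intro polynomial2_add polynomial2_mult polynomial2_fst polynomial2_snd)
qed

lemma norm_cscale: "norm (cscale c v) = norm c * norm v"
  by (simp add: cscale_def norm_Pair norm_prod_def norm_mult power_mult_distrib real_sqrt_mult
      flip: distrib_left)

text \<open>On the line through \<open>p\<close> and a point \<open>x\<close> of the ball the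
  parameter \<open>t = 1\<close> gives \<open>x\<close>, while the function is still defined for
  \<open>norm t \<le> 2\<close>. Cauchy's inequality on the circle of radius 2 therefore bounds the
  Taylor terms by \<open>M * (1/2) ^ n\<close>, uniformly in \<open>x\<close>.\<close>

lemma holo_polynomial_approximation:
  assumes h: "holo U h" and r: "r > 0" "cball p (2 * r) \<subseteq> U" and e: "e > 0"
  obtains P where "polynomial2 P" "\<And>x. x \<in> cball p r \<Longrightarrow> norm (h x - P x) < e"
proof -
  have "compact (h ` cball p (2 * r))"
    using h r(2) by (intro compact_continuous_image) (auto simp: holo_def intro: continuous_on_subset)
  then obtain M where M: "M > 0" "\<And>y. y \<in> cball p (2 * r) \<Longrightarrow> norm (h y) \<le> M"
    using bounded_pos[of "h ` cball p (2 * r)"] compact_imp_bounded by auto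
  have "(\<lambda>N. M * (1/2) ^ N * 2) \<longlonglongrightarrow> M * 0 * 2"
    by (intro tendsto_intros LIMSEQ_power_zero) auto
  then have "eventually (\<lambda>N. M * (1/2) ^ N * 2 < e) sequentially"
    by (rule order_tendstoD) (use e in simp)
  then obtain N where N: "M * (1/2) ^ N * 2 < e" by (auto simp: eventually_sequentially)
  define a where "a = (\<lambda>n x. (deriv ^^ n) (\<lambda>t. h (p + cscale t x)) 0 / fact n)"
  define P where "P = (\<lambda>x. \<Sum>n<N. a n (x - p))"
  have pU: "p \<in> U" using r by auto
  have "polynomial2 (\<lambda>x. a n x)" for n
  proof -
    have "polynomial2 (\<lambda>x. (1 / fact n) * (deriv ^^ n) (\<lambda>t. h (p + cscale t x)) 0)"
      by (intro polynomial2_mult polynomial2_const polynomial2_higher_deriv[OF h pU])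
    then show ?thesis by (simp add: a_def)
  qed
  then have "polynomial2 (\<lambda>x. a n (x - p))" for n
    by (rule polynomial2_translate)
  then have "polynomial2 P" unfolding P_def by (intro polynomial2_sum) auto
  moreover have "norm (h x - P x) < e" if x: "x \<in> cball p r" for x
  proof -
    define f where "f = (\<lambda>t. h (p + cscale t (x - p)))"
    have in_ball: "p + cscale t (x - p) \<in> cball p (2 * r)" if "t \<in> cball 0 2" for t
    proof -
      have "norm (cscale t (x - p)) \<le> 2 * r" unfolding norm_cscale
        using that x by (intro mult_mono) (auto simp: dist_norm norm_minus_commute)
      then show ?thesis by (simp add: dist_norm)
    qed
    have hol: "f holomorphic_on cball 0 2"
      unfolding f_def using in_ball r(2) by (intro holomorphic_on_subset[OF holo_along_line(3)[OF h]]) blast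
    have bound: "norm (a n (x - p)) \<le> M * (1/2) ^ n" for n
    proof -
      have "norm ((deriv ^^ n) f 0) \<le> fact n * M / 2 ^ n"
      proof (rule Cauchy_inequality)
        show "f holomorphic_on ball 0 2" using hol holomorphic_on_subset ball_subset_cball by blast
        show "continuous_on (cball 0 2) f" using hol by (rule holomorphic_on_imp_continuous_on)
        show "norm (f t) \<le> M" if "norm (0 - t) = 2" for t
          using M(2)[OF in_ball[of t]] that by (simp add: f_def)
      qed simp
      then show ?thesis by (simp add: a_def f_def norm_divide field_simps)
    qed
    have "(\<lambda>n. (deriv ^^ n) f 0 / fact n * (1 - 0) ^ n) sums f 1"
      using hol by (intro holomorphic_power_series[of f 0 2]) (auto intro: holomorphic_on_subset)
    moreover have "p + cscale 1 (x - p) = x" by (simp add: cscale_def prod_eq_iff)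
    then have "f 1 = h x" by (simp add: f_def)
    ultimately have sums: "(\<lambda>n. a n (x - p)) sums h x" by (simp add: a_def f_def)
    have geo: "(\<lambda>n. M * (1/2) ^ (n + N)) sums (M * (1/2) ^ N * 2)"
      using sums_mult[OF geometric_sums[of "1/2 :: real"], of "M * (1/2) ^ N"] by (simp add: power_add mult_ac)
    have "(\<lambda>n. a (n + N) (x - p)) sums (h x - P x)"
      using sums_split_initial_segment[OF sums, of N] by (simp add: P_def)
    then have "norm (h x - P x) \<le> M * (1/2) ^ N * 2"
      using bound geo by (metis (no_types, lifting) sums_unique sums_summable suminf_le norm_suminf_le)
    then show ?thesis using N by simp
  qed
  ultimately show ?thesis using that by blast
qed

lemma polynomial_hull_subset_cball:
  assumes "K \<subseteq> cball p r" "x \<in> polynomial_hull K"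
  shows "x \<in> cball p r"
proof -
  \<comment> \<open>The Hermitian product of \<open>y - p\<close> with \<open>x - p\<close>, a
    polynomial in \<open>y\<close>: its value at \<open>x\<close> is the square of
    \<open>norm (x - p)\<close>, and on \<open>K\<close> Cauchy-Schwarz bounds it by
    \<open>r * norm (x - p)\<close>.\<close>
  define P where "P = (\<lambda>y. (fst y + - fst p) * cnj (fst (x - p)) + (snd y + - snd p) * cnj (snd (x - p)))"
  have "polynomial2 P" unfolding P_def
    by (intro polynomial2_add polynomial2_mult polynomial2_const polynomial2_fst polynomial2_snd)
  then obtain y where y: "y \<in> K" "norm (P x) \<le> norm (P y)"
    using assms(2) by (auto simp: polynomial_hull_def)
  have "P x = of_real ((norm (x - p))\<^sup>2)"
    by (simp add: P_def norm_prod_def complex_norm_square del: complex_cnj_diff of_real_power)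
  then have "(norm (x - p))\<^sup>2 \<le> norm (P y)" using y(2) by (simp add: norm_power)
  also have "norm (P y) \<le> norm (fst (y - p)) * norm (fst (x - p)) + norm (snd (y - p)) * norm (snd (x - p))"
    unfolding P_def by (rule order_trans[OF norm_triangle_ineq]) (simp add: norm_mult del: complex_cnj_diff)
  also have "\<dots> = inner (norm (fst (y - p)), norm (snd (y - p))) (norm (fst (x - p)), norm (snd (x - p)))"
    by simp
  also have "\<dots> \<le> norm (y - p) * norm (x - p)"
    using norm_cauchy_schwarz[of "(norm (fst (y - p)), norm (snd (y - p)))" "(norm (fst (x - p)), norm (snd (x - p)))"]
    by (simp add: norm_prod_def)
  also have "\<dots> \<le> r * norm (x - p)"
    using y(1) assms(1) by (intro mult_right_mono) (auto simp: dist_norm norm_minus_commute)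
  finally have "norm (x - p) * norm (x - p) \<le> r * norm (x - p)" by (simp add: power2_eq_square)
  moreover have "0 \<le> r" using assms(1) y(1) by (metis empty_iff cball_empty not_le subsetD)
  ultimately have "norm (x - p) \<le> r" by (metis mult_right_le_imp_le norm_ge_zero order_le_less)
  then show ?thesis by (simp add: dist_norm norm_minus_commute)
qed

text \<open>The hull of \<open>K\<close> stays in \<open>cball p r\<close>, where holomorphic
  functions are uniform limits of polynomials, so the hull inequality passes from polynomials to
  \<open>h\<close>. The doubled ball is the price of the Taylor approximation.\<close>

lemma polynomial_hull_holo_bound:
  assumes h: "holo U h" and r: "r > 0" "cball p (2 * r) \<subseteq> U" and K: "K \<subseteq> cball p r"
    and x: "x \<in> polynomial_hull K" and B: "\<And>y. y \<in> K \<Longrightarrow> norm (h y) \<le> B"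
  shows "norm (h x) \<le> B"
proof (rule field_le_epsilon)
  fix e :: real assume e: "e > 0"
  obtain P where P: "polynomial2 P" "\<And>x. x \<in> cball p r \<Longrightarrow> norm (h x - P x) < e / 2"
    using holo_polynomial_approximation[OF h r, of "e / 2"] e by auto
  obtain y where y: "y \<in> K" "norm (P x) \<le> norm (P y)"
    using x P(1) by (auto simp: polynomial_hull_def)
  have "norm (h x) \<le> norm (P x) + norm (h x - P x)" by (metis add.commute norm_triangle_sub)
  moreover have "norm (P y) \<le> norm (h y) + norm (h y - P y)" by (metis norm_minus_commute norm_triangle_sub)
  ultimately show "norm (h x) \<le> B + e"
    using y B[OF y(1)] P(2)[of x] P(2)[of y] polynomial_hull_subset_cball[OF K x] K by fastforce
qed

lemma holo_compose_entire:
  assumes "holo U h" "g holomorphic_on UNIV"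
  shows "holo U (\<lambda>x. g (h x))"
proof -
  have "(\<lambda>t. g (f t)) field_differentiable at a" if "f field_differentiable at a" for f a
    using field_differentiable_compose[OF that, of g] assms(2)
    by (simp add: o_def holomorphic_on_imp_differentiable_at)
  moreover have "continuous_on U (\<lambda>x. g (h x))"
    using continuous_on_compose2[OF holomorphic_on_imp_continuous_on[OF assms(2)]] assms(1) by (auto simp: holo_def)
  ultimately show ?thesis using assms(1) by (auto simp: holo_def)
qed

lemma holo_mult: "holo U g \<Longrightarrow> holo U h \<Longrightarrow> holo U (\<lambda>x. g x * h x)"
  by (auto simp: holo_def intro!: continuous_intros field_differentiable_mult)

text \<open>The derivative of the composite is built from composites of the same kind with
  \<open>dz h\<close> and \<open>dw h\<close>, so the induction on the order runs over all
  \<open>h\<close>.\<close>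

lemma Ck_on_holo_compose:
  fixes \<sigma> :: "'a::real_normed_vector \<Rightarrow> C2"
  assumes "open V" "holo U h" "Ck_on k V \<sigma>" "\<sigma> ` V \<subseteq> U"
  shows "Ck_on k V (\<lambda>x. h (\<sigma> x))"
  using assms(2,3)
proof (induction k arbitrary: h)
  case 0
  then show ?case using assms(4) by (auto simp: holo_def intro: continuous_on_compose2)
next
  case (Suc k)
  obtain D where D: "\<And>x. x \<in> V \<Longrightarrow> (\<sigma> has_derivative D x) (at x)" "\<And>v. Ck_on k V (\<lambda>x. D x v)"
    using Ck_on_SucE[OF Suc.prems(2)] by blast
  have \<sigma>: "Ck_on k V \<sigma>" using Suc.prems(2) by (rule Ck_on_SucD)
  show ?case
  proof (rule Ck_on_SucI[OF assms(1), where D = "\<lambda>x v. dz h (\<sigma> x) * fst (D x v) + dw h (\<sigma> x) * snd (D x v)"])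
    show "((\<lambda>x. h (\<sigma> x)) has_derivative (\<lambda>v. dz h (\<sigma> x) * fst (D x v) + dw h (\<sigma> x) * snd (D x v))) (at x)"
      if "x \<in> V" for x
      using has_derivative_compose[OF D(1)[OF that] holo_has_derivative[OF Suc.prems(1)]] assms(4) that by blast
    show "Ck_on k V (\<lambda>x. dz h (\<sigma> x) * fst (D x v) + dw h (\<sigma> x) * snd (D x v))" for v
      using D(2) Suc.IH[OF holo_dz[OF Suc.prems(1)] \<sigma>] Suc.IH[OF holo_dw[OF Suc.prems(1)] \<sigma>]
      by (intro Ck_on_add[OF assms(1)] Ck_on_mult[OF assms(1)] Ck_on_bounded_linear[OF assms(1) bounded_linear_fst]
          Ck_on_bounded_linear[OF assms(1) bounded_linear_snd])
  qed
qed

section \<open>Local graphs\<close>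

lemma Ck_on_iterated_directional:
  assumes "Ck_on n A f" "j \<le> n"
  shows "Ck_on (n - j) A (((\<lambda>g x. frechet_derivative g (at x) v) ^^ j) f)"
  using assms(2)
proof (induction j)
  case 0 then show ?case using assms(1) by simp
next
  case (Suc j)
  then have "Ck_on (Suc (n - Suc j)) A (((\<lambda>g x. frechet_derivative g (at x) v) ^^ j) f)"
    by (simp add: Suc_diff_Suc del: Ck_on.simps)
  then show ?case by simp
qed

text \<open>Interpolation at the scale \<open>\<rho> = norm (x - a)\<close>: on the segment from
  \<open>x\<close> of length \<open>\<rho>\<close> in direction \<open>v\<close>, rescaled to the
  unit interval, \<open>f\<close> and its derivative of order \<open>m + 1\<close> are both of size
  \<open>\<rho> ^ (m + 1)\<close>, hence so is \<open>\<rho>\<close> times the first derivative. The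
  radius \<open>r / 4\<close> keeps the segment in \<open>cball a (r/2)\<close>, where the top
  derivative is bounded.\<close>

lemma Ck_on_derivative_decay:
  fixes f :: "'a::euclidean_space \<Rightarrow> 'b::real_normed_vector"
  assumes f: "Ck_on (Suc m) (ball a r) f" and r: "r > 0" and v: "norm v = 1"
    and C: "\<And>x. x \<in> ball a r \<Longrightarrow> norm (f x) \<le> C * norm (x - a) ^ Suc m"
  obtains C' where "C' \<ge> 0"
    "\<And>x. x \<in> ball a (r / 4) \<Longrightarrow> x \<noteq> a \<Longrightarrow> norm (frechet_derivative f (at x) v) \<le> C' * norm (x - a) ^ m"
proof -
  define D where "D = (\<lambda>j. ((\<lambda>g x. frechet_derivative g (at x) v) ^^ j) f)"
  have D_Suc: "D (Suc j) x = frechet_derivative (D j) (at x) v" for j x by (simp add: D_def)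
  have D_Ck: "Ck_on (Suc m - j) (ball a r) (D j)" if "j \<le> Suc m" for j
    using Ck_on_iterated_directional[OF f that] by (simp add: D_def)
  have D_der: "(D j has_derivative frechet_derivative (D j) (at x)) (at x)" if "j \<le> m" "x \<in> ball a r" for j x
  proof -
    have "Ck_on (Suc (m - j)) (ball a r) (D j)" using D_Ck[of j] that(1) by (simp add: Suc_diff_le del: Ck_on.simps)
    then show ?thesis using that(2) by (simp add: frechet_derivative_works[symmetric])
  qed
  have "continuous_on (ball a r) (D (Suc m))" using D_Ck[of "Suc m"] by simp
  then have "continuous_on (cball a (r/2)) (D (Suc m))"
    by (rule continuous_on_subset) (use r in \<open>auto simp: cball_subset_ball_iff\<close>)
  then have "bounded (D (Suc m) ` cball a (r/2))"
    by (intro compact_imp_bounded compact_continuous_image) auto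
  then obtain B where B: "B > 0" "\<And>x. x \<in> cball a (r/2) \<Longrightarrow> norm (D (Suc m) x) \<le> B"
    unfolding bounded_pos by blast
  obtain K where K: "K \<ge> 0" and LK: "\<forall>(g :: nat \<Rightarrow> real \<Rightarrow> 'b) A B.
     (\<forall>j\<le>m. \<forall>s\<in>{0..1}. (g j has_vector_derivative g (Suc j) s) (at s within {0..1})) \<longrightarrow>
     (\<forall>s\<in>{0..1}. norm (g 0 s) \<le> A) \<longrightarrow> (\<forall>s\<in>{0..1}. norm (g (Suc m) s) \<le> B) \<longrightarrow>
     (\<forall>s\<in>{0..1}. norm (g 1 s) \<le> K * (A + B))"
    using landau_kolmogorov[of m, where 'a = 'b] by (elim exE conjE)
  define C' where "C' = K * (\<bar>C\<bar> * 2 ^ Suc m + B)"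
  show ?thesis
  proof (rule that)
    show "C' \<ge> 0" using K B(1) by (simp add: C'_def)
    fix x assume x: "x \<in> ball a (r / 4)" "x \<noteq> a"
    define \<rho> where "\<rho> = norm (x - a)"
    have \<rho>: "0 < \<rho>" "\<rho> < r / 4" using x by (auto simp: \<rho>_def dist_norm norm_minus_commute)
    define y where "y = (\<lambda>s. x + (s * \<rho>) *\<^sub>R v)"
    have y: "norm (y s - a) \<le> 2 * \<rho>" if "s \<in> {0..1}" for s
    proof -
      have "norm (y s - a) \<le> norm (x - a) + norm ((s * \<rho>) *\<^sub>R v)"
        unfolding y_def by (metis add_diff_eq add.commute norm_triangle_ineq)
      also have "norm ((s * \<rho>) *\<^sub>R v) \<le> 1 * \<rho>" using that \<rho>(1) v by (simp add: mult_right_le_one_le abs_mult)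
      finally show ?thesis by (simp add: \<rho>_def)
    qed
    have yb: "y s \<in> cball a (r/2)" "y s \<in> ball a r" if "s \<in> {0..1}" for s
      using y[OF that] \<rho> by (auto simp: dist_norm norm_minus_commute)
    define g where "g = (\<lambda>j s. \<rho> ^ j *\<^sub>R D j (y s))"
    have "(g j has_vector_derivative g (Suc j) s) (at s within {0..1})" if "j \<le> m" "s \<in> {0..1}" for j s
    proof -
      have "(y has_derivative (\<lambda>h. (h * \<rho>) *\<^sub>R v)) (at s within {0..1})"
        unfolding y_def by (auto intro!: derivative_eq_intros)
      from has_derivative_compose[OF this D_der[OF that(1) yb(2)[OF that(2)]]]
      have "(g j has_derivative (\<lambda>h. \<rho> ^ j *\<^sub>R frechet_derivative (D j) (at (y s)) ((h * \<rho>) *\<^sub>R v))) (at s within {0..1})"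
        unfolding g_def by (intro has_derivative_scaleR_right)
      moreover have "frechet_derivative (D j) (at (y s)) ((h * \<rho>) *\<^sub>R v) = (h * \<rho>) *\<^sub>R D (Suc j) (y s)" for h
        using has_derivative_linear[OF D_der[OF that(1) yb(2)[OF that(2)]]] by (simp add: D_Suc linear_cmul)
      ultimately show ?thesis by (simp add: has_vector_derivative_def g_def mult_ac)
    qed
    moreover have "norm (g 0 s) \<le> \<bar>C\<bar> * (2 * \<rho>) ^ Suc m" if "s \<in> {0..1}" for s
    proof -
      have "norm (g 0 s) \<le> C * norm (y s - a) ^ Suc m" using C[OF yb(2)[OF that]] by (simp add: g_def D_def)
      also have "\<dots> \<le> \<bar>C\<bar> * (2 * \<rho>) ^ Suc m"
        using y[OF that] by (intro mult_mono power_mono) auto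
      finally show ?thesis .
    qed
    moreover have "norm (g (Suc m) s) \<le> B * \<rho> ^ Suc m" if "s \<in> {0..1}" for s
      using B(2)[OF yb(1)[OF that]] \<rho>(1) by (simp add: g_def mult.commute mult_right_mono)
    ultimately have "norm (g 1 s) \<le> K * (\<bar>C\<bar> * (2 * \<rho>) ^ Suc m + B * \<rho> ^ Suc m)" if "s \<in> {0..1}" for s
      using LK that by blast
    then have "\<rho> * norm (D 1 x) \<le> K * (\<bar>C\<bar> * (2 * \<rho>) ^ Suc m + B * \<rho> ^ Suc m)"
      using \<rho>(1) by (force simp: g_def y_def dest: meta_spec[of _ 0])
    also have "\<dots> = \<rho> * (C' * \<rho> ^ m)" by (simp add: C'_def power_mult_distrib algebra_simps)
    finally have "norm (D 1 x) \<le> C' * \<rho> ^ m" using \<rho>(1) by simp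
    then show "norm (frechet_derivative f (at x) v) \<le> C' * norm (x - a) ^ m"
      by (simp add: D_def \<rho>_def)
  qed
qed

lemma has_derivative_zero_quadratic:
  fixes f :: "'a::real_normed_vector \<Rightarrow> 'b::real_normed_vector"
  assumes "e > 0" "\<And>z. norm z < e \<Longrightarrow> norm (f z) \<le> C * (norm z)\<^sup>2"
  shows "(f has_derivative (\<lambda>_. 0)) (at 0)"
proof -
  have f0: "f 0 = 0" using assms(2)[of 0] assms(1) by simp
  have "((\<lambda>z. norm (f z) / norm z) \<longlongrightarrow> 0) (at 0)"
  proof (rule tendsto_sandwich[of "\<lambda>_. 0" _ _ "\<lambda>z. C * norm z"])
    have "eventually (\<lambda>z::'a. norm z < e \<and> z \<noteq> 0) (at 0)"
      using assms(1) by (auto simp: eventually_at dist_norm)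
    then show "eventually (\<lambda>z. norm (f z) / norm z \<le> C * norm z) (at 0)"
      by eventually_elim (use assms(2) in \<open>auto simp: divide_le_eq power2_eq_square mult.assoc\<close>)
    show "((\<lambda>z. C * norm z) \<longlongrightarrow> 0) (at (0::'a))" by (auto intro!: tendsto_eq_intros)
  qed auto
  then show ?thesis by (simp add: has_derivative_at f0)
qed

text \<open>Explicit inverse of the real linear map \<open>h \<mapsto> Re h * a + Im h * b\<close> of \<open>\<complex>\<close>.\<close>

definition plane_inv :: "complex \<Rightarrow> complex \<Rightarrow> complex \<Rightarrow> complex" where
  "plane_inv a b k = Complex (Im (cnj k * b) / Im (cnj a * b)) (Im (cnj a * k) / Im (cnj a * b))"

lemma plane_inv:
  assumes "Im (cnj a * b) \<noteq> 0"
  shows "(of_real (Re (plane_inv a b k)) * a + of_real (Im (plane_inv a b k)) * b) = k"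
    and "plane_inv a b (of_real (Re h) * a + of_real (Im h) * b) = h"
proof -
  define J where "J = Re a * Im b - Im a * Re b"
  have J: "J \<noteq> 0" "Im (cnj a * b) = J" using assms by (auto simp: J_def)
  define x where "x = Re k * Im b - Im k * Re b"
  define y where "y = Re a * Im k - Im a * Re k"
  have "x * Re a + y * Re b = Re k * J" "x * Im a + y * Im b = Im k * J"
    by (simp_all add: J_def x_def y_def algebra_simps)
  then have "x / J * Re a + y / J * Re b = Re k" "x / J * Im a + y / J * Im b = Im k"
    using J(1) by (simp_all add: field_simps)
  moreover have "plane_inv a b k = Complex (x / J) (y / J)"
    using J(2) by (simp add: plane_inv_def x_def y_def algebra_simps)
  ultimately show "(of_real (Re (plane_inv a b k)) * a + of_real (Im (plane_inv a b k)) * b) = k"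
    by (simp add: complex_eq_iff)
  have "Im (cnj (of_real (Re h) * a + of_real (Im h) * b) * b) = Re h * J"
    "Im (cnj a * (of_real (Re h) * a + of_real (Im h) * b)) = Im h * J"
    by (simp_all add: J_def algebra_simps)
  then show "plane_inv a b (of_real (Re h) * a + of_real (Im h) * b) = h"
    using J by (simp add: plane_inv_def complex_eq_iff)
qed

lemma plane_inv_linear:
  "plane_inv a b k = of_real (Re k) * plane_inv a b 1 + of_real (Im k) * plane_inv a b \<i>"
proof -
  define J where "J = Im (cnj a * b)"
  have "plane_inv a b k = Complex (Im (cnj k * b) / J) (Im (cnj a * k) / J)" for k
    by (simp only: plane_inv_def J_def)
  then show ?thesis
    by (simp add: complex_eq_iff add_divide_distrib diff_divide_distrib mult.commute)
qed

lemma real_linear_complex: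
  fixes D :: "complex \<Rightarrow> 'a::real_vector"
  assumes "linear D" shows "D h = Re h *\<^sub>R D 1 + Im h *\<^sub>R D \<i>"
proof -
  have "h = Re h *\<^sub>R 1 + Im h *\<^sub>R \<i>" by (simp add: complex_eq_iff)
  then show ?thesis using assms by (metis linear_add linear_cmul)
qed

lemma plane_independent:
  assumes "\<And>h. of_real (Re h) * a + of_real (Im h) * b = 0 \<Longrightarrow> h = 0"
  shows "Im (cnj a * b) \<noteq> 0"
proof
  assume "Im (cnj a * b) = 0"
  then have J: "Re a * Im b = Im a * Re b" by simp
  \<comment> \<open>If the determinant vanishes, both vectors lie in the kernel; being zero by
    hypothesis, they make \<open>a\<close> and \<open>b\<close> vanish.\<close>
  have "Complex (Re b) (- Re a) = 0" "Complex (Im b) (- Im a) = 0"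
    by (rule assms, use J in \<open>simp add: complex_eq_iff algebra_simps\<close>)+
  then have "a = 0" "b = 0" by (auto simp: complex_eq_iff)
  then show False using assms[of 1] by simp
qed

text \<open>Inverse function theorem in the plane. The formula \<open>plane_inv\<close> for the
  inverse derivative makes the partial derivatives \<open>ex\<close> and \<open>ey\<close> of the
  inverse visibly continuous; the image is open by invariance of domain.\<close>

lemma plane_local_inverse:
  fixes \<zeta> :: "complex \<Rightarrow> complex"
  assumes V: "open V" "x0 \<in> V" and C1: "Ck_on 1 V \<zeta>" and inj: "inj (frechet_derivative \<zeta> (at x0))"
  obtains N e ex ey where "open N" "x0 \<in> N" "N \<subseteq> V" "open (\<zeta> ` N)" "\<And>x. x \<in> N \<Longrightarrow> e (\<zeta> x) = x"
    "\<And>z. z \<in> \<zeta> ` N \<Longrightarrow> (e has_derivative (\<lambda>h. of_real (Re h) * ex z + of_real (Im h) * ey z)) (at z)"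
    "continuous_on (\<zeta> ` N) ex" "continuous_on (\<zeta> ` N) ey"
proof -
  define a where "a = (\<lambda>x. frechet_derivative \<zeta> (at x) 1)"
  define b where "b = (\<lambda>x. frechet_derivative \<zeta> (at x) \<i>)"
  define D where "D = (\<lambda>x h. of_real (Re h) * a x + of_real (Im h) * b x)"
  have der: "(\<zeta> has_derivative D x) (at x)" and D: "frechet_derivative \<zeta> (at x) = D x" if "x \<in> V" for x
  proof -
    have 1: "(\<zeta> has_derivative frechet_derivative \<zeta> (at x)) (at x)"
      using C1 that by (simp add: frechet_derivative_works[symmetric])
    show 2: "frechet_derivative \<zeta> (at x) = D x"
      by (rule ext, subst real_linear_complex[OF has_derivative_linear[OF 1]])
        (simp add: D_def a_def b_def scaleR_conv_of_real)
    show "(\<zeta> has_derivative D x) (at x)" using 1 2 by simp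
  qed
  have ca: "continuous_on V a" and cb: "continuous_on V b" using C1 by (simp_all add: a_def b_def)
  define V0 where "V0 = {x \<in> V. Im (cnj (a x) * b x) \<noteq> 0}"
  have "continuous_on V (\<lambda>x. Im (cnj (a x) * b x))" by (intro continuous_intros ca cb)
  then have "open (V \<inter> (\<lambda>x. Im (cnj (a x) * b x)) -` (- {0}))"
    by (rule continuous_open_preimage[OF _ V(1)]) auto
  moreover have "V \<inter> (\<lambda>x. Im (cnj (a x) * b x)) -` (- {0}) = V0" by (auto simp: V0_def)
  ultimately have "open V0" by simp
  have "x0 \<in> V0"
  proof -
    have "inj (D x0)" using inj D[OF V(2)] by simp
    then have "D x0 h = 0 \<Longrightarrow> h = 0" for h
      using linear_injective_0[OF has_derivative_linear[OF der[OF V(2)]]] by blast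
    then have "h = 0" if "of_real (Re h) * a x0 + of_real (Im h) * b x0 = 0" for h
      using that unfolding D_def by blast
    then have "Im (cnj (a x0) * b x0) \<noteq> 0" by (rule plane_independent)
    then show ?thesis using V(2) unfolding V0_def by blast
  qed
  have lin: "bounded_linear (plane_inv p q)" for p q
    unfolding linear_conv_bounded_linear[symmetric]
    by (rule linearI) (simp_all add: plane_inv_def complex_eq_iff add_divide_distrib[symmetric] algebra_simps)
  obtain r where r: "r > 0" "ball x0 r \<subseteq> V0" "inj_on \<zeta> (ball x0 r)"
  proof (rule has_derivative_locally_injective[of x0 V0 "plane_inv (a x0) (b x0)" D \<zeta>])
    show "plane_inv (a x0) (b x0) \<circ> D x0 = id"
      using \<open>x0 \<in> V0\<close> plane_inv(2) by (auto simp: D_def V0_def fun_eq_iff)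
    show "(\<zeta> has_derivative D x) (at x)" if "x \<in> V0" for x using der that by (simp add: V0_def)
    show "\<exists>d>0. \<forall>x. dist x0 x < d \<longrightarrow> onorm (\<lambda>v. D x v - D x0 v) < e" if "e > 0" for e
    proof -
      have "((\<lambda>x. norm (a x - a x0) + norm (b x - b x0)) \<longlongrightarrow> norm (a x0 - a x0) + norm (b x0 - b x0)) (at x0)"
        using ca cb V by (intro tendsto_intros) (auto simp: continuous_on_eq_continuous_at isCont_def)
      then have "eventually (\<lambda>x. norm (a x - a x0) + norm (b x - b x0) < e) (at x0)"
        using that by (intro order_tendstoD(2)) auto
      then obtain d where d: "d > 0" "\<And>x. x \<noteq> x0 \<Longrightarrow> dist x x0 < d \<Longrightarrow> norm (a x - a x0) + norm (b x - b x0) < e"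
        by (auto simp: eventually_at)
      have "onorm (\<lambda>v. D x v - D x0 v) \<le> norm (a x - a x0) + norm (b x - b x0)" for x
      proof (rule onorm_le)
        fix v
        have "D x v - D x0 v = of_real (Re v) * (a x - a x0) + of_real (Im v) * (b x - b x0)"
          by (simp add: D_def algebra_simps)
        also have "norm \<dots> \<le> \<bar>Re v\<bar> * norm (a x - a x0) + \<bar>Im v\<bar> * norm (b x - b x0)"
          by (rule order_trans[OF norm_triangle_ineq]) (simp add: norm_mult)
        also have "\<dots> \<le> norm v * norm (a x - a x0) + norm v * norm (b x - b x0)"
          by (intro add_mono mult_right_mono abs_Re_le_cmod abs_Im_le_cmod) auto
        finally show "norm (D x v - D x0 v) \<le> (norm (a x - a x0) + norm (b x - b x0)) * norm v"
          by (simp add: algebra_simps)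
      qed
      then have "dist x0 x < d \<Longrightarrow> onorm (\<lambda>v. D x v - D x0 v) < e" for x
        using d(2)[of x] that by (cases "x = x0") (auto simp: dist_commute onorm_zero intro: le_less_trans)
      then show ?thesis using d(1) by blast
    qed
  qed (use \<open>open V0\<close> \<open>x0 \<in> V0\<close> lin that in auto)
  define N where "N = ball x0 r"
  have N: "open N" "x0 \<in> N" "N \<subseteq> V0" "N \<subseteq> V" using r by (auto simp: N_def V0_def)
  define e where "e = inv_into N \<zeta>"
  have e: "e (\<zeta> x) = x" if "x \<in> N" for x using that r(3) by (simp add: e_def N_def)
  have c\<zeta>: "continuous_on N \<zeta>"
    using der N by (meson continuous_at_imp_continuous_on has_derivative_continuous subsetD)
  have op: "open (\<zeta> ` N)" using invariance_of_domain[OF c\<zeta> N(1)] r(3) N_def by blast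
  define ex where "ex = (\<lambda>z. plane_inv (a (e z)) (b (e z)) 1)"
  define ey where "ey = (\<lambda>z. plane_inv (a (e z)) (b (e z)) \<i>)"
  have eder: "(e has_derivative (\<lambda>h. of_real (Re h) * ex z + of_real (Im h) * ey z)) (at z)" if "z \<in> \<zeta> ` N" for z
  proof -
    obtain x where x: "x \<in> N" "z = \<zeta> x" using \<open>z \<in> \<zeta> ` N\<close> by blast
    have "(e has_derivative plane_inv (a x) (b x)) (at (\<zeta> x))"
    proof (rule has_derivative_inverse_strong[OF N(1) x(1) c\<zeta> e])
      show "(\<zeta> has_derivative D x) (at x)" using der x N by blast
      show "D x \<circ> plane_inv (a x) (b x) = id"
        using x N(3) plane_inv(1) by (auto simp: D_def V0_def fun_eq_iff)
    qed
    moreover have "plane_inv (a x) (b x) = (\<lambda>h. of_real (Re h) * ex z + of_real (Im h) * ey z)"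
      unfolding ex_def ey_def x(2) e[OF x(1)] by (rule ext) (rule plane_inv_linear)
    ultimately show ?thesis using x(2) by simp
  qed
  have ce: "continuous_on (\<zeta> ` N) e"
    by (intro continuous_at_imp_continuous_on ballI has_derivative_continuous[OF eder])
  have eV: "e ` (\<zeta> ` N) \<subseteq> V" using e N(4) by auto
  have "continuous_on (\<zeta> ` N) (\<lambda>z. a (e z))" "continuous_on (\<zeta> ` N) (\<lambda>z. b (e z))"
    by (rule continuous_on_compose2[OF ca ce eV] continuous_on_compose2[OF cb ce eV])+
  note cab = this
  have J: "Im (cnj (a (e z)) * b (e z)) \<noteq> 0" if "z \<in> \<zeta> ` N" for z
  proof -
    have "e z \<in> V0" using that e N(3) by auto
    then show ?thesis unfolding V0_def by blast
  qed
  have cp: "continuous_on (\<zeta> ` N) (\<lambda>z. plane_inv (a (e z)) (b (e z)) k)" for k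
    unfolding plane_inv_def Complex_eq
    by (intro continuous_on_add continuous_on_mult continuous_on_of_real continuous_on_divide continuous_on_Im
        continuous_on_cnj continuous_on_const cab ballI J)
  show ?thesis
    by (rule that[OF N(1,2,4) op e eder]) (auto simp: ex_def ey_def cp)
qed

text \<open>The derivative written through \<open>dz\<close> and \<open>dw\<close> instead of
  \<open>frechet_derivative\<close>, so that complex linearity and continuous dependence on the
  point can be read off.\<close>

definition jac :: "(C2 \<Rightarrow> C2) \<Rightarrow> C2 \<Rightarrow> C2 \<Rightarrow> C2" where
  "jac f x v = (dz (fst \<circ> f) x * fst v + dw (fst \<circ> f) x * snd v, dz (snd \<circ> f) x * fst v + dw (snd \<circ> f) x * snd v)"

lemma jac_has_derivative:
  assumes "open U" "holomorphic2_on U f" "x \<in> U"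
  shows "(f has_derivative jac f x) (at x)"
proof -
  note h = holomorphic2_on_holo[OF assms(1,2)]
  have "((\<lambda>y. ((fst \<circ> f) y, (snd \<circ> f) y)) has_derivative jac f x) (at x)"
    unfolding jac_def by (intro has_derivative_Pair holo_has_derivative[OF h(1) assms(3)] holo_has_derivative[OF h(2) assms(3)])
  then show ?thesis by simp
qed

lemma jac_cscale: "jac f x (cscale c v) = cscale c (jac f x v)"
  by (simp add: jac_def cscale_def algebra_simps)

lemma jac_zero [simp]: "jac f x 0 = 0"
  by (simp add: jac_def zero_prod_def)

lemma jac_left_inverse:
  assumes "open U" "holomorphic2_on U f" "open V" "holomorphic2_on V g" "f ` U \<subseteq> V"
    "\<And>x. x \<in> U \<Longrightarrow> g (f x) = x" "x \<in> U"
  shows "jac g (f x) (jac f x v) = v"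
proof -
  have "((\<lambda>x. g (f x)) has_derivative (\<lambda>v. jac g (f x) (jac f x v))) (at x)"
    using assms by (intro has_derivative_compose[OF jac_has_derivative jac_has_derivative]) auto
  then have "((\<lambda>x. x) has_derivative (\<lambda>v. jac g (f x) (jac f x v))) (at x)"
    by (rule has_derivative_transform_within_open[OF _ assms(1,7)]) (use assms(6) in auto)
  from has_derivative_unique[OF this has_derivative_ident] show ?thesis by (rule fun_cong)
qed

lemma biholomorphic2_onD:
  assumes "biholomorphic2_on U \<Phi>"
  shows "open U" "open (\<Phi> ` U)" "inj_on \<Phi> U" "holomorphic2_on U \<Phi>" "holomorphic2_on (\<Phi> ` U) (inv_into U \<Phi>)"
  using assms by (simp_all add: biholomorphic2_on_def)

lemma biholomorphic2_jac_inverse: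
  assumes b: "biholomorphic2_on U \<Phi>"
  shows "q \<in> U \<Longrightarrow> jac (inv_into U \<Phi>) (\<Phi> q) (jac \<Phi> q v) = v"
    and "y \<in> \<Phi> ` U \<Longrightarrow> jac \<Phi> (inv_into U \<Phi> y) (jac (inv_into U \<Phi>) y v) = v"
proof -
  note d = biholomorphic2_onD[OF b]
  show "q \<in> U \<Longrightarrow> jac (inv_into U \<Phi>) (\<Phi> q) (jac \<Phi> q v) = v"
    using d by (intro jac_left_inverse[where U = U and V = "\<Phi> ` U"]) auto
  show "y \<in> \<Phi> ` U \<Longrightarrow> jac \<Phi> (inv_into U \<Phi> y) (jac (inv_into U \<Phi>) y v) = v"
    using d by (intro jac_left_inverse[where U = "\<Phi> ` U" and V = U]) (auto simp: f_inv_into_f)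
qed

lemma homogeneous_polynomial_bound:
  assumes "homogeneous_polynomial m F"
  obtains C where "C \<ge> 0" "\<And>z. norm (F z) \<le> C * norm z ^ m"
proof -
  obtain c where F: "\<And>z. F z = (\<Sum>j\<le>m. c j * z ^ j * cnj z ^ (m - j))"
    using assms unfolding homogeneous_polynomial_def by blast
  have "norm (F z) \<le> (\<Sum>j\<le>m. norm (c j)) * norm z ^ m" for z
  proof -
    have "norm (c j * z ^ j * cnj z ^ (m - j)) = norm (c j) * norm z ^ m" if "j \<le> m" for j
      using that by (simp add: norm_mult norm_power mult.assoc flip: power_add)
    then show ?thesis unfolding F sum_distrib_right by (intro sum_norm_le) auto
  qed
  then show ?thesis using that[of "\<Sum>j\<le>m. norm (c j)"] by (simp add: sum_nonneg)
qed

lemma Ck_on_homogeneous_polynomial: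
  assumes "homogeneous_polynomial m F" "open A" "Ck_on k A \<zeta>"
  shows "Ck_on k A (\<lambda>x. F (\<zeta> x))"
proof -
  obtain c where F: "\<And>z. F z = (\<Sum>j\<le>m. c j * z ^ j * cnj z ^ (m - j))"
    using assms unfolding homogeneous_polynomial_def by blast
  show ?thesis unfolding F
    by (intro Ck_on_sum Ck_on_mult Ck_on_power Ck_on_const Ck_on_bounded_linear[OF _ bounded_linear_cnj] assms)
qed

lemma has_derivative_lipschitz_at:
  assumes "(f has_derivative D) (at a)"
  obtains L r where "r > 0" "L \<ge> 0" "\<And>x. x \<in> ball a r \<Longrightarrow> norm (f x - f a) \<le> L * norm (x - a)"
proof -
  obtain r where r: "r > 0" "\<And>x. norm (x - a) < r \<Longrightarrow> norm (f x - f a - D (x - a)) \<le> 1 * norm (x - a)"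
    using assms unfolding has_derivative_at_alt by (meson zero_less_one)
  have "norm (f x - f a) \<le> (onorm D + 1) * norm (x - a)" if "x \<in> ball a r" for x
  proof -
    have "norm (f x - f a) \<le> norm (D (x - a)) + norm (f x - f a - D (x - a))"
      using norm_triangle_ineq[of "D (x - a)" "f x - f a - D (x - a)"] by simp
    also have "\<dots> \<le> onorm D * norm (x - a) + 1 * norm (x - a)"
      using r(2)[of x] that onorm[OF has_derivative_bounded_linear[OF assms], of "x - a"]
      by (intro add_mono) (auto simp: dist_norm norm_minus_commute[of a x])
    finally show ?thesis by (simp add: algebra_simps)
  qed
  then show ?thesis using that r(1) onorm_pos_le[OF has_derivative_bounded_linear[OF assms]] by (metis add_nonneg_nonneg zero_le_one)
qed

text \<open>The Landau bound on \<open>R\<close> says nothing at \<open>0\<close> itself;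
  \<open>R 0 = 0\<close> comes from \<open>p\<close> lying on the surface. With
  \<open>e \<le> 1\<close> all higher powers are dominated by the square, which makes the graph
  tangent to \<open>w = 0\<close>.\<close>

lemma graph_coordinates_quadratic:
  assumes G: "graph_coordinates S p m U \<Phi> F R" and m: "2 \<le> m" and p: "p \<in> S"
  obtains e C where "e > 0" "e \<le> 1" "C \<ge> 0" "R 0 = 0" "F 0 = 0"
    "\<And>z. norm z < e \<Longrightarrow> norm (R z) \<le> C * norm z ^ (m + 1)"
    "\<And>z. norm z < e \<Longrightarrow> norm (F z + R z) \<le> C * norm z ^ 2"
proof -
  have hp: "homogeneous_polynomial m F" and R: "R \<in> O[at 0](\<lambda>z. z ^ (m + 1))" and pU: "p \<in> U" "\<Phi> p = 0"
    and S: "S \<inter> U = {q \<in> U. snd (\<Phi> q) = F (fst (\<Phi> q)) + R (fst (\<Phi> q))}"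
    using G by (auto simp: graph_coordinates_def)
  obtain CF where CF: "CF \<ge> 0" "\<And>z. norm (F z) \<le> CF * norm z ^ m"
    using homogeneous_polynomial_bound[OF hp] by blast
  have F0: "F 0 = 0" using CF(2)[of 0] m by (simp add: power_0_left)
  have R0: "R 0 = 0"
  proof -
    have "p \<in> S \<inter> U" using p pU by simp
    then have "snd (\<Phi> p) = F (fst (\<Phi> p)) + R (fst (\<Phi> p))" unfolding S by simp
    then show ?thesis using pU F0 by simp
  qed
  obtain C where C: "C > 0" "eventually (\<lambda>z. norm (R z) \<le> C * norm (z ^ (m + 1))) (at 0)"
    using landau_o.bigE[OF R] by blast
  then obtain d where d: "d > 0" "\<And>z. z \<noteq> 0 \<Longrightarrow> dist z 0 < d \<Longrightarrow> norm (R z) \<le> C * norm (z ^ (m + 1))"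
    by (auto simp: eventually_at)
  have Rb: "norm (R z) \<le> C * norm z ^ (m + 1)" if "norm z < d" for z
    using d(2)[of z] that R0 by (cases "z = 0") (auto simp: norm_power norm_mult)
  show ?thesis
  proof (rule that[of "min d 1" "CF + C"])
    fix z :: complex assume z: "norm z < min d 1"
    show "norm (R z) \<le> (CF + C) * norm z ^ (m + 1)"
      using Rb[of z] z CF(1) by (intro order_trans[OF Rb]) (auto intro!: mult_right_mono)
    have pw: "norm z ^ n \<le> norm z ^ 2" if "2 \<le> n" for n
      using z that by (intro power_decreasing) auto
    have "norm (F z + R z) \<le> CF * norm z ^ m + C * norm z ^ (m + 1)"
      using norm_triangle_ineq[of "F z" "R z"] CF(2)[of z] Rb[of z] z by simp
    also have "\<dots> \<le> CF * norm z ^ 2 + C * norm z ^ 2"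
      using CF(1) C(1) m by (intro add_mono mult_left_mono pw) auto
    finally show "norm (F z + R z) \<le> (CF + C) * norm z ^ 2" by (simp add: algebra_simps)
  qed (use d CF C R0 F0 in auto)
qed

text \<open>A priori \<open>R\<close> is only a function with a growth bound. Its regularity is read
  off a parametrization of the surface: composed with the first coordinate \<open>\<zeta>\<close> of
  the parametrization, \<open>R\<close> becomes the difference of the second coordinate
  \<open>\<omega>\<close> and \<open>F \<circ> \<zeta>\<close>, which is of class
  \<open>C^k\<close>, and \<open>\<zeta>\<close> is a local diffeomorphism because the surface is
  tangent to \<open>w = 0\<close>. As \<open>m + 1 \<le> k\<close>, the decay of derivatives applies
  at order \<open>m\<close>.\<close>

lemma local_graph:
  assumes S: "Ck_surface k S" and p: "p \<in> S" and G: "graph_coordinates S p m U \<Phi> F R" and m: "2 \<le> m" "m < k"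
  obtains \<delta> M rx ry where "\<delta> > 0" "M \<ge> 0" "\<And>z. z \<in> ball 0 \<delta> \<Longrightarrow> (z, F z + R z) \<in> \<Phi> ` U"
    "\<And>z. z \<in> ball 0 \<delta> \<Longrightarrow> (R has_derivative (\<lambda>h. of_real (Re h) * rx z + of_real (Im h) * ry z)) (at z)"
    "continuous_on (ball 0 \<delta>) rx" "continuous_on (ball 0 \<delta>) ry"
    "\<And>z. z \<in> ball 0 \<delta> \<Longrightarrow> norm (R z) \<le> M * norm z ^ (m + 1)"
    "\<And>z. z \<in> ball 0 \<delta> \<Longrightarrow> norm (rx z) \<le> M * norm z ^ m"
    "\<And>z. z \<in> ball 0 \<delta> \<Longrightarrow> norm (ry z) \<le> M * norm z ^ m"
proof -
  have b: "biholomorphic2_on U \<Phi>" and pU: "p \<in> U" "\<Phi> p = 0" and hp: "homogeneous_polynomial m F"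
    and SU: "S \<inter> U = {q \<in> U. snd (\<Phi> q) = F (fst (\<Phi> q)) + R (fst (\<Phi> q))}"
    using G by (auto simp: graph_coordinates_def)
  note bd = biholomorphic2_onD[OF b]
  obtain e0 C0 where e0: "e0 > 0" "e0 \<le> 1" "C0 \<ge> 0" "R 0 = 0" "F 0 = 0"
    "\<And>z. norm z < e0 \<Longrightarrow> norm (R z) \<le> C0 * norm z ^ (m + 1)"
    "\<And>z. norm z < e0 \<Longrightarrow> norm (F z + R z) \<le> C0 * norm z ^ 2"
    using graph_coordinates_quadratic[OF G m(1) p] by metis
  obtain W V \<sigma> where W: "openin (top_of_set S) W" "p \<in> W" and par: "parametrization k V \<sigma> W"
    using S p unfolding Ck_surface_def by meson
  have V: "open V" and \<sigma>Ck: "Ck_on k V \<sigma>" and \<sigma>inj: "\<And>x. x \<in> V \<Longrightarrow> inj (frechet_derivative \<sigma> (at x))"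
    and hom: "homeomorphism V W \<sigma> (inv_into V \<sigma>)"
    using par by (auto simp: parametrization_def)
  have WS: "W \<subseteq> S" using W(1) by (rule openin_imp_subset)
  define x0 where "x0 = inv_into V \<sigma> p"
  have x0: "x0 \<in> V" "\<sigma> x0 = p" using hom W(2) by (auto simp: homeomorphism_def x0_def)
  define V1 where "V1 = V \<inter> \<sigma> -` U"
  have V1: "open V1" "V1 \<subseteq> V" "x0 \<in> V1"
    using continuous_open_preimage[OF Ck_on_imp_continuous_on[OF \<sigma>Ck] V bd(1)] x0 pU by (auto simp: V1_def)
  have \<sigma>1: "Ck_on k V1 \<sigma>" using Ck_on_subset[OF \<sigma>Ck V1(2)] .
  have \<sigma>U: "\<sigma> ` V1 \<subseteq> U" by (auto simp: V1_def)
  note hol = holomorphic2_on_holo[OF bd(1,4)]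
  define \<zeta> where "\<zeta> = (\<lambda>x. fst (\<Phi> (\<sigma> x)))"
  define \<omega> where "\<omega> = (\<lambda>x. snd (\<Phi> (\<sigma> x)))"
  have \<zeta>Ck: "Ck_on k V1 \<zeta>" and \<omega>Ck: "Ck_on k V1 \<omega>"
    using Ck_on_holo_compose[OF V1(1) hol(1) \<sigma>1 \<sigma>U] Ck_on_holo_compose[OF V1(1) hol(2) \<sigma>1 \<sigma>U]
    by (simp_all add: \<zeta>_def \<omega>_def)
  have \<zeta>0: "\<zeta> x0 = 0" using x0 pU by (simp add: \<zeta>_def)
  have graph: "\<omega> x = F (\<zeta> x) + R (\<zeta> x)" if "x \<in> V1" for x
  proof -
    have "\<sigma> x \<in> W" using that V1(2) hom by (auto simp: homeomorphism_def)
    then have "\<sigma> x \<in> S \<inter> U" using that WS \<sigma>U by auto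
    then show ?thesis unfolding SU by (simp add: \<zeta>_def \<omega>_def)
  qed
  obtain k' where k': "k = Suc k'" using m(2) by (cases k) auto
  have der\<zeta>: "(\<zeta> has_derivative frechet_derivative \<zeta> (at x)) (at x)" if "x \<in> V1" for x
    using \<zeta>Ck that k' by (simp add: frechet_derivative_works[symmetric])
  have f0: "((\<lambda>z. F z + R z) has_derivative (\<lambda>_. 0)) (at 0)"
    using has_derivative_zero_quadratic[OF e0(1,7)] .
  have R0: "(R has_derivative (\<lambda>_. 0)) (at 0)"
  proof (rule has_derivative_zero_quadratic[OF e0(1)])
    fix z :: complex assume z: "norm z < e0"
    have "norm z ^ (m + 1) \<le> norm z ^ 2" using z e0(2) m by (intro power_decreasing) auto
    then show "norm (R z) \<le> C0 * (norm z)\<^sup>2" using e0(6)[OF z] e0(3) by (meson mult_left_mono order_trans)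
  qed
  \<comment> \<open>The second component of the derivative of \<open>\<Phi> \<circ> \<sigma>\<close>
    vanishes at \<open>x0\<close>, as \<open>F + R\<close> has derivative zero at \<open>0\<close>;
    injectivity of the whole derivative is thus carried by the first component.\<close>
  have inj: "inj (frechet_derivative \<zeta> (at x0))"
  proof -
    have lin: "linear (frechet_derivative \<zeta> (at x0))" by (rule has_derivative_linear[OF der\<zeta>[OF V1(3)]])
    define D where "D = frechet_derivative \<sigma> (at x0)"
    have D: "(\<sigma> has_derivative D) (at x0)"
      using \<sigma>Ck x0(1) k' by (simp add: D_def frechet_derivative_works[symmetric])
    have D\<Phi>: "((\<lambda>x. \<Phi> (\<sigma> x)) has_derivative (\<lambda>h. jac \<Phi> p (D h))) (at x0)"
      using has_derivative_compose[OF D, of \<Phi>] jac_has_derivative[OF bd(1,4) pU(1)] x0(2) by simp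
    then have 1: "(\<zeta> has_derivative (\<lambda>h. fst (jac \<Phi> p (D h)))) (at x0)"
      and 2: "(\<omega> has_derivative (\<lambda>h. snd (jac \<Phi> p (D h)))) (at x0)"
      unfolding \<zeta>_def \<omega>_def by (auto intro: has_derivative_fst has_derivative_snd)
    have "((\<lambda>x. F (\<zeta> x) + R (\<zeta> x)) has_derivative (\<lambda>_. 0)) (at x0)"
      using has_derivative_compose[OF 1, of "\<lambda>z. F z + R z"] f0 \<zeta>0 by simp
    then have "(\<omega> has_derivative (\<lambda>_. 0)) (at x0)"
      by (rule has_derivative_transform_within_open[OF _ V1(1,3)]) (simp add: graph)
    then have snd0: "snd (jac \<Phi> p (D h)) = 0" for h using has_derivative_unique[OF 2] by metis
    have fst1: "frechet_derivative \<zeta> (at x0) h = fst (jac \<Phi> p (D h))" for h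
      using has_derivative_unique[OF der\<zeta>[OF V1(3)] 1] by metis
    have "h = 0" if "frechet_derivative \<zeta> (at x0) h = 0" for h
    proof -
      have "jac \<Phi> p (D h) = 0" using snd0[of h] fst1[of h] that by (simp add: prod_eq_iff)
      then have "D h = 0" using biholomorphic2_jac_inverse(1)[OF b pU(1), of "D h"] by simp
      then show ?thesis
        using \<sigma>inj[OF x0(1)] linear_injective_0[OF has_derivative_linear[OF D]] by (auto simp: D_def)
    qed
    then show ?thesis unfolding linear_injective_0[OF lin] by blast
  qed
  define \<rho> where "\<rho> = (\<lambda>x. R (\<zeta> x))"
  have \<rho>Ck: "Ck_on k V1 \<rho>"
  proof (rule Ck_on_cong[OF V1(1)])
    show "Ck_on k V1 (\<lambda>x. \<omega> x + (-1) * F (\<zeta> x))"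
      by (intro Ck_on_add[OF V1(1)] Ck_on_mult[OF V1(1)] Ck_on_const \<omega>Ck Ck_on_homogeneous_polynomial[OF hp V1(1) \<zeta>Ck])
  qed (simp add: graph \<rho>_def)
  obtain L r where L: "r > 0" "L \<ge> 0" "\<And>x. x \<in> ball x0 r \<Longrightarrow> norm (\<zeta> x - \<zeta> x0) \<le> L * norm (x - x0)"
    using has_derivative_lipschitz_at[OF der\<zeta>[OF V1(3)]] by metis
  obtain s where s: "s > 0" "ball x0 s \<subseteq> V1" using V1 open_contains_ball by blast
  \<comment> \<open>In this ball \<open>norm (\<zeta> x) < e0\<close>, where the bound on
    \<open>R\<close> is valid; the summand 1 guards against \<open>L = 0\<close>.\<close>
  define r1 where "r1 = min (min r s) (e0 / (L + 1))"
  have r1: "r1 > 0" "r1 \<le> r" "r1 \<le> s" "r1 \<le> e0 / (L + 1)" using L s e0 by (auto simp: r1_def)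
  have sub: "ball x0 r1 \<subseteq> V1" using s r1 by (meson order_trans subset_ball)
  have \<zeta>L: "norm (\<zeta> x) \<le> L * norm (x - x0)" "norm (\<zeta> x) < e0" if "x \<in> ball x0 r1" for x
  proof -
    show 1: "norm (\<zeta> x) \<le> L * norm (x - x0)" using L(3)[of x] that r1 \<zeta>0 by auto
    have "norm (x - x0) < e0 / (L + 1)" using that r1 by (auto simp: dist_norm norm_minus_commute)
    then have "(L + 1) * norm (x - x0) < e0" using L(2) by (simp add: field_simps)
    moreover have "L * norm (x - x0) \<le> (L + 1) * norm (x - x0)" by (intro mult_right_mono) auto
    ultimately show "norm (\<zeta> x) < e0" using 1 by linarith
  qed
  have \<rho>1: "Ck_on (Suc m) (ball x0 r1) \<rho>"
    using Ck_on_subset[OF Ck_on_mono[OF \<rho>Ck, of "Suc m"] sub] m by simp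
  have \<rho>b: "norm (\<rho> x) \<le> (C0 * L ^ Suc m) * norm (x - x0) ^ Suc m" if "x \<in> ball x0 r1" for x
  proof -
    have "norm (\<rho> x) \<le> C0 * norm (\<zeta> x) ^ Suc m" using e0(6)[OF \<zeta>L(2)[OF that]] by (simp add: \<rho>_def)
    also have "\<dots> \<le> C0 * (L * norm (x - x0)) ^ Suc m"
      using \<zeta>L(1)[OF that] e0(3) by (intro mult_left_mono power_mono) auto
    finally show ?thesis by (simp add: power_mult_distrib mult_ac)
  qed
  define \<rho>x where "\<rho>x = (\<lambda>x. frechet_derivative \<rho> (at x) 1)"
  define \<rho>y where "\<rho>y = (\<lambda>x. frechet_derivative \<rho> (at x) \<i>)"
  obtain C1 where C1: "C1 \<ge> 0" "\<And>x. x \<in> ball x0 (r1/4) \<Longrightarrow> x \<noteq> x0 \<Longrightarrow> norm (\<rho>x x) \<le> C1 * norm (x - x0) ^ m"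
    using Ck_on_derivative_decay[OF \<rho>1 r1(1) norm_one \<rho>b] unfolding \<rho>x_def by metis
  obtain C2 where C2: "C2 \<ge> 0" "\<And>x. x \<in> ball x0 (r1/4) \<Longrightarrow> x \<noteq> x0 \<Longrightarrow> norm (\<rho>y x) \<le> C2 * norm (x - x0) ^ m"
    using Ck_on_derivative_decay[OF \<rho>1 r1(1) norm_ii \<rho>b] unfolding \<rho>y_def by metis
  define B where "B = ball x0 (r1/4)"
  have B: "open B" "x0 \<in> B" "B \<subseteq> ball x0 r1" "B \<subseteq> V1" using r1(1) sub by (auto simp: B_def)
  have \<rho>der: "(\<rho> has_derivative (\<lambda>h. of_real (Re h) * \<rho>x x + of_real (Im h) * \<rho>y x)) (at x)" if "x \<in> B" for x
  proof -
    have 1: "(\<rho> has_derivative frechet_derivative \<rho> (at x)) (at x)"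
      using \<rho>1 that B(3) by (auto simp: frechet_derivative_works[symmetric])
    show ?thesis
      by (rule has_derivative_eq_rhs[OF 1], rule ext, subst real_linear_complex[OF has_derivative_linear[OF 1]])
        (simp add: \<rho>x_def \<rho>y_def scaleR_conv_of_real)
  qed
  have c\<rho>: "continuous_on B \<rho>x" "continuous_on B \<rho>y"
    using Ck_on_subset[OF Ck_on_mono[OF \<rho>1, of 1] B(3)] by (auto simp: \<rho>x_def \<rho>y_def)
  have \<zeta>1: "Ck_on 1 B \<zeta>" using Ck_on_subset[OF Ck_on_mono[OF \<zeta>Ck, of 1] B(4)] k' by simp
  obtain N e ex ey where N: "open N" "x0 \<in> N" "N \<subseteq> B" "open (\<zeta> ` N)" "\<And>x. x \<in> N \<Longrightarrow> e (\<zeta> x) = x"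
    and eder: "\<And>z. z \<in> \<zeta> ` N \<Longrightarrow> (e has_derivative (\<lambda>h. of_real (Re h) * ex z + of_real (Im h) * ey z)) (at z)"
    and cex: "continuous_on (\<zeta> ` N) ex" "continuous_on (\<zeta> ` N) ey"
  proof (rule plane_local_inverse[OF B(1,2) \<zeta>1 inj])
    fix N e ex ey
    assume "open N" "x0 \<in> N" "N \<subseteq> B" "open (\<zeta> ` N)" "\<And>x. x \<in> N \<Longrightarrow> e (\<zeta> x) = x"
      "\<And>z. z \<in> \<zeta> ` N \<Longrightarrow> (e has_derivative (\<lambda>h. of_real (Re h) * ex z + of_real (Im h) * ey z)) (at z)"
      "continuous_on (\<zeta> ` N) ex" "continuous_on (\<zeta> ` N) ey"
    then show thesis by (rule that)
  qed
  \<comment> \<open>Chain rule for \<open>R = \<rho> \<circ> e\<close>, with \<open>e\<close> the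
    local inverse of \<open>\<zeta>\<close>: \<open>rr ex\<close> and \<open>rr ey\<close> are the
    partial derivatives of \<open>R\<close>.\<close>
  define rr where "rr = (\<lambda>E z. of_real (Re (E z)) * \<rho>x (e z) + of_real (Im (E z)) * \<rho>y (e z))"
  have z0N: "0 \<in> \<zeta> ` N" using N(2) \<zeta>0 by force
  have e00: "e 0 = x0" using N(2,5) \<zeta>0 by metis
  have eN: "e z \<in> N" "\<zeta> (e z) = z" if "z \<in> \<zeta> ` N" for z using that N(5) by auto
  have Rder: "(R has_derivative (\<lambda>h. of_real (Re h) * rr ex z + of_real (Im h) * rr ey z)) (at z)" if z: "z \<in> \<zeta> ` N" for z
  proof -
    have "((\<lambda>z. \<rho> (e z)) has_derivative (\<lambda>h. of_real (Re (of_real (Re h) * ex z + of_real (Im h) * ey z)) * \<rho>x (e z)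
        + of_real (Im (of_real (Re h) * ex z + of_real (Im h) * ey z)) * \<rho>y (e z))) (at z)"
      using has_derivative_compose[OF eder[OF z] \<rho>der] eN(1)[OF z] N(3) by blast
    then have "(R has_derivative (\<lambda>h. of_real (Re (of_real (Re h) * ex z + of_real (Im h) * ey z)) * \<rho>x (e z)
        + of_real (Im (of_real (Re h) * ex z + of_real (Im h) * ey z)) * \<rho>y (e z))) (at z)"
      by (rule has_derivative_transform_within_open[OF _ N(4) z]) (simp add: \<rho>_def eN)
    then show ?thesis by (rule has_derivative_eq_rhs) (simp add: rr_def algebra_simps fun_eq_iff)
  qed
  have ce: "continuous_on (\<zeta> ` N) e"
    by (intro continuous_at_imp_continuous_on ballI has_derivative_continuous[OF eder])
  have eB: "e ` (\<zeta> ` N) \<subseteq> B" using eN N(3) by blast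
  have crr: "continuous_on (\<zeta> ` N) (rr ex)" "continuous_on (\<zeta> ` N) (rr ey)"
    unfolding rr_def
    by (intro continuous_on_add continuous_on_mult continuous_on_of_real continuous_on_Re continuous_on_Im cex
        continuous_on_compose2[OF c\<rho>(1) ce eB] continuous_on_compose2[OF c\<rho>(2) ce eB])+
  obtain L' r' where L': "r' > 0" "L' \<ge> 0" "\<And>z. z \<in> ball 0 r' \<Longrightarrow> norm (e z - e 0) \<le> L' * norm (z - 0)"
    using has_derivative_lipschitz_at[OF eder[OF z0N]] by metis
  obtain d1 where d1: "d1 > 0" "ball 0 d1 \<subseteq> \<zeta> ` N" using N(4) z0N open_contains_ball by blast
  have "\<exists>d>0. \<forall>z\<in>ball 0 d. norm (E z) \<le> norm (E 0) + 1" if "continuous_on (\<zeta> ` N) E" for E :: "complex \<Rightarrow> complex"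
  proof -
    have "isCont E 0" using that z0N unfolding continuous_on_eq_continuous_at[OF N(4)] by blast
    then obtain d where d: "d > 0" "\<And>z. dist z 0 < d \<Longrightarrow> dist (E z) (E 0) < 1"
      unfolding continuous_at_eps_delta dist_norm by (meson zero_less_one)
    have "norm (E z) \<le> norm (E 0) + 1" if "z \<in> ball 0 d" for z
      using norm_triangle_sub[of "E z" "E 0"] d(2)[of z] that by (simp add: dist_norm)
    then show ?thesis using d(1) by blast
  qed
  then obtain d2 d3 where d2: "d2 > 0" "\<And>z. z \<in> ball 0 d2 \<Longrightarrow> norm (ex z) \<le> norm (ex 0) + 1"
    and d3: "d3 > 0" "\<And>z. z \<in> ball 0 d3 \<Longrightarrow> norm (ey z) \<le> norm (ey 0) + 1" using cex by meson
  define \<delta> where "\<delta> = Min {r', d1, d2, d3, e0}"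
  have \<delta>: "\<delta> > 0" "\<delta> \<le> r'" "\<delta> \<le> d1" "\<delta> \<le> d2" "\<delta> \<le> d3" "\<delta> \<le> e0"
    using L'(1) d1(1) d2(1) d3(1) e0(1) by (auto simp: \<delta>_def)
  define A where "A = max (norm (ex 0) + 1) (norm (ey 0) + 1)"
  have A0: "0 \<le> A" unfolding A_def by (rule max.coboundedI1) simp
  define M where "M = max C0 (A * ((C1 + C2) * L' ^ m))"
  \<comment> \<open>The decay estimate omits the centre; there the partial derivatives vanish
    because \<open>R\<close> is quadratically small.\<close>
  have rr0: "rr ex 0 = 0" "rr ey 0 = 0"
    using fun_cong[OF has_derivative_unique[OF Rder[OF z0N] R0], of 1]
      fun_cong[OF has_derivative_unique[OF Rder[OF z0N] R0], of \<i>] by simp_all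
  have rrb: "norm (rr E z) \<le> M * norm z ^ m" if z: "z \<in> ball 0 \<delta>" and E: "norm (E z) \<le> A" "rr E 0 = 0" for E z
  proof (cases "z = 0")
    case True then show ?thesis using E(2) m by (simp add: power_0_left)
  next
    case False
    have zN: "z \<in> \<zeta> ` N" using z \<delta>(3) d1(2) by auto
    have ne: "e z \<noteq> x0" using False eN(2)[OF zN] \<zeta>0 by auto
    have eB': "e z \<in> ball x0 (r1/4)" using eN(1)[OF zN] N(3) B_def by auto
    have el: "norm (e z - x0) ^ m \<le> L' ^ m * norm z ^ m"
      using L'(3)[of z] z \<delta>(2) e00 by (auto simp flip: power_mult_distrib intro!: power_mono)
    have "norm (rr E z) \<le> \<bar>Re (E z)\<bar> * norm (\<rho>x (e z)) + \<bar>Im (E z)\<bar> * norm (\<rho>y (e z))"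
      unfolding rr_def by (rule order_trans[OF norm_triangle_ineq]) (simp add: norm_mult)
    also have "\<dots> \<le> A * norm (\<rho>x (e z)) + A * norm (\<rho>y (e z))"
      using E(1) abs_Re_le_cmod[of "E z"] abs_Im_le_cmod[of "E z"] by (intro add_mono mult_right_mono) auto
    also have "\<dots> \<le> A * (C1 * norm (e z - x0) ^ m) + A * (C2 * norm (e z - x0) ^ m)"
      using C1(2)[OF eB' ne] C2(2)[OF eB' ne] by (intro add_mono mult_left_mono A0)
    also have "\<dots> = A * ((C1 + C2) * norm (e z - x0) ^ m)" by (simp add: algebra_simps)
    also have "\<dots> \<le> A * ((C1 + C2) * (L' ^ m * norm z ^ m))"
      using el C1(1) C2(1) by (intro mult_left_mono A0) auto
    also have "\<dots> = A * ((C1 + C2) * L' ^ m) * norm z ^ m" by simp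
    also have "\<dots> \<le> M * norm z ^ m" by (intro mult_right_mono) (auto simp: M_def)
    finally show ?thesis .
  qed
  show ?thesis
  proof (rule that[of \<delta> M "rr ex" "rr ey"])
    fix z :: complex assume z: "z \<in> ball 0 \<delta>"
    have zN: "z \<in> \<zeta> ` N" using z \<delta>(3) d1(2) by auto
    show "(R has_derivative (\<lambda>h. of_real (Re h) * rr ex z + of_real (Im h) * rr ey z)) (at z)" by (rule Rder[OF zN])
    have "e z \<in> V1" using eN(1)[OF zN] N(3) B(4) by auto
    then have "\<Phi> (\<sigma> (e z)) = (z, F z + R z)" and "\<sigma> (e z) \<in> U"
      using graph[of "e z"] eN(2)[OF zN] \<sigma>U by (auto simp: \<zeta>_def \<omega>_def prod_eq_iff)
    then show "(z, F z + R z) \<in> \<Phi> ` U" by (metis imageI)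
    have "norm (R z) \<le> C0 * norm z ^ (m + 1)" using e0(6)[of z] z \<delta>(6) by simp
    also have "\<dots> \<le> M * norm z ^ (m + 1)" by (intro mult_right_mono) (auto simp: M_def)
    finally show "norm (R z) \<le> M * norm z ^ (m + 1)" .
    have "norm (ex z) \<le> A" "norm (ey z) \<le> A" using z d2(2)[of z] d3(2)[of z] \<delta> by (auto simp: A_def)
    then show "norm (rr ex z) \<le> M * norm z ^ m" "norm (rr ey z) \<le> M * norm z ^ m" using rrb z rr0 by blast+
  next
    have "ball 0 \<delta> \<subseteq> \<zeta> ` N" using \<delta>(3) d1(2) by auto
    then show "continuous_on (ball 0 \<delta>) (rr ex)" "continuous_on (ball 0 \<delta>) (rr ey)"
      using crr continuous_on_subset by blast+
  qed (use \<delta>(1) e0(3) in \<open>auto simp: M_def\<close>)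
qed

section \<open>Tangent planes and CR singularities of a graph\<close>

lemma continuous_on_jac:
  assumes "open U" "holomorphic2_on U f" "continuous_on A x" "x ` A \<subseteq> U" "continuous_on A v"
  shows "continuous_on A (\<lambda>t. jac f (x t) (v t))"
proof -
  note h = holomorphic2_on_holo[OF assms(1,2)]
  have "continuous_on U (dz (fst \<circ> f))" "continuous_on U (dw (fst \<circ> f))"
    "continuous_on U (dz (snd \<circ> f))" "continuous_on U (dw (snd \<circ> f))"
    using holo_dz[OF h(1)] holo_dw[OF h(1)] holo_dz[OF h(2)] holo_dw[OF h(2)] by (simp_all add: holo_def)
  then show ?thesis unfolding jac_def
    by (intro continuous_on_Pair continuous_on_add continuous_on_mult continuous_on_fst continuous_on_snd assms(5)
        continuous_on_compose2[OF _ assms(3,4)])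
qed

text \<open>Only the \<open>C^1\<close> data of a graph are recorded; the splitting into leading
  form and remainder enters through further hypotheses. This lets the locale serve also for the
  model graph of a form and for the surface carried into its own coordinates, both with the identity
  as chart.\<close>

locale graph_chart =
  fixes S U :: "C2 set" and \<Phi> :: "C2 \<Rightarrow> C2" and f :: "complex \<Rightarrow> complex" and \<delta> :: real and fx fy :: "complex \<Rightarrow> complex"
  assumes biholo: "biholomorphic2_on U \<Phi>" and \<delta>: "\<delta> > 0"
    and S: "S \<inter> U = {q \<in> U. snd (\<Phi> q) = f (fst (\<Phi> q))}"
    and in_chart: "z \<in> ball 0 \<delta> \<Longrightarrow> (z, f z) \<in> \<Phi> ` U"
    and f_der: "z \<in> ball 0 \<delta> \<Longrightarrow> (f has_derivative (\<lambda>h. of_real (Re h) * fx z + of_real (Im h) * fy z)) (at z)"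
    and continuous_fx: "continuous_on (ball 0 \<delta>) fx" and continuous_fy: "continuous_on (ball 0 \<delta>) fy"
begin

definition pt :: "complex \<Rightarrow> C2" where "pt z = inv_into U \<Phi> (z, f z)"

definition df :: "complex \<Rightarrow> complex \<Rightarrow> complex" where
  "df z h = of_real (Re h) * fx z + of_real (Im h) * fy z"

definition dpt :: "complex \<Rightarrow> complex \<Rightarrow> C2" where "dpt z h = jac (inv_into U \<Phi>) (z, f z) (h, df z h)"

lemmas chart = biholomorphic2_onD[OF biholo]

lemma pt:
  assumes "z \<in> ball 0 \<delta>" shows "pt z \<in> S" "pt z \<in> U" "\<Phi> (pt z) = (z, f z)"
proof -
  show 1: "pt z \<in> U" unfolding pt_def by (rule inv_into_into[OF in_chart[OF assms]])
  show 2: "\<Phi> (pt z) = (z, f z)" unfolding pt_def by (rule f_inv_into_f[OF in_chart[OF assms]])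
  have "pt z \<in> S \<inter> U" unfolding S using 1 2 by simp
  then show "pt z \<in> S" by simp
qed

lemma pt_fst:
  assumes "q \<in> S" "q \<in> U" shows "pt (fst (\<Phi> q)) = q"
proof -
  have "q \<in> S \<inter> U" using assms by simp
  then have "(fst (\<Phi> q), f (fst (\<Phi> q))) = \<Phi> q" unfolding S by (simp add: prod_eq_iff)
  then show ?thesis using chart(3) assms(2) by (simp add: pt_def)
qed

lemma continuous_on_f: "continuous_on (ball 0 \<delta>) f"
  by (intro continuous_at_imp_continuous_on ballI has_derivative_continuous[OF f_der])

lemma pt_has_derivative:
  assumes "z \<in> ball 0 \<delta>" shows "(pt has_derivative dpt z) (at z)"
proof -
  have 1: "((\<lambda>z. (z, f z)) has_derivative (\<lambda>h. (h, df z h))) (at z)"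
    unfolding df_def by (intro has_derivative_Pair has_derivative_ident f_der assms)
  have 2: "(inv_into U \<Phi> has_derivative jac (inv_into U \<Phi>) (z, f z)) (at (z, f z))"
    by (rule jac_has_derivative[OF chart(2,5) in_chart[OF assms]])
  show ?thesis unfolding pt_def dpt_def using has_derivative_compose[OF 1, of "inv_into U \<Phi>", OF 2] .
qed

lemma jac_dpt:
  assumes "z \<in> ball 0 \<delta>" shows "jac \<Phi> (pt z) (dpt z h) = (h, df z h)"
  unfolding dpt_def pt_def by (rule biholomorphic2_jac_inverse(2)[OF biholo in_chart[OF assms]])

lemma continuous_on_pt: "continuous_on (ball 0 \<delta>) pt"
  by (intro continuous_at_imp_continuous_on ballI has_derivative_continuous[OF pt_has_derivative])

lemma continuous_on_dpt:
  assumes "continuous_on A z" "z ` A \<subseteq> ball 0 \<delta>" "continuous_on A h"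
  shows "continuous_on A (\<lambda>t. dpt (z t) (h t))"
  unfolding dpt_def df_def
  by (intro continuous_on_jac[OF chart(2,5)] continuous_on_Pair continuous_on_add continuous_on_mult
      continuous_on_of_real continuous_on_Re continuous_on_Im assms
      continuous_on_compose2[OF continuous_on_f assms(1,2)]
      continuous_on_compose2[OF continuous_fx assms(1,2)] continuous_on_compose2[OF continuous_fy assms(1,2)])
    (use assms(2) in_chart in blast)

text \<open>In the chart a curve in the surface satisfies \<open>snd = f \<circ> fst\<close> for
  small times, and uniqueness of derivatives gives one inclusion; the other comes from straight
  segments in the parameter disc, lifted by \<open>pt\<close>.\<close>

lemma tangent_space_pt:
  assumes z: "z \<in> ball 0 \<delta>" shows "tangent_space S (pt z) = range (dpt z)"
proof (intro equalityI subsetI)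
  fix v assume "v \<in> tangent_space S (pt z)"
  then obtain e \<gamma> where e: "e > 0" "\<gamma> 0 = pt z" "\<gamma> ` {-e<..<e} \<subseteq> S" "(\<gamma> has_vector_derivative v) (at 0)"
    unfolding tangent_space_def by blast
  have \<gamma>: "(\<gamma> has_derivative (\<lambda>t. t *\<^sub>R v)) (at 0)" using e(4) by (simp add: has_vector_derivative_def)
  have \<Phi>\<gamma>: "((\<lambda>t. \<Phi> (\<gamma> t)) has_derivative (\<lambda>t. jac \<Phi> (pt z) (t *\<^sub>R v))) (at 0)"
    using has_derivative_compose[OF \<gamma>, of \<Phi>] jac_has_derivative[OF chart(1,4) pt(2)[OF z]] e(2) by simp
  define c where "c = fst (jac \<Phi> (pt z) v)"
  have lin: "linear (jac \<Phi> (pt z))" by (rule has_derivative_linear[OF jac_has_derivative[OF chart(1,4) pt(2)[OF z]]])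
  have 1: "((\<lambda>t. fst (\<Phi> (\<gamma> t))) has_derivative (\<lambda>t. t *\<^sub>R c)) (at 0)"
    using has_derivative_fst[OF \<Phi>\<gamma>] by (simp add: c_def linear_cmul[OF lin])
  have 2: "((\<lambda>t. snd (\<Phi> (\<gamma> t))) has_derivative (\<lambda>t. t *\<^sub>R snd (jac \<Phi> (pt z) v))) (at 0)"
    using has_derivative_snd[OF \<Phi>\<gamma>] by (simp add: linear_cmul[OF lin])
  have 3: "((\<lambda>t. f (fst (\<Phi> (\<gamma> t)))) has_derivative (\<lambda>t. df z (t *\<^sub>R c))) (at 0)"
  proof -
    have "(f has_derivative df z) (at (fst (\<Phi> (\<gamma> 0))))" using f_der[OF z] e(2) pt(3)[OF z] by (simp add: df_def[abs_def])
    from has_derivative_compose[OF 1 this] show ?thesis .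
  qed
  have "((\<lambda>t. snd (\<Phi> (\<gamma> t))) has_derivative (\<lambda>t. df z (t *\<^sub>R c))) (at 0)"
  proof (rule has_derivative_transform_eventually[OF 3])
    have "isCont \<gamma> 0" using \<gamma> by (rule has_derivative_continuous)
    then have "eventually (\<lambda>t. \<gamma> t \<in> U) (at 0)"
      using chart(1) pt(2)[OF z] e(2) by (auto simp: isCont_def dest: topological_tendstoD)
    moreover have "eventually (\<lambda>t. t \<in> {-e<..<e}) (at 0)"
      using e(1) by (intro eventually_at_in_open') auto
    ultimately show "eventually (\<lambda>t. f (fst (\<Phi> (\<gamma> t))) = snd (\<Phi> (\<gamma> t))) (at 0)"
    proof eventually_elim
      case (elim t)
      then have "\<gamma> t \<in> S \<inter> U" using e(3) by auto
      then show ?case unfolding S by simp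
    qed
    show "f (fst (\<Phi> (\<gamma> 0))) = snd (\<Phi> (\<gamma> 0))" using e(2) pt(3)[OF z] by simp
  qed simp
  from fun_cong[OF has_derivative_unique[OF 2 this], of 1]
  have "jac \<Phi> (pt z) v = (c, df z c)" by (simp add: c_def prod_eq_iff)
  then have "v = dpt z c"
    unfolding dpt_def using biholomorphic2_jac_inverse(1)[OF biholo pt(2)[OF z], of v] pt(3)[OF z] by simp
  then show "v \<in> range (dpt z)" by blast
next
  fix v assume "v \<in> range (dpt z)"
  then obtain h where v: "v = dpt z h" by blast
  \<comment> \<open>Keeps the segment in the parameter disc, also when \<open>h = 0\<close>.\<close>
  define e where "e = (\<delta> - norm z) / (norm h + 1)"
  have e: "e > 0" using z by (simp add: e_def add_nonneg_pos)
  have zt: "z + t *\<^sub>R h \<in> ball 0 \<delta>" if "t \<in> {-e<..<e}" for t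
  proof -
    have "\<bar>t\<bar> < (\<delta> - norm z) / (norm h + 1)" using that by (simp only: e_def) auto
    then have "\<bar>t\<bar> * (norm h + 1) < \<delta> - norm z" by (simp add: pos_less_divide_eq add_nonneg_pos)
    moreover have "\<bar>t\<bar> * norm h \<le> \<bar>t\<bar> * (norm h + 1)" by (intro mult_left_mono) auto
    ultimately show ?thesis using norm_triangle_ineq[of z "t *\<^sub>R h"] by simp
  qed
  define \<gamma> where "\<gamma> = (\<lambda>t. pt (z + t *\<^sub>R h))"
  have der: "(\<gamma> has_vector_derivative dpt (z + t *\<^sub>R h) h) (at t)" if "t \<in> {-e<..<e}" for t
  proof -
    have "((\<lambda>t. z + t *\<^sub>R h) has_derivative (\<lambda>s. s *\<^sub>R h)) (at t)" by (auto intro!: derivative_eq_intros)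
    from has_derivative_compose[OF this pt_has_derivative[OF zt[OF that]]]
    show ?thesis
      using has_derivative_linear[OF pt_has_derivative[OF zt[OF that]]]
      by (simp add: \<gamma>_def has_vector_derivative_def linear_cmul)
  qed
  have "continuous_on {-e<..<e} (\<lambda>t. dpt (z + t *\<^sub>R h) h)"
    using zt by (intro continuous_on_dpt continuous_intros) auto
  then have "\<gamma> C1_differentiable_on {-e<..<e}"
    unfolding C1_differentiable_on_def by (intro exI[of _ "\<lambda>t. dpt (z + t *\<^sub>R h) h"] conjI ballI der)
  moreover have "(\<gamma> has_vector_derivative v) (at 0)" using der[of 0] e v by simp
  moreover have "\<gamma> ` {-e<..<e} \<subseteq> S" using zt pt(1) by (auto simp: \<gamma>_def)
  moreover have "\<gamma> 0 = pt z" by (simp add: \<gamma>_def)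
  ultimately show "v \<in> tangent_space S (pt z)"
    unfolding tangent_space_def mem_Collect_eq using e by (intro exI[of _ e] exI[of _ \<gamma>] conjI)
qed

text \<open>In the chart the tangent plane consists of the vectors \<open>(h, df z h)\<close>. It is
  a complex line exactly when \<open>df z\<close> is complex linear, that is, under the
  Cauchy-Riemann equation.\<close>

lemma CR_singularity_pt:
  assumes z: "z \<in> ball 0 \<delta>" shows "CR_singularity S (pt z) \<longleftrightarrow> fy z = \<i> * fx z"
proof
  assume "CR_singularity S (pt z)"
  then obtain v where v: "range (dpt z) = range (\<lambda>c. cscale c v)"
    unfolding CR_singularity_def tangent_space_pt[OF z] by (elim exE conjE)
  have "dpt z 1 \<in> range (\<lambda>c. cscale c v)" unfolding v[symmetric] by (rule rangeI)
  then obtain c where c: "dpt z 1 = cscale c v" by (rule rangeE)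
  have "cscale \<i> (dpt z 1) = cscale (\<i> * c) v" by (simp add: c cscale_def)
  then have "cscale \<i> (dpt z 1) \<in> range (dpt z)" unfolding v by (rule range_eqI)
  \<comment> \<open>Multiplication by \<open>\<i>\<close> preserves the tangent plane; the first
    coordinates then force \<open>h = \<i>\<close>, and the second ones give the equation.\<close>
  then obtain h where h: "cscale \<i> (dpt z 1) = dpt z h" by (rule rangeE)
  have "(h, df z h) = jac \<Phi> (pt z) (cscale \<i> (dpt z 1))" by (simp add: h jac_dpt[OF z])
  also have "\<dots> = cscale \<i> (1, df z 1)" by (simp add: jac_cscale jac_dpt[OF z])
  finally show "fy z = \<i> * fx z" by (auto simp: cscale_def df_def)
next
  assume eq: "fy z = \<i> * fx z"
  have "df z h = (of_real (Re h) + \<i> * of_real (Im h)) * fx z" for h by (simp add: df_def eq algebra_simps)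
  then have "df z h = h * fx z" for h by (simp flip: complex_eq)
  then have eqh: "(h, df z h) = cscale h (1, df z 1)" for h by (simp add: cscale_def)
  have dpt: "dpt z h = cscale h (dpt z 1)" for h
    unfolding dpt_def by (subst eqh) (rule jac_cscale)
  have "dpt z 1 \<noteq> 0"
  proof
    assume "dpt z 1 = 0"
    then have "fst (jac \<Phi> (pt z) 0) = 1" using jac_dpt[OF z, of 1] by (simp only: fst_conv)
    then show False by (simp only: jac_zero) simp
  qed
  moreover have "range (dpt z) = range (\<lambda>c. cscale c (dpt z 1))" by (rule image_cong[OF refl dpt])
  ultimately show "CR_singularity S (pt z)"
    unfolding CR_singularity_def tangent_space_pt[OF z] using pt(1)[OF z] by blast
qed

end

section \<open>The leading form\<close>

lemma holomorphic2_on_compose: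
  assumes "open U" "holomorphic2_on U f" "open V" "holomorphic2_on V g" "f ` U \<subseteq> V"
  shows "holomorphic2_on U (\<lambda>x. g (f x))"
  unfolding holomorphic2_on_def
proof
  fix x assume x: "x \<in> U"
  then have "f x \<in> V" using assms(5) by auto
  from has_derivative_compose[OF jac_has_derivative[OF assms(1,2) x] jac_has_derivative[OF assms(3,4) this]]
  show "\<exists>D. ((\<lambda>x. g (f x)) has_derivative D) (at x) \<and> (\<forall>c v. D (cscale c v) = cscale c (D v))"
    by (intro exI[of _ "\<lambda>v. jac g (f x) (jac f x v)"] conjI allI) (auto simp: jac_cscale)
qed

lemma holomorphic2_on_id: "holomorphic2_on U (\<lambda>x. x)"
  unfolding holomorphic2_on_def
proof
  fix x assume "x \<in> U"
  show "\<exists>D. ((\<lambda>x. x) has_derivative D) (at x) \<and> (\<forall>c v. D (cscale c v) = cscale c (D v))"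
    by (intro exI[of _ "\<lambda>v. v"] conjI allI has_derivative_ident) simp
qed

lemma biholomorphic2_on_id:
  assumes "open U" shows "biholomorphic2_on U (\<lambda>x. x)"
proof -
  have "holomorphic2_on U (inv_into U (\<lambda>x. x))"
    unfolding holomorphic2_on_def
  proof
    fix x assume x: "x \<in> U"
    have "(inv_into U (\<lambda>x. x) has_derivative (\<lambda>v. v)) (at x)"
      by (rule has_derivative_transform_within_open[OF has_derivative_ident assms x]) (simp add: inv_into_f_f)
    then show "\<exists>D. (inv_into U (\<lambda>x. x) has_derivative D) (at x) \<and> (\<forall>c v. D (cscale c v) = cscale c (D v))"
      by (intro exI[of _ "\<lambda>v. v"] conjI allI) simp_all
  qed
  then show ?thesis using assms by (simp add: biholomorphic2_on_def holomorphic2_on_id)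
qed

lemma jac_id: "jac (\<lambda>x. x) x v = v"
  using fun_cong[OF has_derivative_unique[OF jac_has_derivative[OF open_UNIV holomorphic2_on_id UNIV_I, of x] has_derivative_ident], of v]
  by simp

lemma field_differentiable_plane:
  assumes "(f has_derivative (\<lambda>h. of_real (Re h) * a + of_real (Im h) * b)) (at z)"
  shows "f field_differentiable at z \<longleftrightarrow> b = \<i> * a"
proof
  assume "f field_differentiable at z"
  then obtain c where "(f has_derivative (\<lambda>h. c * h)) (at z)"
    by (auto simp: field_differentiable_def has_field_derivative_def)
  from has_derivative_unique[OF this assms] have "c * h = of_real (Re h) * a + of_real (Im h) * b" for h by metis
  from this[of 1] this[of \<i>] show "b = \<i> * a" by (simp add: mult.commute)
next
  assume "b = \<i> * a"
  then have "of_real (Re h) * a + of_real (Im h) * b = (of_real (Re h) + \<i> * of_real (Im h)) * a" for h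
    by (simp add: algebra_simps)
  then have "(\<lambda>h. of_real (Re h) * a + of_real (Im h) * b) = (\<lambda>h. a * h)"
    by (simp add: mult.commute flip: complex_eq)
  then show "f field_differentiable at z"
    using assms by (auto simp: field_differentiable_def has_field_derivative_def)
qed

lemma homogeneous_polynomial_partials:
  assumes "homogeneous_polynomial m F"
  obtains Fx Fy where
    "\<And>z. (F has_derivative (\<lambda>h. of_real (Re h) * Fx z + of_real (Im h) * Fy z)) (at z)"
    "continuous_on UNIV Fx" "continuous_on UNIV Fy"
proof -
  have "Ck_on 1 UNIV F" using Ck_on_homogeneous_polynomial[OF assms open_UNIV Ck_on_id[OF open_UNIV]] by simp
  then have F: "(F has_derivative frechet_derivative F (at z)) (at z)"
    "continuous_on UNIV (\<lambda>z. frechet_derivative F (at z) v)" for z v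
    by (auto simp: frechet_derivative_works[symmetric])
  have "(F has_derivative (\<lambda>h. of_real (Re h) * frechet_derivative F (at z) 1 + of_real (Im h) * frechet_derivative F (at z) \<i>)) (at z)" for z
    by (rule has_derivative_eq_rhs[OF F(1)], rule ext, subst real_linear_complex[OF has_derivative_linear[OF F(1)]])
      (simp add: scaleR_conv_of_real)
  then show ?thesis using that F(2) by meson
qed

lemma homogeneous_polynomial_scale:
  assumes "homogeneous_polynomial m F"
  shows "F (of_real t * z) = of_real t ^ m * F z"
proof -
  obtain c where F: "\<And>z. F z = (\<Sum>j\<le>m. c j * z ^ j * cnj z ^ (m - j))"
    using assms unfolding homogeneous_polynomial_def by blast
  have "c j * (of_real t * z) ^ j * cnj (of_real t * z) ^ (m - j) = of_real t ^ m * (c j * z ^ j * cnj z ^ (m - j))"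
    if "j \<le> m" for j
  proof -
    have "(of_real t :: complex) ^ j * of_real t ^ (m - j) = of_real t ^ m" using that by (simp flip: power_add)
    then show ?thesis by (simp add: power_mult_distrib mult_ac)
  qed
  then show ?thesis unfolding F sum_distrib_left by (intro sum.cong) auto
qed

text \<open>CR singularities of a graph are the points where the function is complex differentiable.
  By homogeneity one such point off \<open>0\<close> produces a whole ray of them, running into
  \<open>0\<close>, against isolation.\<close>

lemma isolated_graph_not_field_differentiable:
  assumes hp: "homogeneous_polynomial m F" and iso: "isolated_CR_singularity (graph_of F) (0, 0)"
    and F0: "F 0 = 0" and z: "z \<noteq> 0"
  shows "\<not> F field_differentiable at z"
proof
  assume fd: "F field_differentiable at z"
  obtain Fx Fy where F: "\<And>z. (F has_derivative (\<lambda>h. of_real (Re h) * Fx z + of_real (Im h) * Fy z)) (at z)"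
    "continuous_on UNIV Fx" "continuous_on UNIV Fy"
    using homogeneous_polynomial_partials[OF hp] by blast
  have CR: "CR_singularity (graph_of F) (u, F u)" if "F field_differentiable at u" for u
  proof -
    have d: "norm u + 1 > 0" by (rule add_nonneg_pos) auto
    interpret graph_chart "graph_of F" UNIV "\<lambda>x. x" F "norm u + 1" Fx Fy
      using d F(1) continuous_on_subset[OF F(2)] continuous_on_subset[OF F(3)]
      by unfold_locales (auto simp: biholomorphic2_on_id graph_of_def prod_eq_iff)
    have "pt u = (u, F u)" unfolding pt_def by (metis UNIV_I inv_into_f_f inj_on_id2)
    then show ?thesis
      using CR_singularity_pt[of u] field_differentiable_plane[OF F(1)] that by simp
  qed
  obtain W where W: "open W" "(0, 0) \<in> W" "\<forall>x\<in>graph_of F \<inter> W. CR_singularity (graph_of F) x \<longrightarrow> x = (0, 0)"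
    using iso unfolding isolated_CR_singularity_def by blast
  have "isCont (\<lambda>t. (of_real t * z, F (of_real t * z))) 0"
  proof -
    have "isCont F w" for w using has_derivative_continuous[OF F(1)] .
    moreover have c: "isCont (\<lambda>t. of_real t * z) 0" by (intro continuous_intros)
    ultimately have "isCont (\<lambda>t. F (of_real t * z)) 0" by (intro isCont_o2[OF c])
    with c show ?thesis by (rule continuous_Pair)
  qed
  then have "((\<lambda>t. (of_real t * z, F (of_real t * z))) \<longlongrightarrow> (0, 0)) (at 0)"
    using F0 by (simp add: isCont_def)
  then have "eventually (\<lambda>t. (of_real t * z, F (of_real t * z)) \<in> W) (at 0)"
    using W(1,2) by (rule topological_tendstoD)
  then obtain t :: real where t: "t \<noteq> 0" "(of_real t * z, F (of_real t * z)) \<in> W"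
    using eventually_happens'[OF at_neq_bot eventually_conj[OF eventually_neq_at_within]] by blast
  have "F field_differentiable at (of_real t * z)"
  proof -
    have eq: "F = (\<lambda>u. of_real t ^ m * F (u / of_real t))"
    proof
      fix u show "F u = of_real t ^ m * F (u / of_real t)"
        using homogeneous_polynomial_scale[OF hp, of t "u / of_real t"] t(1) by simp
    qed
    have "(\<lambda>u. of_real t ^ m * F (u / of_real t)) field_differentiable at (of_real t * z)"
    proof (rule field_differentiable_mult[OF field_differentiable_const])
      have "(\<lambda>u. u / of_real t) field_differentiable at (of_real t * z)"
        using t(1) by (intro field_differentiable_divide field_differentiable_ident field_differentiable_const) auto
      then show "(\<lambda>u. F (u / of_real t)) field_differentiable at (of_real t * z)"
        using field_differentiable_compose[of "\<lambda>u. u / of_real t" "of_real t * z" F] fd t(1) by (simp add: o_def)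
    qed
    then show ?thesis by (subst eq)
  qed
  then have "(of_real t * z, F (of_real t * z)) = (0, 0)"
    using W(3) t(2) CR graph_of_def by blast
  then show False using t(1) z by simp
qed

text \<open>A limit of \<open>Q / t ^ j\<close> along the positive axis means that \<open>Q\<close>
  vanishes to order at least \<open>j\<close>, so that \<open>Q\<close> behaves like
  \<open>L * z ^ j\<close> along every ray. The induction divides out one zero at a time.\<close>

lemma holomorphic_radial_limit:
  assumes "r > 0" "Q holomorphic_on ball 0 r" "((\<lambda>t. Q (of_real t) / of_real t ^ j) \<longlongrightarrow> L) (at_right 0)"
  shows "((\<lambda>t. Q (of_real t * \<zeta>) / of_real t ^ j) \<longlongrightarrow> L * \<zeta> ^ j) (at_right 0)"
  using assms(2,3)
proof (induction j arbitrary: Q)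
  case 0
  have c: "isCont Q 0"
    using 0(1) assms(1) by (meson centre_in_ball continuous_on_eq_continuous_at holomorphic_on_imp_continuous_on open_ball)
  have lim: "((\<lambda>t. Q (of_real t * u)) \<longlongrightarrow> Q 0) (at_right 0)" for u
  proof -
    have "((\<lambda>t. of_real t * u) \<longlongrightarrow> 0) (at_right 0)" by (auto intro!: tendsto_eq_intros)
    then show ?thesis using c by (rule isCont_tendsto_compose[rotated])
  qed
  have "L = Q 0" using tendsto_unique[OF _ _ lim[of 1]] 0(2) by simp
  then show ?case using lim by simp
next
  case (Suc j)
  define Q1 where "Q1 = (\<lambda>z. if z = 0 then deriv Q 0 else (Q z - Q 0) / (z - 0))"
  have Q1: "Q1 holomorphic_on ball 0 r" unfolding Q1_def
    using pole_lemma_open[OF Suc.prems(1) open_ball, of 0] .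
  have ev: "eventually (\<lambda>t::real. t > 0) (at_right 0)" by (rule eventually_at_right_less)
  have "((\<lambda>t. Q (of_real t) / of_real t ^ Suc j * of_real t ^ Suc j) \<longlongrightarrow> L * 0) (at_right 0)"
    by (intro tendsto_mult Suc.prems(2)) (auto intro!: tendsto_eq_intros)
  then have "((\<lambda>t. Q (of_real t)) \<longlongrightarrow> L * 0) (at_right 0)"
    by (rule Lim_transform_eventually) (use ev in \<open>eventually_elim, simp\<close>)
  moreover have "((\<lambda>t. Q (of_real t)) \<longlongrightarrow> Q 0) (at_right 0)"
  proof -
    have "isCont Q 0"
      using Suc.prems(1) assms(1) by (meson centre_in_ball continuous_on_eq_continuous_at holomorphic_on_imp_continuous_on open_ball)
    moreover have "((\<lambda>t. of_real t :: complex) \<longlongrightarrow> 0) (at_right 0)" by (auto intro!: tendsto_eq_intros)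
    ultimately show ?thesis by (rule isCont_tendsto_compose)
  qed
  ultimately have Q0: "Q 0 = 0" using tendsto_unique[of "at_right (0::real)"] by fastforce
  have "((\<lambda>t. Q1 (of_real t) / of_real t ^ j) \<longlongrightarrow> L) (at_right 0)"
    by (rule Lim_transform_eventually[OF Suc.prems(2)])
      (use ev in \<open>eventually_elim, simp add: Q1_def Q0\<close>)
  from tendsto_mult[OF tendsto_const[of \<zeta>] Suc.IH[OF Q1 this]]
  have *: "((\<lambda>t. \<zeta> * (Q1 (of_real t * \<zeta>) / of_real t ^ j)) \<longlongrightarrow> \<zeta> * (L * \<zeta> ^ j)) (at_right 0)" .
  have "((\<lambda>t. Q (of_real t * \<zeta>) / of_real t ^ Suc j) \<longlongrightarrow> \<zeta> * (L * \<zeta> ^ j)) (at_right 0)"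
    by (rule Lim_transform_eventually[OF *])
      (use ev in \<open>eventually_elim, auto simp: Q1_def Q0\<close>)
  then show ?case by (simp add: mult_ac)
qed

text \<open>At \<open>z = 1\<close> the imaginary part of \<open>q\<close> vanishes, and at a root
  of \<open>z ^ m = \<i>\<close> the real part.\<close>

lemma real_monomial_zero:
  assumes "m \<noteq> 0" "\<And>z. q * z ^ m \<in> \<real>" shows "q = (0 :: complex)"
proof -
  have "Im (q * 1 ^ m) = 0" "Im (q * cis (pi / real (2 * m)) ^ m) = 0" using assms(2) complex_is_Real_iff by blast+
  moreover have "real m * (pi / real (2 * m)) = pi / 2" using assms(1) by simp
  then have "cis (pi / real (2 * m)) ^ m = \<i>" by (simp only: Complex.DeMoivre cis_pi_half)
  ultimately show ?thesis by (simp add: complex_eq_iff)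
qed

lemma tendsto_div_power_0:
  fixes g :: "real \<Rightarrow> complex"
  assumes "((\<lambda>t. g t / of_real t ^ n) \<longlongrightarrow> L) (at_right 0)" "j < n"
  shows "((\<lambda>t. g t / of_real t ^ j) \<longlongrightarrow> 0) (at_right 0)"
proof -
  have "((\<lambda>t. g t / of_real t ^ n * of_real t ^ (n - j)) \<longlongrightarrow> L * 0) (at_right 0)"
    using assms(2) by (intro tendsto_mult assms(1)) (auto intro!: tendsto_eq_intros)
  moreover have "eventually (\<lambda>t::real. t > 0) (at_right 0)" by (rule eventually_at_right_less)
  ultimately show ?thesis
    by (elim Lim_transform_eventually[THEN tendsto_eq_rhs])
      (auto elim!: eventually_mono simp: power_diff assms(2) less_imp_le)
qed

text \<open>With a vanishing form the graph would be within \<open>M * norm z ^ (m + 1)\<close> of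
  its tangent plane \<open>w = 0\<close>, one order more than the order of contact allows.\<close>

lemma (in graph_chart) contact_order_nonzero:
  assumes f: "\<And>z. z \<in> ball 0 \<delta> \<Longrightarrow> f z = F z + R z" and F0: "F 0 = 0" "R 0 = 0" and d0: "fx 0 = 0" "fy 0 = 0"
    and R: "\<And>z. z \<in> ball 0 \<delta> \<Longrightarrow> norm (R z) \<le> M * norm z ^ (m + 1)" and M: "M \<ge> 0"
    and contact: "tangent_contact_order (\<Phi> ` (S \<inter> U)) 0 m"
  obtains z where "F z \<noteq> 0"
proof (rule ccontr)
  assume "\<not> thesis"
  then have Fz: "F z = 0" for z using that by blast
  define S' where "S' = \<Phi> ` (S \<inter> U)"
  \<comment> \<open>The surface in its own coordinates, where the order of contact is
    measured.\<close>
  interpret T: graph_chart S' "\<Phi> ` U" "\<lambda>x. x" f \<delta> fx fy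
  proof
    show "S' \<inter> \<Phi> ` U = {q \<in> \<Phi> ` U. snd q = f (fst q)}" unfolding S'_def S by auto
  qed (use biholomorphic2_on_id[OF chart(2)] \<delta> in_chart f_der continuous_fx continuous_fy in auto)
  have z0: "0 \<in> ball 0 \<delta>" using \<delta> by simp
  have f0: "f 0 = 0" using f[OF z0] F0 by simp
  have Tpt: "T.pt z = (z, f z)" if "z \<in> ball 0 \<delta>" for z using T.pt(3)[OF that] .
  have "T.dpt 0 h = (h, 0)" for h
    using T.jac_dpt[OF z0, of h] by (simp add: jac_id T.df_def d0)
  then have tan: "tangent_space S' 0 = range (\<lambda>h. (h, 0))"
    using T.tangent_space_pt[OF z0] Tpt[OF z0] f0 by (simp add: zero_prod_def)
  define d where "d = (\<lambda>q. infdist q ((+) 0 ` tangent_space S' 0))"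
  have "d \<in> O[at 0 within S'](\<lambda>q. norm (q - 0) ^ (m + 1))"
  proof (rule landau_o.bigI[of "M + 1"])
    have "eventually (\<lambda>q. q \<in> \<Phi> ` U \<and> fst q \<in> ball 0 \<delta>) (at 0 within S')"
    proof (rule eventually_conj)
      have "(0::C2) \<in> \<Phi> ` U" using in_chart[OF z0] f0 by (simp add: zero_prod_def)
      then show "eventually (\<lambda>q. q \<in> \<Phi> ` U) (at 0 within S')"
        using chart(2) by (intro eventually_at_topological[THEN iffD2]) blast
      have "((\<lambda>q. fst q) \<longlongrightarrow> fst (0::C2)) (at 0 within S')" by (intro tendsto_intros)
      then show "eventually (\<lambda>q. fst q \<in> ball 0 \<delta>) (at 0 within S')"
        using z0 by (intro topological_tendstoD) auto
    qed
    moreover have "eventually (\<lambda>q. q \<in> S') (at 0 within S')"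
      by (auto simp: eventually_at_filter)
    ultimately show "eventually (\<lambda>q. norm (d q) \<le> (M + 1) * norm (norm (q - 0) ^ (m + 1))) (at 0 within S')"
    proof eventually_elim
      case (elim q)
      define z where "z = fst q"
      have z: "z \<in> ball 0 \<delta>" using elim by (simp add: z_def)
      have "q \<in> S' \<inter> \<Phi> ` U" using elim by simp
      then have "snd q = f z" unfolding T.S by (simp add: z_def)
      then have q: "q = (z, R z)" using f[OF z] Fz by (simp add: z_def prod_eq_iff)
      have "(z, 0) \<in> (+) 0 ` tangent_space S' 0" unfolding tan by auto
      then have "d q \<le> dist q (z, 0)" unfolding d_def by (rule infdist_le)
      also have "\<dots> = norm (R z)" by (simp add: q dist_Pair_Pair)
      also have "\<dots> \<le> M * norm z ^ (m + 1)" by (rule R[OF z])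
      also have "\<dots> \<le> (M + 1) * norm q ^ (m + 1)"
        using norm_fst_le[of "fst q" "snd q"] M by (intro mult_mono power_mono) (auto simp: z_def)
      finally show ?case by (simp add: d_def infdist_nonneg)
    qed
  qed (use M in simp)
  then show False using contact unfolding tangent_contact_order_def Let_def S'_def[symmetric] d_def by blast
qed

lemma tendsto_of_has_derivative_ray:
  fixes g :: "real \<Rightarrow> complex"
  assumes "(g has_derivative (\<lambda>t. of_real t * L)) (at 0)" "g 0 = 0"
  shows "((\<lambda>t. g t / of_real t) \<longlongrightarrow> L) (at_right 0)"
proof -
  have "((\<lambda>h. norm (g h - of_real h * L) / norm h) \<longlongrightarrow> 0) (at 0)"
    using assms by (simp add: has_derivative_at)
  then have "((\<lambda>h. norm (g h - of_real h * L) / norm h) \<longlongrightarrow> 0) (at_right 0)"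
    by (rule tendsto_within_subset) simp
  then have "((\<lambda>h. norm (g h / of_real h - L)) \<longlongrightarrow> 0) (at_right 0)"
  proof (rule Lim_transform_eventually)
    have "norm (g h - of_real h * L) / norm h = norm (g h / of_real h - L)" if "h > 0" for h
    proof -
      have "g h / of_real h - L = (g h - of_real h * L) / of_real h" using that by (simp add: field_simps)
      then show ?thesis by (simp add: norm_divide)
    qed
    then show "eventually (\<lambda>h. norm (g h - of_real h * L) / norm h = norm (g h / of_real h - L)) (at_right 0)"
      using eventually_at_right_less[of "0::real"] by (rule eventually_mono[rotated])
  qed
  then have "((\<lambda>h. g h / of_real h - L) \<longlongrightarrow> 0) (at_right 0)" by (rule tendsto_norm_zero_cancel)
  then show ?thesis by (rule LIM_zero_cancel)
qed

text \<open>In a second pair of coordinates the function of the graph differs, up to scaling and terms of order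
  \<open>m + 1\<close>, by a holomorphic function of \<open>z\<close>; comparing leading terms along rays shows that the two
  leading polynomials have the same degree and differ by a monomial in \<open>z\<close>.\<close>

lemma (in graph_chart) leading_form_not_field_differentiable:
  assumes f: "\<And>z. z \<in> ball 0 \<delta> \<Longrightarrow> f z = F z + R z" and p: "p \<in> U" "\<Phi> p = 0" and pS: "p \<in> S"
    and hp: "homogeneous_polynomial m F" and m: "2 \<le> m" and F0: "F 0 = 0" "R 0 = 0"
    and R: "\<And>z. z \<in> ball 0 \<delta> \<Longrightarrow> norm (R z) \<le> M * norm z ^ (m + 1)"
    and d0: "fx 0 = 0" "fy 0 = 0"
    and real: "\<And>z. F z \<in> \<real>" and nz: "F z1 \<noteq> 0"
    and G': "graph_coordinates S p m' U' \<Phi>' F' R'" and m': "2 \<le> m'"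
    and iso: "isolated_CR_singularity (graph_of F') (0, 0)" and z: "z \<noteq> 0"
  shows "\<not> F field_differentiable at z"
proof -
  define \<Psi> where "\<Psi> = inv_into U \<Phi>"
  have b': "biholomorphic2_on U' \<Phi>'" and p': "p \<in> U'" "\<Phi>' p = 0" and hp': "homogeneous_polynomial m' F'"
    and SU': "S \<inter> U' = {q \<in> U'. snd (\<Phi>' q) = F' (fst (\<Phi>' q)) + R' (fst (\<Phi>' q))}"
    using G' by (auto simp: graph_coordinates_def)
  note chart' = biholomorphic2_onD[OF b']
  obtain e0 C0 where e0: "e0 > 0" "e0 \<le> 1" "C0 \<ge> 0" "R' 0 = 0" "F' 0 = 0"
    "\<And>z. norm z < e0 \<Longrightarrow> norm (R' z) \<le> C0 * norm z ^ (m' + 1)"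
    using graph_coordinates_quadratic[OF G' m' pS] by metis
  have z0: "0 \<in> ball 0 \<delta>" using \<delta> by simp
  have f0: "f 0 = 0" using f[OF z0] F0 by simp
  have \<Psi>0: "\<Psi> 0 = p" using p chart(3) by (metis \<Psi>_def inv_into_f_f)
  have zin: "(0::C2) \<in> \<Phi> ` U" using p by (metis imageI)
  define Y where "Y = \<Phi> ` U \<inter> \<Psi> -` U'"
  have c\<Psi>: "continuous_on (\<Phi> ` U) \<Psi>"
    using has_derivative_continuous[OF jac_has_derivative[OF chart(2,5)]]
    by (auto simp: \<Psi>_def intro!: continuous_at_imp_continuous_on)
  have Y: "open Y" "0 \<in> Y" "Y \<subseteq> \<Phi> ` U"
    using continuous_open_preimage[OF c\<Psi> chart(2) chart'(1)] zin \<Psi>0 p' by (auto simp: Y_def)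
  \<comment> \<open>The transition map from the thin coordinates to the ones that witness
    non-parabolicity.\<close>
  define H where "H = (\<lambda>y. \<Phi>' (\<Psi> y))"
  have \<Psi>Y: "holomorphic2_on Y \<Psi>" using chart(5) Y(3) by (auto simp: holomorphic2_on_def \<Psi>_def)
  have H: "holomorphic2_on Y H" unfolding H_def
    by (rule holomorphic2_on_compose[OF Y(1) \<Psi>Y chart'(1,4)]) (auto simp: Y_def)
  have HA: "holo Y (fst \<circ> H)" and HB: "holo Y (snd \<circ> H)" using holomorphic2_on_holo[OF Y(1) H] .
  define A where "A = fst \<circ> H" define B where "B = snd \<circ> H"
  note AB = HA[folded A_def] HB[folded B_def]
  have H0: "H 0 = 0" by (simp add: H_def \<Psi>0 p')
  \<comment> \<open>The diagonal entries of the Jacobian of \<open>H\<close> at \<open>0\<close>.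
    The entry \<open>dz B 0\<close> turns out to be zero, so that invertibility makes both
    nonzero.\<close>
  define a where "a = dz A 0" define c where "c = dw B 0"
  have Ad: "(A has_derivative (\<lambda>v. a * fst v + dw A 0 * snd v)) (at 0)"
    using holo_has_derivative[OF AB(1) Y(2)] by (simp add: a_def)
  have fd0: "(f has_derivative (\<lambda>_. 0)) (at 0)" using f_der[OF z0] d0 by simp
  have ray: "((\<lambda>t. (of_real t * \<zeta>, f (of_real t * \<zeta>))) has_derivative (\<lambda>t. (of_real t * \<zeta>, 0))) (at (0::real))" for \<zeta>
  proof -
    have 1: "((\<lambda>t. of_real t * \<zeta>) has_derivative (\<lambda>t. of_real t * \<zeta>)) (at (0::real))"
      by (auto intro!: derivative_eq_intros)
    have "((\<lambda>t. f (of_real t * \<zeta>)) has_derivative (\<lambda>t. 0)) (at (0::real))"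
      using has_derivative_compose[OF 1, of f "\<lambda>_. 0"] fd0 by simp
    with 1 show ?thesis by (rule has_derivative_Pair)
  qed
  have ev_pos: "eventually (\<lambda>t::real. t > 0) (at_right 0)" by (rule eventually_at_right_less)
  have t_lim: "((\<lambda>t. of_real t * \<zeta>) \<longlongrightarrow> 0) (at_right (0::real))" for \<zeta> :: complex by (auto intro!: tendsto_eq_intros)
  have ev_ball: "eventually (\<lambda>t::real. of_real t * \<zeta> \<in> ball 0 \<delta>) (at_right 0)" for \<zeta> :: complex
    using t_lim[of \<zeta>] by (rule topological_tendstoD) (use \<delta> in auto)
  have y_lim: "((\<lambda>t. (of_real t * \<zeta>, f (of_real t * \<zeta>))) \<longlongrightarrow> 0) (at_right (0::real))" for \<zeta>
    using has_derivative_continuous[OF ray[of \<zeta>]] f0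
    by (auto simp: isCont_def zero_prod_def intro: tendsto_within_subset)
  have q_lim: "((\<lambda>t. (of_real t * \<zeta>, 0)) \<longlongrightarrow> (0::C2)) (at_right (0::real))" for \<zeta>
    using tendsto_Pair[OF t_lim[of \<zeta>] tendsto_const[of 0]] by (simp add: zero_prod_def)
  have f_lim: "((\<lambda>t. f (of_real t * \<zeta>) / of_real t ^ m) \<longlongrightarrow> F \<zeta>) (at_right 0)" for \<zeta>
  proof -
    have "((\<lambda>t. F \<zeta> + R (of_real t * \<zeta>) / of_real t ^ m) \<longlongrightarrow> F \<zeta> + 0) (at_right 0)"
    proof (rule tendsto_add[OF tendsto_const Lim_null_comparison])
      show "eventually (\<lambda>t. norm (R (of_real t * \<zeta>) / of_real t ^ m) \<le> M * norm \<zeta> ^ (m + 1) * t) (at_right 0)"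
        using ev_pos ev_ball[of \<zeta>]
      proof eventually_elim
        case (elim t)
        have "norm (R (of_real t * \<zeta>)) \<le> M * (t * norm \<zeta>) ^ (m + 1)" using R[OF elim(2)] elim(1) by (simp add: norm_mult)
        also have "\<dots> = (M * norm \<zeta> ^ (m + 1) * t) * t ^ m" by (simp add: power_mult_distrib mult_ac)
        finally show ?case using elim(1) by (simp add: norm_divide norm_power divide_le_eq)
      qed
      show "((\<lambda>t. M * norm \<zeta> ^ (m + 1) * t) \<longlongrightarrow> 0) (at_right 0)" by (auto intro!: tendsto_eq_intros)
    qed
    then have "((\<lambda>t. F \<zeta> + R (of_real t * \<zeta>) / of_real t ^ m) \<longlongrightarrow> F \<zeta>) (at_right 0)" by simp
    then show ?thesis
    proof (rule Lim_transform_eventually)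
      show "eventually (\<lambda>t. F \<zeta> + R (of_real t * \<zeta>) / of_real t ^ m = f (of_real t * \<zeta>) / of_real t ^ m) (at_right 0)"
        using ev_pos ev_ball[of \<zeta>]
        by eventually_elim (simp add: f homogeneous_polynomial_scale[OF hp] add_divide_distrib)
    qed
  qed
  have A_lim: "((\<lambda>t. A (of_real t * \<zeta>, f (of_real t * \<zeta>)) / of_real t) \<longlongrightarrow> a * \<zeta>) (at_right 0)" for \<zeta>
  proof (rule tendsto_of_has_derivative_ray)
    have "(A has_derivative (\<lambda>v. a * fst v + dw A 0 * snd v)) (at (of_real 0 * \<zeta>, f (of_real 0 * \<zeta>)))"
      using Ad f0 by (simp add: zero_prod_def)
    from has_derivative_compose[OF ray this]
    show "((\<lambda>t. A (of_real t * \<zeta>, f (of_real t * \<zeta>))) has_derivative (\<lambda>t. of_real t * (a * \<zeta>))) (at 0)"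
      by (rule has_derivative_eq_rhs) (simp add: fun_eq_iff mult_ac)
    show "A (of_real 0 * \<zeta>, f (of_real 0 * \<zeta>)) = 0" using H0 f0 by (simp add: A_def zero_prod_def[symmetric])
  qed
  have A_lim0: "((\<lambda>t. A (of_real t * \<zeta>, f (of_real t * \<zeta>))) \<longlongrightarrow> 0) (at_right (0::real))" for \<zeta>
    using tendsto_div_power_0[of "\<lambda>t. A (of_real t * \<zeta>, f (of_real t * \<zeta>))" 1 "a * \<zeta>" 0] A_lim by simp
  have F'cont: "isCont F' u" for u
    using homogeneous_polynomial_partials[OF hp'] has_derivative_continuous by metis
  \<comment> \<open>Along the graph \<open>B\<close> obeys the second defining equation, so its
    leading term is \<open>F'\<close> at the linearised first coordinate, of order
    \<open>m'\<close>.\<close>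
  have B_lim: "((\<lambda>t. B (of_real t * \<zeta>, f (of_real t * \<zeta>)) / of_real t ^ m') \<longlongrightarrow> F' (a * \<zeta>)) (at_right 0)" for \<zeta>
  proof -
    define A' where "A' = (\<lambda>t. A (of_real t * \<zeta>, f (of_real t * \<zeta>)))"
    have "((\<lambda>t. F' (A' t / of_real t) + R' (A' t) / of_real t ^ m') \<longlongrightarrow> F' (a * \<zeta>) + 0) (at_right 0)"
    proof (rule tendsto_add[OF isCont_tendsto_compose[OF F'cont] Lim_null_comparison])
      show "((\<lambda>t. A' t / of_real t) \<longlongrightarrow> a * \<zeta>) (at_right 0)" using A_lim by (simp add: A'_def)
      have "eventually (\<lambda>t. A' t \<in> ball 0 e0) (at_right 0)"
        using A_lim0[of \<zeta>] unfolding A'_def by (rule topological_tendstoD) (use e0 in auto)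
      with ev_pos show "eventually (\<lambda>t. norm (R' (A' t) / of_real t ^ m') \<le> C0 * norm (A' t / of_real t) ^ m' * norm (A' t)) (at_right 0)"
      proof eventually_elim
        case (elim t)
        have "norm (R' (A' t)) \<le> C0 * norm (A' t) ^ (m' + 1)" using e0(6) elim(2) by simp
        also have "\<dots> = (C0 * norm (A' t / of_real t) ^ m' * norm (A' t)) * t ^ m'"
          using elim(1) by (simp add: norm_divide power_divide)
        finally show ?case using elim(1) by (simp add: norm_divide norm_power divide_le_eq)
      qed
      have "((\<lambda>t. C0 * norm (A' t / of_real t) ^ m' * norm (A' t)) \<longlongrightarrow> C0 * norm (a * \<zeta>) ^ m' * norm (0::complex)) (at_right 0)"
        using A_lim[of \<zeta>] A_lim0[of \<zeta>] unfolding A'_def by (intro tendsto_intros)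
      then show "((\<lambda>t. C0 * norm (A' t / of_real t) ^ m' * norm (A' t)) \<longlongrightarrow> 0) (at_right 0)" by simp
    qed
    then have "((\<lambda>t. F' (A' t / of_real t) + R' (A' t) / of_real t ^ m') \<longlongrightarrow> F' (a * \<zeta>)) (at_right 0)" by simp
    then show ?thesis
    proof (rule Lim_transform_eventually)
      have "eventually (\<lambda>t. (of_real t * \<zeta>, f (of_real t * \<zeta>)) \<in> Y) (at_right 0)"
        using y_lim[of \<zeta>] Y(1,2) by (rule topological_tendstoD)
      with ev_pos ev_ball[of \<zeta>]
      show "eventually (\<lambda>t. F' (A' t / of_real t) + R' (A' t) / of_real t ^ m' = B (of_real t * \<zeta>, f (of_real t * \<zeta>)) / of_real t ^ m') (at_right 0)"
      proof eventually_elim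
        case (elim t)
        define y where "y = (of_real t * \<zeta>, f (of_real t * \<zeta>))"
        have "\<Psi> y = pt (of_real t * \<zeta>)" by (simp add: y_def pt_def \<Psi>_def)
        then have "\<Psi> y \<in> S \<inter> U'" using pt(1)[OF elim(2)] elim(3) by (simp add: Y_def y_def)
        then have "B y = F' (A y) + R' (A y)" unfolding SU' by (simp add: A_def B_def H_def)
        moreover have "F' (A y) = of_real t ^ m' * F' (A y / of_real t)"
          using homogeneous_polynomial_scale[OF hp', of t "A y / of_real t"] elim(1) by simp
        ultimately show ?case using elim(1) by (simp add: A'_def y_def add_divide_distrib)
      qed
    qed
  qed
  \<comment> \<open>The restriction to \<open>w = 0\<close> is the part of \<open>B\<close> that
    does not see \<open>f\<close>: it is holomorphic in \<open>z\<close>, hence a monomial to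
    leading order.\<close>
  define Q where "Q = (\<lambda>z. B (z, 0))"
  obtain rY where rY: "rY > 0" "cball (fst (0::C2)) rY \<times> cball (snd (0::C2)) rY \<subseteq> Y"
    using closed_bidisc_in_open[OF Y(1,2)] by blast
  have Qh: "Q holomorphic_on ball 0 rY" unfolding Q_def
    by (rule holomorphic_on_subset[OF holo_slice1[OF AB(2)]]) (use rY in auto)
  \<comment> \<open>Mean value estimate in \<open>w\<close>: moving from \<open>w = 0\<close> to
    \<open>w = f z\<close> changes \<open>B\<close> by \<open>c * f z\<close> up to an error of
    smaller order than \<open>norm z ^ m\<close>.\<close>
  have BQ_lim: "((\<lambda>t. (B (of_real t * \<zeta>, f (of_real t * \<zeta>)) - Q (of_real t * \<zeta>)) / of_real t ^ m) \<longlongrightarrow> c * F \<zeta>) (at_right 0)" for \<zeta>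
  proof -
    define D where "D = (\<lambda>t. B (of_real t * \<zeta>, f (of_real t * \<zeta>)) - Q (of_real t * \<zeta>) - c * f (of_real t * \<zeta>))"
    have cdw: "continuous_on Y (dw B)" using holo_dw[OF AB(2)] by (simp add: holo_def)
    have "((\<lambda>t. D t / of_real t ^ m) \<longlongrightarrow> 0) (at_right 0)"
    proof (rule tendstoI)
      fix e :: real assume e: "e > 0"
      define e' where "e' = e / (norm (F \<zeta>) + 1)"
      have e': "e' > 0" using e by (simp add: e'_def add_nonneg_pos)
      have "isCont (dw B) 0" using cdw Y(1,2) continuous_on_eq_continuous_at by blast
      then obtain d where d: "d > 0" "\<And>y. dist y 0 < d \<Longrightarrow> dist (dw B y) (dw B 0) < e'"
        using e' unfolding continuous_at_eps_delta dist_norm by metis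
      have ev1: "eventually (\<lambda>t. (of_real t * \<zeta>, f (of_real t * \<zeta>)) \<in> ball 0 (min d rY)) (at_right 0)"
        using y_lim[of \<zeta>] by (rule topological_tendstoD) (use d rY in auto)
      have "((\<lambda>t. norm (f (of_real t * \<zeta>) / of_real t ^ m)) \<longlongrightarrow> norm (F \<zeta>)) (at_right 0)"
        by (intro tendsto_norm f_lim)
      then have ev2: "eventually (\<lambda>t. norm (f (of_real t * \<zeta>) / of_real t ^ m) < norm (F \<zeta>) + 1) (at_right 0)"
        by (rule order_tendstoD) simp
      show "eventually (\<lambda>t. dist (D t / of_real t ^ m) 0 < e) (at_right 0)"
        using ev_pos ev1 ev2
      proof eventually_elim
        case (elim t)
        define u where "u = of_real t * \<zeta>"
        define w where "w = f u"
        have uw: "norm (u, w) < min d rY" using elim(2) by (simp add: u_def w_def)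
        have seg: "norm (u, s) < min d rY" "(u, s) \<in> Y" if "s \<in> closed_segment 0 w" for s
        proof -
          have "norm s \<le> norm w" using segment_bound1[OF that] by simp
          then have "norm (u, s) \<le> norm (u, w)" by (simp add: norm_Pair power_mono)
          then show 1: "norm (u, s) < min d rY" using uw by linarith
          show "(u, s) \<in> Y" using 1 norm_fst_le[of u s] norm_snd_le[of s u] by (intro subsetD[OF rY(2)]) auto
        qed
        have "norm ((B (u, w) - c * w) - (B (u, 0) - c * 0)) \<le> e' * norm (w - 0)"
        proof (rule field_differentiable_bound[where S = "closed_segment 0 w" and f = "\<lambda>s. B (u, s) - c * s" and f' = "\<lambda>s. dw B (u, s) - c"])
          show "((\<lambda>s. B (u, s) - c * s) has_field_derivative dw B (u, s) - c) (at s within closed_segment 0 w)"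
            if "s \<in> closed_segment 0 w" for s
          proof -
            have "((\<lambda>s. B (u, s)) has_field_derivative dw B (u, s)) (at s)"
              using AB(2) seg(2)[OF that] by (auto simp: holo_def dw_def DERIV_deriv_iff_field_differentiable)
            then have "((\<lambda>s. B (u, s) - c * s) has_field_derivative dw B (u, s) - c) (at s)"
              by (auto intro!: derivative_eq_intros)
            then show ?thesis by (rule has_field_derivative_at_within)
          qed
          show "norm (dw B (u, s) - c) \<le> e'" if "s \<in> closed_segment 0 w" for s
            using d(2)[of "(u, s)"] seg(1)[OF that] by (simp add: c_def dist_norm)
        qed auto
        then have "norm (D t) \<le> e' * norm w" by (simp add: D_def Q_def u_def w_def algebra_simps)
        then have "norm (D t / of_real t ^ m) \<le> e' * norm (w / of_real t ^ m)"
          using elim(1) by (simp add: norm_divide norm_power divide_right_mono)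
        also have "\<dots> < e' * (norm (F \<zeta>) + 1)" using elim(3) e' by (simp add: w_def u_def)
        also have "\<dots> = e" using norm_ge_zero[of "F \<zeta>"] by (simp add: e'_def add_nonneg_eq_0_iff)
        finally show ?case by simp
      qed
    qed
    from tendsto_add[OF this tendsto_mult[OF tendsto_const f_lim[of \<zeta>], of c]]
    have "((\<lambda>t. D t / of_real t ^ m + c * (f (of_real t * \<zeta>) / of_real t ^ m)) \<longlongrightarrow> c * F \<zeta>) (at_right 0)" by simp
    then show ?thesis by (simp add: D_def diff_divide_distrib)
  qed
  have Q_lim: "((\<lambda>t. Q (of_real t * \<zeta>) / of_real t ^ j) \<longlongrightarrow> L1 - L2) (at_right 0)"
    if "((\<lambda>t. B (of_real t * \<zeta>, f (of_real t * \<zeta>)) / of_real t ^ j) \<longlongrightarrow> L1) (at_right 0)"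
      "((\<lambda>t. (B (of_real t * \<zeta>, f (of_real t * \<zeta>)) - Q (of_real t * \<zeta>)) / of_real t ^ j) \<longlongrightarrow> L2) (at_right 0)" for \<zeta> j L1 L2
    using tendsto_diff[OF that] by (simp flip: diff_divide_distrib)
  \<comment> \<open>Both \<open>m\<close> and \<open>m'\<close> exceed 1, so \<open>Q\<close> has no
    linear term; this is the vanishing of \<open>dz B 0\<close>.\<close>
  have Q1: "((\<lambda>t. Q (of_real t * 1) / of_real t ^ 1) \<longlongrightarrow> 0 - 0) (at_right 0)"
    using tendsto_div_power_0[OF B_lim[of 1], of 1] tendsto_div_power_0[OF BQ_lim[of 1], of 1] m m' by (intro Q_lim) auto
  have dzB: "dz B 0 = 0"
  proof -
    have Bz: "((\<lambda>z. B (z, 0)) has_field_derivative dz B 0) (at 0)"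
      using AB(2) Y(2) by (force simp: holo_def dz_def DERIV_deriv_iff_field_differentiable)
    have 1: "((\<lambda>t. of_real t) has_derivative (\<lambda>t. of_real t)) (at (0::real))" by (auto intro!: derivative_eq_intros)
    have "((\<lambda>t. Q (of_real t)) has_derivative (\<lambda>t. of_real t * dz B 0)) (at (0::real))"
    proof -
      have "(Q has_derivative (\<lambda>v. dz B 0 * v)) (at (of_real 0))" using Bz by (simp add: Q_def has_field_derivative_def)
      from has_derivative_compose[OF 1 this] show ?thesis by (simp add: mult.commute)
    qed
    moreover have "Q (of_real 0) = 0" using H0 by (simp add: Q_def B_def zero_prod_def[symmetric])
    ultimately have "((\<lambda>t. Q (of_real t) / of_real t) \<longlongrightarrow> dz B 0) (at_right 0)"
      by (rule tendsto_of_has_derivative_ray)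
    from tendsto_unique[OF _ this, of 0] Q1 show ?thesis by simp
  qed
  have jH: "jac H 0 v = (a * fst v + dw A 0 * snd v, c * snd v)" for v
    using dzB by (simp add: jac_def a_def c_def A_def B_def)
  have jH0: "v = 0" if "jac H 0 v = 0" for v
  proof -
    have "(H has_derivative (\<lambda>v. jac \<Phi>' p (jac \<Psi> 0 v))) (at 0)"
      unfolding H_def using has_derivative_compose[OF jac_has_derivative[OF Y(1) \<Psi>Y Y(2)], of \<Phi>'] jac_has_derivative[OF chart'(1,4) p'(1)] \<Psi>0 by simp
    from has_derivative_unique[OF this jac_has_derivative[OF Y(1) H Y(2)]]
    have "jac \<Phi>' p (jac \<Psi> 0 v) = 0" using that by metis
    then have "jac \<Psi> 0 v = 0" using biholomorphic2_jac_inverse(1)[OF b' p'(1), of "jac \<Psi> 0 v"] by simp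
    then show ?thesis using biholomorphic2_jac_inverse(2)[OF biholo zin, of v] by (simp add: \<Psi>_def)
  qed
  have a0: "a \<noteq> 0"
  proof
    assume "a = 0"
    then have "jac H 0 (1, 0) = 0" by (simp add: jH prod_eq_iff)
    then show False using jH0 by (metis fst_conv fst_zero one_neq_zero)
  qed
  have c0: "c \<noteq> 0"
  proof
    assume "c = 0"
    then have "jac H 0 (- dw A 0, a) = 0" by (simp add: jH prod_eq_iff)
    then show False using jH0 a0 by (metis snd_conv snd_zero)
  qed
  have iso': "\<not> F' field_differentiable at u" if "u \<noteq> 0" for u
    using isolated_graph_not_field_differentiable[OF hp' iso e0(5) that] .
  show ?thesis
  proof (cases m' m rule: linorder_cases)
    \<comment> \<open>If \<open>m' < m\<close>, the form \<open>F'\<close> is itself a holomorphic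
      monomial, against isolation.\<close>
    case less
    have L: "((\<lambda>t. Q (of_real t * \<zeta>) / of_real t ^ m') \<longlongrightarrow> F' (a * \<zeta>) - 0) (at_right 0)" for \<zeta>
      by (rule Q_lim[OF B_lim tendsto_div_power_0[OF BQ_lim less]])
    have L1: "((\<lambda>t. Q (of_real t) / of_real t ^ m') \<longlongrightarrow> F' a) (at_right 0)" using L[of 1] by simp
    have scaled: "F' (a * \<zeta>) = F' a * \<zeta> ^ m'" for \<zeta>
      using tendsto_unique[OF _ L holomorphic_radial_limit[OF rY(1) Qh L1]] by simp
    have eq: "F' u = F' a * (u / a) ^ m'" for u using scaled[of "u / a"] a0 by simp
    have "(\<lambda>u. F' a * (u / a) ^ m') field_differentiable at 1"
      using a0 by (intro field_differentiable_mult field_differentiable_const field_differentiable_power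
          field_differentiable_divide field_differentiable_ident)
    then have "F' field_differentiable at 1" by (subst ext[of F', OF eq])
    then show ?thesis using iso'[of 1] by simp
  next
    \<comment> \<open>Up to complex scaling of variable and value the two forms differ by a
      holomorphic monomial, so complex differentiability of \<open>F\<close> at \<open>z\<close>
      passes to \<open>F'\<close> at \<open>a * z\<close>.\<close>
    case equal
    have L: "((\<lambda>t. Q (of_real t * \<zeta>) / of_real t ^ m) \<longlongrightarrow> F' (a * \<zeta>) - c * F \<zeta>) (at_right 0)" for \<zeta>
      using Q_lim[OF B_lim[unfolded equal] BQ_lim] .
    have L1: "((\<lambda>t. Q (of_real t) / of_real t ^ m) \<longlongrightarrow> F' a - c * F 1) (at_right 0)" using L[of 1] by simp
    define q where "q = F' a - c * F 1"
    have scaled: "F' (a * \<zeta>) = q * \<zeta> ^ m + c * F \<zeta>" for \<zeta>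
      using tendsto_unique[OF _ L holomorphic_radial_limit[OF rY(1) Qh L1]] by (simp add: q_def algebra_simps)
    have "F' u = q * (u / a) ^ m + c * F (u / a)" for u using scaled[of "u / a"] a0 by simp
    then have eq: "F' = (\<lambda>u. q * (u / a) ^ m + c * F (u / a))" by (rule ext)
    show ?thesis
    proof
      assume fd: "F field_differentiable at z"
      have d: "(\<lambda>u. u / a) field_differentiable at (a * z)"
        using a0 by (intro field_differentiable_divide field_differentiable_ident field_differentiable_const)
      have "(\<lambda>u. F (u / a)) field_differentiable at (a * z)"
        using field_differentiable_compose[OF d, of F] fd a0 by (simp add: o_def)
      then have "(\<lambda>u. q * (u / a) ^ m + c * F (u / a)) field_differentiable at (a * z)"
        by (intro field_differentiable_add field_differentiable_mult field_differentiable_const field_differentiable_power d)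
      then have "F' field_differentiable at (a * z)" by (simp only: eq[symmetric])
      then show False using iso'[of "a * z"] a0 z by simp
    qed
  next
    \<comment> \<open>If \<open>m < m'\<close>, then \<open>F\<close> is a real-valued holomorphic
      monomial, hence zero.\<close>
    case greater
    have L: "((\<lambda>t. Q (of_real t * \<zeta>) / of_real t ^ m) \<longlongrightarrow> 0 - c * F \<zeta>) (at_right 0)" for \<zeta>
      by (rule Q_lim[OF tendsto_div_power_0[OF B_lim greater] BQ_lim])
    have L1: "((\<lambda>t. Q (of_real t) / of_real t ^ m) \<longlongrightarrow> - c * F 1) (at_right 0)" using L[of 1] by simp
    have scaled: "c * F \<zeta> = c * F 1 * \<zeta> ^ m" for \<zeta>
      using tendsto_unique[OF _ L holomorphic_radial_limit[OF rY(1) Qh L1]] by simp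
    have F1: "F \<zeta> = F 1 * \<zeta> ^ m" for \<zeta> using scaled[of \<zeta>] c0 by (simp add: mult.assoc)
    have "F 1 * \<zeta> ^ m \<in> \<real>" for \<zeta> using real[of \<zeta>] F1[of \<zeta>] by (simp only:)
    then have "F 1 = 0" using real_monomial_zero[of m "F 1"] m by simp
    then show ?thesis using F1[of z1] nz by simp
  qed
qed

section \<open>The index at a definite leading form\<close>

lemma tangent_space_open_subset:
  assumes "open O'" "q \<in> O'" shows "tangent_space (S \<inter> O') q = tangent_space S q"
proof (intro equalityI subsetI)
  fix v assume "v \<in> tangent_space (S \<inter> O') q"
  then show "v \<in> tangent_space S q" unfolding tangent_space_def by blast
next
  fix v assume "v \<in> tangent_space S q"
  then obtain e \<gamma> where e: "e > 0" "\<gamma> 0 = q" "\<gamma> ` {-e<..<e} \<subseteq> S" "\<gamma> C1_differentiable_on {-e<..<e}"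
    "(\<gamma> has_vector_derivative v) (at 0)" unfolding tangent_space_def by blast
  have "isCont \<gamma> 0" using e(5) by (rule has_vector_derivative_continuous)
  then have "(\<gamma> \<longlongrightarrow> q) (at 0)" using e(2) by (simp add: isCont_def)
  then have "eventually (\<lambda>t. \<gamma> t \<in> O') (at 0)" using assms by (rule topological_tendstoD)
  then obtain d where d: "d > 0" "\<And>t. t \<noteq> 0 \<Longrightarrow> dist t 0 < d \<Longrightarrow> \<gamma> t \<in> O'" by (auto simp: eventually_at)
  have "\<gamma> t \<in> O'" if "\<bar>t\<bar> < d" for t using d(2)[of t] that assms(2) e(2) by (cases "t = 0") auto
  moreover have "\<gamma> t \<in> S" if "\<bar>t\<bar> < e" for t using that by (intro subsetD[OF e(3)] imageI) auto
  ultimately have "\<gamma> ` {- min e d<..<min e d} \<subseteq> S \<inter> O'" by auto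
  moreover have "\<gamma> C1_differentiable_on {- min e d<..<min e d}"
    by (rule C1_differentiable_on_subset[OF e(4)]) auto
  ultimately show "v \<in> tangent_space (S \<inter> O') q"
    unfolding tangent_space_def mem_Collect_eq using e(1,2,5) d(1)
    by (intro exI[of _ "min e d"] exI[of _ \<gamma>] conjI) auto
qed

lemma winding_number_cmult_circlepath:
  assumes "c \<noteq> 0" "\<rho> > 0" shows "winding_number (\<lambda>t. c * circlepath 0 \<rho> t) 0 = 1"
proof -
  have an: "(\<lambda>w. c * w) analytic_on UNIV" by (intro analytic_intros)
  have eq: "(\<lambda>t. c * circlepath 0 \<rho> t) = (\<lambda>w. c * w) \<circ> circlepath 0 \<rho>" by (simp add: fun_eq_iff)
  have v: "valid_path ((\<lambda>w. c * w) \<circ> circlepath 0 \<rho>)"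
    by (rule valid_path_compose_analytic[OF _ an]) auto
  have n0: "0 \<notin> path_image ((\<lambda>w. c * w) \<circ> circlepath 0 \<rho>)"
    using assms by (auto simp: path_image_compose)
  have "contour_integral ((\<lambda>w. c * w) \<circ> circlepath 0 \<rho>) (\<lambda>w. 1 / w) = contour_integral (circlepath 0 \<rho>) (\<lambda>w. deriv (\<lambda>w. c * w) w * (1 / (c * w)))"
    by (rule contour_integral_comp_analyticW[OF an]) auto
  also have "\<dots> = contour_integral (circlepath 0 \<rho>) (\<lambda>w. 1 / (w - 0))" using assms(1) by simp
  also have "\<dots> = 2 * pi * \<i> * winding_number (circlepath 0 \<rho>) 0"
    using assms(2) by (subst winding_number_valid_path) auto
  also have "winding_number (circlepath 0 \<rho>) 0 = 1" using assms(2) by (simp add: winding_number_circlepath)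
  finally have ci: "contour_integral ((\<lambda>w. c * w) \<circ> circlepath 0 \<rho>) (\<lambda>w. 1 / w) = 2 * pi * \<i> * 1" .
  show ?thesis unfolding eq winding_number_valid_path[OF v n0] diff_0_right ci by simp
qed

context graph_chart
begin

text \<open>The Jacobian determinant of the inverse chart at the graph point over
  \<open>z\<close>.\<close>

definition jdet :: "complex \<Rightarrow> complex" where
  "jdet z = dz (fst \<circ> inv_into U \<Phi>) (z, f z) * dw (snd \<circ> inv_into U \<Phi>) (z, f z)
    - dw (fst \<circ> inv_into U \<Phi>) (z, f z) * dz (snd \<circ> inv_into U \<Phi>) (z, f z)"

lemma det2_jac: "det2 (jac (inv_into U \<Phi>) (z, f z) v) (jac (inv_into U \<Phi>) (z, f z) w) = jdet z * det2 v w"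
  by (simp add: det2_def jac_def jdet_def algebra_simps)

text \<open>In the chart the frame is \<open>(1, fx z)\<close>, \<open>(\<i>, fy z)\<close>. The
  second factor vanishes exactly at CR singularities, and its winding is the index, since
  \<open>jdet\<close> has no zero on the disc.\<close>

lemma det2_dpt: "det2 (dpt z 1) (dpt z \<i>) = jdet z * (fy z - \<i> * fx z)"
  unfolding dpt_def det2_jac by (simp add: det2_def df_def)

lemma jdet_nonzero:
  assumes z: "z \<in> ball 0 \<delta>" shows "jdet z \<noteq> 0"
proof
  assume "jdet z = 0"
  then have "det2 (jac (inv_into U \<Phi>) (z, f z) v) (jac (inv_into U \<Phi>) (z, f z) w) = 0" for v w by (simp add: det2_jac)
  moreover have "jac (inv_into U \<Phi>) (z, f z) (jac \<Phi> (pt z) v) = v" for v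
    using biholomorphic2_jac_inverse(1)[OF biholo pt(2)[OF z], of v] pt(3)[OF z] by simp
  ultimately have "det2 v w = 0" for v w by metis
  from this[of "(1, 0)" "(0, 1)"] show False by (simp add: det2_def)
qed

lemma continuous_on_jdet: "continuous_on (ball 0 \<delta>) jdet"
proof -
  note h = holomorphic2_on_holo[OF chart(2,5)]
  have c: "continuous_on (\<Phi> ` U) (dz (fst \<circ> inv_into U \<Phi>))" "continuous_on (\<Phi> ` U) (dw (fst \<circ> inv_into U \<Phi>))"
    "continuous_on (\<Phi> ` U) (dz (snd \<circ> inv_into U \<Phi>))" "continuous_on (\<Phi> ` U) (dw (snd \<circ> inv_into U \<Phi>))"
    using holo_dz[OF h(1)] holo_dw[OF h(1)] holo_dz[OF h(2)] holo_dw[OF h(2)] by (simp_all add: holo_def)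
  have g: "continuous_on (ball 0 \<delta>) (\<lambda>z. (z, f z))" by (intro continuous_on_Pair continuous_on_id continuous_on_f)
  have i: "(\<lambda>z. (z, f z)) ` ball 0 \<delta> \<subseteq> \<Phi> ` U" using in_chart by blast
  show ?thesis unfolding jdet_def
    by (intro continuous_on_diff continuous_on_mult continuous_on_compose2[OF c(1) g i] continuous_on_compose2[OF c(2) g i]
        continuous_on_compose2[OF c(3) g i] continuous_on_compose2[OF c(4) g i])
qed

text \<open>On the disc parametrised by \<open>pt\<close>, the loop \<open>|z| = \<rho>\<close> is admissible; in the frame of the coordinate
  vectors the determinant is, up to a positive real factor and a constant, \<open>z\<close> times a function with values
  in a half plane.\<close>

lemma maslov_index_one:
  assumes p: "p \<in> U" "\<Phi> p = 0" "p \<in> S" and d0: "fx 0 = 0" "fy 0 = 0"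
    and iso: "isolated_CR_singularity S p" and ind: "has_maslov_index S p n"
    and \<delta>1: "0 < \<delta>1" "\<delta>1 \<le> \<delta>"
    and pos: "\<And>z. z \<in> ball 0 \<delta>1 \<Longrightarrow> z \<noteq> 0 \<Longrightarrow> 0 < Re (s * (cnj z * (fx z + \<i> * fy z) * (jdet z / jdet 0)))"
    and s: "s = 1 \<or> s = -1"
  shows "n = 1"
proof -
  have z0: "0 \<in> ball 0 \<delta>" using \<delta> by simp
  have pt0: "pt 0 = p" using pt_fst[OF p(3,1)] p(2) by simp
  obtain U0 where U0: "open U0" "p \<in> U0" "\<And>x. x \<in> S \<Longrightarrow> x \<in> U0 \<Longrightarrow> CR_singularity S x \<Longrightarrow> x = p" and CRp: "CR_singularity S p"
    using iso unfolding isolated_CR_singularity_def by blast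
  have "isCont pt 0" using has_derivative_continuous[OF pt_has_derivative[OF z0]] .
  then have "(pt \<longlongrightarrow> p) (at 0)" using pt0 by (simp add: isCont_def)
  then have "eventually (\<lambda>z. pt z \<in> U0) (at 0)" using U0(1,2) by (rule topological_tendstoD)
  then obtain d where d: "d > 0" "\<And>z. z \<noteq> 0 \<Longrightarrow> dist z 0 < d \<Longrightarrow> pt z \<in> U0" by (auto simp: eventually_at)
  define r where "r = min \<delta>1 d"
  have r: "0 < r" "r \<le> \<delta>1" "r \<le> \<delta>" "r \<le> d" using \<delta>1 d(1) by (auto simp: r_def)
  have rb: "z \<in> ball 0 \<delta>" if "z \<in> ball 0 r" for z using that r by auto
  have CR_iff: "CR_singularity S (pt z) \<longleftrightarrow> z = 0" if "z \<in> ball 0 r" for z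
  proof
    assume cr: "CR_singularity S (pt z)"
    show "z = 0"
    proof (rule ccontr)
      assume "z \<noteq> 0"
      then have "pt z \<in> U0" using d(2)[of z] that r by auto
      then have "pt z = p" using U0(3) cr pt(1)[OF rb[OF that]] by blast
      then have "z = 0" using pt(3)[OF rb[OF that]] p(2) by (simp add: zero_prod_def)
      then show False using \<open>z \<noteq> 0\<close> by simp
    qed
  qed (use CRp pt0 in simp)
  \<comment> \<open>Open sets of the ambient space cut out by conditions on the parameter; they make
    \<open>W\<close>, and later \<open>W\<close> without \<open>p\<close>, relatively open in the
    surface.\<close>
  define Or where "Or A = {q \<in> U. fst (\<Phi> q) \<in> A}" for A
  have cont\<Phi>: "continuous_on U (\<lambda>q. fst (\<Phi> q))"
    using has_derivative_continuous[OF jac_has_derivative[OF chart(1,4)]]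
    by (intro continuous_on_fst continuous_at_imp_continuous_on ballI)
  have oOr: "open (Or A)" if "open A" for A
    using continuous_open_preimage[OF cont\<Phi> chart(1) that] by (simp add: Or_def Int_def vimage_def)
  define V where "V = ball (0::complex) r"
  define W where "W = S \<inter> Or V"
  have ptW: "pt z \<in> W" if "z \<in> V" for z
    using pt[OF rb] that by (simp add: W_def Or_def V_def)
  have Wpt: "\<exists>z\<in>V. q = pt z" if "q \<in> W" for q
    using pt_fst[of q] that by (auto simp: W_def Or_def intro!: bexI[of _ "fst (\<Phi> q)"])
  have Weq: "W = pt ` V" using ptW Wpt by blast
  have inj: "inj_on pt V"
    by (rule inj_onI) (metis V_def rb pt(3) fst_conv)
  have inv: "inv_into V pt (pt z) = z" if "z \<in> V" for z using inj that by simp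
  have homeo: "homeomorphism V W pt (inv_into V pt)"
  proof (rule homeomorphismI)
    show "continuous_on V pt" by (rule continuous_on_subset[OF continuous_on_pt]) (use r in \<open>auto simp: V_def\<close>)
    have "continuous_on W (\<lambda>q. fst (\<Phi> q))" by (rule continuous_on_subset[OF cont\<Phi>]) (auto simp: W_def Or_def)
    then show "continuous_on W (inv_into V pt)"
    proof (rule continuous_on_eq)
      fix q assume "q \<in> W"
      then obtain z where "z \<in> V" "q = pt z" using Wpt by blast
      then show "fst (\<Phi> q) = inv_into V pt q" using inv pt(3)[OF rb] by (simp add: V_def)
    qed
  qed (use Weq inv in auto)
  have oW: "openin (top_of_set S) W" unfolding W_def using oOr by (simp add: V_def openin_open_Int)
  have pW: "p \<in> W" using ptW[of 0] pt0 r by (simp add: V_def)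
  have nb: "CR_neighbourhood S p W"
    unfolding CR_neighbourhood_def
  proof (intro conjI ballI)
    have "W homeomorphic V" using homeo by (metis homeomorphic_def homeomorphic_sym)
    moreover have "contractible V" by (simp add: V_def convex_imp_contractible)
    ultimately show "contractible W" using homeomorphic_contractible_eq by blast
    fix q assume "q \<in> W"
    then obtain z where z: "z \<in> V" "q = pt z" using Wpt by blast
    have "pt z = p \<longleftrightarrow> z = 0" using inj_onD[OF inj _ z(1), of 0] pt0 r by (auto simp: V_def)
    then show "CR_singularity S q \<longleftrightarrow> q = p" using CR_iff[of z] z by (simp add: V_def)
  qed (use oW pW in auto)
  define \<rho> where "\<rho> = r / 2"
  define zt where "zt = circlepath 0 \<rho>"
  have \<rho>: "0 < \<rho>" "\<rho> < r" using r by (auto simp: \<rho>_def)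
  have nzt: "norm (zt t) = \<rho>" for t using \<rho> by (simp add: zt_def circlepath norm_mult)
  have ztV: "zt t \<in> V" "zt t \<in> ball 0 \<delta>" "zt t \<in> ball 0 \<delta>1" "zt t \<noteq> 0" for t
    using nzt[of t] \<rho> r by (auto simp: V_def)
  define \<gamma> where "\<gamma> t = pt (zt t)" for t
  have zt_der: "(zt has_vector_derivative 2 * pi * \<i> * zt t) (at t)" for t
  proof -
    have "((\<lambda>w. of_real \<rho> * exp (2 * of_real pi * \<i> * w)) has_field_derivative
        2 * pi * \<i> * (of_real \<rho> * exp (2 * of_real pi * \<i> * of_real t))) (at (of_real t))"
      by (auto intro!: derivative_eq_intros)
    from has_vector_derivative_real_field[OF this] show ?thesis by (simp add: zt_def circlepath)
  qed
  have zt_cont: "continuous_on UNIV zt" unfolding zt_def circlepath by (intro continuous_intros)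
  have \<gamma>der: "(\<gamma> has_vector_derivative dpt (zt t) (2 * pi * \<i> * zt t)) (at t)" for t
    using has_derivative_compose[OF zt_der[unfolded has_vector_derivative_def] pt_has_derivative[OF ztV(2)], of t]
    unfolding \<gamma>_def[abs_def] has_vector_derivative_def
    by (simp only: linear_cmul[OF has_derivative_linear[OF pt_has_derivative[OF ztV(2)]]])
  have loop: "positive_loop_around W p \<gamma>"
    unfolding positive_loop_around_def
  proof (intro conjI exI[of _ V] exI[of _ pt] exI[of _ \<i>] allI)
    show "\<gamma> (t + 1) = \<gamma> t" for t
      by (simp add: \<gamma>_def zt_def circlepath distrib_left exp_add)
    have "continuous_on UNIV (\<lambda>t. dpt (zt t) (2 * pi * \<i> * zt t))"
      using ztV(2) zt_cont by (intro continuous_on_dpt continuous_intros) auto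
    then show "\<gamma> C1_differentiable_on UNIV"
      unfolding C1_differentiable_on_def by (intro exI[of _ "\<lambda>t. dpt (zt t) (2 * pi * \<i> * zt t)"] conjI ballI \<gamma>der)
    have piV: "path_image zt \<subseteq> V" using ztV(1) by (auto simp: path_image_def)
    have "simple_path (pt \<circ> zt)"
    proof (rule simple_path_continuous_image)
      show "simple_path zt" using \<rho> by (simp add: zt_def simple_path_circlepath)
      show "continuous_on (path_image zt) pt"
        by (rule continuous_on_subset[OF continuous_on_pt]) (use piV r in \<open>auto simp: V_def\<close>)
      show "inj_on pt (path_image zt)" using inj_on_subset[OF inj piV] .
    qed
    then show "simple_path \<gamma>" by (simp add: \<gamma>_def[abs_def] o_def)
    have np: "\<gamma> t \<noteq> p" for t
      using pt(3)[OF ztV(2)[of t]] ztV(4)[of t] p(2) by (auto simp: \<gamma>_def zero_prod_def)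
    show "path_image \<gamma> \<subseteq> W - {p}"
    proof
      fix q assume "q \<in> path_image \<gamma>"
      then obtain t where "q = \<gamma> t" by (auto simp: path_image_def)
      then show "q \<in> W - {p}" using np[of t] ptW[OF ztV(1)[of t]] by (simp add: \<gamma>_def)
    qed
    have fr: "frechet_derivative pt (at z) = dpt z" if "z \<in> V" for z
      using pt_has_derivative[OF rb] that frechet_derivative_at by (metis V_def)
    show "parametrization 1 V pt W"
      unfolding parametrization_def
    proof (intro conjI ballI homeo)
      have "Ck_on (Suc 0) V pt"
      proof (rule Ck_on_SucI[where D = dpt])
        show "(pt has_derivative dpt z) (at z)" if "z \<in> V" for z using pt_has_derivative[OF rb] that by (simp add: V_def)
        show "Ck_on 0 V (\<lambda>z. dpt z v)" for v
          using r by (simp only: Ck_on.simps) (intro continuous_on_dpt continuous_intros, auto simp: V_def)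
      qed (simp add: V_def)
      then show "Ck_on 1 V pt" by simp
      fix z assume z: "z \<in> V"
      show "inj (frechet_derivative pt (at z))"
        unfolding fr[OF z] by (rule injI) (metis V_def z rb jac_dpt fst_conv)
    qed (simp add: V_def)
    show "0 \<in> V" "pt 0 = p" using r pt0 by (auto simp: V_def)
    \<comment> \<open>At \<open>0\<close> the derivative of \<open>f\<close> vanishes, so
      \<open>pt\<close> is complex linear to first order and positively oriented with factor
      \<open>\<i>\<close>.\<close>
    have "dpt 0 h = jac (inv_into U \<Phi>) (0, f 0) (cscale h (1, 0))" for h
      by (simp add: dpt_def df_def d0 cscale_def)
    then have "dpt 0 h = cscale h (jac (inv_into U \<Phi>) (0, f 0) (1, 0))" for h by (simp only: jac_cscale)
    then show "frechet_derivative pt (at 0) \<i> = cscale \<i> (frechet_derivative pt (at 0) 1)"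
      unfolding fr[OF \<open>0 \<in> V\<close>] by (simp add: cscale_def)
    have "inv_into V pt \<circ> \<gamma> = circlepath 0 \<rho>" using inv[OF ztV(1)] by (simp add: fun_eq_iff \<gamma>_def zt_def)
    then show "winding_number (inv_into V pt \<circ> \<gamma>) 0 = 1" using \<rho> by (simp add: winding_number_circlepath)
  qed simp
  from ind nb loop have "has_maslov_path_index (W - {p}) \<gamma> n" unfolding has_maslov_index_def by blast
  then obtain X Y where XY: "path X" "path Y" "X 1 = X 0" "Y 1 = Y 0"
    "\<And>t. t \<in> {0..1} \<Longrightarrow> orthonormal_basis_of (tangent_space (W - {p}) (\<gamma> t)) (X t) (Y t)"
    and wn: "winding_number (\<lambda>t. det2 (X t) (Y t)) 0 = of_int n"
    unfolding has_maslov_path_index_def by blast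
  have Wp: "W - {p} = S \<inter> Or (V - {0})"
  proof -
    have "q = p" if "q \<in> S" "q \<in> U" "fst (\<Phi> q) = 0" for q using pt_fst[OF that(1,2)] that(3) pt0 by simp
    moreover have "fst (\<Phi> p) = 0" using p(2) by simp
    ultimately show ?thesis unfolding W_def Or_def by blast
  qed
  have T: "tangent_space (W - {p}) (\<gamma> t) = range (dpt (zt t))" for t
  proof -
    have "\<gamma> t \<in> Or (V - {0})" using pt(2,3)[OF ztV(2)[of t]] ztV[of t] by (simp add: Or_def \<gamma>_def)
    moreover have "open (Or (V - {0}))" by (intro oOr) (simp add: V_def open_delete)
    ultimately show ?thesis unfolding Wp using tangent_space_open_subset tangent_space_pt[OF ztV(2)] by (simp add: \<gamma>_def)
  qed
  \<comment> \<open>\<open>X t\<close> and \<open>Y t\<close> are real combinations of the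
    coordinate vectors; orthonormality keeps the determinant \<open>c\<close> of this change of
    basis nonzero. Its sign may so far depend on \<open>t\<close>.\<close>
  have real_det: "\<exists>c::real. c \<noteq> 0 \<and> det2 (X t) (Y t) = of_real c * det2 (dpt (zt t) 1) (dpt (zt t) \<i>)" if t: "t \<in> {0..1}" for t
  proof -
    have on: "norm (X t) = 1" "norm (Y t) = 1" "inner (X t) (Y t) = 0" "span {X t, Y t} = range (dpt (zt t))"
      using XY(5)[OF t] unfolding orthonormal_basis_of_def T by auto
    have "X t \<in> span {X t, Y t}" "Y t \<in> span {X t, Y t}" by (simp_all add: span_base)
    then obtain a b where ab: "X t = dpt (zt t) a" "Y t = dpt (zt t) b" unfolding on(4) by blast
    have lin: "linear (dpt (zt t))" by (rule has_derivative_linear[OF pt_has_derivative[OF ztV(2)]])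
    define A where "A = dpt (zt t) 1" define B where "B = dpt (zt t) \<i>"
    have e: "dpt (zt t) h = Re h *\<^sub>R A + Im h *\<^sub>R B" for h unfolding A_def B_def by (rule real_linear_complex[OF lin])
    define c where "c = Re a * Im b - Im a * Re b"
    have "det2 (X t) (Y t) = of_real c * det2 A B"
      by (simp add: ab e det2_def c_def scaleR_conv_of_real algebra_simps)
    moreover have "c \<noteq> 0"
    proof
      assume c: "c = 0"
      have "Re b *\<^sub>R X t = Re a *\<^sub>R Y t" "Im b *\<^sub>R X t = Im a *\<^sub>R Y t"
        using c by (simp_all add: ab e c_def scaleR_add_right mult.commute)
      then have "inner (Re b *\<^sub>R X t) (Y t) = Re a * inner (Y t) (Y t)" "inner (Im b *\<^sub>R X t) (Y t) = Im a * inner (Y t) (Y t)" by simp_all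
      then have "Re a = 0" "Im a = 0" using on by (simp_all add: dot_square_norm)
      then have "X t = 0" by (simp add: ab e)
      then show False using on(1) by simp
    qed
    ultimately show ?thesis by (auto simp: A_def B_def)
  qed
  \<comment> \<open>Normalised so that the determinant of the coordinate frame at
    \<open>zt t\<close> is \<open>\<kappa> * zt t * P\<close> with \<open>Re P > 0\<close>; the
    denominator is the value of \<open>zt t * cnj (zt t)\<close>.\<close>
  define \<kappa> where "\<kappa> = - \<i> * s * jdet 0 / of_real (\<rho>\<^sup>2)"
  have J0: "jdet 0 \<noteq> 0" by (rule jdet_nonzero[OF z0])
  have \<kappa>: "\<kappa> \<noteq> 0" using J0 \<rho> s by (auto simp: \<kappa>_def)
  define q where "q t = det2 (X t) (Y t) / (\<kappa> * zt t)" for t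
  have q0: "Re (q t) \<noteq> 0" if t: "t \<in> {0..1}" for t
  proof -
    obtain c where c: "c \<noteq> 0" "det2 (X t) (Y t) = of_real c * det2 (dpt (zt t) 1) (dpt (zt t) \<i>)" using real_det[OF t] by blast
    define P where "P = s * (cnj (zt t) * (fx (zt t) + \<i> * fy (zt t)) * (jdet (zt t) / jdet 0))"
    have P: "Re P > 0" unfolding P_def by (rule pos[OF ztV(3,4)])
    have zz: "zt t * cnj (zt t) = of_real (\<rho>\<^sup>2)" using complex_norm_square[of "zt t"] nzt[of t] by simp
    have ss: "s * s = 1" using s by auto
    have "\<kappa> * zt t * P = - \<i> * (s * s) * (zt t * cnj (zt t)) / of_real (\<rho>\<^sup>2) * (fx (zt t) + \<i> * fy (zt t)) * jdet (zt t)"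
      using J0 by (simp add: \<kappa>_def P_def)
    also have "\<dots> = jdet (zt t) * (fy (zt t) - \<i> * fx (zt t))"
      unfolding zz ss using \<rho> by (simp add: algebra_simps)
    finally have "det2 (X t) (Y t) = of_real c * (\<kappa> * zt t * P)" using c(2) by (simp add: det2_dpt)
    then have "q t = of_real c * P" using \<kappa> ztV(4)[of t] by (simp add: q_def)
    then show ?thesis using c(1) P by simp
  qed
  have qc: "continuous_on {0..1} q"
  proof -
    have "continuous_on {0..1} (\<lambda>t. det2 (X t) (Y t))" using XY(1,2) unfolding path_def det2_def by (intro continuous_intros)
    moreover have "continuous_on {0..1} zt" using zt_cont continuous_on_subset by blast
    ultimately show ?thesis unfolding q_def using \<kappa> ztV(4) by (intro continuous_intros) auto
  qed
  \<comment> \<open>\<open>Re (q t)\<close> is continuous without zeros, hence of constant sign;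
    this takes the place of orienting the frame \<open>(X, Y)\<close>.\<close>
  have sgn: "0 < Re (q t) * Re (q 0)" if t: "t \<in> {0..1}" for t
  proof (rule ccontr)
    assume "\<not> ?thesis"
    then have le: "Re (q t) * Re (q 0) \<le> 0" by simp
    have c: "continuous_on {0..t} (\<lambda>u. Re (q u) * Re (q 0))"
      using t by (intro continuous_intros continuous_on_subset[OF qc]) auto
    have "\<exists>u. 0 \<le> u \<and> u \<le> t \<and> Re (q u) * Re (q 0) = 0"
      using IVT2'[of "\<lambda>u. Re (q u) * Re (q 0)" t 0 0] le c t q0[of 0] by auto
    then obtain u where "0 \<le> u" "u \<le> t" "Re (q u) * Re (q 0) = 0" by blast
    then show False using q0[of u] q0[of 0] t by auto
  qed
  have det_eq: "det2 (X t) (Y t) = \<kappa> * zt t * q t" for t using \<kappa> ztV(4)[of t] by (simp add: q_def)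
  \<comment> \<open>All values \<open>q t\<close> lie in one half plane with \<open>q 0\<close>, so
    the linear homotopy that freezes \<open>q\<close> avoids \<open>0\<close> and ends in a multiple
    of the circle.\<close>
  have "homotopic_loops (- {0}) (\<lambda>t. \<kappa> * zt t * q t) (\<lambda>t. \<kappa> * zt t * q 0)"
  proof (rule homotopic_loops_linear)
    have "continuous_on {0..1} zt" using zt_cont continuous_on_subset by blast
    then show "path (\<lambda>t. \<kappa> * zt t * q t)" "path (\<lambda>t. \<kappa> * zt t * q 0)"
      unfolding path_def by (auto intro!: continuous_intros qc)
    have z1: "zt 1 = zt 0" by (simp add: zt_def circlepath)
    then have "q 1 = q 0" using XY(3,4) by (simp add: q_def)
    then show "pathfinish (\<lambda>t. \<kappa> * zt t * q t) = pathstart (\<lambda>t. \<kappa> * zt t * q t)"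
      "pathfinish (\<lambda>t. \<kappa> * zt t * q 0) = pathstart (\<lambda>t. \<kappa> * zt t * q 0)"
      using z1 by (simp_all add: pathfinish_def pathstart_def)
    fix t :: real assume t: "t \<in> {0..1}"
    show "closed_segment (\<kappa> * zt t * q t) (\<kappa> * zt t * q 0) \<subseteq> - {0}"
    proof
      fix w assume "w \<in> closed_segment (\<kappa> * zt t * q t) (\<kappa> * zt t * q 0)"
      then obtain u where u: "0 \<le> u" "u \<le> 1" "w = (1 - u) *\<^sub>R (\<kappa> * zt t * q t) + u *\<^sub>R (\<kappa> * zt t * q 0)"
        by (auto simp: in_segment)
      then have w: "w = \<kappa> * zt t * ((1 - u) *\<^sub>R q t + u *\<^sub>R q 0)" by (simp add: scaleR_conv_of_real algebra_simps)
      have "Re ((1 - u) *\<^sub>R q t + u *\<^sub>R q 0) * Re (q 0) = (1 - u) * (Re (q t) * Re (q 0)) + u * (Re (q 0) * Re (q 0))"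
        by (simp add: algebra_simps)
      also have "\<dots> > 0"
      proof (cases "u = 0")
        case False
        then show ?thesis using u sgn[OF t] sgn[of 0, simplified]
          by (intro add_nonneg_pos[OF mult_nonneg_nonneg mult_pos_pos]) linarith+
      qed (use sgn[OF t] in simp)
      finally have "(1 - u) *\<^sub>R q t + u *\<^sub>R q 0 \<noteq> 0" by (metis less_irrefl mult_zero_left zero_complex.simps(1))
      then show "w \<in> - {0}" unfolding w using \<kappa> ztV(4)[of t] by simp
    qed
  qed
  from winding_number_homotopic_loops[OF this]
  have "of_int n = winding_number (\<lambda>t. \<kappa> * q 0 * circlepath 0 \<rho> t) 0"
    using wn by (simp add: det_eq zt_def mult_ac)
  also have "\<dots> = 1" using \<kappa> q0[of 0] \<rho> by (intro winding_number_cmult_circlepath) auto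
  finally show "n = 1" by (metis of_int_eq_1_iff)
qed

end

section \<open>Energy estimates for boundary values\<close>

lemma complex_Basis: "(Basis :: complex set) = {1, \<i>}"
  by (simp add: Basis_complex_def)

lemma measurable_Complex: "(\<lambda>p. Complex (fst p) (snd p)) \<in> measurable (lborel :: (real \<times> real) measure) borel"
proof -
  have "continuous_on UNIV (\<lambda>p. Complex (fst p) (snd p))"
    unfolding Complex_eq by (intro continuous_intros)
  then show ?thesis using borel_measurable_continuous_onI by simp
qed

text \<open>Carries Fubini's theorem from pairs of reals to \<open>complex\<close>.\<close>

lemma lborel_complex: "(lborel :: complex measure) = distr (lborel :: (real \<times> real) measure) borel (\<lambda>p. Complex (fst p) (snd p))"
proof (rule lborel_eqI)
  note m = measurable_Complex
  fix l u :: complex assume le: "\<And>b. b \<in> Basis \<Longrightarrow> l \<bullet> b \<le> u \<bullet> b"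
  have "(\<lambda>p. Complex (fst p) (snd p)) -` box l u = box (Re l, Im l) (Re u, Im u)"
    by (auto simp: box_def complex_Basis inner_complex_def Basis_prod_def)
  then have "emeasure (distr (lborel :: (real \<times> real) measure) borel (\<lambda>p. Complex (fst p) (snd p))) (box l u)
      = emeasure (lborel :: (real \<times> real) measure) (box (Re l, Im l) (Re u, Im u))"
    by (simp add: emeasure_distr[OF m])
  also have "\<dots> = ennreal ((Re u - Re l) * (Im u - Im l))"
    using le[of 1] le[of \<i>] by (subst emeasure_lborel_box) (auto simp: Basis_prod_def complex_Basis inner_complex_def prod.union_disjoint)
  also have "\<dots> = (\<Prod>b\<in>Basis. (u - l) \<bullet> b)"
    by (simp add: complex_Basis inner_complex_def)
  finally show "emeasure (distr (lborel :: (real \<times> real) measure) borel (\<lambda>p. Complex (fst p) (snd p))) (box l u) = (\<Prod>b\<in>Basis. (u - l) \<bullet> b)" .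
qed simp

lemma integral_complex_plane:
  fixes \<phi> :: "complex \<Rightarrow> real"
  assumes "integrable lborel \<phi>"
  shows "integral\<^sup>L lborel \<phi> = (\<integral>y. (\<integral>x. \<phi> (Complex x y) \<partial>lborel) \<partial>lborel)"
    and "integral\<^sup>L lborel \<phi> = (\<integral>x. (\<integral>y. \<phi> (Complex x y) \<partial>lborel) \<partial>lborel)"
proof -
  note m = measurable_Complex
  have \<phi>: "\<phi> \<in> borel_measurable borel" using assms by (auto simp: borel_measurable_integrable)
  have int: "integrable (lborel :: (real \<times> real) measure) (\<lambda>p. \<phi> (Complex (fst p) (snd p)))"
    using assms \<phi> by (subst (asm) lborel_complex) (simp add: integrable_distr_eq[OF m])
  then have int': "integrable (lborel \<Otimes>\<^sub>M lborel) (\<lambda>p. \<phi> (Complex (fst p) (snd p)))"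
    by (simp add: lborel_prod)
  have eq: "integral\<^sup>L lborel \<phi> = integral\<^sup>L (lborel \<Otimes>\<^sub>M lborel) (\<lambda>p. \<phi> (Complex (fst p) (snd p)))"
    using \<phi> by (subst lborel_complex) (simp add: integral_distr[OF m] lborel_prod)
  show "integral\<^sup>L lborel \<phi> = (\<integral>x. (\<integral>y. \<phi> (Complex x y) \<partial>lborel) \<partial>lborel)"
    using lborel_pair.integral_fst'[OF int'] eq by simp
  show "integral\<^sup>L lborel \<phi> = (\<integral>y. (\<integral>x. \<phi> (Complex x y) \<partial>lborel) \<partial>lborel)"
    using lborel_pair.integral_snd[of "\<lambda>x y. \<phi> (Complex x y)"] int' eq by (simp add: case_prod_beta')
qed

lemma integral_derivative_compact_support:
  fixes g g' :: "real \<Rightarrow> real"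
  assumes "\<And>x. (g has_real_derivative g' x) (at x)" "continuous_on UNIV g'"
    and "\<And>x. \<bar>x\<bar> \<ge> M \<Longrightarrow> g x = 0" "\<And>x. \<bar>x\<bar> \<ge> M \<Longrightarrow> g' x = 0" "M \<ge> 0"
  shows "integral\<^sup>L lborel g' = 0"
proof -
  have "has_bochner_integral lborel (\<lambda>x. g' x * indicator {-M .. M} x) (g M - g (-M))"
    using assms by (intro has_bochner_integral_FTC_Icc_real) (auto simp: continuous_on_eq_continuous_at)
  moreover have "(\<lambda>x. g' x * indicator {-M .. M} x) = g'"
  proof
    fix x show "g' x * indicator {-M .. M} x = g' x"
      using assms(4)[of x] by (cases "\<bar>x\<bar> \<le> M") (auto simp: indicator_def abs_le_iff)
  qed
  ultimately show ?thesis using assms(3,5) by (simp add: has_bochner_integral_integral_eq)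
qed

lemma integrable_continuous_compact_support:
  fixes \<phi> :: "complex \<Rightarrow> real"
  assumes "continuous_on UNIV \<phi>" "\<And>z. norm z \<ge> M \<Longrightarrow> \<phi> z = 0"
  shows "integrable lborel \<phi>"
proof -
  have "integrable lborel (\<lambda>z. indicator (cball 0 M) z *\<^sub>R \<phi> z)"
    using assms(1) by (intro borel_integrable_compact) (auto intro: continuous_on_subset)
  moreover have "(\<lambda>z. indicator (cball 0 M) z *\<^sub>R \<phi> z) = \<phi>"
    using assms(2) by (auto simp: fun_eq_iff indicator_def)
  ultimately show ?thesis by simp
qed

text \<open>Extension by zero is \<open>C^1\<close> on the whole plane, since the open sets
  \<open>\<Omega>\<close> and \<open>- K\<close> cover it; each integral then vanishes line by line.
  The boundary of \<open>\<Omega>\<close> does not enter, as \<open>K\<close> stays away from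
  it.\<close>

lemma integral_partial_derivative:
  fixes P Px Py :: "complex \<Rightarrow> real"
  assumes \<Omega>: "open \<Omega>" and K: "compact K" "K \<subseteq> \<Omega>"
    and der: "\<And>z. z \<in> \<Omega> \<Longrightarrow> (P has_derivative (\<lambda>h. Re h * Px z + Im h * Py z)) (at z)"
    and cont: "continuous_on \<Omega> Px" "continuous_on \<Omega> Py"
    and supp: "\<And>z. z \<in> \<Omega> - K \<Longrightarrow> P z = 0"
  shows "integrable lborel (\<lambda>z. indicator \<Omega> z * Px z)" "(\<integral>z. indicator \<Omega> z * Px z \<partial>lborel) = 0"
    and "integrable lborel (\<lambda>z. indicator \<Omega> z * Py z)" "(\<integral>z. indicator \<Omega> z * Py z \<partial>lborel) = 0"
proof -
  define P0 where "P0 = (\<lambda>z. if z \<in> \<Omega> then P z else 0)"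
  have oK: "open (- K)" using K(1) compact_imp_closed by blast
  have z0: "Px z = 0 \<and> Py z = 0" if "z \<in> \<Omega> - K" for z
  proof -
    have "open (\<Omega> - K)" using \<Omega> oK by (simp add: Diff_eq open_Int)
    have "((\<lambda>_. 0) has_derivative (\<lambda>h. Re h * Px z + Im h * Py z)) (at z)"
      by (rule has_derivative_transform_within_open[OF der \<open>open (\<Omega> - K)\<close> that]) (use that supp in auto)
    from has_derivative_unique[OF this has_derivative_const]
    have "Re h * Px z + Im h * Py z = 0" for h by metis
    from this[of 1] this[of \<i>] show ?thesis by simp
  qed
  have der0: "(P0 has_derivative (\<lambda>h. Re h * (indicator \<Omega> z * Px z) + Im h * (indicator \<Omega> z * Py z))) (at z)" for z
  proof (cases "z \<in> \<Omega>")
    case True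
    have "(P0 has_derivative (\<lambda>h. Re h * Px z + Im h * Py z)) (at z)"
      by (rule has_derivative_transform_within_open[OF der[OF True] \<Omega> True]) (simp add: P0_def)
    then show ?thesis using True by simp
  next
    case False
    then have zK: "z \<in> - K" using K(2) by auto
    have "(P0 has_derivative (\<lambda>h. 0)) (at z)"
      by (rule has_derivative_transform_within_open[OF has_derivative_const oK zK]) (use supp in \<open>auto simp: P0_def\<close>)
    then show ?thesis using False by simp
  qed
  have cont0: "continuous_on UNIV (\<lambda>z. indicator \<Omega> z * G z)" if "continuous_on \<Omega> G" "\<And>z. z \<in> \<Omega> - K \<Longrightarrow> G z = 0" for G :: "complex \<Rightarrow> real"
  proof -
    have 1: "continuous_on \<Omega> (\<lambda>z. indicator \<Omega> z * G z)"
      using that(1) by (rule continuous_on_eq) simp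
    have 2: "continuous_on (- K) (\<lambda>z. indicator \<Omega> z * G z)"
      by (rule continuous_on_eq[of _ "\<lambda>_. 0"]) (use that(2) in \<open>auto simp: indicator_def\<close>)
    have "\<Omega> \<union> - K = UNIV" using K(2) by auto
    then show ?thesis using continuous_on_open_Un[OF \<Omega> oK 1 2] by simp
  qed
  have cx: "continuous_on UNIV (\<lambda>z. indicator \<Omega> z * Px z)" and cy: "continuous_on UNIV (\<lambda>z. indicator \<Omega> z * Py z)"
    using cont0 cont z0 by blast+
  obtain M where M: "M > 0" "\<And>z. z \<in> K \<Longrightarrow> norm z < M"
    using compact_imp_bounded[OF K(1)] bounded_pos_less by metis
  have far: "P0 z = 0" "indicator \<Omega> z * Px z = 0" "indicator \<Omega> z * Py z = 0" if "norm z \<ge> M" for z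
    using M(2)[of z] that supp[of z] z0[of z] by (auto simp: P0_def indicator_def)
  show ix: "integrable lborel (\<lambda>z. indicator \<Omega> z * Px z)"
    using integrable_continuous_compact_support[OF cx] far by blast
  show iy: "integrable lborel (\<lambda>z. indicator \<Omega> z * Py z)"
    using integrable_continuous_compact_support[OF cy] far by blast
  have "integral\<^sup>L lborel (\<lambda>x. indicator \<Omega> (Complex x y) * Px (Complex x y)) = 0" for y
  proof (rule integral_derivative_compact_support[where g = "\<lambda>x. P0 (Complex x y)" and M = M])
    show "((\<lambda>x. P0 (Complex x y)) has_real_derivative indicator \<Omega> (Complex x y) * Px (Complex x y)) (at x)" for x
    proof -
      have "((\<lambda>x. Complex x y) has_derivative (\<lambda>h. of_real h)) (at x)"
        unfolding Complex_eq by (auto intro!: derivative_eq_intros)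
      from has_derivative_compose[OF this der0] show ?thesis
        unfolding has_field_derivative_def by (rule has_derivative_eq_rhs) (auto simp: fun_eq_iff mult.commute)
    qed
    show "continuous_on UNIV (\<lambda>x. indicator \<Omega> (Complex x y) * Px (Complex x y))"
      using continuous_on_compose2[OF cx, of UNIV "\<lambda>x. Complex x y"] by (simp add: Complex_eq continuous_intros)
    show "P0 (Complex x y) = 0" "indicator \<Omega> (Complex x y) * Px (Complex x y) = 0" if "\<bar>x\<bar> \<ge> M" for x
      using far[of "Complex x y"] abs_Re_le_cmod[of "Complex x y"] that by auto
  qed (use M(1) in auto)
  then show "(\<integral>z. indicator \<Omega> z * Px z \<partial>lborel) = 0" using integral_complex_plane(1)[OF ix] by simp
  have "integral\<^sup>L lborel (\<lambda>y. indicator \<Omega> (Complex x y) * Py (Complex x y)) = 0" for x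
  proof (rule integral_derivative_compact_support[where g = "\<lambda>y. P0 (Complex x y)" and M = M])
    show "((\<lambda>y. P0 (Complex x y)) has_real_derivative indicator \<Omega> (Complex x y) * Py (Complex x y)) (at y)" for y
    proof -
      have "((\<lambda>y. Complex x y) has_derivative (\<lambda>h. \<i> * of_real h)) (at y)"
        unfolding Complex_eq by (auto intro!: derivative_eq_intros)
      from has_derivative_compose[OF this der0] show ?thesis
        unfolding has_field_derivative_def by (rule has_derivative_eq_rhs) (auto simp: fun_eq_iff mult.commute)
    qed
    show "continuous_on UNIV (\<lambda>y. indicator \<Omega> (Complex x y) * Py (Complex x y))"
      using continuous_on_compose2[OF cy, of UNIV "\<lambda>y. Complex x y"] by (simp add: Complex_eq continuous_intros)
    show "P0 (Complex x y) = 0" "indicator \<Omega> (Complex x y) * Py (Complex x y) = 0" if "\<bar>y\<bar> \<ge> M" for y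
      using far[of "Complex x y"] abs_Im_le_cmod[of "Complex x y"] that by auto
  qed (use M(1) in auto)
  then show "(\<integral>z. indicator \<Omega> z * Py z \<partial>lborel) = 0" using integral_complex_plane(2)[OF iy] by simp
qed

lemma extend_by_zero:
  fixes G :: "complex \<Rightarrow> real"
  assumes \<Omega>: "open \<Omega>" and K: "compact K" "K \<subseteq> \<Omega>" and G: "continuous_on \<Omega> G" "\<And>z. z \<in> \<Omega> - K \<Longrightarrow> G z = 0"
  shows "continuous_on UNIV (\<lambda>z. indicator \<Omega> z * G z)" "integrable lborel (\<lambda>z. indicator \<Omega> z * G z)"
proof -
  have oK: "open (- K)" using K(1) compact_imp_closed by blast
  have 1: "continuous_on \<Omega> (\<lambda>z. indicator \<Omega> z * G z)"
    using G(1) by (rule continuous_on_eq) simp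
  have 2: "continuous_on (- K) (\<lambda>z. indicator \<Omega> z * G z)"
    by (rule continuous_on_eq[of _ "\<lambda>_. 0"]) (use G(2) in \<open>auto simp: indicator_def\<close>)
  have "\<Omega> \<union> - K = UNIV" using K(2) by auto
  then show c: "continuous_on UNIV (\<lambda>z. indicator \<Omega> z * G z)" using continuous_on_open_Un[OF \<Omega> oK 1 2] by simp
  obtain M where M: "M > 0" "\<And>z. z \<in> K \<Longrightarrow> norm z < M"
    using compact_imp_bounded[OF K(1)] bounded_pos_less by metis
  have "indicator \<Omega> z * G z = 0" if "norm z \<ge> M" for z
    using M(2)[of z] that G(2)[of z] by (auto simp: indicator_def)
  then show "integrable lborel (\<lambda>z. indicator \<Omega> z * G z)"
    by (rule integrable_continuous_compact_support[OF c])
qed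

section \<open>Null sets and level sets of functions of class C^1\<close>

lemma AE_lborel_sections:
  fixes A :: "complex set"
  assumes A: "A \<in> sets borel" and c: "(\<forall>y. countable {x. Complex x y \<in> A}) \<or> (\<forall>x. countable {y. Complex x y \<in> A})"
  shows "AE z in lborel. z \<notin> A"
proof -
  define B where "B = (\<lambda>p. Complex (fst p) (snd p)) -` A"
  have B: "B \<in> sets (borel :: (real \<times> real) measure)"
    using measurable_sets[OF measurable_Complex A] by (simp add: B_def)
  then have B': "B \<in> sets (lborel \<Otimes>\<^sub>M lborel :: (real \<times> real) measure)" by (simp only: lborel_prod sets_lborel)
  have "emeasure (lborel \<Otimes>\<^sub>M lborel) B = 0"
  proof (rule disjE[OF c])
    assume "\<forall>y. countable {x. Complex x y \<in> A}"
    then have "emeasure lborel ((\<lambda>x. (x, y)) -` B) = 0" for y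
      using emeasure_lborel_countable[of "{x. Complex x y \<in> A}"] by (simp add: B_def vimage_def)
    then show ?thesis using lborel_pair.emeasure_pair_measure_alt2[OF B'] by simp
  next
    assume "\<forall>x. countable {y. Complex x y \<in> A}"
    then have "emeasure lborel (Pair x -` B) = 0" for x
      using emeasure_lborel_countable[of "{y. Complex x y \<in> A}"] by (simp add: B_def vimage_def)
    then show ?thesis using lborel.emeasure_pair_measure_alt[OF B'] by simp
  qed
  then have "emeasure (lborel :: complex measure) A = 0"
    using A by (subst lborel_complex) (simp add: emeasure_distr[OF measurable_Complex] B_def lborel_prod)
  then show ?thesis using A by (intro AE_not_in) (auto simp: null_sets_def)
qed

text \<open>Where the derivative is nonzero, zeros are isolated.\<close>

lemma countable_simple_zeros:
  fixes g g' :: "real \<Rightarrow> real"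
  assumes "open O'" "\<And>x. x \<in> O' \<Longrightarrow> (g has_real_derivative g' x) (at x)" "\<And>x. x \<in> O' \<Longrightarrow> g' x \<noteq> 0"
  shows "countable {x \<in> O'. g x = 0}"
proof -
  have nl: "\<not> x islimpt {x \<in> O'. g x = 0}" if x: "x \<in> O'" for x
  proof -
    have "eventually (\<lambda>y. g y \<noteq> 0) (at x)"
    proof (cases "g x = 0")
      case True
      have "((\<lambda>y. (g y - g x) / (y - x)) \<longlongrightarrow> g' x) (at x)"
        using assms(2)[OF x] by (simp add: has_field_derivative_iff)
      then have "eventually (\<lambda>y. (g y - g x) / (y - x) \<noteq> 0) (at x)"
        using assms(3)[OF x] by (rule tendsto_imp_eventually_ne)
      then show ?thesis by eventually_elim (use True in auto)
    next
      case False
      have "(g \<longlongrightarrow> g x) (at x)" using DERIV_isCont[OF assms(2)[OF x]] by (simp add: isCont_def)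
      then show ?thesis using False by (rule tendsto_imp_eventually_ne)
    qed
    then show ?thesis unfolding islimpt_iff_eventually by (auto elim: eventually_mono)
  qed
  have "{x \<in> O'. g x = 0} sparse_in O'"
    unfolding sparse_in_def using nl assms(1) by blast
  from sparse_imp_countable[OF assms(1) this] show ?thesis by (simp add: Int_def conj_commute)
qed

text \<open>On a horizontal line the zeros of \<open>w\<close> with \<open>wx \<noteq> 0\<close> are
  isolated, hence countable, and likewise on vertical lines with \<open>wy\<close>; Fubini makes
  both exceptional sets null. Truncations see only the set where \<open>w \<noteq> 0\<close>, and
  this lemma accounts for the rest.\<close>

lemma AE_gradient_zero_on_level_set:
  fixes w wx wy :: "complex \<Rightarrow> real"
  assumes \<Omega>: "open \<Omega>"
    and der: "\<And>z. z \<in> \<Omega> \<Longrightarrow> (w has_derivative (\<lambda>h. Re h * wx z + Im h * wy z)) (at z)"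
    and cont: "continuous_on \<Omega> wx" "continuous_on \<Omega> wy"
  shows "AE z in lborel. z \<in> \<Omega> \<longrightarrow> w z = 0 \<longrightarrow> wx z = 0 \<and> wy z = 0"
proof -
  have cw: "continuous_on \<Omega> w"
    by (intro continuous_at_imp_continuous_on ballI has_derivative_continuous[OF der])
  have O1: "open {z \<in> \<Omega>. G z \<noteq> 0}" if "continuous_on \<Omega> G" for G :: "complex \<Rightarrow> real"
    using continuous_open_preimage[OF that \<Omega> open_Compl[OF closed_singleton], of 0] by (simp add: Int_def vimage_def)
  have meas: "{z \<in> \<Omega>. G z \<noteq> 0 \<and> w z = 0} \<in> sets borel" if "continuous_on \<Omega> G" for G :: "complex \<Rightarrow> real"
  proof -
    have "{z \<in> \<Omega>. G z \<noteq> 0 \<and> w z = 0} = {z \<in> \<Omega>. G z \<noteq> 0} - {z \<in> \<Omega>. w z \<noteq> 0}" by auto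
    then show ?thesis using O1[OF that] O1[OF cw] by simp
  qed
  have "AE z in lborel. z \<notin> {z \<in> \<Omega>. wx z \<noteq> 0 \<and> w z = 0}"
  proof (rule AE_lborel_sections[OF meas[OF cont(1)]], intro disjI1 allI)
    fix y
    have d: "((\<lambda>x. Complex x y) has_derivative (\<lambda>h. of_real h)) (at x)" for x
      unfolding Complex_eq by (auto intro!: derivative_eq_intros)
    have "open {x. Complex x y \<in> {z \<in> \<Omega>. wx z \<noteq> 0}}"
      using open_vimage[OF O1[OF cont(1)], of "\<lambda>x. Complex x y"] unfolding Complex_eq by (simp add: vimage_def continuous_intros)
    then have "countable {x \<in> {x. Complex x y \<in> {z \<in> \<Omega>. wx z \<noteq> 0}}. w (Complex x y) = 0}"
    proof (rule countable_simple_zeros[where g' = "\<lambda>x. wx (Complex x y)"])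
      fix x assume "x \<in> {x. Complex x y \<in> {z \<in> \<Omega>. wx z \<noteq> 0}}"
      then have "Complex x y \<in> \<Omega>" by simp
      from has_derivative_compose[OF d der[OF this]]
      show "((\<lambda>x. w (Complex x y)) has_real_derivative wx (Complex x y)) (at x)"
        unfolding has_field_derivative_def by (rule has_derivative_eq_rhs) (auto simp: fun_eq_iff mult.commute)
    qed simp
    then show "countable {x. Complex x y \<in> {z \<in> \<Omega>. wx z \<noteq> 0 \<and> w z = 0}}" by (simp add: conj_ac)
  qed
  moreover have "AE z in lborel. z \<notin> {z \<in> \<Omega>. wy z \<noteq> 0 \<and> w z = 0}"
  proof (rule AE_lborel_sections[OF meas[OF cont(2)]], intro disjI2 allI)
    fix x
    have d: "((\<lambda>y. Complex x y) has_derivative (\<lambda>h. \<i> * of_real h)) (at y)" for y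
      unfolding Complex_eq by (auto intro!: derivative_eq_intros)
    have "open {y. Complex x y \<in> {z \<in> \<Omega>. wy z \<noteq> 0}}"
      using open_vimage[OF O1[OF cont(2)], of "\<lambda>y. Complex x y"] unfolding Complex_eq by (simp add: vimage_def continuous_intros)
    then have "countable {y \<in> {y. Complex x y \<in> {z \<in> \<Omega>. wy z \<noteq> 0}}. w (Complex x y) = 0}"
    proof (rule countable_simple_zeros[where g' = "\<lambda>y. wy (Complex x y)"])
      fix y assume "y \<in> {y. Complex x y \<in> {z \<in> \<Omega>. wy z \<noteq> 0}}"
      then have "Complex x y \<in> \<Omega>" by simp
      from has_derivative_compose[OF d der[OF this]]
      show "((\<lambda>y. w (Complex x y)) has_real_derivative wy (Complex x y)) (at y)"
        unfolding has_field_derivative_def by (rule has_derivative_eq_rhs) (auto simp: fun_eq_iff mult.commute)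
    qed simp
    then show "countable {y. Complex x y \<in> {z \<in> \<Omega>. wy z \<noteq> 0 \<and> w z = 0}}" by (simp add: conj_ac)
  qed
  ultimately show ?thesis by eventually_elim auto
qed

text \<open>Zero for \<open>\<bar>s\<bar> \<le> \<epsilon>\<close>, between 0 and 1, and tending to
  1 off \<open>0\<close> as \<open>\<epsilon> \<rightarrow> 0\<close>. Being continuous it has a
  \<open>C^1\<close> antiderivative, which is the actual truncation.\<close>

definition cutoff :: "real \<Rightarrow> real \<Rightarrow> real" where "cutoff \<epsilon> s = 1 - (\<epsilon> / max \<bar>s\<bar> \<epsilon>)\<^sup>2"

lemma cutoff_bounds: assumes "\<epsilon> > 0" shows "0 \<le> cutoff \<epsilon> s" "cutoff \<epsilon> s \<le> 1"
proof -
  have "0 \<le> \<epsilon> / max \<bar>s\<bar> \<epsilon>" "\<epsilon> / max \<bar>s\<bar> \<epsilon> \<le> 1" using assms by (auto simp: divide_le_eq)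
  then show "0 \<le> cutoff \<epsilon> s" "cutoff \<epsilon> s \<le> 1" by (auto simp: cutoff_def power_le_one)
qed

lemma continuous_cutoff: "\<epsilon> > 0 \<Longrightarrow> continuous_on UNIV (cutoff \<epsilon>)"
  unfolding cutoff_def by (intro continuous_intros) auto

text \<open>The constant of integration is fixed by making \<open>T\<close> vanish on
  \<open>[-\<epsilon>, \<epsilon>]\<close>, so that \<open>T\<close> of a function with zero
  boundary values has compact support.\<close>

lemma cutoff_antiderivative:
  assumes "\<epsilon> > 0"
  obtains T where "\<And>s. (T has_real_derivative cutoff \<epsilon> s) (at s)" "\<And>s. \<bar>s\<bar> \<le> \<epsilon> \<Longrightarrow> T s = 0"
proof -
  obtain F where F: "\<And>s. (F has_real_derivative cutoff \<epsilon> s) (at s)"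
    using einterval_antiderivative[of "-\<infinity>" \<infinity> "cutoff \<epsilon>"] continuous_cutoff[OF assms]
    by (auto simp: continuous_on_eq_continuous_at has_real_derivative_iff_has_vector_derivative)
  have "\<exists>c. \<forall>s\<in>{-\<epsilon>..\<epsilon>}. F s = c"
  proof (rule has_field_derivative_zero_constant)
    show "(F has_real_derivative 0) (at s within {-\<epsilon>..\<epsilon>})" if "s \<in> {-\<epsilon>..\<epsilon>}" for s
    proof -
      have "cutoff \<epsilon> s = 0" using that assms by (simp add: cutoff_def max_def abs_le_iff)
      then show ?thesis using F[of s] has_field_derivative_at_within by metis
    qed
  qed simp
  then obtain c where c: "\<And>s. \<bar>s\<bar> \<le> \<epsilon> \<Longrightarrow> F s = c" by (auto simp: abs_le_iff)
  show ?thesis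
  proof (rule that[of "\<lambda>s. F s - c"])
    show "((\<lambda>s. F s - c) has_real_derivative cutoff \<epsilon> s) (at s)" for s
      using DERIV_diff[OF F[of s] DERIV_const[of c]] by simp
  qed (use c in simp)
qed

lemma cutoff_tendsto:
  assumes "s \<noteq> 0" shows "(\<lambda>n. cutoff (1 / real (Suc n)) s) \<longlonglongrightarrow> 1"
proof -
  have l: "(\<lambda>n. 1 / real (Suc n)) \<longlonglongrightarrow> 0" using LIMSEQ_Suc[OF lim_const_over_n[of "1 :: real"]] by simp
  have "(\<lambda>n. cutoff (1 / real (Suc n)) s) \<longlonglongrightarrow> 1 - (0 / max \<bar>s\<bar> 0)\<^sup>2"
    unfolding cutoff_def using assms by (intro tendsto_intros l) auto
  then show ?thesis by simp
qed

text \<open>Dirichlet's principle. Nothing is known about the boundary of \<open>\<Omega>\<close>, so the test function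
  \<open>r - Im h\<close> is truncated near its zero set.\<close>

lemma dirichlet_estimate:
  fixes r rx ry :: "complex \<Rightarrow> real"
  assumes \<Omega>: "open \<Omega>" and h: "h holomorphic_on \<Omega>"
    and der: "\<And>z. z \<in> \<Omega> \<Longrightarrow> (r has_derivative (\<lambda>k. Re k * rx z + Im k * ry z)) (at z)"
    and cont: "continuous_on \<Omega> rx" "continuous_on \<Omega> ry"
    and bdry: "\<And>\<epsilon>. \<epsilon> > 0 \<Longrightarrow> compact {z \<in> \<Omega>. \<epsilon> \<le> \<bar>r z - Im (h z)\<bar>}"
    and N: "integrable lborel (\<lambda>z. indicator \<Omega> z * ((rx z)\<^sup>2 + (ry z)\<^sup>2))"
  shows "integrable lborel (\<lambda>z. indicator \<Omega> z * (norm (deriv h z))\<^sup>2)"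
    and "(\<integral>z. indicator \<Omega> z * (norm (deriv h z))\<^sup>2 \<partial>lborel) \<le> 2 * (\<integral>z. indicator \<Omega> z * ((rx z)\<^sup>2 + (ry z)\<^sup>2) \<partial>lborel)"
proof -
  define w where "w = (\<lambda>z. r z - Im (h z))"
  \<comment> \<open>For holomorphic \<open>h\<close> the partial derivatives of \<open>Im h\<close>
    are the imaginary and the real part of \<open>deriv h\<close>.\<close>
  define wx where "wx = (\<lambda>z. rx z - Im (deriv h z))"
  define wy where "wy = (\<lambda>z. ry z - Re (deriv h z))"
  define E where "E = (\<lambda>z. (norm (deriv h z))\<^sup>2)"
  define N' where "N' = (\<lambda>z. (rx z)\<^sup>2 + (ry z)\<^sup>2)"
  have h1: "deriv h holomorphic_on \<Omega>" using h \<Omega> by (rule holomorphic_deriv)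
  have hd: "(h has_derivative (\<lambda>k. deriv h z * k)) (at z)" "(deriv h has_derivative (\<lambda>k. deriv (deriv h) z * k)) (at z)"
    if "z \<in> \<Omega>" for z
    using holomorphic_derivI[OF h \<Omega> that] holomorphic_derivI[OF h1 \<Omega> that] by (simp_all add: has_field_derivative_def)
  have ch: "continuous_on \<Omega> (deriv h)" "continuous_on \<Omega> (deriv (deriv h))"
    using h1 holomorphic_deriv[OF h1 \<Omega>] by (simp_all add: holomorphic_on_imp_continuous_on)
  have wder: "(w has_derivative (\<lambda>k. Re k * wx z + Im k * wy z)) (at z)" if "z \<in> \<Omega>" for z
    unfolding w_def
    by (rule has_derivative_eq_rhs[OF has_derivative_diff[OF der[OF that] has_derivative_Im[OF hd(1)[OF that]]]])
      (auto simp: wx_def wy_def fun_eq_iff algebra_simps)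
  have cw: "continuous_on \<Omega> w" "continuous_on \<Omega> wx" "continuous_on \<Omega> wy"
    using continuous_at_imp_continuous_on[OF ballI[OF has_derivative_continuous[OF wder]]]
    unfolding wx_def wy_def by (auto intro!: continuous_intros cont ch)
  have aeZ: "AE z in lborel. z \<in> \<Omega> \<longrightarrow> w z = 0 \<longrightarrow> wx z = 0 \<and> wy z = 0"
    by (rule AE_gradient_zero_on_level_set[OF \<Omega> wder cw(2,3)])
  have cE: "continuous_on \<Omega> E" unfolding E_def by (intro continuous_intros ch)
  \<comment> \<open>Harmonicity of \<open>Im h\<close> is tested with \<open>T (w z)\<close>: the
    gradients of \<open>T \<circ> w\<close> and of \<open>Im h\<close> are orthogonal in
    mean.\<close>
  have step: "integrable lborel (\<lambda>z. indicator \<Omega> z * (cutoff \<epsilon> (w z) * E z)) \<and>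
      (\<integral>z. indicator \<Omega> z * (cutoff \<epsilon> (w z) * E z) \<partial>lborel) \<le> (\<integral>z. indicator \<Omega> z * N' z \<partial>lborel)" if \<epsilon>: "\<epsilon> > 0" for \<epsilon>
  proof -
    obtain T where T: "\<And>s. (T has_real_derivative cutoff \<epsilon> s) (at s)" "\<And>s. \<bar>s\<bar> \<le> \<epsilon> \<Longrightarrow> T s = 0"
      using cutoff_antiderivative[OF \<epsilon>] by blast
    define K where "K = {z \<in> \<Omega>. \<epsilon> \<le> \<bar>w z\<bar>}"
    have K: "compact K" "K \<subseteq> \<Omega>" using bdry[OF \<epsilon>] by (auto simp: K_def w_def)
    have supp: "T (w z) = 0" "cutoff \<epsilon> (w z) = 0" if "z \<in> \<Omega> - K" for z
      using that T(2)[of "w z"] \<epsilon> by (auto simp: K_def cutoff_def max_def)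
    have cT: "continuous_on \<Omega> (\<lambda>z. T (w z))" "continuous_on \<Omega> (\<lambda>z. cutoff \<epsilon> (w z))"
      using continuous_on_compose2[OF _ cw(1), of UNIV T] continuous_on_compose2[OF continuous_cutoff[OF \<epsilon>] cw(1)]
        DERIV_isCont[OF T(1)] by (auto simp: continuous_at_imp_continuous_on)
    have Td: "((\<lambda>z. T (w z)) has_derivative (\<lambda>k. Re k * (cutoff \<epsilon> (w z) * wx z) + Im k * (cutoff \<epsilon> (w z) * wy z))) (at z)"
      if "z \<in> \<Omega>" for z
      using has_derivative_compose[OF wder[OF that] T(1)[unfolded has_field_derivative_def]]
      by (rule has_derivative_eq_rhs) (auto simp: fun_eq_iff algebra_simps)
    \<comment> \<open>This and the next derivative make up the divergence of \<open>T (w z)\<close>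
      times the gradient of \<open>Im h\<close>. On adding, the second-derivative terms cancel, as
      \<open>Im h\<close> is harmonic.\<close>
    have 1: "((\<lambda>z. T (w z) * Im (deriv h z)) has_derivative (\<lambda>k.
        Re k * (cutoff \<epsilon> (w z) * wx z * Im (deriv h z) + T (w z) * Im (deriv (deriv h) z))
        + Im k * (cutoff \<epsilon> (w z) * wy z * Im (deriv h z) + T (w z) * Re (deriv (deriv h) z)))) (at z)" if "z \<in> \<Omega>" for z
      by (rule has_derivative_eq_rhs[OF has_derivative_mult[OF Td[OF that] has_derivative_Im[OF hd(2)[OF that]]]])
        (auto simp: fun_eq_iff algebra_simps)
    have 2: "((\<lambda>z. T (w z) * Re (deriv h z)) has_derivative (\<lambda>k.
        Re k * (cutoff \<epsilon> (w z) * wx z * Re (deriv h z) + T (w z) * Re (deriv (deriv h) z))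
        + Im k * (cutoff \<epsilon> (w z) * wy z * Re (deriv h z) - T (w z) * Im (deriv (deriv h) z)))) (at z)" if "z \<in> \<Omega>" for z
      by (rule has_derivative_eq_rhs[OF has_derivative_mult[OF Td[OF that] has_derivative_Re[OF hd(2)[OF that]]]])
        (auto simp: fun_eq_iff algebra_simps)
    note i1 = integral_partial_derivative(1,2)[OF \<Omega> K 1]
    note i2 = integral_partial_derivative(3,4)[OF \<Omega> K 2]
    have c: "continuous_on \<Omega> (\<lambda>z. Im (deriv h z))" "continuous_on \<Omega> (\<lambda>z. Re (deriv h z))"
      "continuous_on \<Omega> (\<lambda>z. Im (deriv (deriv h) z))" "continuous_on \<Omega> (\<lambda>z. Re (deriv (deriv h) z))"
      by (intro continuous_intros ch)+
    have j1: "integrable lborel (\<lambda>z. indicator \<Omega> z * (cutoff \<epsilon> (w z) * wx z * Im (deriv h z) + T (w z) * Im (deriv (deriv h) z)))"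
        "(\<integral>z. indicator \<Omega> z * (cutoff \<epsilon> (w z) * wx z * Im (deriv h z) + T (w z) * Im (deriv (deriv h) z)) \<partial>lborel) = 0"
      by (rule i1; (intro continuous_on_add continuous_on_diff continuous_on_mult cw cT c | simp add: supp))+
    have j2: "integrable lborel (\<lambda>z. indicator \<Omega> z * (cutoff \<epsilon> (w z) * wy z * Re (deriv h z) - T (w z) * Im (deriv (deriv h) z)))"
        "(\<integral>z. indicator \<Omega> z * (cutoff \<epsilon> (w z) * wy z * Re (deriv h z) - T (w z) * Im (deriv (deriv h) z)) \<partial>lborel) = 0"
      by (rule i2; (intro continuous_on_add continuous_on_diff continuous_on_mult cw cT c | simp add: supp))+
    have iE: "integrable lborel (\<lambda>z. indicator \<Omega> z * (cutoff \<epsilon> (w z) * E z))"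
      by (rule extend_by_zero(2)[OF \<Omega> K]) (auto intro!: continuous_on_mult cT cE simp: supp)
    have "(\<integral>z. indicator \<Omega> z * (cutoff \<epsilon> (w z) * (wx z * Im (deriv h z) + wy z * Re (deriv h z))) \<partial>lborel)
      = (\<integral>z. indicator \<Omega> z * (cutoff \<epsilon> (w z) * wx z * Im (deriv h z) + T (w z) * Im (deriv (deriv h) z))
          + indicator \<Omega> z * (cutoff \<epsilon> (w z) * wy z * Re (deriv h z) - T (w z) * Im (deriv (deriv h) z)) \<partial>lborel)"
      by (intro Bochner_Integration.integral_cong) (auto simp: algebra_simps)
    also have "\<dots> = 0" using j1 j2 by simp
    finally have z0: "(\<integral>z. indicator \<Omega> z * (cutoff \<epsilon> (w z) * (wx z * Im (deriv h z) + wy z * Re (deriv h z))) \<partial>lborel) = 0" .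
    have "0 \<le> (\<integral>z. indicator \<Omega> z * N' z / 2 - indicator \<Omega> z * (cutoff \<epsilon> (w z) * E z) / 2 \<partial>lborel)"
      unfolding z0[symmetric]
    proof (rule integral_mono_AE)
      show "integrable lborel (\<lambda>z. indicator \<Omega> z * (cutoff \<epsilon> (w z) * (wx z * Im (deriv h z) + wy z * Re (deriv h z))))"
        by (rule extend_by_zero(2)[OF \<Omega> K]) (auto intro!: continuous_on_mult continuous_on_add cT cw c simp: supp)
      show "integrable lborel (\<lambda>z. indicator \<Omega> z * N' z / 2 - indicator \<Omega> z * (cutoff \<epsilon> (w z) * E z) / 2)"
        using N iE by (auto simp: N'_def)
      have "cutoff \<epsilon> (w z) * (wx z * Im (deriv h z) + wy z * Re (deriv h z)) \<le> N' z / 2 - cutoff \<epsilon> (w z) * E z / 2" for z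
      proof -
        define a where "a = Im (deriv h z)" define b where "b = Re (deriv h z)"
        have E: "E z = a\<^sup>2 + b\<^sup>2" by (simp add: E_def a_def b_def cmod_power2 add.commute)
        \<comment> \<open>Nonnegativity of this square bounds the inner product of the gradients of
          \<open>w\<close> and \<open>Im h\<close> by half of \<open>N' z - E z\<close>.\<close>
        have eq: "(rx z - a)\<^sup>2 + (ry z - b)\<^sup>2 = (N' z + E z) - 2 * (rx z * a + ry z * b)"
          by (simp add: E N'_def power2_diff)
        have "0 \<le> (N' z + E z) - 2 * (rx z * a + ry z * b)" unfolding eq[symmetric] by simp
        moreover have "wx z * a + wy z * b = rx z * a + ry z * b - E z"
          by (simp add: E wx_def wy_def power2_eq_square algebra_simps flip: a_def b_def)
        ultimately have "wx z * a + wy z * b \<le> (N' z - E z) / 2" by (simp add: field_simps)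
        then have "cutoff \<epsilon> (w z) * (wx z * a + wy z * b) \<le> cutoff \<epsilon> (w z) * ((N' z - E z) / 2)"
          using cutoff_bounds[OF \<epsilon>] by (intro mult_left_mono) auto
        moreover have "cutoff \<epsilon> (w z) * N' z \<le> 1 * N' z"
          using cutoff_bounds[OF \<epsilon>] by (intro mult_right_mono) (auto simp: N'_def)
        ultimately show ?thesis by (simp add: a_def b_def field_simps)
      qed
      then show "AE z in lborel. indicator \<Omega> z * (cutoff \<epsilon> (w z) * (wx z * Im (deriv h z) + wy z * Re (deriv h z)))
          \<le> indicator \<Omega> z * N' z / 2 - indicator \<Omega> z * (cutoff \<epsilon> (w z) * E z) / 2"
        by (auto simp: indicator_def)
    qed
    then show ?thesis using N iE by (simp add: N'_def)
  qed
  define I where "I = (\<integral>z. indicator \<Omega> z * N' z \<partial>lborel)"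
  have I0: "I \<ge> 0" unfolding I_def by (intro integral_nonneg_AE) (auto simp: N'_def)
  have mE: "(\<lambda>z. indicator \<Omega> z * E z) \<in> borel_measurable lborel"
    using borel_measurable_continuous_on_indicator[OF borel_open[OF \<Omega>] cE] by simp
  define u where "u = (\<lambda>n z. ennreal (indicator \<Omega> z * (cutoff (1 / real (Suc n)) (w z) * E z)))"
  have u: "(\<integral>\<^sup>+z. u n z \<partial>lborel) \<le> ennreal I" for n
  proof -
    have "(\<integral>\<^sup>+z. u n z \<partial>lborel) = ennreal (\<integral>z. indicator \<Omega> z * (cutoff (1 / real (Suc n)) (w z) * E z) \<partial>lborel)"
      unfolding u_def using step[of "1 / real (Suc n)"] cutoff_bounds[of "1 / real (Suc n)"]
      by (intro nn_integral_eq_integral) (auto simp: E_def)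
    then show ?thesis using step[of "1 / real (Suc n)"] by (simp add: I_def ennreal_leI del: of_nat_Suc)
  qed
  have um: "u n \<in> borel_measurable lborel" for n
    unfolding u_def using step[of "1 / real (Suc n)"] by (auto dest!: conjunct1 borel_measurable_integrable)
  \<comment> \<open>Fatou's lemma bounds the energy on \<open>w \<noteq> 0\<close> by
    \<open>I\<close>. On \<open>w = 0\<close> the gradients of \<open>r\<close> and
    \<open>Im h\<close> agree almost everywhere, so this part costs at most another
    \<open>I\<close>; hence the factor 2.\<close>
  have "(\<integral>\<^sup>+z. ennreal (indicator \<Omega> z * E z) \<partial>lborel) \<le> (\<integral>\<^sup>+z. liminf (\<lambda>n. u n z) + ennreal (indicator \<Omega> z * N' z) \<partial>lborel)"
  proof (rule nn_integral_mono_AE, use aeZ in eventually_elim)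
    case (elim z)
    show ?case
    proof (cases "z \<in> \<Omega> \<and> w z \<noteq> 0")
      case True
      have "(\<lambda>n. indicator \<Omega> z * (cutoff (1 / real (Suc n)) (w z) * E z)) \<longlonglongrightarrow> indicator \<Omega> z * (1 * E z)"
        using True by (intro tendsto_intros cutoff_tendsto) auto
      then have "(\<lambda>n. u n z) \<longlonglongrightarrow> ennreal (indicator \<Omega> z * E z)" unfolding u_def by (intro tendsto_ennrealI) simp
      then show ?thesis by (simp add: lim_imp_Liminf)
    next
      case False
      have "indicator \<Omega> z * E z \<le> indicator \<Omega> z * N' z"
        using False elim by (auto simp: indicator_def E_def N'_def wx_def wy_def cmod_power2)
      then have "ennreal (indicator \<Omega> z * E z) \<le> ennreal (indicator \<Omega> z * N' z)" by (rule ennreal_leI)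
      then show ?thesis by (simp add: add_increasing)
    qed
  qed
  also have "\<dots> = (\<integral>\<^sup>+z. liminf (\<lambda>n. u n z) \<partial>lborel) + (\<integral>\<^sup>+z. ennreal (indicator \<Omega> z * N' z) \<partial>lborel)"
    using um N by (intro nn_integral_add) (auto simp: N'_def dest: borel_measurable_integrable)
  also have "(\<integral>\<^sup>+z. liminf (\<lambda>n. u n z) \<partial>lborel) \<le> ennreal I"
  proof -
    have "(\<integral>\<^sup>+z. liminf (\<lambda>n. u n z) \<partial>lborel) \<le> liminf (\<lambda>n. \<integral>\<^sup>+z. u n z \<partial>lborel)"
      by (rule nn_integral_liminf[OF um])
    also have "\<dots> \<le> liminf (\<lambda>n. ennreal I)" by (intro Liminf_mono always_eventually allI u)
    finally show ?thesis by (simp add: Liminf_const)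
  qed
  also have "(\<integral>\<^sup>+z. ennreal (indicator \<Omega> z * N' z) \<partial>lborel) = ennreal I"
    unfolding I_def using N by (intro nn_integral_eq_integral) (auto simp: N'_def)
  also have "ennreal I + ennreal I = ennreal (2 * I)" using I0 by (simp flip: ennreal_plus)
  finally have fin: "(\<integral>\<^sup>+z. ennreal (indicator \<Omega> z * E z) \<partial>lborel) \<le> ennreal (2 * I)" by (simp add: add_right_mono)
  have nonneg: "AE z in lborel. 0 \<le> indicator \<Omega> z * E z" by (auto simp: E_def)
  have intE: "integrable lborel (\<lambda>z. indicator \<Omega> z * E z)"
    using fin by (intro integrableI_nonneg[OF mE nonneg]) (auto intro: le_less_trans)
  have "ennreal (\<integral>z. indicator \<Omega> z * E z \<partial>lborel) \<le> ennreal (2 * I)"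
    using fin nn_integral_eq_integral[OF intE nonneg] by simp
  then have "(\<integral>z. indicator \<Omega> z * E z \<partial>lborel) \<le> 2 * I" using I0 by (simp add: ennreal_le_iff)
  then show "integrable lborel (\<lambda>z. indicator \<Omega> z * (norm (deriv h z))\<^sup>2)"
    "(\<integral>z. indicator \<Omega> z * (norm (deriv h z))\<^sup>2 \<partial>lborel) \<le> 2 * (\<integral>z. indicator \<Omega> z * ((rx z)\<^sup>2 + (ry z)\<^sup>2) \<partial>lborel)"
    using intE by (simp_all add: E_def I_def N'_def)
qed

text \<open>\<open>T (v z)\<close> times the gradient of \<open>G\<close>, turned by a right angle,
  has divergence \<open>cutoff \<epsilon> (v z)\<close> times the bracket, the mixed terms with
  \<open>Gxy\<close> cancelling. The cutoffs tend to 1 where \<open>v \<noteq> 0\<close>, and where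
  \<open>v = 0\<close> the bracket vanishes almost everywhere; \<open>int\<close> supplies the
  majorant.\<close>

lemma poisson_bracket_integral_zero:
  fixes v vx vy G Gx Gy Gxx Gxy Gyy :: "complex \<Rightarrow> real"
  assumes \<Omega>: "open \<Omega>"
    and der: "\<And>z. z \<in> \<Omega> \<Longrightarrow> (v has_derivative (\<lambda>k. Re k * vx z + Im k * vy z)) (at z)"
    and cont: "continuous_on \<Omega> vx" "continuous_on \<Omega> vy"
    and bdry: "\<And>\<epsilon>. \<epsilon> > 0 \<Longrightarrow> compact {z \<in> \<Omega>. \<epsilon> \<le> \<bar>v z\<bar>}"
    and Gx: "\<And>z. z \<in> \<Omega> \<Longrightarrow> (Gx has_derivative (\<lambda>k. Re k * Gxx z + Im k * Gxy z)) (at z)"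
    and Gy: "\<And>z. z \<in> \<Omega> \<Longrightarrow> (Gy has_derivative (\<lambda>k. Re k * Gxy z + Im k * Gyy z)) (at z)"
    and contG: "continuous_on \<Omega> Gxx" "continuous_on \<Omega> Gxy" "continuous_on \<Omega> Gyy"
    and int: "integrable lborel (\<lambda>z. indicator \<Omega> z * (vx z * Gy z - vy z * Gx z))"
  shows "(\<integral>z. indicator \<Omega> z * (vx z * Gy z - vy z * Gx z) \<partial>lborel) = 0"
proof -
  have cv: "continuous_on \<Omega> v"
    by (intro continuous_at_imp_continuous_on ballI has_derivative_continuous[OF der])
  have cG: "continuous_on \<Omega> Gx"
    by (intro continuous_at_imp_continuous_on ballI has_derivative_continuous[OF Gx])
  have cG': "continuous_on \<Omega> Gy"
    by (intro continuous_at_imp_continuous_on ballI has_derivative_continuous[OF Gy])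
  have aeZ: "AE z in lborel. z \<in> \<Omega> \<longrightarrow> v z = 0 \<longrightarrow> vx z = 0 \<and> vy z = 0"
    by (rule AE_gradient_zero_on_level_set[OF \<Omega> der cont])
  have step: "integrable lborel (\<lambda>z. indicator \<Omega> z * (cutoff \<epsilon> (v z) * (vx z * Gy z - vy z * Gx z))) \<and>
      (\<integral>z. indicator \<Omega> z * (cutoff \<epsilon> (v z) * (vx z * Gy z - vy z * Gx z)) \<partial>lborel) = 0" if \<epsilon>: "\<epsilon> > 0" for \<epsilon>
  proof -
    obtain T where T: "\<And>s. (T has_real_derivative cutoff \<epsilon> s) (at s)" "\<And>s. \<bar>s\<bar> \<le> \<epsilon> \<Longrightarrow> T s = 0"
      using cutoff_antiderivative[OF \<epsilon>] by blast
    define K where "K = {z \<in> \<Omega>. \<epsilon> \<le> \<bar>v z\<bar>}"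
    have K: "compact K" "K \<subseteq> \<Omega>" using bdry[OF \<epsilon>] by (auto simp: K_def)
    have supp: "T (v z) = 0" "cutoff \<epsilon> (v z) = 0" if "z \<in> \<Omega> - K" for z
      using that T(2)[of "v z"] \<epsilon> by (auto simp: K_def cutoff_def max_def)
    have cT: "continuous_on \<Omega> (\<lambda>z. T (v z))" "continuous_on \<Omega> (\<lambda>z. cutoff \<epsilon> (v z))"
      using continuous_on_compose2[OF _ cv, of UNIV T] continuous_on_compose2[OF continuous_cutoff[OF \<epsilon>] cv]
        DERIV_isCont[OF T(1)] by (auto simp: continuous_at_imp_continuous_on)
    have Td: "((\<lambda>z. T (v z)) has_derivative (\<lambda>k. Re k * (cutoff \<epsilon> (v z) * vx z) + Im k * (cutoff \<epsilon> (v z) * vy z))) (at z)"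
      if "z \<in> \<Omega>" for z
      using has_derivative_compose[OF der[OF that] T(1)[unfolded has_field_derivative_def]]
      by (rule has_derivative_eq_rhs) (auto simp: fun_eq_iff algebra_simps)
    have 1: "((\<lambda>z. T (v z) * Gy z) has_derivative (\<lambda>k.
        Re k * (cutoff \<epsilon> (v z) * vx z * Gy z + T (v z) * Gxy z)
        + Im k * (cutoff \<epsilon> (v z) * vy z * Gy z + T (v z) * Gyy z))) (at z)" if "z \<in> \<Omega>" for z
      by (rule has_derivative_eq_rhs[OF has_derivative_mult[OF Td[OF that] Gy[OF that]]])
        (auto simp: fun_eq_iff algebra_simps)
    have 2: "((\<lambda>z. T (v z) * Gx z) has_derivative (\<lambda>k.
        Re k * (cutoff \<epsilon> (v z) * vx z * Gx z + T (v z) * Gxx z)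
        + Im k * (cutoff \<epsilon> (v z) * vy z * Gx z + T (v z) * Gxy z))) (at z)" if "z \<in> \<Omega>" for z
      by (rule has_derivative_eq_rhs[OF has_derivative_mult[OF Td[OF that] Gx[OF that]]])
        (auto simp: fun_eq_iff algebra_simps)
    note i1 = integral_partial_derivative(1,2)[OF \<Omega> K 1]
    note i2 = integral_partial_derivative(3,4)[OF \<Omega> K 2]
    have j1: "integrable lborel (\<lambda>z. indicator \<Omega> z * (cutoff \<epsilon> (v z) * vx z * Gy z + T (v z) * Gxy z))"
        "(\<integral>z. indicator \<Omega> z * (cutoff \<epsilon> (v z) * vx z * Gy z + T (v z) * Gxy z) \<partial>lborel) = 0"
      by (rule i1; (intro continuous_on_add continuous_on_mult cont cT cG cG' contG | simp add: supp))+
    have j2: "integrable lborel (\<lambda>z. indicator \<Omega> z * (cutoff \<epsilon> (v z) * vy z * Gx z + T (v z) * Gxy z))"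
        "(\<integral>z. indicator \<Omega> z * (cutoff \<epsilon> (v z) * vy z * Gx z + T (v z) * Gxy z) \<partial>lborel) = 0"
      by (rule i2; (intro continuous_on_add continuous_on_mult cont cT cG cG' contG | simp add: supp))+
    have "(\<lambda>z. indicator \<Omega> z * (cutoff \<epsilon> (v z) * (vx z * Gy z - vy z * Gx z))) =
        (\<lambda>z. indicator \<Omega> z * (cutoff \<epsilon> (v z) * vx z * Gy z + T (v z) * Gxy z)
          - indicator \<Omega> z * (cutoff \<epsilon> (v z) * vy z * Gx z + T (v z) * Gxy z))"
      by (auto simp: fun_eq_iff algebra_simps)
    then show ?thesis using j1 j2 by simp
  qed
  have "(\<lambda>n. \<integral>z. indicator \<Omega> z * (cutoff (1 / real (Suc n)) (v z) * (vx z * Gy z - vy z * Gx z)) \<partial>lborel)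
      \<longlonglongrightarrow> (\<integral>z. indicator \<Omega> z * (vx z * Gy z - vy z * Gx z) \<partial>lborel)"
  proof (rule integral_dominated_convergence[where w = "\<lambda>z. norm (indicator \<Omega> z * (vx z * Gy z - vy z * Gx z))"])
    show "AE z in lborel. (\<lambda>n. indicator \<Omega> z * (cutoff (1 / real (Suc n)) (v z) * (vx z * Gy z - vy z * Gx z)))
        \<longlonglongrightarrow> indicator \<Omega> z * (vx z * Gy z - vy z * Gx z)"
    proof (use aeZ in eventually_elim)
      case (elim z)
      show ?case
      proof (cases "z \<in> \<Omega> \<and> v z \<noteq> 0")
        case True
        have "(\<lambda>n. indicator \<Omega> z * (cutoff (1 / real (Suc n)) (v z) * (vx z * Gy z - vy z * Gx z)))
            \<longlonglongrightarrow> indicator \<Omega> z * (1 * (vx z * Gy z - vy z * Gx z))"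
          using True by (intro tendsto_mult tendsto_const cutoff_tendsto) auto
        then show ?thesis by simp
      next
        case False
        then show ?thesis using elim by (cases "z \<in> \<Omega>") auto
      qed
    qed
    show "AE z in lborel. norm (indicator \<Omega> z * (cutoff (1 / real (Suc n)) (v z) * (vx z * Gy z - vy z * Gx z)))
        \<le> norm (indicator \<Omega> z * (vx z * Gy z - vy z * Gx z))" for n
      using cutoff_bounds[of "1 / real (Suc n)"]
      by (intro AE_I2) (auto simp: abs_mult indicator_def intro!: mult_left_le_one_le)
    show "(\<lambda>z. indicator \<Omega> z * (cutoff (1 / real (Suc n)) (v z) * (vx z * Gy z - vy z * Gx z))) \<in> borel_measurable lborel" for n
      using step[of "1 / real (Suc n)"] by (intro borel_measurable_integrable) simp
  qed (use int in \<open>auto dest: borel_measurable_integrable\<close>)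
  then have "(\<lambda>n. 0 :: real) \<longlonglongrightarrow> (\<integral>z. indicator \<Omega> z * (vx z * Gy z - vy z * Gx z) \<partial>lborel)"
    using step by simp
  then show ?thesis using LIMSEQ_unique tendsto_const by blast
qed

text \<open>If \<open>u + i s\<close> has holomorphic boundary values \<open>h\<close> on \<open>\<Omega>\<close> and the gradient of \<open>s\<close> is small, then \<open>h'\<close> is
  small in \<open>L\<^sup>2\<close> by Dirichlet's principle, so that \<open>u\<close> is close to \<open>u - Re h\<close>, whose Poisson bracket with
  any \<open>G\<close> has mean zero.\<close>

lemma no_holomorphic_boundary_values:
  fixes u ux uy s sx sy G Gx Gy Gxx Gxy Gyy W :: "complex \<Rightarrow> real"
  assumes \<Omega>: "open \<Omega>" "bounded \<Omega>" "\<Omega> \<noteq> {}" and h: "h holomorphic_on \<Omega>"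
    and u: "\<And>z. z \<in> \<Omega> \<Longrightarrow> (u has_derivative (\<lambda>k. Re k * ux z + Im k * uy z)) (at z)"
      "continuous_on \<Omega> ux" "continuous_on \<Omega> uy"
    and s: "\<And>z. z \<in> \<Omega> \<Longrightarrow> (s has_derivative (\<lambda>k. Re k * sx z + Im k * sy z)) (at z)"
      "continuous_on \<Omega> sx" "continuous_on \<Omega> sy"
    and bdry: "\<And>\<epsilon>. \<epsilon> > 0 \<Longrightarrow> compact {z \<in> \<Omega>. \<epsilon> \<le> \<bar>u z - Re (h z)\<bar>}" "\<And>\<epsilon>. \<epsilon> > 0 \<Longrightarrow> compact {z \<in> \<Omega>. \<epsilon> \<le> \<bar>s z - Im (h z)\<bar>}"
    and Gx: "\<And>z. z \<in> \<Omega> \<Longrightarrow> (Gx has_derivative (\<lambda>k. Re k * Gxx z + Im k * Gxy z)) (at z)"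
    and Gy: "\<And>z. z \<in> \<Omega> \<Longrightarrow> (Gy has_derivative (\<lambda>k. Re k * Gxy z + Im k * Gyy z)) (at z)"
    and contG: "continuous_on \<Omega> Gxx" "continuous_on \<Omega> Gxy" "continuous_on \<Omega> Gyy"
    and W: "continuous_on UNIV W" "\<And>z. 0 \<le> W z" "\<And>z. z \<noteq> 0 \<Longrightarrow> 0 < W z"
    and c: "c > 0" "C > 0" "4 * C * \<eta>\<^sup>2 \<le> c\<^sup>2"
    and bu: "\<And>z. z \<in> \<Omega> \<Longrightarrow> (ux z)\<^sup>2 + (uy z)\<^sup>2 \<le> C * W z"
    and bG: "\<And>z. z \<in> \<Omega> \<Longrightarrow> (Gx z)\<^sup>2 + (Gy z)\<^sup>2 \<le> C * W z"
    and bs: "\<And>z. z \<in> \<Omega> \<Longrightarrow> (sx z)\<^sup>2 + (sy z)\<^sup>2 \<le> \<eta>\<^sup>2 * W z"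
    and br: "\<And>z. z \<in> \<Omega> \<Longrightarrow> c * W z \<le> ux z * Gy z - uy z * Gx z"
  shows False
proof -
  have m\<Omega>: "\<Omega> \<in> sets borel" using \<Omega>(1) by simp
  obtain B where B: "\<Omega> \<subseteq> cball 0 B" using bounded_subset_ballD[OF \<Omega>(2), of 0] ball_subset_cball by blast
  have meas: "(\<lambda>z. indicator \<Omega> z * H z) \<in> borel_measurable lborel" if "continuous_on \<Omega> H" for H :: "complex \<Rightarrow> real"
    using borel_measurable_continuous_on_indicator[OF m\<Omega> that] by simp
  have iW: "integrable lborel (\<lambda>z. indicator \<Omega> z * W z)"
  proof -
    have "integrable lborel (\<lambda>z. indicator (cball 0 B) z *\<^sub>R W z)"
      using W(1) by (intro borel_integrable_compact) (auto intro: continuous_on_subset)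
    then show ?thesis
    proof (rule Bochner_Integration.integrable_bound)
      show "AE z in lborel. norm (indicator \<Omega> z * W z) \<le> norm (indicator (cball 0 B) z *\<^sub>R W z)"
      proof (rule AE_I2)
        fix z show "norm (indicator \<Omega> z * W z) \<le> norm (indicator (cball 0 B) z *\<^sub>R W z)"
          using B by (cases "z \<in> \<Omega>") auto
      qed
    qed (rule meas[OF continuous_on_subset[OF W(1)]], simp)
  qed
  \<comment> \<open>Measurability comes from continuity, so integrability over
    \<open>\<Omega>\<close> reduces to a pointwise bound by \<open>W\<close> and one further
    integrable function.\<close>
  have dom: "integrable lborel (\<lambda>z. indicator \<Omega> z * H z)"
    if "continuous_on \<Omega> H" "\<And>z. z \<in> \<Omega> \<Longrightarrow> \<bar>H z\<bar> \<le> a * W z + b * E z" "integrable lborel (\<lambda>z. indicator \<Omega> z * E z)"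
    for H E :: "complex \<Rightarrow> real" and a b
  proof (rule Bochner_Integration.integrable_bound)
    show "integrable lborel (\<lambda>z. a * (indicator \<Omega> z * W z) + b * (indicator \<Omega> z * E z))"
      using iW that(3) by simp
    show "AE z in lborel. norm (indicator \<Omega> z * H z) \<le> norm (a * (indicator \<Omega> z * W z) + b * (indicator \<Omega> z * E z))"
      using that(2) by (intro AE_I2) (force simp: indicator_def)
  qed (use meas that(1) in simp)
  have i0: "integrable lborel (\<lambda>z. indicator \<Omega> z * (0 :: real))" by simp
  have iN: "integrable lborel (\<lambda>z. indicator \<Omega> z * ((sx z)\<^sup>2 + (sy z)\<^sup>2))"
    by (rule dom[OF _ _ i0, where a = "\<eta>\<^sup>2" and b = 0]) (use bs in \<open>auto intro!: continuous_intros s\<close>)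
  define E where "E z = (norm (deriv h z))\<^sup>2" for z
  note dir = dirichlet_estimate[OF \<Omega>(1) h s bdry(2) iN, folded E_def]
  define I where "I = (\<integral>z. indicator \<Omega> z * W z \<partial>lborel)"
  have EI: "(\<integral>z. indicator \<Omega> z * E z \<partial>lborel) \<le> 2 * \<eta>\<^sup>2 * I"
  proof -
    have "(\<integral>z. indicator \<Omega> z * ((sx z)\<^sup>2 + (sy z)\<^sup>2) \<partial>lborel) \<le> (\<integral>z. \<eta>\<^sup>2 * (indicator \<Omega> z * W z) \<partial>lborel)"
      using iN iW bs by (intro integral_mono_AE AE_I2) (auto simp: indicator_def)
    then show ?thesis using dir(2) by (simp add: I_def)
  qed
  have h1: "deriv h holomorphic_on \<Omega>" using h \<Omega>(1) by (rule holomorphic_deriv)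
  have ch: "continuous_on \<Omega> (\<lambda>z. Re (deriv h z))" "continuous_on \<Omega> (\<lambda>z. Im (deriv h z))"
    using h1 by (auto intro!: continuous_intros holomorphic_on_imp_continuous_on)
  have cGx: "continuous_on \<Omega> Gx"
    by (intro continuous_at_imp_continuous_on ballI has_derivative_continuous[OF Gx])
  have cGy: "continuous_on \<Omega> Gy"
    by (intro continuous_at_imp_continuous_on ballI has_derivative_continuous[OF Gy])
  have E: "E z = (Re (deriv h z))\<^sup>2 + (Im (deriv h z))\<^sup>2" for z by (simp add: E_def cmod_power2)
  \<comment> \<open>Young's inequality for a two-dimensional determinant; the weight
    \<open>t\<close> is fixed below.\<close>
  have ab: "\<bar>a * b' - b * a'\<bar> \<le> (a\<^sup>2 + b\<^sup>2) / (2 * t) + t * (a'\<^sup>2 + b'\<^sup>2) / 2" if "t > 0" for a b a' b' t :: real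
  proof -
    have am: "\<bar>p * q\<bar> \<le> p\<^sup>2 / (2 * t) + t * q\<^sup>2 / 2" for p q
    proof -
      have "0 \<le> (\<bar>p\<bar> - t * \<bar>q\<bar>)\<^sup>2" by simp
      then have "2 * t * (\<bar>p\<bar> * \<bar>q\<bar>) \<le> p\<^sup>2 + t\<^sup>2 * q\<^sup>2" by (simp add: power2_diff power_mult_distrib mult_ac)
      then show ?thesis using that by (simp add: abs_mult field_simps power2_eq_square)
    qed
    have "\<bar>a * b' - b * a'\<bar> \<le> \<bar>a * b'\<bar> + \<bar>b * a'\<bar>" by (rule abs_triangle_ineq4)
    also have "\<dots> \<le> (a\<^sup>2 / (2 * t) + t * b'\<^sup>2 / 2) + (b\<^sup>2 / (2 * t) + t * a'\<^sup>2 / 2)" using am by (intro add_mono)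
    also have "\<dots> = (a\<^sup>2 + b\<^sup>2) / (2 * t) + t * (a'\<^sup>2 + b'\<^sup>2) / 2" by (simp add: add_divide_distrib algebra_simps)
    finally show ?thesis .
  qed
  have iU: "integrable lborel (\<lambda>z. indicator \<Omega> z * (ux z * Gy z - uy z * Gx z))"
  proof (rule dom[OF _ _ i0, where a = C and b = 0])
    show "continuous_on \<Omega> (\<lambda>z. ux z * Gy z - uy z * Gx z)" by (intro continuous_intros u cGx cGy)
    show "\<bar>ux z * Gy z - uy z * Gx z\<bar> \<le> C * W z + 0 * 0" if "z \<in> \<Omega>" for z
    proof -
      have "\<bar>ux z * Gy z - uy z * Gx z\<bar> \<le> ((ux z)\<^sup>2 + (uy z)\<^sup>2) / 2 + ((Gx z)\<^sup>2 + (Gy z)\<^sup>2) / 2"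
        using ab[of 1 "ux z" "Gy z" "uy z" "Gx z"] by simp
      also have "\<dots> \<le> C * W z / 2 + C * W z / 2"
        using bu[OF that] bG[OF that] by (intro add_mono divide_right_mono) auto
      finally show ?thesis by simp
    qed
  qed
  have bH: "\<bar>Re (deriv h z) * Gy z - (- Im (deriv h z)) * Gx z\<bar> \<le> E z / (2 * t) + t * C / 2 * W z" if "z \<in> \<Omega>" "t > 0" for z t
  proof -
    have "t * ((Gx z)\<^sup>2 + (Gy z)\<^sup>2) / 2 \<le> t * (C * W z) / 2"
      using bG[OF that(1)] that(2) by (intro divide_right_mono mult_left_mono) auto
    then show ?thesis
      using ab[OF that(2), of "Re (deriv h z)" "Gy z" "- Im (deriv h z)" "Gx z"] by (simp add: E)
  qed
  have iH: "integrable lborel (\<lambda>z. indicator \<Omega> z * (Re (deriv h z) * Gy z - (- Im (deriv h z)) * Gx z))"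
  proof (rule dom[OF _ _ dir(1), where a = "C / 2" and b = "1 / 2"])
    show "continuous_on \<Omega> (\<lambda>z. Re (deriv h z) * Gy z - (- Im (deriv h z)) * Gx z)" by (intro continuous_intros ch cGx cGy)
    show "\<bar>Re (deriv h z) * Gy z - (- Im (deriv h z)) * Gx z\<bar> \<le> C / 2 * W z + 1 / 2 * E z" if "z \<in> \<Omega>" for z
      using bH[OF that, of 1] by simp
  qed
  have hd: "((\<lambda>z. Re (h z)) has_derivative (\<lambda>k. Re k * Re (deriv h z) + Im k * (- Im (deriv h z)))) (at z)" if "z \<in> \<Omega>" for z
    by (rule has_derivative_eq_rhs[OF has_derivative_Re[OF holomorphic_derivI[OF h \<Omega>(1) that, unfolded has_field_derivative_def]]])
      (auto simp: fun_eq_iff)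
  have "(\<integral>z. indicator \<Omega> z * ((ux z - Re (deriv h z)) * Gy z - (uy z - (- Im (deriv h z))) * Gx z) \<partial>lborel) = 0"
  proof (rule poisson_bracket_integral_zero[OF \<Omega>(1) _ _ _ bdry(1) Gx Gy contG])
    show "((\<lambda>z. u z - Re (h z)) has_derivative (\<lambda>k. Re k * (ux z - Re (deriv h z)) + Im k * (uy z - (- Im (deriv h z))))) (at z)" if "z \<in> \<Omega>" for z
      by (rule has_derivative_eq_rhs[OF has_derivative_diff[OF u(1)[OF that] hd[OF that]]]) (auto simp: fun_eq_iff algebra_simps)
    show "continuous_on \<Omega> (\<lambda>z. ux z - Re (deriv h z))" "continuous_on \<Omega> (\<lambda>z. uy z - (- Im (deriv h z)))"
      by (intro continuous_intros u ch)+
    show "integrable lborel (\<lambda>z. indicator \<Omega> z * ((ux z - Re (deriv h z)) * Gy z - (uy z - (- Im (deriv h z))) * Gx z))"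
      using Bochner_Integration.integrable_diff[OF iU iH] by (rule Bochner_Integration.integrable_cong[THEN iffD1, rotated 2]) (auto simp: algebra_simps)
  qed
  also have "(\<lambda>z. indicator \<Omega> z * ((ux z - Re (deriv h z)) * Gy z - (uy z - (- Im (deriv h z))) * Gx z))
      = (\<lambda>z. indicator \<Omega> z * (ux z * Gy z - uy z * Gx z) - indicator \<Omega> z * (Re (deriv h z) * Gy z - (- Im (deriv h z)) * Gx z))"
    by (auto simp: fun_eq_iff algebra_simps)
  finally have eq: "(\<integral>z. indicator \<Omega> z * (ux z * Gy z - uy z * Gx z) \<partial>lborel)
      = (\<integral>z. indicator \<Omega> z * (Re (deriv h z) * Gy z - (- Im (deriv h z)) * Gx z) \<partial>lborel)"
    using iU iH by simp
  \<comment> \<open>Balances the two terms: the one with \<open>W\<close> becomes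
    \<open>c / 2\<close>, and the energy term \<open>C * \<eta>\<^sup>2 / c\<close> is at most
    \<open>c / 4\<close> by hypothesis, in total less than \<open>c\<close>.\<close>
  define t where "t = c / C"
  have t: "t > 0" using c by (simp add: t_def)
  have "c * I = (\<integral>z. c * (indicator \<Omega> z * W z) \<partial>lborel)" by (simp add: I_def)
  also have "\<dots> \<le> (\<integral>z. indicator \<Omega> z * (ux z * Gy z - uy z * Gx z) \<partial>lborel)"
    using iW iU br by (intro integral_mono_AE AE_I2) (auto simp: indicator_def)
  also have "\<dots> \<le> (\<integral>z. 1 / (2 * t) * (indicator \<Omega> z * E z) + t * C / 2 * (indicator \<Omega> z * W z) \<partial>lborel)"
    unfolding eq using iH iW dir(1) bH[OF _ t] by (intro integral_mono_AE AE_I2) (auto simp: indicator_def abs_le_iff)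
  also have "\<dots> = 1 / (2 * t) * (\<integral>z. indicator \<Omega> z * E z \<partial>lborel) + t * C / 2 * I"
    using iW dir(1) by (simp add: I_def)
  also have "\<dots> \<le> 1 / (2 * t) * (2 * \<eta>\<^sup>2 * I) + t * C / 2 * I"
    using EI t by (intro add_right_mono mult_left_mono) auto
  also have "\<dots> = (C * \<eta>\<^sup>2 / c + c / 2) * I" using c by (simp add: t_def algebra_simps)
  also have "\<dots> \<le> (3 / 4 * c) * I"
  proof (rule mult_right_mono)
    show "C * \<eta>\<^sup>2 / c + c / 2 \<le> 3 / 4 * c" using c by (simp add: field_simps power2_eq_square)
    show "0 \<le> I" unfolding I_def using W(2) by (intro integral_nonneg_AE AE_I2) simp
  qed
  finally have "I \<le> 0" using c(1) by simp
  moreover have "0 \<le> I" unfolding I_def using W(2) by (intro integral_nonneg_AE AE_I2) simp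
  \<comment> \<open>A weight that is positive off \<open>0\<close> cannot have integral zero over a
    nonempty open set.\<close>
  ultimately have "(\<integral>z. indicator \<Omega> z * W z \<partial>lborel) = 0" by (simp add: I_def)
  then have "AE z in lborel. indicator \<Omega> z * W z = 0"
    by (subst (asm) integral_nonneg_eq_0_iff_AE[OF iW]) (use W(2) in auto)
  then have ae: "AE z in lborel. z \<notin> \<Omega> - {0}"
    by eventually_elim (use W(3) in \<open>force simp: indicator_def\<close>)
  have op: "open (\<Omega> - {0})" using \<Omega>(1) by (simp add: open_delete)
  have "\<Omega> - {0} \<in> null_sets lborel"
    using ae op by (subst AE_iff_null_sets) (simp_all only: sets_lborel borel_open)
  then have "\<Omega> - {0} \<in> null_sets lebesgue" by (rule null_sets_completionI)
  then have "negligible (\<Omega> - {0})" by (simp add: negligible_iff_null_sets)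
  then have "\<Omega> - {0} = {}" using op open_not_negligible by blast
  then have "\<Omega> = {0}" using \<Omega>(3) by auto
  then show False using \<Omega>(1) not_open_singleton by metis
qed

section \<open>Univalence from injectivity on the circle\<close>

text \<open>By the argument principle the number of preimages of a point off the boundary curve is the winding
  number of a simple closed curve.\<close>

lemma inj_on_disc_off_curve:
  assumes hol: "a holomorphic_on ball 0 1" and cont: "continuous_on (cball 0 1) a"
    and simple: "simple_path (a \<circ> circlepath 0 1)" and w: "w \<notin> a ` sphere 0 1"
    and \<zeta>: "\<zeta>1 \<in> ball 0 1" "\<zeta>2 \<in> ball 0 1" "a \<zeta>1 = w" "a \<zeta>2 = w"
  shows "\<zeta>1 = \<zeta>2"
proof (rule ccontr)
  assume ne: "\<zeta>1 \<noteq> \<zeta>2"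
  define f where "f = (\<lambda>\<zeta>. a \<zeta> - w)"
  have fh: "f holomorphic_on ball 0 1" unfolding f_def by (intro holomorphic_intros hol)
  define Z where "Z = {\<zeta> \<in> cball 0 1. f \<zeta> = 0}"
  have Zb: "Z \<subseteq> ball 0 1" using w by (force simp: Z_def f_def)
  have cf: "continuous_on (cball 0 1) f" unfolding f_def by (intro continuous_intros cont)
  have "closed (cball 0 1 \<inter> f -` {0})"
    by (rule continuous_closed_preimage[OF cf]) auto
  then have "closed Z" by (simp add: Z_def vimage_def Int_def)
  moreover have "bounded Z" by (rule bounded_subset[OF bounded_cball[of 0 1]]) (auto simp: Z_def)
  ultimately have Zc: "compact Z" by (simp add: compact_eq_bounded_closed)
  have \<zeta>Z: "\<zeta>1 \<in> Z" "\<zeta>2 \<in> Z" using \<zeta> by (auto simp: Z_def f_def)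
  have "continuous_on Z norm" by (intro continuous_intros)
  then obtain \<zeta>m where \<zeta>m: "\<zeta>m \<in> Z" "\<And>\<zeta>. \<zeta> \<in> Z \<Longrightarrow> norm \<zeta> \<le> norm \<zeta>m"
    using continuous_attains_sup[OF Zc] \<zeta>Z by blast
  \<comment> \<open>The map is holomorphic only in the open disc. The circle of radius
    \<open>\<rho>\<close> encloses all zeros, so the argument principle applies to it; the annulus
    up to the unit circle is free of zeros, so the winding number is that of the boundary
    curve.\<close>
  define \<rho> where "\<rho> = (norm \<zeta>m + 1) / 2"
  have \<rho>: "norm \<zeta>m < \<rho>" "\<rho> < 1" "0 < \<rho>" using \<zeta>m(1) Zb by (auto simp: \<rho>_def intro: add_nonneg_pos)
  have \<rho>Z: "norm \<zeta> < \<rho>" if "\<zeta> \<in> Z" for \<zeta> using \<zeta>m(2)[OF that] \<rho>(1) by linarith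
  define \<gamma> where "\<gamma> = circlepath 0 \<rho>"
  have pi\<gamma>: "path_image \<gamma> = sphere 0 \<rho>" using \<rho> by (simp add: \<gamma>_def)
  define X where "X = {\<zeta> \<in> cball 0 1. f \<zeta> \<noteq> 0}"
  have "homotopic_loops X \<gamma> (circlepath 0 1)"
  proof (rule homotopic_loops_linear)
    fix t :: real assume "t \<in> {0..1}"
    define e where "e = exp (2 * of_real pi * \<i> * of_real t)"
    have ne1: "norm e = 1" by (simp add: e_def)
    have seg: "closed_segment (\<gamma> t) (circlepath 0 1 t) = (\<lambda>s. (1 - s) *\<^sub>R (of_real \<rho> * e) + s *\<^sub>R e) ` {0..1}"
      by (simp add: \<gamma>_def circlepath e_def closed_segment_image_interval)
    show "closed_segment (\<gamma> t) (circlepath 0 1 t) \<subseteq> X"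
    proof
      fix \<zeta> assume "\<zeta> \<in> closed_segment (\<gamma> t) (circlepath 0 1 t)"
      then obtain s where s: "0 \<le> s" "s \<le> 1" "\<zeta> = of_real ((1 - s) * \<rho> + s) * e"
        unfolding seg by (auto simp: scaleR_conv_of_real algebra_simps)
      have "norm \<zeta> = (1 - s) * \<rho> + s" using s \<rho>(3) ne1 by (simp add: norm_mult del: of_real_add of_real_mult of_real_diff)
      moreover have "(1 - s) * \<rho> \<le> (1 - s) * 1" using s \<rho>(2) by (intro mult_left_mono) auto
      moreover have "s * \<rho> \<le> s * 1" using s \<rho>(2) by (intro mult_left_mono) auto
      then have "\<rho> \<le> (1 - s) * \<rho> + s" by (simp add: algebra_simps)
      ultimately have "norm \<zeta> \<le> 1" "\<not> norm \<zeta> < \<rho>" by auto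
      then show "\<zeta> \<in> X" using \<rho>Z[of \<zeta>] by (auto simp: X_def Z_def)
    qed
  qed (auto simp: \<gamma>_def)
  then have "homotopic_loops (- {0}) (f \<circ> \<gamma>) (f \<circ> circlepath 0 1)"
    by (rule homotopic_loops_continuous_image) (auto simp: X_def intro: continuous_on_subset[OF cf])
  then have wn: "winding_number (f \<circ> \<gamma>) 0 = winding_number (f \<circ> circlepath 0 1) 0"
    by (rule winding_number_homotopic_loops)
  have "winding_number (f \<circ> circlepath 0 1) 0 = winding_number (a \<circ> circlepath 0 1) w"
    by (subst winding_number_offset[of "a \<circ> circlepath 0 1" w]) (simp add: f_def o_def)
  moreover have "winding_number (a \<circ> circlepath 0 1) w \<in> {-1, 0, 1}"
  proof (rule simple_closed_path_winding_number_cases[OF simple])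
    show "pathfinish (a \<circ> circlepath 0 1) = pathstart (a \<circ> circlepath 0 1)" by (simp add: pathfinish_compose pathstart_compose)
    show "w \<notin> path_image (a \<circ> circlepath 0 1)" using w by (simp add: path_image_compose)
  qed
  ultimately have wn3: "winding_number (f \<circ> \<gamma>) 0 \<in> {-1, 0, 1}" using wn by simp
  have nc: "\<not> f constant_on ball 0 1"
  proof
    assume "f constant_on ball 0 1"
    then have "f \<zeta> = f \<zeta>1" if "\<zeta> \<in> ball 0 1" for \<zeta> using that \<zeta>(1) unfolding constant_on_def by metis
    then have "of_real \<rho> \<in> Z" using \<rho> \<zeta>(3) by (simp add: Z_def f_def)
    from \<rho>Z[OF this] show False using \<rho> by simp
  qed
  have fin: "finite Z"
  proof -
    have "finite {z \<in> Z. f z = 0}"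
      by (rule holomorphic_compact_finite_zeros[OF fh _ _ Zc Zb nc]) auto
    then show ?thesis by (simp add: Z_def)
  qed
  have pz: "{p \<in> ball 0 1. f p = 0 \<or> p \<in> {}} = Z" using Zb by (auto simp: Z_def)
  have "contour_integral \<gamma> (\<lambda>x. deriv f x * 1 / f x) = 2 * pi * \<i> * (\<Sum>p\<in>{p \<in> ball 0 1. f p = 0 \<or> p \<in> {}}. winding_number \<gamma> p * 1 * zorder f p)"
  proof (rule argument_principle)
    show "path_image \<gamma> \<subseteq> ball 0 1 - {p \<in> ball 0 1. f p = 0 \<or> p \<in> {}}"
      unfolding pz pi\<gamma> using \<rho> \<rho>Z by fastforce
    show "\<forall>z. z \<notin> ball 0 1 \<longrightarrow> winding_number \<gamma> z = 0"
    proof (intro allI impI winding_number_zero_outside)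
      fix z :: complex assume "z \<notin> ball 0 1"
      then show "z \<notin> cball 0 \<rho>" using \<rho> by auto
      show "path_image \<gamma> \<subseteq> cball 0 \<rho>" unfolding pi\<gamma> by auto
    qed (auto simp: \<gamma>_def)
    show "finite {p \<in> ball 0 1. f p = 0 \<or> p \<in> {}}" unfolding pz by (rule fin)
  qed (use fh in \<open>auto simp: \<gamma>_def\<close>)
  also have "(\<Sum>p\<in>{p \<in> ball 0 1. f p = 0 \<or> p \<in> {}}. winding_number \<gamma> p * 1 * zorder f p) = of_int (\<Sum>p\<in>Z. zorder f p)"
    unfolding pz of_int_sum using \<rho>Z by (intro sum.cong) (auto simp: \<gamma>_def winding_number_circlepath)
  finally have ci: "contour_integral \<gamma> (\<lambda>x. deriv f x / f x) = 2 * pi * \<i> * of_int (\<Sum>p\<in>Z. zorder f p)" by simp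
  have an: "f analytic_on ball 0 1" using fh by (simp add: analytic_on_open)
  have valid: "valid_path (f \<circ> \<gamma>)"
    by (rule valid_path_compose_analytic[OF _ an]) (use \<rho> in \<open>auto simp: \<gamma>_def\<close>)
  have not0: "0 \<notin> path_image (f \<circ> \<gamma>)"
  proof
    assume "0 \<in> path_image (f \<circ> \<gamma>)"
    then obtain x where x: "norm x = \<rho>" "f x = 0" by (auto simp: path_image_compose pi\<gamma>)
    then have "x \<in> Z" using \<rho> by (simp add: Z_def)
    from \<rho>Z[OF this] x show False by simp
  qed
  have "contour_integral (f \<circ> \<gamma>) (\<lambda>w. 1 / w) = contour_integral \<gamma> (\<lambda>x. deriv f x * (1 / f x))"
    by (rule contour_integral_comp_analyticW[OF an]) (use \<rho> in \<open>auto simp: \<gamma>_def\<close>)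
  then have "winding_number (f \<circ> \<gamma>) 0 = of_int (\<Sum>p\<in>Z. zorder f p)"
    using winding_number_valid_path[OF valid not0] ci by simp
  moreover have zpos: "zorder f p > 0" if "p \<in> Z" for p
  proof -
    have p: "p \<in> ball 0 1" "f p = 0" using that Zb by (auto simp: Z_def)
    have \<beta>: "of_real \<rho> \<in> ball (0::complex) 1" "f (of_real \<rho>) \<noteq> 0"
      using \<rho> \<rho>Z[of "of_real \<rho>"] by (auto simp: Z_def)
    obtain r where r: "r > 0" "\<And>z. z \<in> ball p r - {p} \<Longrightarrow> f z \<noteq> 0"
    proof (rule isolated_zeros[OF fh open_ball connected_ball p(1,2) \<beta>])
      fix r assume "0 < r" "ball p r \<subseteq> ball 0 1" "\<And>z. z \<in> ball p r - {p} \<Longrightarrow> f z \<noteq> 0"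
      then show thesis by (intro that)
    qed
    have "eventually (\<lambda>z. f z \<noteq> 0) (at p)"
      unfolding eventually_at using r by (intro exI[of _ r]) (auto simp: dist_commute)
    then have "frequently (\<lambda>z. f z \<noteq> 0) (at p)" by (rule eventually_frequently[rotated]) simp
    then show ?thesis using zorder_pos_iff[OF fh open_ball p(1)] p(2) by blast
  qed
  \<comment> \<open>Two distinct zeros, each of positive order, against a winding number of modulus
    at most 1.\<close>
  have "(\<Sum>p\<in>Z. zorder f p) \<ge> 2"
  proof -
    have "(\<Sum>p\<in>Z. zorder f p) \<ge> (\<Sum>p\<in>{\<zeta>1, \<zeta>2}. zorder f p)"
      using \<zeta>Z fin zpos by (intro sum_mono2) (auto intro: less_imp_le)
    moreover have "(\<Sum>p\<in>{\<zeta>1, \<zeta>2}. zorder f p) \<ge> 2"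
      using ne zpos[OF \<zeta>Z(1)] zpos[OF \<zeta>Z(2)] by simp
    ultimately show ?thesis by linarith
  qed
  ultimately show False using wn3
    by (auto simp: complex_eq_iff simp flip: of_int_sum)
qed

text \<open>The counting argument leaves out values on the boundary curve. If such a value had two
  preimages, the open mapping theorem would give an open set of values taken twice; by the counting
  argument it lies in the curve, which has empty interior.\<close>

lemma inj_on_disc:
  assumes hol: "a holomorphic_on ball 0 1" and cont: "continuous_on (cball 0 1) a"
    and simple: "simple_path (a \<circ> circlepath 0 1)"
  shows "inj_on a (ball 0 1)"
proof (rule inj_onI, rule ccontr)
  fix \<zeta>1 \<zeta>2 assume \<zeta>: "\<zeta>1 \<in> ball 0 1" "\<zeta>2 \<in> ball 0 1" "a \<zeta>1 = a \<zeta>2" "\<zeta>1 \<noteq> \<zeta>2"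
  define J where "J = path_image (a \<circ> circlepath 0 1)"
  have J: "J = a ` sphere 0 1" by (simp add: J_def path_image_compose)
  \<comment> \<open>A constant map would identify the points of the circle at the parameters
    \<open>0\<close> and \<open>1/2\<close>.\<close>
  have nc: "\<not> a constant_on ball 0 1"
  proof
    assume "a constant_on ball 0 1"
    then obtain c where c: "\<And>\<zeta>. \<zeta> \<in> ball 0 1 \<Longrightarrow> a \<zeta> = c" unfolding constant_on_def by blast
    have "a \<zeta> = c" if "\<zeta> \<in> closure (ball 0 1)" for \<zeta>
      by (rule continuous_constant_on_closure[OF _ c that]) (use cont in simp)
    then have "a 1 = a (-1)" by simp
    moreover have "(a \<circ> circlepath 0 1) 0 = a 1" "(a \<circ> circlepath 0 1) (1/2) = a (-1)"
      by (simp_all add: circlepath)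
    moreover have "\<forall>x\<in>{0..1}. \<forall>y\<in>{0..1}. (a \<circ> circlepath 0 1) x = (a \<circ> circlepath 0 1) y \<longrightarrow>
        x = y \<or> x = 0 \<and> y = 1 \<or> x = 1 \<and> y = 0"
      using simple by (simp add: simple_path_def loop_free_def)
    from this[rule_format, of 0 "1/2"] have "(a \<circ> circlepath 0 1) 0 \<noteq> (a \<circ> circlepath 0 1) (1/2)" by auto
    ultimately show False by simp
  qed
  obtain r where r: "r > 0" "ball \<zeta>1 r \<subseteq> ball 0 1" "ball \<zeta>2 r \<subseteq> ball 0 1" "ball \<zeta>1 r \<inter> ball \<zeta>2 r = {}"
  proof -
    obtain r1 r2 where "r1 > 0" "ball \<zeta>1 r1 \<subseteq> ball 0 1" "r2 > 0" "ball \<zeta>2 r2 \<subseteq> ball 0 1"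
      using \<zeta>(1,2) open_contains_ball open_ball by metis
    moreover have "dist \<zeta>1 \<zeta>2 > 0" using \<zeta>(4) by simp
    ultimately show ?thesis
      by (intro that[of "min (min r1 r2) (dist \<zeta>1 \<zeta>2 / 2)"]) (auto simp: disjoint_ballI subset_ball)
  qed
  have op: "open (a ` ball \<zeta> r)" if "ball \<zeta> r \<subseteq> ball 0 1" for \<zeta>
    using open_mapping_thm[OF hol open_ball connected_ball open_ball that nc] .
  define V where "V = a ` ball \<zeta>1 r \<inter> a ` ball \<zeta>2 r"
  have "a \<zeta>1 \<in> a ` ball \<zeta>1 r" "a \<zeta>2 \<in> a ` ball \<zeta>2 r" using r(1) by (intro imageI; simp)+
  then have V: "open V" "a \<zeta>1 \<in> V" using op r(2,3) \<zeta>(3) by (auto simp: V_def)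
  have "V \<subseteq> J"
  proof
    fix w assume "w \<in> V"
    then obtain \<eta>1 \<eta>2 where \<eta>: "\<eta>1 \<in> ball \<zeta>1 r" "\<eta>2 \<in> ball \<zeta>2 r" "a \<eta>1 = w" "a \<eta>2 = w" by (auto simp: V_def)
    then have "\<eta>1 \<noteq> \<eta>2" using r(4) by auto
    then show "w \<in> J"
      using inj_on_disc_off_curve[OF hol cont simple, of w \<eta>1 \<eta>2] \<eta> r(2,3) J by blast
  qed
  \<comment> \<open>A Jordan curve is the frontier of its outside, and frontiers of open sets have
    empty interior.\<close>
  moreover have "interior J = {}"
  proof -
    have "frontier (outside J) = J"
      using Jordan_inside_outside[OF simple] by (simp add: J_def pathfinish_compose pathstart_compose)
    moreover have "open (outside J)"
      using compact_simple_path_image[OF simple] by (intro open_outside) (auto simp: J_def compact_imp_closed)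
    moreover have "interior (frontier A) = {}" if "open A" for A :: "complex set"
    proof -
      have "interior (frontier A) \<inter> A = {}"
        using that interior_subset[of "frontier A"] by (auto simp: frontier_def interior_open)
      then have "interior (frontier A) \<inter> closure A = {}"
        by (subst (asm) open_Int_closure_eq_empty[symmetric]) auto
      then show ?thesis using interior_subset[of "frontier A"] by (auto simp: frontier_def)
    qed
    ultimately show ?thesis by metis
  qed
  ultimately show False using V interior_maximal by blast
qed

section \<open>Real homogeneous polynomials in the plane\<close>

lemma homogeneous_polynomial_rotate:
  assumes "homogeneous_polynomial m F"
  shows "homogeneous_polynomial m (\<lambda>z. F (a * z))"
proof -
  obtain c where F: "\<And>z. F z = (\<Sum>j\<le>m. c j * z ^ j * cnj z ^ (m - j))"
    using assms unfolding homogeneous_polynomial_def by blast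
  have "F (a * z) = (\<Sum>j\<le>m. (c j * a ^ j * cnj a ^ (m - j)) * z ^ j * cnj z ^ (m - j))" for z
    unfolding F by (intro sum.cong) (auto simp: power_mult_distrib mult_ac)
  then show ?thesis unfolding homogeneous_polynomial_def by (intro exI[of _ "\<lambda>j. c j * a ^ j * cnj a ^ (m - j)"]) blast
qed

text \<open>After the rotation \<open>z \<mapsto> a * z\<close> the zero is at \<open>1\<close>, so
  the coefficients sum to 0 and \<open>cnj z ^ Suc m\<close> may be subtracted from every monomial.
  Each difference is divisible by \<open>z - cnj z\<close>, which is \<open>2 * \<i>\<close> times
  \<open>Im z\<close>; collecting powers gives the tail sums \<open>d i\<close>.\<close>

lemma homogeneous_polynomial_factor:
  assumes F: "homogeneous_polynomial (Suc m) F" and a: "norm a = 1" "F a = 0"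
  obtains F1 where "homogeneous_polynomial m F1" "\<And>z. F z = of_real (Im (z * cnj a)) * F1 z"
proof -
  obtain c where c: "\<And>z. F (a * z) = (\<Sum>j\<le>Suc m. c j * z ^ j * cnj z ^ (Suc m - j))"
    using homogeneous_polynomial_rotate[OF F, of a] unfolding homogeneous_polynomial_def by blast
  have c0: "(\<Sum>j\<le>Suc m. c j) = 0" using c[of 1] a(2) by simp
  define d where "d i = 2 * \<i> * (\<Sum>j\<in>{Suc i..Suc m}. c j)" for i
  define F1 where "F1 z = (\<Sum>i\<le>m. d i * z ^ i * cnj z ^ (m - i))" for z
  have "F (a * z) = of_real (Im z) * F1 z" for z
  proof -
    have zj: "z ^ j * cnj z ^ (Suc m - j) - cnj z ^ Suc m = (z - cnj z) * (\<Sum>i<j. z ^ i * cnj z ^ (m - i))"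
      if j: "j \<le> Suc m" for j
    proof -
      have "z ^ j * cnj z ^ (Suc m - j) - cnj z ^ Suc m = (z ^ j - cnj z ^ j) * cnj z ^ (Suc m - j)"
      proof -
        have "cnj z ^ Suc m = cnj z ^ j * cnj z ^ (Suc m - j)" using j by (simp flip: power_add)
        then show ?thesis by (simp add: algebra_simps)
      qed
      also have "z ^ j - cnj z ^ j = (z - cnj z) * (\<Sum>i<j. cnj z ^ (j - Suc i) * z ^ i)"
        by (rule power_diff_sumr2)
      also have "(z - cnj z) * (\<Sum>i<j. cnj z ^ (j - Suc i) * z ^ i) * cnj z ^ (Suc m - j)
          = (z - cnj z) * (\<Sum>i<j. z ^ i * cnj z ^ (m - i))"
      proof -
        have "(\<Sum>i<j. cnj z ^ (j - Suc i) * z ^ i) * cnj z ^ (Suc m - j) = (\<Sum>i<j. z ^ i * cnj z ^ (m - i))"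
          unfolding sum_distrib_right
        proof (rule sum.cong[OF refl])
          fix i assume "i \<in> {..<j}"
          then have "cnj z ^ (j - Suc i) * cnj z ^ (Suc m - j) = cnj z ^ (m - i)"
            using j by (simp flip: power_add)
          then show "cnj z ^ (j - Suc i) * z ^ i * cnj z ^ (Suc m - j) = z ^ i * cnj z ^ (m - i)"
            by (simp add: mult_ac)
        qed
        then show ?thesis by (simp only: mult.assoc)
      qed
      finally show ?thesis .
    qed
    have "F (a * z) = (\<Sum>j\<le>Suc m. c j * (z ^ j * cnj z ^ (Suc m - j) - cnj z ^ Suc m)) + (\<Sum>j\<le>Suc m. c j) * cnj z ^ Suc m"
      by (simp only: c sum_distrib_right sum.distrib[symmetric]) (intro sum.cong refl, simp add: algebra_simps)
    also have "\<dots> = (\<Sum>j\<le>Suc m. c j * ((z - cnj z) * (\<Sum>i<j. z ^ i * cnj z ^ (m - i))))"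
    proof -
      have "(\<Sum>j\<le>Suc m. c j * (z ^ j * cnj z ^ (Suc m - j) - cnj z ^ Suc m)) =
          (\<Sum>j\<le>Suc m. c j * ((z - cnj z) * (\<Sum>i<j. z ^ i * cnj z ^ (m - i))))"
        by (rule sum.cong[OF refl]) (simp only: zj atMost_iff)
      then show ?thesis by (simp only: c0 mult_zero_left add_0_right)
    qed
    also have "\<dots> = (z - cnj z) * (\<Sum>j\<le>Suc m. \<Sum>i<j. c j * (z ^ i * cnj z ^ (m - i)))"
      by (simp only: sum_distrib_left mult_ac)
    also have "(\<Sum>j\<le>Suc m. \<Sum>i<j. c j * (z ^ i * cnj z ^ (m - i))) = (\<Sum>i\<le>m. \<Sum>j\<in>{Suc i..Suc m}. c j * (z ^ i * cnj z ^ (m - i)))"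
    proof -
      have "(\<Sum>j\<le>Suc m. \<Sum>i<j. c j * (z ^ i * cnj z ^ (m - i))) = (\<Sum>(j, i)\<in>(SIGMA j:{..Suc m}. {..<j}). c j * (z ^ i * cnj z ^ (m - i)))"
        by (rule sum.Sigma) auto
      also have "\<dots> = (\<Sum>(i, j)\<in>(SIGMA i:{..m}. {Suc i..Suc m}). c j * (z ^ i * cnj z ^ (m - i)))"
        by (rule sum.reindex_bij_witness[of _ "\<lambda>(i, j). (j, i)" "\<lambda>(j, i). (i, j)"]) auto
      also have "\<dots> = (\<Sum>i\<le>m. \<Sum>j\<in>{Suc i..Suc m}. c j * (z ^ i * cnj z ^ (m - i)))"
        by (rule sum.Sigma[symmetric]) auto
      finally show ?thesis .
    qed
    also have "(z - cnj z) * (\<Sum>i\<le>m. \<Sum>j\<in>{Suc i..Suc m}. c j * (z ^ i * cnj z ^ (m - i))) = of_real (Im z) * F1 z"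
    proof -
      have zc: "z - cnj z = 2 * \<i> * of_real (Im z)" by (simp add: complex_eq_iff)
      show ?thesis unfolding zc F1_def d_def
        by (simp only: sum_distrib_left sum_distrib_right mult_ac)
    qed
    finally show ?thesis .
  qed
  moreover have aa: "a * (cnj a * z) = z" for z
    using a(1) complex_norm_square[of a] by (simp flip: mult.assoc)
  ultimately have "F z = of_real (Im (z * cnj a)) * F1 (cnj a * z)" for z
    by (metis mult.commute)
  moreover have "homogeneous_polynomial m F1" unfolding homogeneous_polynomial_def F1_def by blast
  ultimately show ?thesis using that homogeneous_polynomial_rotate by blast
qed

lemma isCont_homogeneous_polynomial:
  assumes "homogeneous_polynomial m F" shows "isCont F z"
proof -
  obtain c where c: "F = (\<lambda>z. \<Sum>j\<le>m. c j * z ^ j * cnj z ^ (m - j))"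
    using assms unfolding homogeneous_polynomial_def by blast
  show ?thesis unfolding c by (intro continuous_intros)
qed

text \<open>One line of zeros is split off at a time, with multiplicity, until no zero off
  \<open>0\<close> is left; the nonzero value at \<open>z1\<close> survives each division. The
  quotient has to stay real for the induction.\<close>

lemma homogeneous_polynomial_linear_factors:
  assumes "homogeneous_polynomial m F" "F z1 \<noteq> 0" "\<And>z. F z \<in> \<real>"
  obtains as Q l where "homogeneous_polynomial l Q" "\<And>z. z \<noteq> 0 \<Longrightarrow> Q z \<noteq> 0" "\<And>z. Q z \<in> \<real>"
    "\<And>a. a \<in> set as \<Longrightarrow> norm a = 1" "\<And>z. F z = of_real (\<Prod>a\<leftarrow>as. Im (z * cnj a)) * Q z" "m = l + length as"
  using assms
proof (induction m arbitrary: F thesis)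
  case 0
  then obtain c where c: "\<And>z. F z = c" by (auto simp: homogeneous_polynomial_def)
  show ?case by (rule 0(1)[of 0 F "[]"]) (use 0 c in auto)
next
  case (Suc m)
  show ?case
  proof (cases "\<exists>z. z \<noteq> 0 \<and> F z = 0")
    case False
    then show ?thesis by (intro Suc.prems(1)[of "Suc m" F "[]"]) (use Suc.prems in auto)
  next
    case True
    then obtain z where z: "z \<noteq> 0" "F z = 0" by blast
    define a where "a = z / of_real (norm z)"
    have a: "norm a = 1" using z by (simp add: a_def norm_divide)
    have "F a = 0"
    proof -
      obtain c where c: "\<And>z. F z = (\<Sum>j\<le>Suc m. c j * z ^ j * cnj z ^ (Suc m - j))"
        using Suc.prems(2) unfolding homogeneous_polynomial_def by blast
      have "F a * of_real (norm z) ^ Suc m = F z"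
        unfolding c sum_distrib_right
      proof (rule sum.cong[OF refl])
        fix j assume "j \<in> {..Suc m}"
        then have e: "(of_real (norm z) :: complex) ^ Suc m = of_real (norm z) ^ j * of_real (norm z) ^ (Suc m - j)"
          by (simp flip: power_add)
        show "c j * a ^ j * cnj a ^ (Suc m - j) * of_real (norm z) ^ Suc m = c j * z ^ j * cnj z ^ (Suc m - j)"
          unfolding e using z(1) by (simp add: a_def power_divide)
      qed
      then show ?thesis using z by simp
    qed
    then obtain F1 where F1: "homogeneous_polynomial m F1" "\<And>z. F z = of_real (Im (z * cnj a)) * F1 z"
      using homogeneous_polynomial_factor[OF Suc.prems(2) a] by blast
    have F1z1: "F1 z1 \<noteq> 0" using Suc.prems(3) F1(2) by auto
    have off: "F1 z \<in> \<real>" if "Im (z * cnj a) \<noteq> 0" for z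
    proof -
      define r where "r = Im (z * cnj a)"
      have "r \<noteq> 0" using that unfolding r_def .
      then have "F1 z = F z / of_real r" using F1(2)[of z, folded r_def] by simp
      then show ?thesis using Suc.prems(4)[of z] by simp
    qed
    have real: "F1 z \<in> \<real>" for z
    proof (cases "Im (z * cnj a) = 0")
      case True
      \<comment> \<open>Points off the line \<open>Im (z * cnj a) = 0\<close> converging to
        \<open>z\<close>; there the quotient is real by division, and the reals are closed.\<close>
      define g where "g = (\<lambda>n. z + \<i> * of_real (1 / real (Suc n)) * a)"
      have "g \<longlonglongrightarrow> z + \<i> * of_real 0 * a"
        unfolding g_def by (intro tendsto_intros LIMSEQ_Suc[OF lim_const_over_n])
      then have lim: "(\<lambda>n. F1 (g n)) \<longlonglongrightarrow> F1 z"
        using isCont_tendsto_compose[OF isCont_homogeneous_polynomial[OF F1(1)]] by simp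
      have "Im (g n * cnj a) \<noteq> 0" for n
      proof -
        have "g n * cnj a = z * cnj a + \<i> * of_real (1 / real (Suc n)) * (a * cnj a)" by (simp add: g_def algebra_simps)
        also have "a * cnj a = 1" using a complex_norm_square[of a] by simp
        finally show ?thesis using True by simp
      qed
      then show ?thesis by (intro closed_sequentially[OF closed_complex_Reals _ lim]) (simp add: off)
    qed (rule off)
    obtain l Q as where IH: "homogeneous_polynomial l Q" "\<And>z. z \<noteq> 0 \<Longrightarrow> Q z \<noteq> 0" "\<And>z. Q z \<in> \<real>"
      "\<And>a. a \<in> set as \<Longrightarrow> norm a = 1" "\<And>z. F1 z = of_real (\<Prod>a\<leftarrow>as. Im (z * cnj a)) * Q z" "m = l + length as"
    proof (rule Suc.IH[OF _ F1(1) F1z1 real])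
      fix l Q as
      assume "homogeneous_polynomial l Q" "\<And>z. z \<noteq> 0 \<Longrightarrow> Q z \<noteq> 0" "\<And>z. Q z \<in> \<real>"
        "\<And>a. a \<in> set as \<Longrightarrow> norm a = 1" "\<And>z. F1 z = of_real (\<Prod>a\<leftarrow>as. Im (z * cnj a)) * Q z" "m = l + length as"
      then show thesis by (rule that)
    qed
    show ?thesis
      by (rule Suc.prems(1)[of l Q "a # as"]) (use IH F1 a in auto)
  qed
qed

text \<open>The same \<open>gxy\<close> appears in the derivatives of \<open>gx\<close> and of
  \<open>gy\<close>, so symmetry of second derivatives is carried along; the vanishing mean of the
  Poisson bracket rests on it.\<close>

definition second_partials :: "(complex \<Rightarrow> 'a::real_normed_algebra) \<Rightarrow> (complex \<Rightarrow> 'a) \<Rightarrow> (complex \<Rightarrow> 'a) \<Rightarrow>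
    (complex \<Rightarrow> 'a) \<Rightarrow> (complex \<Rightarrow> 'a) \<Rightarrow> (complex \<Rightarrow> 'a) \<Rightarrow> bool" where
  "second_partials g gx gy gxx gxy gyy \<longleftrightarrow>
     (\<forall>z. (g has_derivative (\<lambda>k. Re k *\<^sub>R gx z + Im k *\<^sub>R gy z)) (at z)) \<and>
     (\<forall>z. (gx has_derivative (\<lambda>k. Re k *\<^sub>R gxx z + Im k *\<^sub>R gxy z)) (at z)) \<and>
     (\<forall>z. (gy has_derivative (\<lambda>k. Re k *\<^sub>R gxy z + Im k *\<^sub>R gyy z)) (at z)) \<and>
     continuous_on UNIV gxx \<and> continuous_on UNIV gxy \<and> continuous_on UNIV gyy"

definition twice_smooth :: "(complex \<Rightarrow> 'a::real_normed_algebra) \<Rightarrow> bool" where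
  "twice_smooth g \<longleftrightarrow> (\<exists>gx gy gxx gxy gyy. second_partials g gx gy gxx gxy gyy)"

lemma twice_smooth_const: "twice_smooth (\<lambda>z. c)"
  unfolding twice_smooth_def second_partials_def by (intro exI[of _ "\<lambda>_. 0"]) auto

lemma twice_smooth_linear:
  assumes "bounded_linear L" shows "twice_smooth L"
proof -
  have "(L has_derivative (\<lambda>k. Re k *\<^sub>R L 1 + Im k *\<^sub>R L \<i>)) (at z)" for z
  proof (rule has_derivative_eq_rhs[OF bounded_linear_imp_has_derivative[OF assms]], rule ext)
    fix k :: complex
    have "k = Re k *\<^sub>R 1 + Im k *\<^sub>R \<i>" by (simp add: complex_eq_iff)
    then show "L k = Re k *\<^sub>R L 1 + Im k *\<^sub>R L \<i>"
      using bounded_linear.linear[OF assms] by (metis linear_add linear_cmul)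
  qed
  then show ?thesis unfolding twice_smooth_def second_partials_def
    by (intro exI[of _ "\<lambda>_. L 1"] exI[of _ "\<lambda>_. L \<i>"] exI[of _ "\<lambda>_. 0"]) auto
qed

lemma twice_smooth_bounded_linear:
  assumes L: "bounded_linear L" and g: "twice_smooth g" shows "twice_smooth (\<lambda>z. L (g z))"
proof -
  obtain gx gy gxx gxy gyy where s: "second_partials g gx gy gxx gxy gyy" using g unfolding twice_smooth_def by blast
  have d: "((\<lambda>z. L (h z)) has_derivative (\<lambda>k. Re k *\<^sub>R L (hx z) + Im k *\<^sub>R L (hy z))) (at z)"
    if "(h has_derivative (\<lambda>k. Re k *\<^sub>R hx z + Im k *\<^sub>R hy z)) (at z)" for h hx hy z
    using bounded_linear.has_derivative[OF L that]
    by (rule has_derivative_eq_rhs) (simp add: fun_eq_iff linear_add linear_cmul bounded_linear.linear[OF L])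
  have "second_partials (\<lambda>z. L (g z)) (\<lambda>z. L (gx z)) (\<lambda>z. L (gy z)) (\<lambda>z. L (gxx z)) (\<lambda>z. L (gxy z)) (\<lambda>z. L (gyy z))"
    using s unfolding second_partials_def by (intro conjI allI d bounded_linear.continuous_on[OF L]) blast+
  then show ?thesis unfolding twice_smooth_def by blast
qed

lemma twice_smooth_add:
  assumes "twice_smooth g" "twice_smooth h" shows "twice_smooth (\<lambda>z. g z + h z)"
proof -
  obtain gx gy gxx gxy gyy where g: "second_partials g gx gy gxx gxy gyy" using assms(1) unfolding twice_smooth_def by blast
  obtain hx hy hxx hxy hyy where h: "second_partials h hx hy hxx hxy hyy" using assms(2) unfolding twice_smooth_def by blast
  have d: "((\<lambda>z. p z + q z) has_derivative (\<lambda>k. Re k *\<^sub>R (px z + qx z) + Im k *\<^sub>R (py z + qy z))) (at z)"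
    if "(p has_derivative (\<lambda>k. Re k *\<^sub>R px z + Im k *\<^sub>R py z)) (at z)" "(q has_derivative (\<lambda>k. Re k *\<^sub>R qx z + Im k *\<^sub>R qy z)) (at z)"
    for p px py q qx qy :: "complex \<Rightarrow> 'a" and z
    by (rule has_derivative_eq_rhs[OF has_derivative_add[OF that]]) (simp add: fun_eq_iff algebra_simps)
  have "second_partials (\<lambda>z. g z + h z) (\<lambda>z. gx z + hx z) (\<lambda>z. gy z + hy z) (\<lambda>z. gxx z + hxx z) (\<lambda>z. gxy z + hxy z) (\<lambda>z. gyy z + hyy z)"
    using g h unfolding second_partials_def by (intro conjI allI d continuous_on_add) blast+
  then show ?thesis unfolding twice_smooth_def by blast
qed

lemma twice_smooth_mult:
  assumes "twice_smooth g" "twice_smooth h" shows "twice_smooth (\<lambda>z. g z * h z)"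
proof -
  obtain gx gy gxx gxy gyy where g: "second_partials g gx gy gxx gxy gyy" using assms(1) unfolding twice_smooth_def by blast
  obtain hx hy hxx hxy hyy where h: "second_partials h hx hy hxx hxy hyy" using assms(2) unfolding twice_smooth_def by blast
  have d: "((\<lambda>z. p z * q z) has_derivative (\<lambda>k. Re k *\<^sub>R (px * q z + p z * qx) + Im k *\<^sub>R (py * q z + p z * qy))) (at z)"
    if "(p has_derivative (\<lambda>k. Re k *\<^sub>R px + Im k *\<^sub>R py)) (at z)" "(q has_derivative (\<lambda>k. Re k *\<^sub>R qx + Im k *\<^sub>R qy)) (at z)"
    for p q :: "complex \<Rightarrow> 'a" and px py qx qy z
    by (rule has_derivative_eq_rhs[OF has_derivative_mult[OF that]]) (simp add: fun_eq_iff algebra_simps)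
  have dd: "((\<lambda>z. p1 z * q1 z + p2 z * q2 z) has_derivative (\<lambda>k. Re k *\<^sub>R X + Im k *\<^sub>R Y)) (at z)"
    if "(p1 has_derivative (\<lambda>k. Re k *\<^sub>R p1x + Im k *\<^sub>R p1y)) (at z)" "(q1 has_derivative (\<lambda>k. Re k *\<^sub>R q1x + Im k *\<^sub>R q1y)) (at z)"
      "(p2 has_derivative (\<lambda>k. Re k *\<^sub>R p2x + Im k *\<^sub>R p2y)) (at z)" "(q2 has_derivative (\<lambda>k. Re k *\<^sub>R q2x + Im k *\<^sub>R q2y)) (at z)"
      "X = (p1x * q1 z + p1 z * q1x) + (p2x * q2 z + p2 z * q2x)" "Y = (p1y * q1 z + p1 z * q1y) + (p2y * q2 z + p2 z * q2y)"
    for p1 q1 p2 q2 :: "complex \<Rightarrow> 'a" and p1x p1y q1x q1y p2x p2y q2x q2y X Y z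
    unfolding that(5,6)
    by (rule has_derivative_eq_rhs[OF has_derivative_add[OF d[OF that(1,2)] d[OF that(3,4)]]]) (simp add: fun_eq_iff algebra_simps)
  have D: "(g has_derivative (\<lambda>k. Re k *\<^sub>R gx z + Im k *\<^sub>R gy z)) (at z)" "(gx has_derivative (\<lambda>k. Re k *\<^sub>R gxx z + Im k *\<^sub>R gxy z)) (at z)"
     "(gy has_derivative (\<lambda>k. Re k *\<^sub>R gxy z + Im k *\<^sub>R gyy z)) (at z)" "(h has_derivative (\<lambda>k. Re k *\<^sub>R hx z + Im k *\<^sub>R hy z)) (at z)"
     "(hx has_derivative (\<lambda>k. Re k *\<^sub>R hxx z + Im k *\<^sub>R hxy z)) (at z)" "(hy has_derivative (\<lambda>k. Re k *\<^sub>R hxy z + Im k *\<^sub>R hyy z)) (at z)" for z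
    using g h unfolding second_partials_def by blast+
  have c: "continuous_on UNIV gxx" "continuous_on UNIV gxy" "continuous_on UNIV gyy" "continuous_on UNIV hxx" "continuous_on UNIV hxy" "continuous_on UNIV hyy"
    using g h unfolding second_partials_def by blast+
  have c': "continuous_on UNIV g" "continuous_on UNIV gx" "continuous_on UNIV gy" "continuous_on UNIV h" "continuous_on UNIV hx" "continuous_on UNIV hy"
    using has_derivative_continuous[OF D(1)] has_derivative_continuous[OF D(2)] has_derivative_continuous[OF D(3)]
      has_derivative_continuous[OF D(4)] has_derivative_continuous[OF D(5)] has_derivative_continuous[OF D(6)]
    by (auto intro!: continuous_at_imp_continuous_on)
  have "second_partials (\<lambda>z. g z * h z) (\<lambda>z. gx z * h z + g z * hx z) (\<lambda>z. gy z * h z + g z * hy z)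
      (\<lambda>z. (gxx z * h z + gx z * hx z) + (gx z * hx z + g z * hxx z))
      (\<lambda>z. (gxy z * h z + gx z * hy z) + (gy z * hx z + g z * hxy z))
      (\<lambda>z. (gyy z * h z + gy z * hy z) + (gy z * hy z + g z * hyy z))"
    unfolding second_partials_def
  proof (intro conjI allI)
    fix z
    show "((\<lambda>z. g z * h z) has_derivative (\<lambda>k. Re k *\<^sub>R (gx z * h z + g z * hx z) + Im k *\<^sub>R (gy z * h z + g z * hy z))) (at z)"
      by (rule d[OF D(1) D(4)])
    show "((\<lambda>z. gx z * h z + g z * hx z) has_derivative (\<lambda>k. Re k *\<^sub>R (gxx z * h z + gx z * hx z + (gx z * hx z + g z * hxx z))
        + Im k *\<^sub>R (gxy z * h z + gx z * hy z + (gy z * hx z + g z * hxy z)))) (at z)"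
      by (rule dd[OF D(2) D(4) D(1) D(5)]) auto
    show "((\<lambda>z. gy z * h z + g z * hy z) has_derivative (\<lambda>k. Re k *\<^sub>R (gxy z * h z + gx z * hy z + (gy z * hx z + g z * hxy z))
        + Im k *\<^sub>R (gyy z * h z + gy z * hy z + (gy z * hy z + g z * hyy z)))) (at z)"
      by (rule dd[OF D(3) D(4) D(1) D(6)]) (auto simp: algebra_simps)
  qed (intro continuous_on_add continuous_on_mult c c')+
  then show ?thesis unfolding twice_smooth_def by blast
qed

lemma twice_smooth_sum: "(\<And>i. i \<in> I \<Longrightarrow> twice_smooth (g i)) \<Longrightarrow> twice_smooth (\<lambda>z. \<Sum>i\<in>I. g i z)"
  by (induction I rule: infinite_finite_induct) (auto intro: twice_smooth_const twice_smooth_add)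

lemma twice_smooth_power:
  fixes g :: "complex \<Rightarrow> 'a::real_normed_algebra_1"
  shows "twice_smooth g \<Longrightarrow> twice_smooth (\<lambda>z. g z ^ n)"
  by (induction n) (auto intro: twice_smooth_const twice_smooth_mult)

lemma twice_smooth_homogeneous_polynomial:
  assumes "homogeneous_polynomial m F" shows "twice_smooth F"
proof -
  obtain c where c: "F = (\<lambda>z. \<Sum>j\<le>m. c j * z ^ j * cnj z ^ (m - j))"
    using assms unfolding homogeneous_polynomial_def by blast
  show ?thesis unfolding c
    by (intro twice_smooth_sum twice_smooth_mult twice_smooth_const twice_smooth_power twice_smooth_linear bounded_linear_ident bounded_linear_cnj)
qed

section \<open>Products of real linear forms and their angular derivatives\<close>

primrec linprod :: "complex list \<Rightarrow> complex \<Rightarrow> real" where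
  "linprod [] z = 1"
| "linprod (a # as) z = Im (z * cnj a) * linprod as z"

primrec linprod1 :: "complex list \<Rightarrow> complex \<Rightarrow> real" where
  "linprod1 [] z = 0"
| "linprod1 (a # as) z = Re (z * cnj a) * linprod as z + Im (z * cnj a) * linprod1 as z"

primrec linprod2 :: "complex list \<Rightarrow> complex \<Rightarrow> real" where
  "linprod2 [] z = 0"
| "linprod2 (a # as) z = - Im (z * cnj a) * linprod as z + 2 * Re (z * cnj a) * linprod1 as z + Im (z * cnj a) * linprod2 as z"

text \<open>\<open>linprod1\<close> and \<open>linprod2\<close> are the first two angular derivatives of \<open>linprod\<close>. The quantity below is
  \<open>- linprod\<^sup>2\<close> times the second angular derivative of \<open>ln |linprod|\<close>, which is a sum of squares.\<close>

lemma linprod_wronskian: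
  shows "(linprod1 (a # as) z)\<^sup>2 - linprod (a # as) z * linprod2 (a # as) z
    = (norm (z * cnj a))\<^sup>2 * (linprod as z)\<^sup>2 + (Im (z * cnj a))\<^sup>2 * ((linprod1 as z)\<^sup>2 - linprod as z * linprod2 as z)"
  unfolding cmod_power2 by (simp add: power2_eq_square algebra_simps del: complex_cnj_mult times_complex.sel)

lemma linprod_wronskian_nonneg: "0 \<le> (linprod1 as z)\<^sup>2 - linprod as z * linprod2 as z"
proof (induction as)
  case (Cons a as)
  then show ?case unfolding linprod_wronskian by (intro add_nonneg_nonneg mult_nonneg_nonneg) auto
qed simp

text \<open>Both summands of the recursion are nonnegative, so both vanish: the first gives a zero
  of the shorter product, the second a further zero factor or a zero of \<open>linprod1\<close>.
  Such points lie on lines of zeros of multiplicity at least 2.\<close>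

lemma linprod_wronskian_zero:
  assumes "as \<noteq> []" "\<And>a. a \<in> set as \<Longrightarrow> a \<noteq> 0" "z \<noteq> 0" "(linprod1 as z)\<^sup>2 - linprod as z * linprod2 as z = 0"
  shows "linprod as z = 0 \<and> linprod1 as z = 0"
  using assms
proof (induction as)
  case (Cons a as)
  have "(norm (z * cnj a))\<^sup>2 * (linprod as z)\<^sup>2 + (Im (z * cnj a))\<^sup>2 * ((linprod1 as z)\<^sup>2 - linprod as z * linprod2 as z) = 0"
    using Cons.prems(4) unfolding linprod_wronskian .
  moreover have "0 \<le> (norm (z * cnj a))\<^sup>2 * (linprod as z)\<^sup>2"
    "0 \<le> (Im (z * cnj a))\<^sup>2 * ((linprod1 as z)\<^sup>2 - linprod as z * linprod2 as z)"
    using linprod_wronskian_nonneg by (auto intro!: mult_nonneg_nonneg)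
  ultimately have 0: "(norm (z * cnj a))\<^sup>2 * (linprod as z)\<^sup>2 = 0"
    "(Im (z * cnj a))\<^sup>2 * ((linprod1 as z)\<^sup>2 - linprod as z * linprod2 as z) = 0" by (simp_all add: add_nonneg_eq_0_iff)
  have "norm (z * cnj a) \<noteq> 0" using Cons.prems(2)[of a] Cons.prems(3) by simp
  then have P: "linprod as z = 0" using 0(1) by simp
  then have "as \<noteq> []" by auto
  have "Im (z * cnj a) = 0 \<or> linprod1 as z = 0"
    using 0(2) Cons.IH[OF \<open>as \<noteq> []\<close>] Cons.prems by (simp only: mult_eq_0_iff power_eq_0_iff) auto
  then show ?case using P by auto
qed simp

text \<open>The direction \<open>\<i> * z\<close> is angular and \<open>z\<close> is radial; in the
  latter, Euler's identity for forms of degree \<open>length as\<close> appears.\<close>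

lemma linprod_angular_derivative:
  "\<exists>D. (linprod as has_derivative D) (at z) \<and> D (\<i> * z) = linprod1 as z \<and> D z = length as * linprod as z"
  "\<exists>D. (linprod1 as has_derivative D) (at z) \<and> D (\<i> * z) = linprod2 as z \<and> D z = length as * linprod1 as z"
proof (induction as)
  case Nil
  show "\<exists>D. (linprod [] has_derivative D) (at z) \<and> D (\<i> * z) = linprod1 [] z \<and> D z = length [] * linprod [] z"
    by (intro exI[of _ "\<lambda>_. 0"]) (simp add: fun_eq_iff linprod.simps(1)[abs_def])
  show "\<exists>D. (linprod1 [] has_derivative D) (at z) \<and> D (\<i> * z) = linprod2 [] z \<and> D z = length [] * linprod1 [] z"
    by (intro exI[of _ "\<lambda>_. 0"]) (simp add: fun_eq_iff linprod1.simps(1)[abs_def])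
next
  case (Cons a as)
  obtain D where D: "(linprod as has_derivative D) (at z)" "D (\<i> * z) = linprod1 as z" "D z = length as * linprod as z"
    using Cons(1) by blast
  obtain E where E: "(linprod1 as has_derivative E) (at z)" "E (\<i> * z) = linprod2 as z" "E z = length as * linprod1 as z"
    using Cons(2) by blast
  have I: "((\<lambda>z. Im (z * cnj a)) has_derivative (\<lambda>h. Im (h * cnj a))) (at z)"
    "((\<lambda>z. Re (z * cnj a)) has_derivative (\<lambda>h. Re (h * cnj a))) (at z)"
    by (auto intro!: derivative_eq_intros)
  have 1: "linprod (a # as) = (\<lambda>z. Im (z * cnj a) * linprod as z)" by (simp add: fun_eq_iff)
  have 2: "linprod1 (a # as) = (\<lambda>z. Re (z * cnj a) * linprod as z + Im (z * cnj a) * linprod1 as z)" by (simp add: fun_eq_iff)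
  show "\<exists>D. (linprod (a # as) has_derivative D) (at z) \<and> D (\<i> * z) = linprod1 (a # as) z \<and> D z = length (a # as) * linprod (a # as) z"
    unfolding 1 by (rule exI, rule conjI, rule has_derivative_mult[OF I(1) D(1)]) (simp add: D algebra_simps)
  show "\<exists>D. (linprod1 (a # as) has_derivative D) (at z) \<and> D (\<i> * z) = linprod2 (a # as) z \<and> D z = length (a # as) * linprod1 (a # as) z"
    unfolding 2
    by (rule exI, rule conjI, rule has_derivative_add[OF has_derivative_mult[OF I(2) D(1)] has_derivative_mult[OF I(1) E(1)]])
      (simp add: D E algebra_simps)
qed

lemma twice_smooth_linprod: "twice_smooth (linprod as)" "twice_smooth (linprod1 as)"
proof (induction as)
  case Nil
  show "twice_smooth (linprod [])" "twice_smooth (linprod1 [])"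
    using twice_smooth_const[of "1::real"] twice_smooth_const[of "0::real"] by (simp_all add: linprod.simps(1)[abs_def] linprod1.simps(1)[abs_def])
next
  case (Cons a as)
  have I: "twice_smooth (\<lambda>z. Im (z * cnj a))" "twice_smooth (\<lambda>z. Re (z * cnj a))"
    by (intro twice_smooth_linear bounded_linear_compose[OF bounded_linear_Im] bounded_linear_compose[OF bounded_linear_Re] bounded_linear_mult_left)+
  show "twice_smooth (linprod (a # as))"
    using twice_smooth_mult[OF I(1) Cons(1)] by (simp add: linprod.simps(2)[abs_def])
  show "twice_smooth (linprod1 (a # as))"
    using twice_smooth_add[OF twice_smooth_mult[OF I(2) Cons(1)] twice_smooth_mult[OF I(1) Cons(2)]] by (simp add: linprod1.simps(2)[abs_def])
qed

section \<open>Homogeneous functions and their derivatives\<close>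

lemma homogeneous_lower_bound:
  fixes E :: "complex \<Rightarrow> real"
  assumes "continuous_on UNIV E" "\<And>t z. t > 0 \<Longrightarrow> E (of_real t * z) = t ^ d * E z" "d \<noteq> 0" "\<And>z. z \<noteq> 0 \<Longrightarrow> 0 < E z"
  obtains c where "c > 0" "\<And>z. c * norm z ^ d \<le> E z"
proof -
  have "compact (sphere (0::complex) 1)" "sphere (0::complex) 1 \<noteq> {}" by auto
  then obtain w where w: "norm w = 1" "\<And>z. norm z = 1 \<Longrightarrow> E w \<le> E z"
    using continuous_attains_inf[of "sphere (0::complex) 1" E] continuous_on_subset[OF assms(1)] by auto
  have E0: "E 0 = 0"
  proof -
    have "E 0 = 2 ^ d * E 0" using assms(2)[of 2 0] by simp
    moreover have "(2::real) ^ d > 1" using assms(3) by simp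
    ultimately show ?thesis by auto
  qed
  show ?thesis
  proof (rule that)
    have "w \<noteq> 0" using w(1) by auto
    then show "E w > 0" by (rule assms(4))
    fix z show "E w * norm z ^ d \<le> E z"
    proof (cases "z = 0")
      case False
      have "E z = norm z ^ d * E (z / of_real (norm z))" using assms(2)[of "norm z" "z / of_real (norm z)"] False by simp
      moreover have "E w \<le> E (z / of_real (norm z))" using False by (intro w(2)) (simp add: norm_divide)
      ultimately show ?thesis using mult_left_mono[of _ _ "norm z ^ d"] by (simp add: mult.commute[of _ "norm z ^ d"])
    qed (use E0 assms(3) in \<open>simp add: power_0_left\<close>)
  qed
qed

lemma homogeneous_upper_bound:
  fixes E :: "complex \<Rightarrow> real"
  assumes "continuous_on UNIV E" "\<And>t z. t > 0 \<Longrightarrow> E (of_real t * z) = t ^ d * E z" "d \<noteq> 0"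
  obtains C where "C > 0" "\<And>z. E z \<le> C * norm z ^ d"
proof -
  have cs: "compact (sphere (0::complex) 1)" "sphere (0::complex) 1 \<noteq> {}" "continuous_on (sphere 0 1) E"
    using continuous_on_subset[OF assms(1)] by auto
  obtain w where "\<forall>z\<in>sphere (0::complex) 1. E z \<le> E w" using continuous_attains_sup[OF cs] by blast
  then have w: "E z \<le> E w" if "norm z = 1" for z using that by simp
  have E0: "E 0 = 0"
  proof -
    have "E 0 = 2 ^ d * E 0" using assms(2)[of 2 0] by simp
    moreover have "(2::real) ^ d > 1" using assms(3) by simp
    ultimately show ?thesis by auto
  qed
  show ?thesis
  proof (rule that[of "\<bar>E w\<bar> + 1"])
    fix z show "E z \<le> (\<bar>E w\<bar> + 1) * norm z ^ d"
    proof (cases "z = 0")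
      case False
      have "E z = norm z ^ d * E (z / of_real (norm z))" using assms(2)[of "norm z" "z / of_real (norm z)"] False by simp
      moreover have "E (z / of_real (norm z)) \<le> \<bar>E w\<bar> + 1" using w[of "z / of_real (norm z)"] False by (simp add: norm_divide)
      ultimately show ?thesis using mult_left_mono[of _ _ "norm z ^ d"] by (simp add: mult.commute[of _ "norm z ^ d"])
    qed (use E0 assms(3) in \<open>simp add: power_0_left\<close>)
  qed simp
qed

text \<open>Differentiating the homogeneity relation in \<open>z\<close> lowers the degree by
  one.\<close>

lemma partial_derivatives_homogeneous:
  fixes g gx gy :: "complex \<Rightarrow> real"
  assumes g: "\<And>z. (g has_derivative (\<lambda>k. Re k * gx z + Im k * gy z)) (at z)"
    and hom: "\<And>t z. t > 0 \<Longrightarrow> g (of_real t * z) = t ^ Suc n * g z" and t: "t > 0"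
  shows "gx (of_real t * z) = t ^ n * gx z" "gy (of_real t * z) = t ^ n * gy z"
proof -
  have 1: "((\<lambda>z. of_real t * z) has_derivative (\<lambda>k. of_real t * k)) (at z)" by (auto intro!: derivative_eq_intros)
  have 2: "((\<lambda>z. g (of_real t * z)) has_derivative (\<lambda>k. Re (of_real t * k) * gx (of_real t * z) + Im (of_real t * k) * gy (of_real t * z))) (at z)"
    by (rule has_derivative_compose[OF 1 g])
  have 3: "((\<lambda>z. g (of_real t * z)) has_derivative (\<lambda>k. t ^ Suc n * (Re k * gx z + Im k * gy z))) (at z)"
    unfolding hom[OF t] by (intro has_derivative_mult_right g)
  have "Re (of_real t * k) * gx (of_real t * z) + Im (of_real t * k) * gy (of_real t * z) = t ^ Suc n * (Re k * gx z + Im k * gy z)" for k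
    using fun_cong[OF has_derivative_unique[OF 2 3]] .
  from this[of 1] this[of \<i>] show "gx (of_real t * z) = t ^ n * gx z" "gy (of_real t * z) = t ^ n * gy z"
    using t by simp_all
qed

lemma euler_identity:
  fixes g :: "complex \<Rightarrow> real"
  assumes g: "(g has_derivative D) (at z)" and hom: "\<And>t. t > 0 \<Longrightarrow> g (of_real t * z) = t ^ n * g z"
  shows "D z = n * g z"
proof -
  have 1: "((\<lambda>t. of_real t * z) has_derivative (\<lambda>s. of_real s * z)) (at (1::real))" by (auto intro!: derivative_eq_intros)
  have g': "(g has_derivative D) (at (of_real 1 * z))" using g by simp
  have 2: "((\<lambda>t. g (of_real t * z)) has_derivative (\<lambda>s. D (of_real s * z))) (at (1::real))"
    by (rule has_derivative_compose[OF 1 g'])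
  have 3: "((\<lambda>t. g (of_real t * z)) has_derivative (\<lambda>s. s * (n * g z))) (at (1::real))"
  proof (rule has_derivative_transform_within_open[where s = "{0<..}" and f = "\<lambda>t. t ^ n * g z"])
    show "((\<lambda>t. t ^ n * g z) has_derivative (\<lambda>s. s * (n * g z))) (at (1::real))"
      by (auto intro!: derivative_eq_intros)
  qed (auto simp: hom)
  have "D (of_real s * z) = s * (n * g z)" for s using fun_cong[OF has_derivative_unique[OF 2 3]] .
  from this[of 1] show ?thesis by simp
qed

lemma linprod_scale: "linprod as (of_real t * z) = t ^ length as * linprod as z"
  by (induction as) (simp_all add: algebra_simps)

lemma linprod1_scale: "linprod1 as (of_real t * z) = t ^ length as * linprod1 as z"
  by (induction as) (simp_all add: linprod_scale, simp add: algebra_simps)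

lemma linprod_eq_prod_list: "linprod as z = (\<Prod>a\<leftarrow>as. Im (z * cnj a))"
  by (induction as) simp_all

text \<open>If \<open>F\<close> vanishes on some line, it is the product of linear forms, with product \<open>P\<close>, and of a form \<open>q\<close>
  without zeros. Then \<open>G = - q \<partial>\<^sub>\<theta>P\<close> works, because the bracket \<open>{F, G}\<close> is a multiple of
  \<open>q\<^sup>2 ((\<partial>\<^sub>\<theta>P)\<^sup>2 - P \<partial>\<^sub>\<theta>\<^sup>2P)\<close>.\<close>

lemma exists_transversal_form:
  assumes hp: "homogeneous_polynomial m F" and m: "2 \<le> m" and real: "\<And>z. F z \<in> \<real>"
    and nz: "F z1 \<noteq> 0" and zero: "z2 \<noteq> 0" "F z2 = 0"
    and ncrit: "\<And>z. z \<noteq> 0 \<Longrightarrow> \<not> F field_differentiable at z"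
  obtains ux uy Gx Gy Gxx Gxy Gyy :: "complex \<Rightarrow> real" and c C where "c > 0" "C > 0"
    "\<And>z. ((\<lambda>z. Re (F z)) has_derivative (\<lambda>k. Re k * ux z + Im k * uy z)) (at z)"
    "continuous_on UNIV ux" "continuous_on UNIV uy"
    "\<And>z. (Gx has_derivative (\<lambda>k. Re k * Gxx z + Im k * Gxy z)) (at z)"
    "\<And>z. (Gy has_derivative (\<lambda>k. Re k * Gxy z + Im k * Gyy z)) (at z)"
    "continuous_on UNIV Gxx" "continuous_on UNIV Gxy" "continuous_on UNIV Gyy"
    "\<And>z. (ux z)\<^sup>2 + (uy z)\<^sup>2 \<le> C * norm z ^ (2 * (m - 1))"
    "\<And>z. (Gx z)\<^sup>2 + (Gy z)\<^sup>2 \<le> C * norm z ^ (2 * (m - 1))"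
    "\<And>z. c * norm z ^ (2 * (m - 1)) \<le> ux z * Gy z - uy z * Gx z"
proof -
  obtain l Q as where Q: "homogeneous_polynomial l Q" "\<And>z. z \<noteq> 0 \<Longrightarrow> Q z \<noteq> 0" "\<And>z. Q z \<in> \<real>"
    and as: "\<And>a. a \<in> set as \<Longrightarrow> norm a = 1" and F: "\<And>z. F z = of_real (\<Prod>a\<leftarrow>as. Im (z * cnj a)) * Q z" and ml: "m = l + length as"
  proof (rule homogeneous_polynomial_linear_factors[OF hp nz real])
    fix l Q as
    assume "homogeneous_polynomial l Q" "\<And>z. z \<noteq> 0 \<Longrightarrow> Q z \<noteq> 0" "\<And>z. Q z \<in> \<real>"
      "\<And>a. a \<in> set as \<Longrightarrow> norm a = 1" "\<And>z. F z = of_real (\<Prod>a\<leftarrow>as. Im (z * cnj a)) * Q z" "m = l + length as"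
    then show thesis by (rule that)
  qed
  define q where "q z = Re (Q z)" for z
  have qQ: "Q z = of_real (q z)" for z using Q(3)[of z] by (simp add: q_def)
  have q0: "q z \<noteq> 0" if "z \<noteq> 0" for z using Q(2)[OF that] qQ[of z] by auto
  define u where "u z = linprod as z * q z" for z
  have Fu: "F z = of_real (u z)" for z unfolding F qQ u_def linprod_eq_prod_list by simp
  define G where "G z = - 1 * (q z * linprod1 as z)" for z
  \<comment> \<open>This is where the zero of \<open>F\<close> off \<open>0\<close> is needed:
    without linear factors the angular derivative of the product, and with it \<open>G\<close>,
    would vanish identically.\<close>
  have ne: "as \<noteq> []"
  proof
    assume "as = []"
    then have "F z2 = Q z2" using F[of z2] by simp
    then show False using Q(2)[OF zero(1)] zero(2) by simp
  qed
  have sq: "twice_smooth q" unfolding q_def[abs_def]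
    by (rule twice_smooth_bounded_linear[OF bounded_linear_Re twice_smooth_homogeneous_polynomial[OF Q(1)]])
  have su: "twice_smooth u" unfolding u_def[abs_def] by (intro twice_smooth_mult twice_smooth_linprod sq)
  have sG: "twice_smooth G" unfolding G_def[abs_def] by (intro twice_smooth_mult twice_smooth_const twice_smooth_linprod sq)
  obtain ux uy uxx uxy uyy where u2: "second_partials u ux uy uxx uxy uyy" using su unfolding twice_smooth_def by blast
  obtain Gx Gy Gxx Gxy Gyy where G2: "second_partials G Gx Gy Gxx Gxy Gyy" using sG unfolding twice_smooth_def by blast
  have ud: "(u has_derivative (\<lambda>k. Re k * ux z + Im k * uy z)) (at z)"
    and Gd: "(G has_derivative (\<lambda>k. Re k * Gx z + Im k * Gy z)) (at z)"
    and uxd: "(ux has_derivative (\<lambda>k. Re k * uxx z + Im k * uxy z)) (at z)"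
    and uyd: "(uy has_derivative (\<lambda>k. Re k * uxy z + Im k * uyy z)) (at z)"
    and Gxd: "(Gx has_derivative (\<lambda>k. Re k * Gxx z + Im k * Gxy z)) (at z)"
    and Gyd: "(Gy has_derivative (\<lambda>k. Re k * Gxy z + Im k * Gyy z)) (at z)" for z
    using u2 G2 unfolding second_partials_def real_scaleR_def by blast+
  have cG: "continuous_on UNIV Gxx" "continuous_on UNIV Gxy" "continuous_on UNIV Gyy"
    using G2 unfolding second_partials_def by blast+
  have c1: "continuous_on UNIV ux" "continuous_on UNIV uy" "continuous_on UNIV Gx" "continuous_on UNIV Gy"
    using has_derivative_continuous[OF uxd] has_derivative_continuous[OF uyd] has_derivative_continuous[OF Gxd] has_derivative_continuous[OF Gyd]
    by (auto intro!: continuous_at_imp_continuous_on)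
  have qs: "q (of_real t * z) = t ^ l * q z" for t z
    unfolding q_def homogeneous_polynomial_scale[OF Q(1)] by (simp flip: of_real_power)
  obtain n where n: "m = Suc n" "n \<noteq> 0" using m by (cases m) auto
  have us: "u (of_real t * z) = t ^ Suc n * u z" for t z
    unfolding u_def qs linprod_scale n(1)[symmetric] ml by (simp add: power_add)
  have Gs: "G (of_real t * z) = t ^ Suc n * G z" for t z
    unfolding G_def qs linprod1_scale n(1)[symmetric] ml by (simp add: power_add)
  note uh = partial_derivatives_homogeneous[OF ud us] and Gh = partial_derivatives_homogeneous[OF Gd Gs]
  have key: "0 < ux z * Gy z - uy z * Gx z" if z: "z \<noteq> 0" for z
  proof -
    define W where "W = (linprod1 as z)\<^sup>2 - linprod as z * linprod2 as z"
    obtain D where D: "(linprod as has_derivative D) (at z)" "D (\<i> * z) = linprod1 as z" "D z = length as * linprod as z"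
      using linprod_angular_derivative(1) by blast
    obtain E where E: "(linprod1 as has_derivative E) (at z)" "E (\<i> * z) = linprod2 as z" "E z = length as * linprod1 as z"
      using linprod_angular_derivative(2) by blast
    obtain B where B: "(q has_derivative B) (at z)"
      using sq unfolding twice_smooth_def second_partials_def by blast
    have Bz: "B z = l * q z" by (rule euler_identity[OF B qs])
    have Du': "(u has_derivative (\<lambda>h. linprod as z * B h + D h * q z)) (at z)"
      unfolding u_def[abs_def] by (rule has_derivative_mult[OF D(1) B])
    have Du: "Re h * ux z + Im h * uy z = linprod as z * B h + D h * q z" for h
      using fun_cong[OF has_derivative_unique[OF ud Du']] .
    have DG': "(G has_derivative (\<lambda>h. - 1 * (q z * E h + B h * linprod1 as z))) (at z)"
      unfolding G_def[abs_def] by (intro has_derivative_mult_right has_derivative_mult[OF B E(1)])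
    have DG: "Re h * Gx z + Im h * Gy z = - 1 * (q z * E h + B h * linprod1 as z)" for h
      using fun_cong[OF has_derivative_unique[OF Gd DG']] .
    \<comment> \<open>In the moving frame \<open>z\<close>, \<open>\<i> * z\<close> the bracket is
      the determinant of radial and angular derivatives; the terms with the angular derivative
      \<open>b\<close> of \<open>q\<close> cancel.\<close>
    define b where "b = B (\<i> * z)"
    have e1: "Re z * ux z + Im z * uy z = m * (linprod as z * q z)"
      using Du[of z] by (simp add: D Bz ml algebra_simps)
    have e2: "- Im z * ux z + Re z * uy z = linprod as z * b + linprod1 as z * q z"
      using Du[of "\<i> * z"] by (simp add: D b_def)
    have e3: "Re z * Gx z + Im z * Gy z = - (m * (q z * linprod1 as z))"
      using DG[of z] by (simp add: E Bz ml algebra_simps)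
    have e4: "- Im z * Gx z + Re z * Gy z = - (q z * linprod2 as z + b * linprod1 as z)"
      using DG[of "\<i> * z"] by (simp add: E b_def)
    have "((Re z)\<^sup>2 + (Im z)\<^sup>2) * (ux z * Gy z - uy z * Gx z) = (Re z * ux z + Im z * uy z) * (- Im z * Gx z + Re z * Gy z)
        - (- Im z * ux z + Re z * uy z) * (Re z * Gx z + Im z * Gy z)"
      by (simp add: power2_eq_square algebra_simps)
    also have "\<dots> = m * ((q z)\<^sup>2 * W)"
      unfolding e1 e2 e3 e4 W_def by (simp add: power2_eq_square algebra_simps)
    finally have eq: "(norm z)\<^sup>2 * (ux z * Gy z - uy z * Gx z) = m * ((q z)\<^sup>2 * W)" by (simp add: cmod_power2)
    \<comment> \<open>Otherwise the product and its angular derivative vanish at \<open>z\<close>,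
      hence so does the gradient of \<open>u\<close>, and \<open>F\<close> would be complex
      differentiable there.\<close>
    have "W \<noteq> 0"
    proof
      assume "W = 0"
      then have "linprod as z = 0 \<and> linprod1 as z = 0"
        using linprod_wronskian_zero[OF ne _ z] as unfolding W_def by fastforce
      then have e: "Re z * ux z + Im z * uy z = 0" "- Im z * ux z + Re z * uy z = 0" using e1 e2 by simp_all
      have "((Re z)\<^sup>2 + (Im z)\<^sup>2) * ux z = Re z * (Re z * ux z + Im z * uy z) - Im z * (- Im z * ux z + Re z * uy z)"
        "((Re z)\<^sup>2 + (Im z)\<^sup>2) * uy z = Im z * (Re z * ux z + Im z * uy z) + Re z * (- Im z * ux z + Re z * uy z)"
        by (simp_all add: power2_eq_square algebra_simps)
      then have "(norm z)\<^sup>2 * ux z = 0" "(norm z)\<^sup>2 * uy z = 0" unfolding e by (simp_all add: cmod_power2)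
      then have "ux z = 0" "uy z = 0" using z by simp_all
      then have "(u has_derivative (\<lambda>k. 0)) (at z)" using ud[of z] by simp
      from has_derivative_of_real[OF this, where 'a = complex]
      have "(F has_derivative (\<lambda>k. 0 * k)) (at z)" by (simp add: Fu[abs_def])
      then have "F field_differentiable at z" unfolding field_differentiable_def has_field_derivative_def by blast
      then show False using ncrit[OF z] by simp
    qed
    then have "0 < W" using linprod_wronskian_nonneg[of as z] by (simp add: W_def)
    then have "0 < m * ((q z)\<^sup>2 * W)" using m q0[OF z] by simp
    then show ?thesis using eq by (metis zero_less_mult_pos zero_less_power2 norm_eq_zero z zero_less_norm_iff zero_less_power)
  qed
  have sc: "(t ^ n * a) * (t ^ n * b) = t ^ (2 * n) * (a * b)" for t a b :: real by (simp add: mult_2 power_add)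
  obtain c where c: "c > 0" "\<And>z. c * norm z ^ (2 * n) \<le> ux z * Gy z - uy z * Gx z"
  proof (rule homogeneous_lower_bound[of "\<lambda>z. ux z * Gy z - uy z * Gx z" "2 * n"])
    show "continuous_on UNIV (\<lambda>z. ux z * Gy z - uy z * Gx z)" by (intro continuous_intros c1)
  qed (use key n(2) in \<open>simp_all add: uh Gh sc right_diff_distrib\<close>)
  obtain C1 where C1: "C1 > 0" "\<And>z. (ux z)\<^sup>2 + (uy z)\<^sup>2 \<le> C1 * norm z ^ (2 * n)"
  proof (rule homogeneous_upper_bound[of "\<lambda>z. (ux z)\<^sup>2 + (uy z)\<^sup>2" "2 * n"])
    show "continuous_on UNIV (\<lambda>z. (ux z)\<^sup>2 + (uy z)\<^sup>2)" by (intro continuous_intros c1)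
  qed (use n(2) in \<open>simp_all add: uh power2_eq_square sc distrib_left\<close>)
  obtain C2 where C2: "C2 > 0" "\<And>z. (Gx z)\<^sup>2 + (Gy z)\<^sup>2 \<le> C2 * norm z ^ (2 * n)"
  proof (rule homogeneous_upper_bound[of "\<lambda>z. (Gx z)\<^sup>2 + (Gy z)\<^sup>2" "2 * n"])
    show "continuous_on UNIV (\<lambda>z. (Gx z)\<^sup>2 + (Gy z)\<^sup>2)" by (intro continuous_intros c1)
  qed (use n(2) in \<open>simp_all add: Gh power2_eq_square sc distrib_left\<close>)
  have mono: "C1 * norm z ^ (2 * n) \<le> max C1 C2 * norm z ^ (2 * n)" "C2 * norm z ^ (2 * n) \<le> max C1 C2 * norm z ^ (2 * n)" for z :: complex
    by (intro mult_right_mono; simp)+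
  show ?thesis
  proof (rule that[of c "max C1 C2" ux uy Gx Gxx Gxy Gy Gyy])
    show "((\<lambda>z. Re (F z)) has_derivative (\<lambda>k. Re k * ux z + Im k * uy z)) (at z)" for z using ud by (simp add: Fu)
    show "(ux z)\<^sup>2 + (uy z)\<^sup>2 \<le> max C1 C2 * norm z ^ (2 * (m - 1))" for z
      using order_trans[OF C1(2) mono(1)] n(1) by simp
    show "(Gx z)\<^sup>2 + (Gy z)\<^sup>2 \<le> max C1 C2 * norm z ^ (2 * (m - 1))" for z
      using order_trans[OF C2(2) mono(2)] n(1) by simp
    show "c * norm z ^ (2 * (m - 1)) \<le> ux z * Gy z - uy z * Gx z" for z using c(2)[of z] n(1) by simp
  qed (use c C1 c1 Gxd Gyd cG in auto)
qed

section \<open>A nonpositive index\<close>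

text \<open>A semidefinite form without critical points off \<open>0\<close> is definite, since a
  zero would be an extremum. By Euler's identity \<open>Re (cnj z * (Fx z + \<i> * Fy z))\<close> is
  \<open>m * Re (F z)\<close>, of the full order \<open>norm z ^ m\<close>, and it dominates the
  remainder and the variation of \<open>jdet\<close> near \<open>0\<close>.\<close>

lemma (in graph_chart) leading_form_changes_sign:
  assumes p: "p \<in> U" "\<Phi> p = 0" "p \<in> S" and iso: "isolated_CR_singularity S p"
    and ind: "has_maslov_index S p n" "n \<le> 0"
    and hp: "homogeneous_polynomial m F" and m: "2 \<le> m" and real: "\<And>z. F z \<in> \<real>" and nz: "F z1 \<noteq> 0"
    and ncrit: "\<And>z. z \<noteq> 0 \<Longrightarrow> \<not> F field_differentiable at z"
    and Fd: "\<And>z. (F has_derivative (\<lambda>h. of_real (Re h) * Fx z + of_real (Im h) * Fy z)) (at z)"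
    and cF: "continuous_on UNIV Fx" "continuous_on UNIV Fy"
    and f_eq: "\<And>z. fx z = Fx z + rx z" "\<And>z. fy z = Fy z + ry z"
    and M: "M \<ge> 0" "\<And>z. z \<in> ball 0 \<delta> \<Longrightarrow> norm (rx z) \<le> M * norm z ^ m" "\<And>z. z \<in> ball 0 \<delta> \<Longrightarrow> norm (ry z) \<le> M * norm z ^ m"
  shows "\<exists>z z'. 0 < Re (F z) \<and> Re (F z') < 0"
proof (rule ccontr)
  assume "\<not> ?thesis"
  then have "(\<forall>z. 0 \<le> Re (F z)) \<or> (\<forall>z. Re (F z) \<le> 0)" by (meson not_le)
  then obtain s :: real where s: "s = 1 \<or> s = -1" "\<And>z. 0 \<le> s * Re (F z)"
    by (metis mult_1 mult_minus1 neg_0_le_iff_le)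
  obtain k where k: "m = Suc k" "k \<noteq> 0" using m by (cases m) auto
  have Fr: "F z = of_real (Re (F z))" for z using real[of z] by simp
  have gd: "((\<lambda>z. Re (F z)) has_derivative (\<lambda>h. Re h * Re (Fx z) + Im h * Re (Fy z))) (at z)" for z
    using bounded_linear.has_derivative[OF bounded_linear_Re Fd[of z]] by simp
  have Fd': "(F has_derivative (\<lambda>h. of_real (Re h * Re (Fx z) + Im h * Re (Fy z)))) (at z)" for z
    using has_derivative_of_real[OF gd[of z], where 'a = complex] Fr by simp
  have Fxy: "Fx z = of_real (Re (Fx z))" "Fy z = of_real (Re (Fy z))" for z
  proof -
    have e: "of_real (Re h) * Fx z + of_real (Im h) * Fy z = of_real (Re h * Re (Fx z) + Im h * Re (Fy z))" for h
      using fun_cong[OF has_derivative_unique[OF Fd Fd']] .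
    show "Fx z = of_real (Re (Fx z))" "Fy z = of_real (Re (Fy z))" using e[of 1] e[of \<i>] by simp_all
  qed
  have hom: "Re (F (of_real t * z)) = t ^ Suc k * Re (F z)" for t z
    unfolding homogeneous_polynomial_scale[OF hp] k(1)[symmetric] by (simp flip: of_real_power)
  note ph = partial_derivatives_homogeneous[of "\<lambda>z. Re (F z)", OF gd hom]
  have pos: "0 < s * Re (F z)" if z: "z \<noteq> 0" for z
  proof (rule ccontr)
    assume "\<not> ?thesis"
    then have 0: "s * Re (F z) = 0" using s(2)[of z] by simp
    have d: "((\<lambda>z. s * Re (F z)) has_derivative (\<lambda>h. s * (Re h * Re (Fx z) + Im h * Re (Fy z)))) (at z)"
      by (intro has_derivative_mult_right gd)
    have "(\<lambda>h. s * (Re h * Re (Fx z) + Im h * Re (Fy z))) = (\<lambda>h. 0)"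
      by (rule differential_zero_maxmin[OF _ open_UNIV d]) (use 0 s(2) in auto)
    then have e: "s * (Re h * Re (Fx z) + Im h * Re (Fy z)) = 0" for h by (rule fun_cong)
    have "Re (Fx z) = 0" "Re (Fy z) = 0" using e[of 1] e[of \<i>] s(1) by auto
    then have "Fy z = \<i> * Fx z" using Fxy[of z] by simp
    then have "F field_differentiable at z" using field_differentiable_plane[OF Fd] by blast
    then show False using ncrit[OF z] by simp
  qed
  have cF': "continuous_on UNIV (\<lambda>z. s * Re (F z))"
    using has_derivative_continuous[OF Fd] by (intro continuous_intros continuous_at_imp_continuous_on) auto
  have "\<exists>c>0. \<forall>z. c * norm z ^ m \<le> s * Re (F z)"
  proof (rule homogeneous_lower_bound[OF cF', of m])
    show "s * Re (F (of_real t * z)) = t ^ m * (s * Re (F z))" for t z unfolding hom k(1) by simp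
  qed (use m pos in auto)
  then obtain c where c: "c > 0" "\<And>z. c * norm z ^ m \<le> s * Re (F z)" by blast
  have "\<exists>K>0. \<forall>z. \<bar>Re (Fx z)\<bar> + \<bar>Re (Fy z)\<bar> \<le> K * norm z ^ k"
  proof (rule homogeneous_upper_bound[of "\<lambda>z. \<bar>Re (Fx z)\<bar> + \<bar>Re (Fy z)\<bar>" k])
    show "continuous_on UNIV (\<lambda>z. \<bar>Re (Fx z)\<bar> + \<bar>Re (Fy z)\<bar>)" by (intro continuous_intros cF)
    show "\<bar>Re (Fx (of_real t * z))\<bar> + \<bar>Re (Fy (of_real t * z))\<bar> = t ^ k * (\<bar>Re (Fx z)\<bar> + \<bar>Re (Fy z)\<bar>)" if "t > 0" for t z
      using ph[OF that, of z] that by (simp add: abs_mult distrib_left)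
  qed (use k in auto)
  then obtain K where K: "K > 0" "\<And>z. \<bar>Re (Fx z)\<bar> + \<bar>Re (Fy z)\<bar> \<le> K * norm z ^ k" by blast
  have nF: "norm (Fx z + \<i> * Fy z) \<le> K * norm z ^ k" for z
  proof -
    have "norm (Fx z + \<i> * Fy z) \<le> norm (Fx z) + norm (\<i> * Fy z)" by (rule norm_triangle_ineq)
    also have "\<dots> = \<bar>Re (Fx z)\<bar> + \<bar>Re (Fy z)\<bar>"
      using arg_cong[OF Fxy(1)[of z], of norm] arg_cong[OF Fxy(2)[of z], of norm] by (simp add: norm_mult)
    finally show ?thesis using K(2)[of z] by simp
  qed
  have 0: "0 \<in> ball (0::complex) \<delta>" using \<delta> by simp
  have "Re (Fx 0) = 0" "Re (Fy 0) = 0" using K(2)[of 0] k by (auto simp: power_0_left)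
  then have "Fx 0 = 0" "Fy 0 = 0" using Fxy[of 0] by (metis of_real_0)+
  moreover have "rx 0 = 0" "ry 0 = 0" using M(2,3)[OF 0] m by (auto simp: power_0_left)
  ultimately have d0: "fx 0 = 0" "fy 0 = 0" by (simp_all add: f_eq)
  have re: "Re (cnj z * (Fx z + \<i> * Fy z)) = m * Re (F z)" for z
  proof -
    have "Re z * Re (Fx z) + Im z * Re (Fy z) = m * Re (F z)"
      unfolding k(1) by (rule euler_identity[OF gd hom])
    moreover have "Im (Fx z) = 0" "Im (Fy z) = 0" using arg_cong[OF Fxy(1)[of z], of Im] arg_cong[OF Fxy(2)[of z], of Im] by simp_all
    ultimately show ?thesis by simp
  qed
  \<comment> \<open>\<open>P * norm z ^ m\<close> will bound the quantity \<open>A\<close> below;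
    \<open>\<epsilon>\<close> and \<open>\<delta>1\<close> make the contributions of
    \<open>jdet\<close> and of the remainder at most a quarter of the lower bound
    \<open>c * norm z ^ m\<close> each.\<close>
  define P where "P = K + 2 * M"
  define \<epsilon> where "\<epsilon> = c / (4 * P)"
  have K2: "P > 0" using K(1) M(1) by (simp add: P_def)
  then have \<epsilon>: "\<epsilon> > 0" using c(1) by (simp add: \<epsilon>_def)
  have J0: "jdet 0 \<noteq> 0" by (rule jdet_nonzero[OF 0])
  have "continuous_on (ball 0 \<delta>) (\<lambda>z. jdet z / jdet 0)" using J0 by (intro continuous_intros continuous_on_jdet) auto
  then have "isCont (\<lambda>z. jdet z / jdet 0) 0" using 0 by (simp add: continuous_on_eq_continuous_at)
  then obtain d where d: "d > 0" "\<And>z. norm z < d \<Longrightarrow> norm (jdet z / jdet 0 - 1) < \<epsilon>"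
    using \<epsilon> J0 unfolding continuous_at_eps_delta dist_norm by (fastforce simp: divide_self)
  define \<delta>1 where "\<delta>1 = min (min \<delta> d) (min 1 (c / (4 * (2 * M + 1))))"
  have \<delta>1: "0 < \<delta>1" "\<delta>1 \<le> \<delta>" "\<delta>1 \<le> d" "\<delta>1 \<le> 1" "\<delta>1 \<le> c / (4 * (2 * M + 1))" using \<delta> d c(1) M(1) by (auto simp: \<delta>1_def)
  have "n = 1"
  proof (rule maslov_index_one[OF p d0 iso ind(1) \<delta>1(1,2)])
    show "(of_real s :: complex) = 1 \<or> (of_real s :: complex) = - 1" using s(1) by auto
    fix z assume z: "z \<in> ball 0 \<delta>1" "z \<noteq> (0::complex)"
    then have zs: "z \<in> ball 0 \<delta>" "norm z < d" "norm z \<le> 1" "norm z < c / (4 * (2 * M + 1))" using \<delta>1 by auto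
    define r where "r = rx z + \<i> * ry z"
    define A where "A = cnj z * (fx z + \<i> * fy z)"
    define B where "B = jdet z / jdet 0 - 1"
    have nr: "norm r \<le> 2 * M * norm z ^ m"
      using norm_triangle_ineq[of "rx z" "\<i> * ry z"] M(2,3)[OF zs(1)] by (simp add: r_def norm_mult)
    have A: "A = cnj z * (Fx z + \<i> * Fy z) + cnj z * r" by (simp add: A_def r_def f_eq algebra_simps)
    have n1: "norm (cnj z * r) \<le> 2 * M * norm z * norm z ^ m"
      using mult_left_mono[OF nr norm_ge_zero[of z]] by (simp add: norm_mult mult_ac)
    have "norm (cnj z * (Fx z + \<i> * Fy z)) \<le> K * norm z ^ m"
      using mult_left_mono[OF nF norm_ge_zero[of z]] by (simp add: norm_mult k(1) mult_ac)
    moreover have "2 * M * norm z * norm z ^ m \<le> 2 * M * norm z ^ m"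
      using mult_right_mono[OF mult_left_mono[OF zs(3), of "2 * M"], of "norm z ^ m"] M(1) by simp
    ultimately have nA: "norm A \<le> P * norm z ^ m"
      using n1 norm_triangle_ineq[of "cnj z * (Fx z + \<i> * Fy z)" "cnj z * r"] unfolding A P_def by (simp add: distrib_right)
    have AB: "norm (A * B) \<le> (c / 4) * norm z ^ m"
    proof -
      have "norm (A * B) \<le> (P * norm z ^ m) * \<epsilon>"
        unfolding norm_mult using nA d(2)[OF zs(2)] K2 by (intro mult_mono) (auto simp: B_def)
      also have "\<dots> = (c / 4) * norm z ^ m" using K2 by (simp add: \<epsilon>_def)
      finally show ?thesis .
    qed
    have zm: "norm z ^ m > 0" using z by simp
    have "2 * M * norm z \<le> (2 * M + 1) * norm z" by (simp add: algebra_simps)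
    also have "\<dots> \<le> c / 4" using zs(4) M(1) by (simp add: field_simps)
    finally have "2 * M * norm z * norm z ^ m \<le> (c / 4) * norm z ^ m" using zm by (intro mult_right_mono) auto
    then have n2: "norm (cnj z * r) \<le> (c / 4) * norm z ^ m" using n1 by simp
    have "c * norm z ^ m \<le> m * (c * norm z ^ m)" using m c(1) zm mult_right_mono[of 1 "real m" "c * norm z ^ m"] by simp
    also have "\<dots> \<le> m * (s * Re (F z))" using c(2)[of z] by (intro mult_left_mono) auto
    finally have low: "c * norm z ^ m \<le> s * (m * Re (F z))" by (simp add: mult_ac)
    have "s * Re (A + A * B) = s * (m * Re (F z)) + s * (Re (cnj z * r) + Re (A * B))"
      unfolding A re[symmetric] by (simp add: algebra_simps)
    moreover have "\<bar>Re (cnj z * r)\<bar> \<le> (c / 4) * norm z ^ m" "\<bar>Re (A * B)\<bar> \<le> (c / 4) * norm z ^ m"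
      using abs_Re_le_cmod[of "cnj z * r"] abs_Re_le_cmod[of "A * B"] n2 AB by linarith+
    moreover have "- (s * (a + b)) \<le> (c / 2) * X" if "\<bar>a\<bar> \<le> (c / 4) * X" "\<bar>b\<bar> \<le> (c / 4) * X" for a b X :: real
      using s(1) that by (auto simp: field_simps abs_le_iff)
    ultimately have "s * (m * Re (F z)) - s * Re (A + A * B) \<le> (c / 2) * norm z ^ m" by simp
    then have "s * Re (A + A * B) \<ge> (c / 2) * norm z ^ m" using low by (simp add: field_simps)
    moreover have "(c / 2) * norm z ^ m > 0" using c(1) zm by simp
    moreover have "Re (of_real s * (cnj z * (fx z + \<i> * fy z) * (jdet z / jdet 0))) = s * Re (A + A * B)"
    proof -
      have "Re (of_real s * w) = s * Re w" for w by simp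
      moreover have "A + A * B = A * (jdet z / jdet 0)" by (simp add: B_def right_diff_distrib)
      ultimately show ?thesis unfolding A_def by (simp only:)
    qed
    ultimately show "0 < Re (of_real s * (cnj z * (fx z + \<i> * fy z) * (jdet z / jdet 0)))" by linarith
  qed
  then show False using ind(2) by simp
qed

text \<open>Intermediate values on the punctured plane, which is connected.\<close>

lemma homogeneous_polynomial_sign_change_zero:
  assumes "homogeneous_polynomial m F" "m \<noteq> 0" "\<And>z. F z \<in> \<real>" "0 < Re (F z)" "Re (F z') < 0"
  shows "\<exists>w. w \<noteq> 0 \<and> F w = 0"
proof -
  obtain Fx Fy where Fd: "\<And>z. (F has_derivative (\<lambda>h. of_real (Re h) * Fx z + of_real (Im h) * Fy z)) (at z)"
  proof (rule homogeneous_polynomial_partials[OF assms(1)])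
    fix Fx Fy assume "\<And>z. (F has_derivative (\<lambda>h. of_real (Re h) * Fx z + of_real (Im h) * Fy z)) (at z)"
    then show thesis by (rule that)
  qed
  have c: "continuous_on (- {0}) (\<lambda>z. Re (F z))"
    using has_derivative_continuous[OF Fd] by (intro continuous_intros continuous_at_imp_continuous_on) auto
  have "connected (- {0::complex})" by (intro connected_punctured_universe) simp
  then have con: "connected ((\<lambda>z. Re (F z)) ` (- {0}))" by (rule connected_continuous_image[OF c])
  have "F 0 = 0" using homogeneous_polynomial_scale[OF assms(1), of 0 0] assms(2) by (simp add: power_0_left)
  then have "z \<noteq> 0" "z' \<noteq> 0" using assms(4,5) by auto
  then have "Re (F z) \<in> (\<lambda>z. Re (F z)) ` (- {0})" "Re (F z') \<in> (\<lambda>z. Re (F z)) ` (- {0})" by auto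
  then have "0 \<in> (\<lambda>z. Re (F z)) ` (- {0})"
    using connectedD_interval[OF con] assms(4,5) by (meson less_imp_le)
  then obtain w where "0 = Re (F w)" "w \<in> - {0}" by (rule imageE)
  then have "w \<noteq> 0" "Re (F w) = 0" by simp_all
  then have "F w = 0" using assms(3)[of w] by (simp add: complex_is_Real_iff complex_eq_iff)
  then show ?thesis using \<open>w \<noteq> 0\<close> by blast
qed

section \<open>Polynomial convexity\<close>

text \<open>Pole pushing: if \<open>1 - (z - a) Q z\<close> is small on \<open>E\<close>, then \<open>Q\<close> is close to \<open>1 / (z - a)\<close> there, so that the same
  \<open>Q\<close> serves all points that are much closer to \<open>a\<close> than \<open>E\<close>.\<close>

definition approximable_pole :: "complex set \<Rightarrow> complex \<Rightarrow> bool" where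
  "approximable_pole E a \<longleftrightarrow> (\<exists>Q \<theta>. Q holomorphic_on UNIV \<and> 0 \<le> \<theta> \<and> \<theta> < 1 \<and> (\<forall>z\<in>E. norm (1 - (z - a) * Q z) \<le> \<theta>))"

text \<open>Multiplying \<open>Q\<close> by a partial geometric series replaces the error term
  \<open>1 - (z - a) * Q z\<close> by its \<open>n\<close>-th power.\<close>

lemma approximable_pole_power:
  assumes "approximable_pole E a" "\<epsilon> > 0"
  obtains Q where "Q holomorphic_on UNIV" "\<And>z. z \<in> E \<Longrightarrow> norm (1 - (z - a) * Q z) \<le> \<epsilon>"
proof -
  obtain Q \<theta> where Q: "Q holomorphic_on UNIV" and \<theta>: "0 \<le> \<theta>" "\<theta> < 1" and b: "\<And>z. z \<in> E \<Longrightarrow> norm (1 - (z - a) * Q z) \<le> \<theta>"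
    using assms(1) unfolding approximable_pole_def by blast
  obtain n where n: "\<theta> ^ n < \<epsilon>" using real_arch_pow_inv[OF assms(2) \<theta>(2)] by blast
  have eq: "1 - (z - a) * (Q z * (\<Sum>i<n. (1 - (z - a) * Q z) ^ i)) = (1 - (z - a) * Q z) ^ n" for z
  proof -
    have "(z - a) * (Q z * (\<Sum>i<n. (1 - (z - a) * Q z) ^ i)) = 1 - (1 - (z - a) * Q z) ^ n"
      using one_diff_power_eq[of "1 - (z - a) * Q z" n] by (simp add: mult.assoc)
    then show ?thesis by (simp only: diff_diff_eq2) simp
  qed
  show thesis
  proof (rule that[of "\<lambda>z. Q z * (\<Sum>i<n. (1 - (z - a) * Q z) ^ i)"])
    show "(\<lambda>z. Q z * (\<Sum>i<n. (1 - (z - a) * Q z) ^ i)) holomorphic_on UNIV" by (intro holomorphic_intros Q)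
    fix z assume "z \<in> E"
    then have "norm (1 - (z - a) * Q z) ^ n \<le> \<theta> ^ n" using b by (intro power_mono) auto
    then show "norm (1 - (z - a) * (Q z * (\<Sum>i<n. (1 - (z - a) * Q z) ^ i))) \<le> \<epsilon>"
      unfolding eq using n by (simp add: norm_power)
  qed
qed

text \<open>With error \<open>1/4\<close> at \<open>a\<close>, \<open>norm (Q z)\<close> is at most
  \<open>5 / (4 * d)\<close>, so moving the pole by \<open>d / 3\<close> adds at most
  \<open>5/12\<close>, and the total \<open>2/3\<close> is below 1.\<close>

lemma approximable_pole_near:
  assumes "approximable_pole E a" "d > 0" "\<And>z. z \<in> E \<Longrightarrow> d \<le> norm (z - a)" "norm (b - a) \<le> d / 3"
  shows "approximable_pole E b"
proof -
  obtain Q where Q: "Q holomorphic_on UNIV" "\<And>z. z \<in> E \<Longrightarrow> norm (1 - (z - a) * Q z) \<le> 1 / 4"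
    by (rule approximable_pole_power[OF assms(1), of "1 / 4"]) auto
  have "norm (1 - (z - b) * Q z) \<le> 2 / 3" if z: "z \<in> E" for z
  proof -
    have "norm ((z - a) * Q z) \<le> 5 / 4" using Q(2)[OF z] norm_triangle_ineq4[of 1 "1 - (z - a) * Q z"] by simp
    moreover have "d * norm (Q z) \<le> norm ((z - a) * Q z)" using assms(3)[OF z] by (simp add: norm_mult mult_right_mono)
    ultimately have "d * norm (Q z) \<le> 5 / 4" by linarith
    moreover have "norm ((b - a) * Q z) \<le> d / 3 * norm (Q z)"
      unfolding norm_mult by (rule mult_right_mono[OF assms(4) norm_ge_zero])
    ultimately have "norm ((b - a) * Q z) \<le> 5 / 12" by linarith
    moreover have eq: "1 - (z - b) * Q z = (1 - (z - a) * Q z) + (b - a) * Q z" by (simp add: algebra_simps)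
    ultimately show ?thesis unfolding eq using norm_triangle_ineq[of "1 - (z - a) * Q z" "(b - a) * Q z"] Q(2)[OF z] by linarith
  qed
  then show ?thesis unfolding approximable_pole_def using Q(1) by (intro exI[of _ Q] exI[of _ "2/3"]) auto
qed

text \<open>For a distant pole the constant \<open>- 1 / a\<close> serves as \<open>Q\<close>: the
  error term is \<open>z / a\<close>.\<close>

lemma approximable_pole_far:
  assumes "E \<subseteq> ball 0 \<rho>" "\<rho> > 0" "norm a \<ge> 2 * \<rho>"
  shows "approximable_pole E a"
proof -
  have a: "a \<noteq> 0" using assms by auto
  have "norm (1 - (z - a) * (- 1 / a)) \<le> 1 / 2" if z: "z \<in> E" for z
  proof -
    have "1 - (z - a) * (- 1 / a) = z / a" using a by (simp add: field_simps)
    moreover have "norm z \<le> norm a / 2" using z assms by auto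
    ultimately show ?thesis using a by (simp add: norm_divide divide_simps)
  qed
  moreover have "(\<lambda>z. - 1 / a) holomorphic_on UNIV" by simp
  ultimately show ?thesis unfolding approximable_pole_def by (intro exI[of _ "\<lambda>z. - 1 / a"] exI[of _ "1/2"]) auto
qed

text \<open>The pole is pushed in from a far point of the component; connectedness turns the local
  step into a global one.\<close>

lemma approximable_pole_unbounded_component:
  assumes E: "compact E" and z: "\<not> bounded (connected_component_set (- E) z0)"
  shows "approximable_pole E z0"
proof -
  obtain \<rho> where \<rho>: "\<rho> > 0" "E \<subseteq> ball 0 \<rho>" using bounded_subset_ballD[OF compact_imp_bounded[OF E]] by blast
  define \<Omega> where "\<Omega> = connected_component_set (- E) z0"
  have "\<not> (\<forall>x\<in>\<Omega>. norm x \<le> 2 * \<rho>)" using z unfolding \<Omega>_def bounded_iff by blast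
  then obtain a where a: "a \<in> \<Omega>" "norm a \<ge> 2 * \<rho>" by (auto simp: not_le)
  then have "\<Omega> \<noteq> {}" by blast
  then have "z0 \<in> - E" unfolding \<Omega>_def connected_component_eq_empty by blast
  then have z0: "z0 \<in> \<Omega>" unfolding \<Omega>_def by (simp add: connected_component_refl)
  have \<Omega>E: "\<Omega> \<subseteq> - E" unfolding \<Omega>_def by (rule connected_component_subset)
  show ?thesis
  proof (rule connected_induction_simple[of \<Omega> a z0 "approximable_pole E"])
    show "connected \<Omega>" by (simp add: \<Omega>_def connected_connected_component)
    show "approximable_pole E a" by (rule approximable_pole_far[OF \<rho>(2,1) a(2)])
    fix b assume b: "b \<in> \<Omega>"
    have "open (- E)" using E by (simp add: compact_imp_closed open_Compl)
    then obtain d where d: "d > 0" "ball b d \<subseteq> - E" using b \<Omega>E open_contains_ball by blast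
    \<comment> \<open>Two points of this small ball are less than \<open>d / 5\<close> apart, and at
      least \<open>9 * d / 10\<close> away from \<open>E\<close>.\<close>
    have "approximable_pole E y" if "x \<in> ball b (d / 10)" "y \<in> ball b (d / 10)" "approximable_pole E x" for x y
    proof (rule approximable_pole_near[OF that(3), of "9 * d / 10"])
      show "norm (y - x) \<le> 9 * d / 10 / 3"
        using that(1,2) dist_triangle[of y x b] d(1) by (simp add: dist_commute flip: dist_norm)
      fix z assume "z \<in> E"
      then have "z \<notin> ball b d" using d(2) by blast
      then show "9 * d / 10 \<le> norm (z - x)"
        using that(1) dist_triangle[of b z x] by (simp add: dist_commute flip: dist_norm)
    qed (use d in simp)
    then have "\<forall>x\<in>\<Omega> \<inter> ball b (d / 10). \<forall>y\<in>\<Omega> \<inter> ball b (d / 10). approximable_pole E x \<longrightarrow> approximable_pole E y" by blast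
    moreover have "openin (top_of_set \<Omega>) (\<Omega> \<inter> ball b (d / 10))" by (rule openin_open_Int) simp
    moreover have "b \<in> \<Omega> \<inter> ball b (d / 10)" using b d(1) by simp
    ultimately show "\<exists>T. openin (top_of_set \<Omega>) T \<and> b \<in> T \<and> (\<forall>x\<in>T. \<forall>y\<in>T. approximable_pole E x \<longrightarrow> approximable_pole E y)"
      by blast
  qed (use a z0 in auto)
qed

text \<open>A bounded component stays in the disc, as the exterior of the disc is connected,
  unbounded and disjoint from the level set. Its frontier lies on the level set while
  \<open>g z0 \<noteq> c\<close>, so an extremum over the closure is attained inside;
  \<open>s\<close> selects maximum or minimum.\<close>

lemma compact_component_extremum:
  fixes g :: "complex \<Rightarrow> real"
  assumes g: "continuous_on (cball 0 \<delta>) g" and z0: "z0 \<in> cball 0 \<delta>" "g z0 \<noteq> c"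
    and bdd: "bounded (connected_component_set (- {z \<in> cball 0 \<delta>. g z = c}) z0)"
  obtains V z s where "open V" "z \<in> V" "V \<subseteq> cball 0 \<delta>" "s = 1 \<or> s = -1" "\<And>y. y \<in> V \<Longrightarrow> s * g y \<le> s * g z"
proof -
  define E where "E = {z \<in> cball 0 \<delta>. g z = c}"
  define \<Omega> where "\<Omega> = connected_component_set (- E) z0"
  have E: "closed E"
    using continuous_closed_preimage_constant[OF g closed_cball] by (simp add: E_def)
  have o\<Omega>: "open \<Omega>" unfolding \<Omega>_def using E by (intro open_connected_component) (simp add: open_Compl)
  have z0\<Omega>: "z0 \<in> \<Omega>" using z0 by (simp add: \<Omega>_def E_def connected_component_refl)
  have con: "connected (- cball 0 \<delta> :: complex set)"
    by (rule connected_complement_bounded_convex) auto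
  have \<Omega>D: "\<Omega> \<subseteq> cball 0 \<delta>"
  proof (rule ccontr)
    assume "\<not> ?thesis"
    then obtain y where y: "y \<in> \<Omega>" "y \<in> - cball 0 \<delta>" by blast
    have "- cball 0 \<delta> \<subseteq> connected_component_set (- E) y"
      by (rule connected_component_maximal[OF y(2) con]) (auto simp: E_def)
    also have "\<dots> = \<Omega>" using y(1) connected_component_eq unfolding \<Omega>_def by blast
    finally have "bounded (- cball 0 \<delta> :: complex set)" using bdd bounded_subset unfolding \<Omega>_def E_def by blast
    then show False using cobounded_imp_unbounded[of "- cball 0 \<delta> :: complex set"] by simp
  qed
  have fr: "closure \<Omega> - \<Omega> \<subseteq> E"
    using frontier_of_connected_component_subset[of "- E" z0] open_Compl[OF E] o\<Omega>
    by (auto simp: frontier_def interior_open \<Omega>_def)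
  have clD: "closure \<Omega> \<subseteq> cball 0 \<delta>" using \<Omega>D by (rule closure_minimal) simp
  have cl: "compact (closure \<Omega>)" "closure \<Omega> \<noteq> {}"
    using compact_Int_closed[OF compact_cball closed_closure, of 0 \<delta> \<Omega>] clD z0\<Omega> closure_subset by (auto simp: Int_absorb1)
  define s :: real where "s = (if g z0 > c then 1 else -1)"
  have s: "s = 1 \<or> s = -1" "s * c < s * g z0" using z0(2) by (auto simp: s_def)
  have "continuous_on (closure \<Omega>) (\<lambda>z. s * g z)" using continuous_on_subset[OF g clD] by (intro continuous_intros)
  then obtain z where z: "z \<in> closure \<Omega>" "\<And>y. y \<in> closure \<Omega> \<Longrightarrow> s * g y \<le> s * g z"
    using continuous_attains_sup[OF cl] by blast
  have "z \<in> \<Omega>"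
  proof (rule ccontr)
    assume "z \<notin> \<Omega>"
    then have "g z = c" using fr z(1) by (auto simp: E_def)
    then show False using z(2)[of z0] s(2) z0\<Omega> closure_subset by fastforce
  qed
  show thesis
  proof (rule that[OF o\<Omega> \<open>z \<in> \<Omega>\<close> \<Omega>D s(1)])
    fix y assume "y \<in> \<Omega>"
    then show "s * g y \<le> s * g z" using z(2) closure_subset by blast
  qed
qed

text \<open>A point of the hull, with coordinates \<open>z1\<close> and \<open>w1\<close>, is tested
  with three kinds of functions: the exponentials of \<open>\<i> * w\<close> and
  \<open>- \<i> * w\<close> make \<open>w1\<close> real, and a Gaussian in \<open>w\<close> times an
  entire function of \<open>z\<close> puts \<open>z1\<close> on the level set
  \<open>Re f = Re w1\<close>.\<close>

lemma (in graph_chart) locally_polynomially_convex: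
  assumes p: "p \<in> U" "\<Phi> p = 0" "p \<in> S" and real: "\<And>z. z \<in> ball 0 \<delta> \<Longrightarrow> f z \<in> \<real>"
    and iso: "isolated_CR_singularity S p"
    and osc: "\<And>e. e > 0 \<Longrightarrow> \<exists>z\<in>ball 0 e. \<exists>z'\<in>ball 0 e. Re (f z) < Re (f 0) \<and> Re (f 0) < Re (f z')"
  shows "locally_polynomially_convex_at S p"
proof -
  have z0: "0 \<in> ball 0 \<delta>" using \<delta> by simp
  have pt0: "pt 0 = p" using pt_fst[OF p(3,1)] p(2) by simp
  obtain U0 where U0: "open U0" "p \<in> U0" "\<And>x. x \<in> S \<Longrightarrow> x \<in> U0 \<Longrightarrow> CR_singularity S x \<Longrightarrow> x = p"
    using iso unfolding isolated_CR_singularity_def by blast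
  have "isCont pt 0" using has_derivative_continuous[OF pt_has_derivative[OF z0]] .
  then have "\<forall>\<^sub>F z in nhds 0. pt z \<in> U0"
    using U0(1,2) pt0 by (auto simp: continuous_at_imp_continuous_at_within isCont_def tendsto_at_iff_tendsto_nhds[symmetric] intro!: topological_tendstoD)
  then obtain d where d: "d > 0" "\<And>z. dist z 0 < d \<Longrightarrow> pt z \<in> U0" unfolding eventually_nhds_metric by blast
  \<comment> \<open>The closed disc of this radius lies in the parameter disc and its image contains
    no CR singularity but \<open>p\<close>.\<close>
  define \<delta>' where "\<delta>' = min \<delta> d / 2"
  have \<delta>': "\<delta>' > 0" "\<delta>' < \<delta>" "\<delta>' < d" using \<delta> d(1) by (auto simp: \<delta>'_def)
  have sub: "cball 0 \<delta>' \<subseteq> ball (0::complex) \<delta>" using \<delta>' by auto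
  have crit: "z = 0" if "z \<in> cball 0 \<delta>'" "fy z = \<i> * fx z" for z
  proof -
    have zb: "z \<in> ball 0 \<delta>" using that(1) sub by blast
    have "pt z = p" using U0(3)[of "pt z"] pt(1)[OF zb] d(2)[of z] CR_singularity_pt[OF zb] that \<delta>' by auto
    then show "z = 0" using pt(3)[OF zb] p(2) by (simp add: zero_prod_def)
  qed
  have fd: "((\<lambda>z. Re (f z)) has_derivative (\<lambda>h. Re h * Re (fx z) + Im h * Re (fy z))) (at z)" if "z \<in> ball 0 \<delta>" for z
    using bounded_linear.has_derivative[OF bounded_linear_Re f_der[OF that]] by simp
  have fr: "f z = of_real (Re (f z))" if "z \<in> ball 0 \<delta>" for z using real[OF that] by simp
  have unb: "\<not> bounded (connected_component_set (- {z \<in> cball 0 \<delta>'. Re (f z) = c}) z1)"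
    if z1: "z1 \<in> cball 0 \<delta>'" "Re (f z1) \<noteq> c" for z1 c
  proof
    assume b: "bounded (connected_component_set (- {z \<in> cball 0 \<delta>'. Re (f z) = c}) z1)"
    have cf: "continuous_on (cball 0 \<delta>') (\<lambda>z. Re (f z))"
      using continuous_on_subset[OF continuous_on_f sub] by (intro continuous_intros)
    obtain V z s where V: "open V" "z \<in> V" "V \<subseteq> cball 0 \<delta>'" "s = 1 \<or> s = -1"
      and ext: "\<And>y. y \<in> V \<Longrightarrow> s * Re (f y) \<le> s * Re (f z)"
    proof (rule compact_component_extremum[OF cf z1 b])
      fix V z s assume "open V" "z \<in> V" "V \<subseteq> cball 0 \<delta>'" "s = 1 \<or> s = (-1::real)" "\<And>y. y \<in> V \<Longrightarrow> s * Re (f y) \<le> s * Re (f z)"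
      then show thesis by (rule that)
    qed
    have zb: "z \<in> ball 0 \<delta>" using V(2,3) sub by blast
    have dd: "((\<lambda>z. s * Re (f z)) has_derivative (\<lambda>h. s * (Re h * Re (fx z) + Im h * Re (fy z)))) (at z)"
      by (intro has_derivative_mult_right fd zb)
    have "(\<lambda>h. s * (Re h * Re (fx z) + Im h * Re (fy z))) = (\<lambda>h. 0)"
      by (rule differential_zero_maxmin[OF V(2,1) dd]) (use ext in auto)
    then have e: "s * (Re h * Re (fx z) + Im h * Re (fy z)) = 0" for h by (rule fun_cong)
    have e0: "Re (fx z) = 0" "Re (fy z) = 0" using e[of 1] e[of \<i>] V(4) by auto
    have "(f has_derivative (\<lambda>h. of_real (Re h * Re (fx z) + Im h * Re (fy z)))) (at z)"
      by (rule has_derivative_transform_within_open[OF has_derivative_of_real[OF fd[OF zb]] open_ball zb]) (simp add: fr[symmetric])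
    from fun_cong[OF has_derivative_unique[OF f_der[OF zb] this]]
    have g: "of_real (Re h) * fx z + of_real (Im h) * fy z = of_real (Re h * Re (fx z) + Im h * Re (fy z))" for h .
    have "fx z = 0" "fy z = 0" using g[of 1] g[of \<i>] e0 by simp_all
    \<comment> \<open>The extremum sits at the CR singularity, where \<open>osc\<close> provides
      values on both sides.\<close>
    then have "z = 0" using crit[of z] V(2,3) by auto
    then obtain e where e: "e > 0" "ball 0 e \<subseteq> V" using V(1,2) open_contains_ball by blast
    obtain y y' where y: "y \<in> ball 0 e" "y' \<in> ball 0 e" "Re (f y) < Re (f 0)" "Re (f 0) < Re (f y')"
      using osc[OF e(1)] by blast
    have "s * Re (f y) \<le> s * Re (f 0)" "s * Re (f y') \<le> s * Re (f 0)" using ext[of y] ext[of y'] e(2) y(1,2) \<open>z = 0\<close> by blast+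
    then show False using V(4) y(3,4) by auto
  qed
  have hol: "holo U (fst \<circ> \<Phi>)" "holo U (snd \<circ> \<Phi>)" using holomorphic2_on_holo[OF chart(1,4)] by simp_all
  have cont\<Phi>: "continuous_on U (\<lambda>q. fst (\<Phi> q))" "continuous_on U (\<lambda>q. snd (\<Phi> q))"
    using hol by (simp_all add: holo_def o_def)
  have "open {q \<in> U. fst (\<Phi> q) \<in> ball 0 \<delta>'}"
    using continuous_open_preimage[OF cont\<Phi>(1) chart(1) open_ball, of 0 \<delta>'] by (simp add: Int_def vimage_def)
  moreover have "p \<in> {q \<in> U. fst (\<Phi> q) \<in> ball 0 \<delta>'}" using p \<delta>' by simp
  ultimately obtain r0 where r0: "r0 > 0" "cball p r0 \<subseteq> {q \<in> U. fst (\<Phi> q) \<in> ball 0 \<delta>'}" using open_contains_cball by blast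
  \<comment> \<open>The hull estimate for functions on \<open>U\<close> needs the ball of twice the
    radius inside \<open>U\<close>.\<close>
  define r where "r = r0 / 2"
  have r: "r > 0" "cball p (2 * r) \<subseteq> U" "cball p r \<subseteq> U"
    using r0 subset_cball[of r r0 p] by (auto simp: r_def simp del: mem_cball)
  have r\<delta>: "fst (\<Phi> q) \<in> ball 0 \<delta>'" if "q \<in> cball p r" for q
    using that r0 subset_cball[of r r0 p] by (auto simp: r_def)
  define K where "K = S \<inter> cball p r"
  have KS: "K = {q \<in> cball p r. snd (\<Phi> q) - f (fst (\<Phi> q)) = 0}" using S r(3) by (auto simp: K_def)
  have "continuous_on (cball p r) (\<lambda>q. snd (\<Phi> q) - f (fst (\<Phi> q)))"
  proof -
    have c: "continuous_on (cball p r) (\<lambda>q. snd (\<Phi> q))" "continuous_on (cball p r) (\<lambda>q. fst (\<Phi> q))"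
      using continuous_on_subset[OF cont\<Phi>(2) r(3)] continuous_on_subset[OF cont\<Phi>(1) r(3)] by simp_all
    have "(\<lambda>q. fst (\<Phi> q)) ` cball p r \<subseteq> cball 0 \<delta>'" using r\<delta> ball_subset_cball by blast
    then show ?thesis
      by (intro continuous_on_diff c(1) continuous_on_compose2[OF continuous_on_subset[OF continuous_on_f sub] c(2)])
  qed
  then have "closed K" unfolding KS by (rule continuous_closed_preimage_constant) simp
  then have "compact (K \<inter> cball p r)" by (intro closed_Int_compact) auto
  then have Kc: "compact K" unfolding K_def by (simp add: Int_assoc)
  have Kf: "snd (\<Phi> y) = of_real (Re (f (fst (\<Phi> y))))" "fst (\<Phi> y) \<in> cball 0 \<delta>'" if "y \<in> K" for y
  proof -
    have "y \<in> cball p r" using that by (simp add: K_def)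
    then have "fst (\<Phi> y) \<in> ball 0 \<delta>'" by (rule r\<delta>)
    then show "fst (\<Phi> y) \<in> cball 0 \<delta>'" by auto
    then show "snd (\<Phi> y) = of_real (Re (f (fst (\<Phi> y))))" using that fr sub by (auto simp: KS)
  qed
  have "x \<in> K" if x: "x \<in> polynomial_hull K" for x
  proof -
    have xr: "x \<in> cball p r" by (rule polynomial_hull_subset_cball[OF _ x]) (simp add: K_def)
    define z1 w1 where "z1 = fst (\<Phi> x)" and "w1 = snd (\<Phi> x)"
    have z1: "z1 \<in> cball 0 \<delta>'" using r\<delta>[OF xr] by (auto simp: z1_def)
    have bound: "norm (h x) \<le> B" if "holo U h" "\<And>y. y \<in> K \<Longrightarrow> norm (h y) \<le> B" for h B
      by (rule polynomial_hull_holo_bound[OF that(1) r(1,2) _ x that(2)]) (auto simp: K_def)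
    have im: "s * Im w1 \<le> 0" if "s = 1 \<or> s = -1" for s :: real
    proof -
      have "holo U (\<lambda>q. exp (- \<i> * of_real s * (snd \<circ> \<Phi>) q))"
        by (rule holo_compose_entire[OF hol(2)]) (intro holomorphic_intros)
      then have "norm (exp (- \<i> * of_real s * (snd \<circ> \<Phi>) x)) \<le> 1"
        by (rule bound) (simp add: Kf(1))
      then show ?thesis by (simp add: w1_def)
    qed
    have w1: "w1 = of_real (Re w1)" using im[of 1] im[of "-1"] by (simp add: complex_eq_iff)
    have "Re (f z1) = Re w1"
    proof (rule ccontr)
      assume ne: "Re (f z1) \<noteq> Re w1"
      define E where "E = {z \<in> cball 0 \<delta>'. Re (f z) = Re w1}"
      have cf: "continuous_on (cball 0 \<delta>') (\<lambda>z. Re (f z))"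
        using continuous_on_subset[OF continuous_on_f sub] by (intro continuous_intros)
      have "closed E" using continuous_closed_preimage_constant[OF cf closed_cball] by (simp add: E_def)
      then have "compact (E \<inter> cball 0 \<delta>')" by (intro closed_Int_compact) auto
      then have E: "compact E" by (simp add: E_def Int_def conj_commute conj_left_commute)
      have ap: "approximable_pole E z1"
        by (rule approximable_pole_unbounded_component[OF E]) (use unb[OF z1 ne] in \<open>simp add: E_def\<close>)
      obtain Q where Q: "Q holomorphic_on UNIV" "\<And>z. z \<in> E \<Longrightarrow> norm (1 - (z - z1) * Q z) \<le> 1 / 4"
        by (rule approximable_pole_power[OF ap, of "1/4"]) auto
      \<comment> \<open>Equal to 1 at \<open>z1\<close> and at most \<open>1/4\<close> in modulus on
        the level set \<open>E\<close>; the Gaussian factor is to suppress it away from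
        \<open>E\<close>.\<close>
      define q where "q z = 1 - (z - z1) * Q z" for z
      have qh: "q holomorphic_on UNIV" unfolding q_def[abs_def] by (intro holomorphic_intros Q(1))
      have qc: "continuous_on A q" for A by (rule continuous_on_subset[OF holomorphic_on_imp_continuous_on[OF qh]]) simp
      \<comment> \<open>The part of the disc where \<open>q\<close> is not yet small. It is compact
        and misses \<open>E\<close>, so \<open>Re f\<close> stays at distance
        \<open>\<mu> > 0\<close> from \<open>Re w1\<close> there.\<close>
      define D where "D = {z \<in> cball 0 \<delta>'. 1 / 2 \<le> norm (q z)}"
      have "closed {z. 1 / 2 \<le> norm (q z)}" by (intro closed_Collect_le continuous_intros qc)
      from compact_Int_closed[OF compact_cball this, of 0 \<delta>'] have D: "compact D" by (simp add: D_def Int_def)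
      have "compact (q ` cball 0 \<delta>')" by (intro compact_continuous_image qc) simp
      then have "bounded (q ` cball 0 \<delta>')" by (rule compact_imp_bounded)
      then obtain B where B': "B > 0" "\<forall>w\<in>q ` cball 0 \<delta>'. norm w \<le> B" unfolding bounded_pos by blast
      then have B: "B > 0" "\<And>z. z \<in> cball 0 \<delta>' \<Longrightarrow> norm (q z) \<le> B" by blast+
      have z1D: "z1 \<in> D" using z1 by (simp add: D_def q_def)
      have "continuous_on D (\<lambda>z. \<bar>Re (f z) - Re w1\<bar>)"
        by (intro continuous_intros continuous_on_subset[OF cf]) (auto simp: D_def)
      then obtain z2 where z2: "z2 \<in> D" "\<And>z. z \<in> D \<Longrightarrow> \<bar>Re (f z2) - Re w1\<bar> \<le> \<bar>Re (f z) - Re w1\<bar>"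
        using continuous_attains_inf[OF D] z1D by blast
      define \<mu> where "\<mu> = \<bar>Re (f z2) - Re w1\<bar>"
      have "z2 \<notin> E" using Q(2)[of z2] z2(1) by (auto simp: D_def q_def)
      then have \<mu>: "\<mu> > 0" using z2(1) by (auto simp: \<mu>_def D_def E_def)
      \<comment> \<open>Makes the Gaussian at most \<open>1 / (2 * B + 1)\<close> on
        \<open>D\<close>, which beats the bound \<open>B\<close> for \<open>q\<close>.\<close>
      define N where "N = ln (2 * B + 1) / \<mu>\<^sup>2"
      have N: "N \<ge> 0" "exp (- N * \<mu>\<^sup>2) = 1 / (2 * B + 1)" using B(1) \<mu> by (simp_all add: N_def exp_minus inverse_eq_divide)
      define h where "h y = exp (- of_real N * ((snd \<circ> \<Phi>) y - w1)\<^sup>2) * q ((fst \<circ> \<Phi>) y)" for y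
      have "holo U h" unfolding h_def[abs_def]
      proof (rule holo_mult)
        show "holo U (\<lambda>y. exp (- of_real N * ((snd \<circ> \<Phi>) y - w1)\<^sup>2))"
          by (rule holo_compose_entire[OF hol(2)]) (intro holomorphic_intros)
        show "holo U (\<lambda>y. q ((fst \<circ> \<Phi>) y))" by (rule holo_compose_entire[OF hol(1) qh])
      qed
      then have "norm (h x) \<le> 1 / 2"
      proof (rule bound)
        fix y assume y: "y \<in> K"
        define z where "z = fst (\<Phi> y)"
        define t where "t = (Re (f z) - Re w1)\<^sup>2"
        have zD: "z \<in> cball 0 \<delta>'" using Kf(2)[OF y] by (simp add: z_def)
        have "(snd (\<Phi> y) - w1)\<^sup>2 = of_real t" using Kf(1)[OF y] w1 by (metis of_real_diff of_real_power t_def z_def)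
        then have hy: "norm (h y) = exp (- N * t) * norm (q z)" by (simp add: h_def norm_mult z_def)
        show "norm (h y) \<le> 1 / 2"
        proof (cases "z \<in> D")
          case True
          then have "\<mu>\<^sup>2 \<le> t" unfolding t_def \<mu>_def using z2(2) by (simp add: abs_le_square_iff[symmetric])
          then have "exp (- N * t) \<le> 1 / (2 * B + 1)" unfolding N(2)[symmetric] using N(1) by (simp add: mult_left_mono)
          then have "norm (h y) \<le> 1 / (2 * B + 1) * B" unfolding hy using B(2)[OF zD] B(1) by (intro mult_mono) auto
          also have "\<dots> \<le> 1 / 2" using B(1) by (simp add: field_simps)
          finally show ?thesis .
        next
          case False
          then have "norm (q z) \<le> 1 / 2" using zD by (simp add: D_def)
          moreover have "exp (- N * t) \<le> 1" using N(1) by (simp add: t_def)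
          ultimately show ?thesis unfolding hy using mult_mono[of "exp (- N * t)" 1 "norm (q z)" "1/2"] by simp
        qed
      qed
      moreover have "h x = 1" by (simp add: h_def w1_def[symmetric] z1_def[symmetric] q_def)
      ultimately show False by simp
    qed
    then have "w1 = f z1" using w1 fr[of z1] z1 sub by auto
    then show ?thesis using xr by (simp add: KS z1_def w1_def)
  qed
  moreover have "x \<in> polynomial_hull K" if "x \<in> K" for x using that by (auto simp: polynomial_hull_def)
  ultimately have "polynomial_hull K = K" by blast
  then show ?thesis unfolding locally_polynomially_convex_at_def polynomially_convex_def using r(1) Kc
    by (intro exI[of _ r]) (simp add: K_def)
qed

section \<open>Analytic discs\<close>

lemma field_differentiable_holo_compose:
  assumes h: "holo U h" and x: "(a t, b t) \<in> U" and a: "a field_differentiable at t" and b: "b field_differentiable at t"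
  shows "(\<lambda>t. h (a t, b t)) field_differentiable at t"
proof -
  obtain a' b' where d: "(a has_derivative (\<lambda>k. a' * k)) (at t)" "(b has_derivative (\<lambda>k. b' * k)) (at t)"
    using a b unfolding field_differentiable_def has_field_derivative_def by blast
  have 1: "((\<lambda>t. (a t, b t)) has_derivative (\<lambda>k. (a' * k, b' * k))) (at t)" by (rule has_derivative_Pair[OF d])
  have "((\<lambda>t. h (a t, b t)) has_derivative (\<lambda>k. dz h (a t, b t) * (a' * k) + dw h (a t, b t) * (b' * k))) (at t)"
    using has_derivative_compose[OF 1 holo_has_derivative[OF h x]] by simp
  then have "((\<lambda>t. h (a t, b t)) has_field_derivative (dz h (a t, b t) * a' + dw h (a t, b t) * b')) (at t)"
    unfolding has_field_derivative_def by (rule has_derivative_eq_rhs) (simp add: fun_eq_iff algebra_simps)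
  then show ?thesis unfolding field_differentiable_def by blast
qed

text \<open>Maximum principle for polynomials on the disc. Its purpose is that a disc with boundary
  in a ball around \<open>p\<close> lies in that ball, hence in the chart.\<close>

lemma disc_in_polynomial_hull:
  assumes g: "continuous_on (cball 0 1) g" "(fst \<circ> g) holomorphic_on ball 0 1" "(snd \<circ> g) holomorphic_on ball 0 1"
    and \<zeta>: "\<zeta> \<in> cball 0 1"
  shows "g \<zeta> \<in> polynomial_hull (g ` sphere 0 1)"
  unfolding polynomial_hull_def
proof (intro CollectI allI impI)
  fix P assume "polynomial2 P"
  then obtain N c where P: "\<And>x. P x = (\<Sum>i\<le>N. \<Sum>j\<le>N. c i j * fst x ^ i * snd x ^ j)" unfolding polynomial2_def by blast
  have hol: "(\<lambda>\<zeta>. P (g \<zeta>)) holomorphic_on ball 0 1"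
    unfolding P using g(2,3) unfolding o_def by (intro holomorphic_intros)
  have cont: "continuous_on (cball 0 1) (\<lambda>\<zeta>. P (g \<zeta>))" unfolding P by (intro continuous_intros g(1))
  have "continuous_on (sphere 0 1) (\<lambda>\<zeta>. norm (P (g \<zeta>)))"
    by (intro continuous_intros continuous_on_subset[OF cont]) auto
  then obtain \<xi> where \<xi>: "\<xi> \<in> sphere 0 1" "\<And>\<eta>. \<eta> \<in> sphere 0 1 \<Longrightarrow> norm (P (g \<eta>)) \<le> norm (P (g \<xi>))"
    using continuous_attains_sup[of "sphere (0::complex) 1" "\<lambda>\<zeta>. norm (P (g \<zeta>))"] by auto
  have "norm (P (g \<zeta>)) \<le> norm (P (g \<xi>))"
    by (rule maximum_modulus_frontier[of "\<lambda>\<zeta>. P (g \<zeta>)" "cball 0 1"]) (use hol cont \<xi>(2) \<zeta> in auto)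
  then show "\<exists>y\<in>g ` sphere 0 1. norm (P (g \<zeta>)) \<le> norm (P y)" using \<xi>(1) by blast
qed

text \<open>With \<open>\<Phi> \<circ> g = (a, b)\<close>, the map \<open>a\<close> is univalent, so that \<open>b \<circ> a\<inverse>\<close> is holomorphic in \<open>a(\<D>)\<close>,
  with the boundary values of \<open>f\<close>.\<close>

lemma (in graph_chart) no_analytic_disc:
  assumes p: "p \<in> U" "\<Phi> p = 0"
    and hp: "homogeneous_polynomial m F" and m: "2 \<le> m" and real: "\<And>z. F z \<in> \<real>"
    and nz: "F z1 \<noteq> 0" and zero: "z2 \<noteq> 0" "F z2 = 0"
    and ncrit: "\<And>z. z \<noteq> 0 \<Longrightarrow> \<not> F field_differentiable at z"
    and Fd: "\<And>z. (F has_derivative (\<lambda>h. of_real (Re h) * Fx z + of_real (Im h) * Fy z)) (at z)"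
    and f_eq: "\<And>z. fx z = Fx z + rx z" "\<And>z. fy z = Fy z + ry z"
    and M: "M \<ge> 0" "\<And>z. z \<in> ball 0 \<delta> \<Longrightarrow> norm (rx z) \<le> M * norm z ^ m" "\<And>z. z \<in> ball 0 \<delta> \<Longrightarrow> norm (ry z) \<le> M * norm z ^ m"
  shows "\<exists>r>0. cball p r \<subseteq> U \<and> (\<forall>g. continuous_on (cball 0 1) g \<longrightarrow> (fst \<circ> g) holomorphic_on ball 0 1 \<longrightarrow>
    (snd \<circ> g) holomorphic_on ball 0 1 \<longrightarrow> g ` sphere 0 1 \<subseteq> S \<inter> cball p r \<longrightarrow> \<not> simple_path (g \<circ> circlepath 0 1))"
proof (rule exists_transversal_form[OF hp m real nz zero ncrit])
  fix ux uy Gx Gy Gxx Gxy Gyy :: "complex \<Rightarrow> real" and c C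
  assume cC: "c > 0" "C > 0"
    and ud: "\<And>z. ((\<lambda>z. Re (F z)) has_derivative (\<lambda>k. Re k * ux z + Im k * uy z)) (at z)"
    and "continuous_on UNIV ux" "continuous_on UNIV uy"
    and Gd: "\<And>z. (Gx has_derivative (\<lambda>k. Re k * Gxx z + Im k * Gxy z)) (at z)"
      "\<And>z. (Gy has_derivative (\<lambda>k. Re k * Gxy z + Im k * Gyy z)) (at z)"
    and cG: "continuous_on UNIV Gxx" "continuous_on UNIV Gxy" "continuous_on UNIV Gyy"
    and bu: "\<And>z. (ux z)\<^sup>2 + (uy z)\<^sup>2 \<le> C * norm z ^ (2 * (m - 1))"
    and bG: "\<And>z. (Gx z)\<^sup>2 + (Gy z)\<^sup>2 \<le> C * norm z ^ (2 * (m - 1))"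
    and br: "\<And>z. c * norm z ^ (2 * (m - 1)) \<le> ux z * Gy z - uy z * Gx z"
  define W where "W z = norm z ^ (2 * (m - 1))" for z :: complex
  have W0: "0 \<le> W z" for z by (simp add: W_def)
  have "((\<lambda>z. Re (F z)) has_derivative (\<lambda>h. Re h * Re (Fx z) + Im h * Re (Fy z))) (at z)" for z
    using bounded_linear.has_derivative[OF bounded_linear_Re Fd[of z]] by simp
  from fun_cong[OF has_derivative_unique[OF this ud]]
  have e: "Re h * Re (Fx z) + Im h * Re (Fy z) = Re h * ux z + Im h * uy z" for h z .
  have reF: "Re (Fx z) = ux z" "Re (Fy z) = uy z" for z using e[of 1 z] e[of \<i> z] by simp_all
  have "((\<lambda>z. Im (F z)) has_derivative (\<lambda>h. Re h * Im (Fx z) + Im h * Im (Fy z))) (at z)" for z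
    using bounded_linear.has_derivative[OF bounded_linear_Im Fd[of z]] by simp
  then have i: "((\<lambda>z. 0) has_derivative (\<lambda>h. Re h * Im (Fx z) + Im h * Im (Fy z))) (at z)" for z
    using real by (simp add: complex_is_Real_iff)
  from fun_cong[OF has_derivative_unique[OF i has_derivative_const]]
  have e: "Re h * Im (Fx z) + Im h * Im (Fy z) = 0" for h z .
  have imF: "Im (Fx z) = 0" "Im (Fy z) = 0" for z using e[of 1 z] e[of \<i> z] by simp_all
  \<comment> \<open>\<open>C' * W z\<close> bounds the squared gradient of \<open>Re f\<close>:
    \<open>2 * C\<close> comes from the leading form and 2 from the remainder, as
    \<open>\<kappa>\<^sup>2 \<le> 1\<close>. The other two bounds on \<open>\<kappa>\<close> meet
    the smallness condition of \<open>no_holomorphic_boundary_values\<close> for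
    \<open>c / 2\<close> and let the remainder cost at most half of the bracket.\<close>
  define C' where "C' = 2 * C + 2"
  define \<kappa> where "\<kappa> = sqrt (min 1 (c\<^sup>2 / (16 * C')))"
  have C': "C' > 0" "C \<le> C'" using cC by (simp_all add: C'_def)
  have \<kappa>2: "\<kappa>\<^sup>2 = min 1 (c\<^sup>2 / (16 * C'))" using C' by (simp add: \<kappa>_def)
  have \<kappa>: "\<kappa> > 0" "\<kappa>\<^sup>2 \<le> 1" "4 * C' * \<kappa>\<^sup>2 \<le> (c / 2)\<^sup>2"
  proof -
    show "\<kappa> > 0" using C' cC by (simp add: \<kappa>_def)
    show "\<kappa>\<^sup>2 \<le> 1" unfolding \<kappa>2 by simp
    have "\<kappa>\<^sup>2 \<le> c\<^sup>2 / (16 * C')" unfolding \<kappa>2 by simp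
    then have "4 * C' * \<kappa>\<^sup>2 \<le> 4 * C' * (c\<^sup>2 / (16 * C'))" using C' by (intro mult_left_mono) auto
    then show "4 * C' * \<kappa>\<^sup>2 \<le> (c / 2)\<^sup>2" using C' by (simp add: power_divide)
  qed
  have \<kappa>C: "\<kappa>\<^sup>2 * C \<le> (c / 2)\<^sup>2"
  proof -
    have "\<kappa>\<^sup>2 * C \<le> \<kappa>\<^sup>2 * (4 * C')" using C' by (intro mult_left_mono) auto
    then show ?thesis using \<kappa>(3) by (simp add: mult_ac)
  qed
  \<comment> \<open>On this disc \<open>2 * M * norm z \<le> \<kappa>\<close>; one power of
    \<open>norm z\<close> is what the derivatives of the remainder gain over those of the
    form.\<close>
  define \<delta>1 where "\<delta>1 = min \<delta> (\<kappa> / (2 * M + 1))"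
  have \<delta>1: "\<delta>1 > 0" "\<delta>1 \<le> \<delta>" "\<delta>1 \<le> \<kappa> / (2 * M + 1)" using \<delta> \<kappa>(1) M(1) by (auto simp: \<delta>1_def)
  have sub: "ball 0 \<delta>1 \<subseteq> ball (0::complex) \<delta>" using \<delta>1 by auto
  have small: "(2 * M * norm z ^ m)\<^sup>2 \<le> \<kappa>\<^sup>2 * W z" if z: "z \<in> ball 0 \<delta>1" for z
  proof -
    have "norm z < \<kappa> / (2 * M + 1)" using z \<delta>1 by simp
    then have "(2 * M + 1) * norm z \<le> \<kappa>" using M(1) by (simp add: field_simps)
    then have "2 * M * norm z \<le> \<kappa>" unfolding distrib_right using norm_ge_zero[of z] by linarith
    then have "(2 * M * norm z)\<^sup>2 \<le> \<kappa>\<^sup>2" using M(1) by (intro power_mono) auto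
    then have "(2 * M * norm z)\<^sup>2 * W z \<le> \<kappa>\<^sup>2 * W z" by (intro mult_right_mono W0)
    moreover have "m = Suc (m - 1)" using m by simp
    then have "norm z ^ m = norm z * norm z ^ (m - 1)" by (metis power_Suc)
    then have "(2 * M * norm z ^ m)\<^sup>2 = (2 * M * norm z)\<^sup>2 * W z" by (simp add: W_def power_even_eq power_mult_distrib mult_ac)
    ultimately show ?thesis by simp
  qed
  have gr: "(Re (rx z))\<^sup>2 + (Re (ry z))\<^sup>2 \<le> \<kappa>\<^sup>2 * W z" "(Im (rx z))\<^sup>2 + (Im (ry z))\<^sup>2 \<le> \<kappa>\<^sup>2 * W z" if z: "z \<in> ball 0 \<delta>1" for z
  proof -
    define B where "B = M * norm z ^ m"
    have zb: "z \<in> ball 0 \<delta>" using z sub by blast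
    have B: "\<bar>Re (rx z)\<bar> \<le> B" "\<bar>Im (rx z)\<bar> \<le> B" "\<bar>Re (ry z)\<bar> \<le> B" "\<bar>Im (ry z)\<bar> \<le> B"
      using M(2,3)[OF zb] abs_Re_le_cmod[of "rx z"] abs_Im_le_cmod[of "rx z"] abs_Re_le_cmod[of "ry z"] abs_Im_le_cmod[of "ry z"]
      unfolding B_def by linarith+
    have sq: "x\<^sup>2 \<le> B\<^sup>2" if "\<bar>x\<bar> \<le> B" for x :: real using that by (rule abs_le_square_iff[THEN iffD1, OF order_trans]) simp
    have "B\<^sup>2 + B\<^sup>2 \<le> (2 * B)\<^sup>2" by (simp add: power_mult_distrib)
    also have "\<dots> \<le> \<kappa>\<^sup>2 * W z" using small[OF z] by (simp add: B_def mult.assoc)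
    finally have "B\<^sup>2 + B\<^sup>2 \<le> \<kappa>\<^sup>2 * W z" .
    then show "(Re (rx z))\<^sup>2 + (Re (ry z))\<^sup>2 \<le> \<kappa>\<^sup>2 * W z" "(Im (rx z))\<^sup>2 + (Im (ry z))\<^sup>2 \<le> \<kappa>\<^sup>2 * W z"
      using sq[OF B(1)] sq[OF B(2)] sq[OF B(3)] sq[OF B(4)] by linarith+
  qed
  have hol: "holo U (fst \<circ> \<Phi>)" "holo U (snd \<circ> \<Phi>)" using holomorphic2_on_holo[OF chart(1,4)] by simp_all
  have cont\<Phi>: "continuous_on U (\<lambda>q. fst (\<Phi> q))" "continuous_on U (\<lambda>q. snd (\<Phi> q))"
    using hol by (simp_all add: holo_def o_def)
  have "open {q \<in> U. fst (\<Phi> q) \<in> ball 0 \<delta>1}"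
    using continuous_open_preimage[OF cont\<Phi>(1) chart(1) open_ball, of 0 \<delta>1] by (simp add: Int_def vimage_def)
  moreover have "p \<in> {q \<in> U. fst (\<Phi> q) \<in> ball 0 \<delta>1}" using p \<delta>1 by simp
  ultimately obtain r where r: "r > 0" "cball p r \<subseteq> {q \<in> U. fst (\<Phi> q) \<in> ball 0 \<delta>1}" using open_contains_cball by blast
  have rU: "cball p r \<subseteq> U" using r(2) by blast
  have False if g: "continuous_on (cball 0 1) g" "(fst \<circ> g) holomorphic_on ball 0 1" "(snd \<circ> g) holomorphic_on ball 0 1"
    and gS: "g ` sphere 0 1 \<subseteq> S \<inter> cball p r" and simple: "simple_path (g \<circ> circlepath 0 1)" for g
  proof -
    have gr': "g \<zeta> \<in> cball p r" if "\<zeta> \<in> cball 0 1" for \<zeta>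
      by (rule polynomial_hull_subset_cball[OF _ disc_in_polynomial_hull[OF g that]]) (use gS in blast)
    then have gU: "g ` cball 0 1 \<subseteq> U" using rU by blast
    define a where "a \<zeta> = fst (\<Phi> (g \<zeta>))" for \<zeta>
    define b where "b \<zeta> = snd (\<Phi> (g \<zeta>))" for \<zeta>
    have ca: "continuous_on (cball 0 1) a" unfolding a_def[abs_def] by (rule continuous_on_compose2[OF cont\<Phi>(1) g(1) gU])
    have cb: "continuous_on (cball 0 1) b" unfolding b_def[abs_def] by (rule continuous_on_compose2[OF cont\<Phi>(2) g(1) gU])
    have a1: "a \<zeta> \<in> ball 0 \<delta>1" if "\<zeta> \<in> cball 0 1" for \<zeta> using gr'[OF that] r(2) by (auto simp: a_def)
    have fa: "f (a \<zeta>) = b \<zeta>" if "\<zeta> \<in> sphere 0 1" for \<zeta>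
    proof -
      have "g \<zeta> \<in> S \<inter> U" using gS rU that by blast
      then show ?thesis unfolding S by (simp add: a_def b_def)
    qed
    have ab: "a field_differentiable at \<zeta>" "b field_differentiable at \<zeta>" if z: "\<zeta> \<in> ball 0 1" for \<zeta>
    proof -
      have d: "(\<lambda>t. fst (g t)) field_differentiable at \<zeta>" "(\<lambda>t. snd (g t)) field_differentiable at \<zeta>"
        using g(2,3) z holomorphic_on_imp_differentiable_at[OF _ open_ball] unfolding o_def by blast+
      have "g \<zeta> \<in> U" using z gU by auto
      then have u: "(fst (g \<zeta>), snd (g \<zeta>)) \<in> U" by simp
      show "a field_differentiable at \<zeta>" "b field_differentiable at \<zeta>"
        using field_differentiable_holo_compose[OF hol(1) u d] field_differentiable_holo_compose[OF hol(2) u d]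
        by (simp_all add: a_def[abs_def] b_def[abs_def])
    qed
    have ah: "a holomorphic_on ball 0 1" and bh: "b holomorphic_on ball 0 1"
      using ab by (auto simp: holomorphic_on_def field_differentiable_at_within)
    \<comment> \<open>On the graph the first coordinate is injective, with inverse
      \<open>pt\<close>, so the boundary curve remains simple after projection.\<close>
    have "simple_path ((\<lambda>q. fst (\<Phi> q)) \<circ> (g \<circ> circlepath 0 1))"
    proof (rule simple_path_continuous_image[OF simple])
      have pi: "path_image (g \<circ> circlepath 0 1) \<subseteq> S \<inter> U" using gS rU by (auto simp: path_image_compose)
      show "continuous_on (path_image (g \<circ> circlepath 0 1)) (\<lambda>q. fst (\<Phi> q))"
        by (rule continuous_on_subset[OF cont\<Phi>(1)]) (use pi in blast)
      show "inj_on (\<lambda>q. fst (\<Phi> q)) (path_image (g \<circ> circlepath 0 1))"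
        by (rule inj_on_inverseI[where g = pt]) (use pi pt_fst in blast)
    qed
    then have "simple_path (a \<circ> circlepath 0 1)" by (simp add: o_def a_def)
    then have inj: "inj_on a (ball 0 1)" by (rule inj_on_disc[OF ah ca])
    define \<Omega> where "\<Omega> = a ` ball 0 1"
    obtain k where k: "k holomorphic_on \<Omega>" "\<And>\<zeta>. \<zeta> \<in> ball 0 1 \<Longrightarrow> k (a \<zeta>) = \<zeta>"
      using holomorphic_has_inverse[OF ah open_ball inj] unfolding \<Omega>_def by metis
    define h where "h z = b (k z)" for z
    have \<Omega>1: "\<Omega> \<subseteq> ball 0 \<delta>1" using a1 by (auto simp: \<Omega>_def)
    then have \<Omega>\<delta>: "\<Omega> \<subseteq> ball 0 \<delta>" using sub by blast
    have hh: "h holomorphic_on \<Omega>"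
      unfolding h_def[abs_def] by (rule holomorphic_on_compose_gen[OF k(1) bh, unfolded o_def]) (auto simp: \<Omega>_def k(2))
    have cfa: "continuous_on (cball 0 1) (\<lambda>\<zeta>. f (a \<zeta>))"
      by (rule continuous_on_compose2[OF continuous_on_f ca]) (use a1 sub in blast)
    \<comment> \<open>The preimage in the closed disc is compact and avoids the unit circle, where
      \<open>f \<circ> a = b\<close>.\<close>
    have cpt: "compact {z \<in> \<Omega>. \<epsilon> \<le> \<bar>T (f z) - T (h z)\<bar>}" if "\<epsilon> > 0" "continuous_on UNIV T" for \<epsilon> and T :: "complex \<Rightarrow> real"
    proof -
      have eq: "{z \<in> \<Omega>. \<epsilon> \<le> \<bar>T (f z) - T (h z)\<bar>} = a ` (cball 0 1 \<inter> {\<zeta> \<in> cball 0 1. \<epsilon> \<le> \<bar>T (f (a \<zeta>)) - T (b \<zeta>)\<bar>})"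
      proof (intro equalityI subsetI)
        fix z assume "z \<in> {z \<in> \<Omega>. \<epsilon> \<le> \<bar>T (f z) - T (h z)\<bar>}"
        then obtain \<zeta> where "\<zeta> \<in> ball 0 1" "z = a \<zeta>" "\<epsilon> \<le> \<bar>T (f z) - T (h z)\<bar>" by (auto simp: \<Omega>_def)
        then show "z \<in> a ` (cball 0 1 \<inter> {\<zeta> \<in> cball 0 1. \<epsilon> \<le> \<bar>T (f (a \<zeta>)) - T (b \<zeta>)\<bar>})"
          using k(2)[of \<zeta>] by (intro image_eqI[of _ _ \<zeta>]) (auto simp: h_def)
      next
        fix z assume "z \<in> a ` (cball 0 1 \<inter> {\<zeta> \<in> cball 0 1. \<epsilon> \<le> \<bar>T (f (a \<zeta>)) - T (b \<zeta>)\<bar>})"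
        then obtain \<zeta> where \<zeta>: "\<zeta> \<in> cball 0 1" "z = a \<zeta>" "\<epsilon> \<le> \<bar>T (f (a \<zeta>)) - T (b \<zeta>)\<bar>" by blast
        have "\<zeta> \<notin> sphere 0 1" using fa[of \<zeta>] \<zeta>(3) that(1) by auto
        then have "\<zeta> \<in> ball 0 1" using \<zeta>(1) by auto
        then show "z \<in> {z \<in> \<Omega>. \<epsilon> \<le> \<bar>T (f z) - T (h z)\<bar>}" using \<zeta>(2,3) k(2)[of \<zeta>] by (auto simp: \<Omega>_def h_def)
      qed
      have "continuous_on (cball 0 1) (\<lambda>\<zeta>. \<bar>T (f (a \<zeta>)) - T (b \<zeta>)\<bar>)"
        using continuous_on_compose2[OF that(2) cfa] continuous_on_compose2[OF that(2) cb] by (intro continuous_intros) auto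
      from continuous_closed_preimage[OF this closed_cball closed_atLeast[of \<epsilon>]]
      have "closed {\<zeta> \<in> cball 0 1. \<epsilon> \<le> \<bar>T (f (a \<zeta>)) - T (b \<zeta>)\<bar>}" by (simp add: Int_def vimage_def)
      from compact_Int_closed[OF compact_cball this]
      show ?thesis unfolding eq by (intro compact_continuous_image continuous_on_subset[OF ca]) auto
    qed
    show False
    proof (rule no_holomorphic_boundary_values[of \<Omega> h "\<lambda>z. Re (f z)" "\<lambda>z. Re (fx z)" "\<lambda>z. Re (fy z)" "\<lambda>z. Im (f z)" "\<lambda>z. Im (fx z)" "\<lambda>z. Im (fy z)"
        Gx Gxx Gxy Gy Gyy W "c / 2" C' \<kappa>])
      show "open \<Omega>" unfolding \<Omega>_def by (rule open_mapping_thm3[OF ah open_ball inj])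
      show "bounded \<Omega>" using \<Omega>1 bounded_ball bounded_subset by blast
      show "\<Omega> \<noteq> {}" by (simp add: \<Omega>_def)
      show "((\<lambda>z. Re (f z)) has_derivative (\<lambda>k. Re k * Re (fx z) + Im k * Re (fy z))) (at z)" if "z \<in> \<Omega>" for z
        using bounded_linear.has_derivative[OF bounded_linear_Re f_der, of z] that \<Omega>\<delta> by auto
      show "((\<lambda>z. Im (f z)) has_derivative (\<lambda>k. Re k * Im (fx z) + Im k * Im (fy z))) (at z)" if "z \<in> \<Omega>" for z
        using bounded_linear.has_derivative[OF bounded_linear_Im f_der, of z] that \<Omega>\<delta> by auto
      show "continuous_on \<Omega> (\<lambda>z. Re (fx z))" "continuous_on \<Omega> (\<lambda>z. Re (fy z))" "continuous_on \<Omega> (\<lambda>z. Im (fx z))" "continuous_on \<Omega> (\<lambda>z. Im (fy z))"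
        using continuous_on_subset[OF continuous_fx \<Omega>\<delta>] continuous_on_subset[OF continuous_fy \<Omega>\<delta>] by (simp_all add: continuous_on_Re continuous_on_Im)
      show "compact {z \<in> \<Omega>. \<epsilon> \<le> \<bar>Re (f z) - Re (h z)\<bar>}" if "\<epsilon> > 0" for \<epsilon> by (intro cpt that continuous_intros)
      show "compact {z \<in> \<Omega>. \<epsilon> \<le> \<bar>Im (f z) - Im (h z)\<bar>}" if "\<epsilon> > 0" for \<epsilon> by (intro cpt that continuous_intros)
      show "continuous_on \<Omega> Gxx" "continuous_on \<Omega> Gxy" "continuous_on \<Omega> Gyy" using cG continuous_on_subset by blast+
      show "continuous_on UNIV W" unfolding W_def[abs_def] by (intro continuous_intros)
      show "0 < W z" if "z \<noteq> 0" for z using that by (simp add: W_def)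
      fix z assume "z \<in> \<Omega>"
      then have z: "z \<in> ball 0 \<delta>1" using \<Omega>1 by blast
      show "(Gx z)\<^sup>2 + (Gy z)\<^sup>2 \<le> C' * W z"
        using bG[of z] mult_right_mono[OF C'(2) W0[of z]] by (simp add: W_def)
      have sq: "(x + y)\<^sup>2 \<le> 2 * x\<^sup>2 + 2 * y\<^sup>2" for x y :: real
        using zero_le_power2[of "x - y"] by (simp add: power2_diff power2_sum)
      have "(Re (fx z))\<^sup>2 + (Re (fy z))\<^sup>2 \<le> 2 * ((ux z)\<^sup>2 + (uy z)\<^sup>2) + 2 * ((Re (rx z))\<^sup>2 + (Re (ry z))\<^sup>2)"
        using sq[of "ux z" "Re (rx z)"] sq[of "uy z" "Re (ry z)"] by (simp add: f_eq reF)
      also have "\<dots> \<le> 2 * (C * W z) + 2 * (1 * W z)"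
        by (intro add_mono mult_left_mono order_trans[OF gr(1)[OF z] mult_right_mono[OF \<kappa>(2) W0[of z]]] bu[of z, folded W_def]) simp_all
      finally show "(Re (fx z))\<^sup>2 + (Re (fy z))\<^sup>2 \<le> C' * W z" by (simp add: C'_def algebra_simps)
      show "(Im (fx z))\<^sup>2 + (Im (fy z))\<^sup>2 \<le> \<kappa>\<^sup>2 * W z" using gr(2)[OF z] by (simp add: f_eq imF)
      \<comment> \<open>The share of the remainder in the bracket, bounded by
        Cauchy-Schwarz.\<close>
      define X where "X = Re (rx z) * Gy z - Re (ry z) * Gx z"
      have "X\<^sup>2 \<le> ((Re (rx z))\<^sup>2 + (Re (ry z))\<^sup>2) * ((Gx z)\<^sup>2 + (Gy z)\<^sup>2)"
        using zero_le_power2[of "Re (rx z) * Gx z + Re (ry z) * Gy z"] by (simp add: X_def power2_eq_square algebra_simps)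
      also have "\<dots> \<le> (\<kappa>\<^sup>2 * W z) * (C * W z)" using gr(1)[OF z] bG[of z] W0[of z] by (intro mult_mono) (auto simp: W_def)
      also have "\<dots> = (\<kappa>\<^sup>2 * C) * (W z)\<^sup>2" by (simp add: power2_eq_square)
      also have "\<dots> \<le> (c / 2)\<^sup>2 * (W z)\<^sup>2" by (intro mult_right_mono \<kappa>C) simp
      finally have "X\<^sup>2 \<le> (c / 2 * W z)\<^sup>2" by (simp only: power_mult_distrib)
      then have "\<bar>X\<bar> \<le> c / 2 * W z" using cC(1) W0[of z] abs_le_square_iff[of X "c / 2 * W z"] by simp
      moreover have "Re (fx z) * Gy z - Re (fy z) * Gx z = (ux z * Gy z - uy z * Gx z) + X"
        by (simp add: f_eq reF X_def algebra_simps)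
      ultimately show "c / 2 * W z \<le> Re (fx z) * Gy z - Re (fy z) * Gx z" using br[of z, folded W_def] by (simp add: abs_le_iff field_simps)
    qed (use hh Gd W0 cC C' \<kappa> in auto)
  qed
  then show ?thesis using r(1) rU by blast
qed

text \<open>Along the ray through \<open>z\<close> the form scales like \<open>t ^ m\<close> and the
  bound on the remainder like \<open>t ^ (m + 1)\<close>, so the sign of \<open>F\<close> wins for
  small \<open>t\<close>.\<close>

lemma homogeneous_polynomial_sign_near_0:
  assumes hp: "homogeneous_polynomial m F" and R: "\<And>z. z \<in> ball 0 \<delta> \<Longrightarrow> norm (R z) \<le> M * norm z ^ (m + 1)"
    and pos: "\<delta> > 0" "M \<ge> 0" "e > 0" and s: "s = 1 \<or> s = (-1::real)" "0 < s * Re (F z)"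
  shows "\<exists>y\<in>ball 0 e. 0 < s * Re (F y + R y)"
proof -
  define a where "a = s * Re (F z)"
  define b where "b = M * norm z ^ (m + 1)"
  \<comment> \<open>Halving the minimum gives strict inequalities: the first puts the point into
    both discs, the second makes the remainder smaller than the form.\<close>
  define t where "t = min (min \<delta> e / (norm z + 1)) (a / (b + 1)) / 2"
  have a: "a > 0" and b: "b \<ge> 0" using s pos by (simp_all add: a_def b_def)
  have z1: "norm z + 1 > 0" by (simp add: add_nonneg_pos)
  have t: "t > 0" "t < min \<delta> e / (norm z + 1)" "t < a / (b + 1)"
  proof -
    have half: "0 < min u v / 2" "min u v / 2 < u" "min u v / 2 < v" if "u > 0" "v > 0" for u v :: real
      using that by (auto simp: min_def)
    have "min \<delta> e / (norm z + 1) > 0" "a / (b + 1) > 0" using a b z1 pos by simp_all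
    from half[OF this] show "t > 0" "t < min \<delta> e / (norm z + 1)" "t < a / (b + 1)" unfolding t_def .
  qed
  have "t * (norm z + 1) < min \<delta> e" using t(2) z1 by (simp add: pos_less_divide_eq)
  then have y: "norm (of_real t * z) < \<delta>" "norm (of_real t * z) < e" using t(1) by (auto simp: norm_mult distrib_left)
  have "t * (b + 1) < a" using t(3) b by (simp add: pos_less_divide_eq)
  then have tb: "t * b < a" using t(1) by (simp add: distrib_left)
  have "\<bar>Re (R (of_real t * z))\<bar> \<le> M * norm (of_real t * z) ^ (m + 1)"
    using abs_Re_le_cmod[of "R (of_real t * z)"] R[of "of_real t * z"] y(1) by simp
  also have "\<dots> = t ^ m * (t * b)" using t(1) by (simp add: b_def norm_mult power_mult_distrib)
  also have "\<dots> < t ^ m * a" using tb t(1) by simp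
  finally have "\<bar>s * Re (R (of_real t * z))\<bar> < t ^ m * a" using s(1) by auto
  moreover have "s * Re (F (of_real t * z)) = t ^ m * a"
    unfolding homogeneous_polynomial_scale[OF hp] a_def by (simp flip: of_real_power)
  ultimately have "0 < s * Re (F (of_real t * z) + R (of_real t * z))" by (simp add: distrib_left)
  then show ?thesis using y(2) by (intro bexI[of _ "of_real t * z"]) auto
qed

theorem theorem1p5:
  fixes S U :: "C2 set" and p :: C2 and \<Phi> :: "C2 \<Rightarrow> C2"
    and F R :: "complex \<Rightarrow> complex" and k m :: nat and n :: int
  assumes "k \<ge> 3" and "Ck_surface k S" and "CR_singularity S p"
    and "non_parabolic k S p" and "thin k S p"
    and "has_maslov_index S p n" and "n \<le> 0"
    and "2 \<le> m" and "m < k" and "thin_coordinates S p m U \<Phi> F R"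
  shows "((\<forall>q \<in> S \<inter> U. R (fst (\<Phi> q)) \<in> \<real>) \<longrightarrow> locally_polynomially_convex_at S p) \<and>
    (k \<ge> 4 \<longrightarrow>
      (\<exists>U\<^sub>p. open U\<^sub>p \<and> p \<in> U\<^sub>p \<and> U\<^sub>p \<subseteq> U \<and>
        (\<forall>\<alpha>::real. 0 < \<alpha> \<and> \<alpha> < 1 \<longrightarrow> \<not> (\<exists>g. shrinking_disc_family \<alpha> S p U\<^sub>p g))))"
proof -
  have G: "graph_coordinates S p m U \<Phi> F R" and contact: "tangent_contact_order (\<Phi> ` (S \<inter> U)) 0 m"
    and real: "\<And>z. F z \<in> \<real>"
    using assms(10) by (auto simp: thin_coordinates_def)
  have pS: "p \<in> S" using assms(3) by (simp add: CR_singularity_def)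
  have p: "p \<in> U" "\<Phi> p = 0" and bih: "biholomorphic2_on U \<Phi>" and hp: "homogeneous_polynomial m F"
    and SU: "S \<inter> U = {q \<in> U. snd (\<Phi> q) = F (fst (\<Phi> q)) + R (fst (\<Phi> q))}"
    using G by (auto simp: graph_coordinates_def)
  obtain m' U' \<Phi>' F' R' where m': "2 \<le> m'" and G': "graph_coordinates S p m' U' \<Phi>' F' R'"
    and iso': "isolated_CR_singularity (graph_of F') (0, 0)" and iso: "isolated_CR_singularity S p"
    using assms(4) unfolding non_parabolic_def by blast
  show ?thesis
  proof (rule local_graph[OF assms(2) pS G assms(8,9)])
    fix \<delta> M rx ry
    assume \<delta>: "\<delta> > 0" and M: "M \<ge> 0" and in_chart: "\<And>z. z \<in> ball 0 \<delta> \<Longrightarrow> (z, F z + R z) \<in> \<Phi> ` U"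
      and Rd: "\<And>z. z \<in> ball 0 \<delta> \<Longrightarrow> (R has_derivative (\<lambda>h. of_real (Re h) * rx z + of_real (Im h) * ry z)) (at z)"
      and cr: "continuous_on (ball 0 \<delta>) rx" "continuous_on (ball 0 \<delta>) ry"
      and R: "\<And>z. z \<in> ball 0 \<delta> \<Longrightarrow> norm (R z) \<le> M * norm z ^ (m + 1)"
      and r: "\<And>z. z \<in> ball 0 \<delta> \<Longrightarrow> norm (rx z) \<le> M * norm z ^ m" "\<And>z. z \<in> ball 0 \<delta> \<Longrightarrow> norm (ry z) \<le> M * norm z ^ m"
    show ?thesis
    proof (rule homogeneous_polynomial_partials[OF hp])
      fix Fx Fy
      assume Fd: "\<And>z. (F has_derivative (\<lambda>h. of_real (Re h) * Fx z + of_real (Im h) * Fy z)) (at z)"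
        and cF: "continuous_on UNIV Fx" "continuous_on UNIV Fy"
      define f where "f z = F z + R z" for z
      define fx where "fx z = Fx z + rx z" for z
      define fy where "fy z = Fy z + ry z" for z
      have fd: "(f has_derivative (\<lambda>h. of_real (Re h) * fx z + of_real (Im h) * fy z)) (at z)" if "z \<in> ball 0 \<delta>" for z
        using has_derivative_add[OF Fd Rd[OF that]] unfolding f_def[abs_def] fx_def fy_def
        by (rule has_derivative_eq_rhs) (simp add: fun_eq_iff algebra_simps)
      interpret graph_chart S U \<Phi> f \<delta> fx fy
      proof
        show "S \<inter> U = {q \<in> U. snd (\<Phi> q) = f (fst (\<Phi> q))}" using SU by (simp add: f_def)
        show "continuous_on (ball 0 \<delta>) fx" "continuous_on (ball 0 \<delta>) fy"
          using continuous_on_add[OF continuous_on_subset[OF cF(1)] cr(1)] continuous_on_add[OF continuous_on_subset[OF cF(2)] cr(2)]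
          by (simp_all add: fx_def[abs_def] fy_def[abs_def])
      qed (use bih \<delta> in_chart fd in \<open>simp_all add: f_def\<close>)
      obtain e C where e: "e > 0" and F0: "F 0 = 0" "R 0 = 0" and q: "\<And>z. norm z < e \<Longrightarrow> norm (F z + R z) \<le> C * norm z ^ 2"
      proof (rule graph_coordinates_quadratic[OF G assms(8) pS])
        fix e C assume "e > 0" "R 0 = 0" "F 0 = 0" "\<And>z. norm z < e \<Longrightarrow> norm (F z + R z) \<le> C * norm z ^ 2"
        then show thesis by (intro that)
      qed
      have "(f has_derivative (\<lambda>h. 0)) (at 0)"
        by (rule has_derivative_zero_quadratic[OF e]) (use q F0 in \<open>simp_all add: f_def\<close>)
      from fun_cong[OF has_derivative_unique[OF fd this]] \<delta>
      have e0: "of_real (Re h) * fx 0 + of_real (Im h) * fy 0 = 0" for h by simp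
      have d0: "fx 0 = 0" "fy 0 = 0" using e0[of 1] e0[of \<i>] by simp_all
      obtain z1 where nz: "F z1 \<noteq> 0"
        by (rule contact_order_nonzero[OF f_def F0 d0 R M contact])
      have ncrit: "\<not> F field_differentiable at z" if "z \<noteq> 0" for z
        by (rule leading_form_not_field_differentiable[OF f_def p pS hp assms(8) F0 R d0 real nz G' m' iso' that])
      obtain y y' where y: "0 < Re (F y)" "Re (F y') < 0"
        using leading_form_changes_sign[OF p pS iso assms(6,7) hp assms(8) real nz ncrit Fd cF fx_def fy_def M r] by blast
      show ?thesis
      proof (intro conjI impI)
        assume Rreal: "\<forall>q \<in> S \<inter> U. R (fst (\<Phi> q)) \<in> \<real>"
        show "locally_polynomially_convex_at S p"
        proof (rule locally_polynomially_convex[OF p pS _ iso])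
          fix z :: complex assume z: "z \<in> ball 0 \<delta>"
          \<comment> \<open>The point \<open>pt z\<close> of the surface has first coordinate
            \<open>z\<close>, which transfers the hypothesis on \<open>R\<close> to the
            disc.\<close>
          have "R z \<in> \<real>" using Rreal pt[OF z] by force
          then show "f z \<in> \<real>" using real[of z] by (simp add: f_def)
        next
          fix e :: real assume e: "e > 0"
          show "\<exists>z\<in>ball 0 e. \<exists>z'\<in>ball 0 e. Re (f z) < Re (f 0) \<and> Re (f 0) < Re (f z')"
          proof -
            have "\<exists>z'\<in>ball 0 e. 0 < 1 * Re (F z' + R z')"
              by (rule homogeneous_polynomial_sign_near_0[OF hp R \<delta> M e]) (use y in auto)
            moreover have "\<exists>z\<in>ball 0 e. 0 < - 1 * Re (F z + R z)"
              by (rule homogeneous_polynomial_sign_near_0[OF hp R \<delta> M e]) (use y in auto)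
            ultimately obtain z z' where "z \<in> ball 0 e" "z' \<in> ball 0 e" "0 < 1 * Re (F z' + R z')" "0 < - 1 * Re (F z + R z)" by blast
            then show ?thesis using F0 by (intro bexI[of _ z] bexI[of _ z']) (simp_all add: f_def)
          qed
        qed
      next
        obtain z2 where zero: "z2 \<noteq> 0" "F z2 = 0"
          using homogeneous_polynomial_sign_change_zero[OF hp _ real y] assms(8) by auto
        obtain s where s: "s > 0" "cball p s \<subseteq> U" and no_disc: "\<And>g. continuous_on (cball 0 1) g \<Longrightarrow> (fst \<circ> g) holomorphic_on ball 0 1 \<Longrightarrow>
            (snd \<circ> g) holomorphic_on ball 0 1 \<Longrightarrow> g ` sphere 0 1 \<subseteq> S \<inter> cball p s \<Longrightarrow> \<not> simple_path (g \<circ> circlepath 0 1)"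
          using no_analytic_disc[OF p hp assms(8) real nz zero ncrit Fd fx_def fy_def M r] by blast
        \<comment> \<open>A family is refuted by one of its members, here the one at
          \<open>1 / 2\<close>: its boundary is a simple curve of the surface in the ball.\<close>
        have "\<not> shrinking_disc_family \<alpha> S p (ball p s) g" for \<alpha> g
        proof
          assume g: "shrinking_disc_family \<alpha> S p (ball p s) g"
          have half: "1 / 2 \<in> {0<..<1::real}" by simp
          have "g (1 / 2) \<in> analytic_discs \<alpha>" "g (1 / 2) ` sphere 0 1 \<subseteq> (S - {p}) \<inter> ball p s"
            "simple_path (g (1 / 2) \<circ> circlepath 0 1)"
            using g half unfolding shrinking_disc_family_def continuous_disc_family_def by blast+
          then show False using no_disc[of "g (1 / 2)"] ball_subset_cball[of p s] unfolding analytic_discs_def by blast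
        qed
        then show "\<exists>U\<^sub>p. open U\<^sub>p \<and> p \<in> U\<^sub>p \<and> U\<^sub>p \<subseteq> U \<and>
            (\<forall>\<alpha>::real. 0 < \<alpha> \<and> \<alpha> < 1 \<longrightarrow> \<not> (\<exists>g. shrinking_disc_family \<alpha> S p U\<^sub>p g))"
          using s ball_subset_cball[of p s] by (intro exI[of _ "ball p s"]) auto
      qed
    qed
  qed
qed

end
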